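(* Let $\mathfrak k$ be a triangularly $\Gamma$-graded Lie algebra over $\Bbbk$ and $\gamma:\mathfrak k^{(0)}\to\Bbbk$ a character. Equip $N^\circledast\otimes_{\Bbbk}B$ with the right $U$-action transported through the isomorphism $\psi:N^\circledast\otimes_{\Bbbk}B\to N^\circledast\otimes_NU$ and the left $U$-action transported through the isomorphism $\phi:N^\circledast\otimes_{\Bbbk}B\to\mathsf{Hom}_B(U,\Bbbk_\gamma\otimes B)$. The left and right $U$-actions on $N^\circledast\otimes_{\Bbbk}B$ commute if $\gamma$ is a semi-infinite character for $\mathfrak k$.
   Context: $\Bbbk$ is an algebraically closed field of characteristic $0$. Let $S$ be a countable set, $\Gamma=\bigoplus_{s\in S}\mathbb Z$ the free abelian group on $S$, and $\mathsf{ht}:\Gamma\to\mathbb Z$, $(a_s)\mapsto\sum_sa_s$. A $\Gamma$-graded Lie algebra $\mathfrak k=\bigoplus_{a\in\Gamma}\mathfrak k^a$ has the associated $\mathbb Z$-grading $\mathfrak k^{(i)}=\bigoplus_{\mathsf{ht}(a)=i}\mathfrak k^a$. The $\Gamma$-grading is triangular if: (i) $\mathfrak k^a=0$ whenever $a=(a_s)$ contains both positive and negative integers; (ii) $\dim_{\Bbbk}\mathfrak k^a<\infty$ if $\mathsf{ht}(a)<0$; (iii) $\mathfrak k$ is generated by $\mathfrak k^{(1)}\oplus\mathfrak k^{(0)}\oplus\mathfrak k^{(-1)}$. (So $\mathfrak k^{(0)}=\mathfrak k^0$.) A character $\gamma:\mathfrak k^{0}\to\Bbbk$ is semi-infinite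 for $\mathfrak k$ if $\gamma([X,Y])=\mathrm{tr}(\mathrm{ad}_X\mathrm{ad}_Y:\mathfrak k^0\to\mathfrak k^0)$ for all $X\in\mathfrak k^{(1)}$, $Y\in\mathfrak k^{(-1)}$. Put $\mathfrak k_<=\bigoplus_{i<0}\mathfrak k^{(i)}$, $\mathfrak k_\ge=\bigoplus_{i\ge0}\mathfrak k^{(i)}$, $N=U(\mathfrak k_<)$, $B=U(\mathfrak k_\ge)$, $U=U(\mathfrak k)$, all $\Gamma$-graded. For $\Gamma$-graded vector spaces $V,W$, $\mathsf{Hom}_{\Bbbk}(V,W)=\bigoplus_{a\in\Gamma}\{f\in\mathrm{Hom}_{\Bbbk}(V,W):f(V^b)\subset W^{a+b}\ \forall b\in\Gamma\}$; $\mathsf{Hom}_B$ is its subspace of left $B$-linear maps. $N^\circledast=\mathsf{Hom}_{\Bbbk}(N,\Bbbk)$ ($\Bbbk$ in degree $0$) is an $N$-bimodule via $(fn)(u)=f(nu)$ and $(nf)(u)=f(un)$. $\Bbbk_\gamma$ is the one dimensional left $B$-module given by $\gamma$ and the surjection $\mathfrak k_\ge\twoheadrightarrow\mathfrak k^{(0)}$ (placed in degree $0$). $\Bbbk_\gamma\otimes_{\Bbbk}B$ is a $B$-bimodule: as left module the tensor product of $\Bbbk_\gamma$ and the left regular module, as right module via right multiplication on $B$. $\mathsf{Hom}_B(U,\Bbbk_\gamma\otimes B)$ has left $U$-action $(uf)(u')=f(u'u)$, and $N^\circledast\otimes_NU$ has right $U$-action by right multiplication. The maps $\psi(f\otimes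 b)=f\otimes b$ and $\phi(f\otimes b)(b'n)=b'(f(n)\otimes b)$ ($f\in N^\circledast$, $b,b'\in B$, $n\in N$) are isomorphisms. *)

theory Defs
  imports
    "HOL-Library.Poly_Mapping"
    "HOL-Library.Set_Algebras"
    "HOL-Library.Countable_Set"
    "HOL-Library.FuncSet"
    "HOL-Computational_Algebra.Polynomial"
    "HOL-Algebra.Module"
begin

section \<open>Graded vector spaces\<close>

text \<open>
  A vector space over the field \<open>'f\<close>, with or without a multiplication, is a record
  \<open>('f, 'v) module\<close>; scalars are all elements of the type \<open>'f\<close>. The fields
  \<open>mult\<close> and \<open>one\<close> are meaningful for algebras only. Linear maps are kept extensional
  (\<open>undefined\<close> outside the carrier), so that equality of maps is equality of functions.
\<close>

definition base_field :: "('f::field, 'f) module" where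
  "base_field = \<lparr>carrier = UNIV, mult = (*), one = 1, zero = 0, add = (+), smult = (*)\<rparr>"

definition lin_maps :: "('f, 'v) module \<Rightarrow> ('f, 'w) module \<Rightarrow> ('v \<Rightarrow> 'w) set" where
  "lin_maps V W = {h \<in> carrier V \<rightarrow>\<^sub>E carrier W.
     (\<forall>x\<in>carrier V. \<forall>y\<in>carrier V. h (x \<oplus>\<^bsub>V\<^esub> y) = h x \<oplus>\<^bsub>W\<^esub> h y) \<and>
     (\<forall>c. \<forall>x\<in>carrier V. h (c \<odot>\<^bsub>V\<^esub> x) = c \<odot>\<^bsub>W\<^esub> h x)}"

definition map_space :: "('f, 'v) module \<Rightarrow> ('f, 'w) module \<Rightarrow> ('v \<Rightarrow> 'w) set \<Rightarrow> ('f, 'v \<Rightarrow> 'w) module" where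
  "map_space V W H = \<lparr>carrier = H, mult = undefined, one = undefined,
     zero = (\<lambda>x\<in>carrier V. \<zero>\<^bsub>W\<^esub>),
     add = (\<lambda>g h. \<lambda>x\<in>carrier V. g x \<oplus>\<^bsub>W\<^esub> h x),
     smult = (\<lambda>c h. \<lambda>x\<in>carrier V. c \<odot>\<^bsub>W\<^esub> h x)\<rparr>"

definition left_action :: "('f, 'a) module \<Rightarrow> ('f, 'v) module \<Rightarrow> ('a \<Rightarrow> 'v \<Rightarrow> 'v) \<Rightarrow> bool" where
  "left_action A V \<rho> \<longleftrightarrow> \<rho> \<in> carrier A \<rightarrow>\<^sub>E lin_maps V V \<and>
     (\<forall>a\<in>carrier A. \<forall>b\<in>carrier A. \<forall>x\<in>carrier V.
        \<rho> (a \<oplus>\<^bsub>A\<^esub> b) x = \<rho> a x \<oplus>\<^bsub>V\<^esub> \<rho> b x \<and> \<rho> (a \<otimes>\<^bsub>A\<^esub> b) x = \<rho> a (\<rho> b x)) \<and>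
     (\<forall>c. \<forall>a\<in>carrier A. \<forall>x\<in>carrier V. \<rho> (c \<odot>\<^bsub>A\<^esub> a) x = c \<odot>\<^bsub>V\<^esub> \<rho> a x) \<and>
     (\<forall>x\<in>carrier V. \<rho> \<one>\<^bsub>A\<^esub> x = x)"

text \<open>
  The group \<open>\<Gamma>\<close> is the set of finitely supported integer functions with support in \<open>S\<close>.
  A grading of a space is the family of its homogeneous subspaces.
\<close>

definition Gam :: "'s set \<Rightarrow> ('s \<Rightarrow>\<^sub>0 int) set" where
  "Gam S = {a. Poly_Mapping.keys a \<subseteq> S}"

definition ht :: "('s \<Rightarrow>\<^sub>0 int) \<Rightarrow> int" where
  "ht a = (\<Sum>s\<in>Poly_Mapping.keys a. Poly_Mapping.lookup a s)"

definition base_grading :: "('s \<Rightarrow>\<^sub>0 int) \<Rightarrow> 'f::field set" where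
  "base_grading a = (if a = 0 then UNIV else {0})"

definition hom_deg ::
    "'s set \<Rightarrow> ('f, 'v) module \<Rightarrow> (('s \<Rightarrow>\<^sub>0 int) \<Rightarrow> 'v set) \<Rightarrow>
     ('f, 'w) module \<Rightarrow> (('s \<Rightarrow>\<^sub>0 int) \<Rightarrow> 'w set) \<Rightarrow> ('s \<Rightarrow>\<^sub>0 int) \<Rightarrow> ('v \<Rightarrow> 'w) set" where
  "hom_deg S V grV W grW a = {h \<in> lin_maps V W. \<forall>b\<in>Gam S. h ` grV b \<subseteq> grW (a + b)}"

definition graded_hom ::
    "'s set \<Rightarrow> ('f, 'v) module \<Rightarrow> (('s \<Rightarrow>\<^sub>0 int) \<Rightarrow> 'v set) \<Rightarrow>
     ('f, 'w) module \<Rightarrow> (('s \<Rightarrow>\<^sub>0 int) \<Rightarrow> 'w set) \<Rightarrow> ('v \<Rightarrow> 'w) set" where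
  "graded_hom S V grV W grW = {(\<lambda>x\<in>carrier V. \<Oplus>\<^bsub>W\<^esub>a\<in>A. g a x) | A g.
     finite A \<and> A \<subseteq> Gam S \<and> (\<forall>a\<in>A. g a \<in> hom_deg S V grV W grW a)}"


section \<open>Quotients of free constructions\<close>

text \<open>
  \<open>'x \<Rightarrow>\<^sub>0 'f\<close> is the vector space with basis \<open>'x\<close>, and elements of a quotient by \<open>R\<close>
  are the cosets \<open>p +o R\<close>.
\<close>

definition fscale :: "'f::field \<Rightarrow> ('x \<Rightarrow>\<^sub>0 'f) \<Rightarrow> ('x \<Rightarrow>\<^sub>0 'f)" where
  "fscale c p = Poly_Mapping.map ((*) c) p"

abbreviation fspan :: "('x \<Rightarrow>\<^sub>0 'f::field) set \<Rightarrow> ('x \<Rightarrow>\<^sub>0 'f) set" where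
  "fspan \<equiv> Modules.module.span fscale"

abbreviation bas :: "'x \<Rightarrow> ('x \<Rightarrow>\<^sub>0 'f::field)" where
  "bas x \<equiv> Poly_Mapping.single x 1"

definition free_on :: "'x set \<Rightarrow> ('x \<Rightarrow>\<^sub>0 'f::field) set" where
  "free_on X = {p. Poly_Mapping.keys p \<subseteq> X}"

subsection \<open>Tensor products\<close>

definition bilinear_rels :: "('f::field, 'v) module \<Rightarrow> ('f, 'w) module \<Rightarrow> ('v \<times> 'w \<Rightarrow>\<^sub>0 'f) set" where
  "bilinear_rels V W =
     {bas (v \<oplus>\<^bsub>V\<^esub> v', w) - bas (v, w) - bas (v', w) | v v' w.
        v \<in> carrier V \<and> v' \<in> carrier V \<and> w \<in> carrier W} \<union>
     {bas (v, w \<oplus>\<^bsub>W\<^esub> w') - bas (v, w) - bas (v, w') | v w w'.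
        v \<in> carrier V \<and> w \<in> carrier W \<and> w' \<in> carrier W} \<union>
     {bas (c \<odot>\<^bsub>V\<^esub> v, w) - fscale c (bas (v, w)) | c v w. v \<in> carrier V \<and> w \<in> carrier W} \<union>
     {bas (v, c \<odot>\<^bsub>W\<^esub> w) - fscale c (bas (v, w)) | c v w. v \<in> carrier V \<and> w \<in> carrier W}"

text \<open>The extra relations \<open>va \<otimes> w = v \<otimes> aw\<close> of a tensor product over an algebra \<open>A\<close>.\<close>

definition balanced_rels ::
    "('f::field, 'v) module \<Rightarrow> ('f, 'w) module \<Rightarrow> ('f, 'a) module \<Rightarrow>
     ('v \<Rightarrow> 'a \<Rightarrow> 'v) \<Rightarrow> ('a \<Rightarrow> 'w \<Rightarrow> 'w) \<Rightarrow> ('v \<times> 'w \<Rightarrow>\<^sub>0 'f) set" where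
  "balanced_rels V W A r l =
     {bas (r v a, w) - bas (v, l a w) | v a w. v \<in> carrier V \<and> a \<in> carrier A \<and> w \<in> carrier W}"

definition tensor_rels ::
    "('f::field, 'v) module \<Rightarrow> ('f, 'w) module \<Rightarrow> ('v \<times> 'w \<Rightarrow>\<^sub>0 'f) set \<Rightarrow> ('v \<times> 'w \<Rightarrow>\<^sub>0 'f) set" where
  "tensor_rels V W E = fspan (bilinear_rels V W \<union> E)"

definition tensor ::
    "('f::field, 'v) module \<Rightarrow> ('f, 'w) module \<Rightarrow> ('v \<times> 'w \<Rightarrow>\<^sub>0 'f) set \<Rightarrow>
     ('f, ('v \<times> 'w \<Rightarrow>\<^sub>0 'f) set) module" where
  "tensor V W E = \<lparr>
     carrier = (\<lambda>p. p +o tensor_rels V W E) ` free_on (carrier V \<times> carrier W),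
     mult = undefined, one = undefined,
     zero = tensor_rels V W E,
     add = (\<lambda>X Y. X + Y),
     smult = (\<lambda>c X. fscale c ` X + tensor_rels V W E)\<rparr>"

definition tens ::
    "('f::field, 'v) module \<Rightarrow> ('f, 'w) module \<Rightarrow> ('v \<times> 'w \<Rightarrow>\<^sub>0 'f) set \<Rightarrow>
     'v \<Rightarrow> 'w \<Rightarrow> ('v \<times> 'w \<Rightarrow>\<^sub>0 'f) set" where
  "tens V W E v w = bas (v, w) +o tensor_rels V W E"

definition tensor_grading ::
    "'s set \<Rightarrow> ('f::field, 'v) module \<Rightarrow> (('s \<Rightarrow>\<^sub>0 int) \<Rightarrow> 'v set) \<Rightarrow>
     ('f, 'w) module \<Rightarrow> (('s \<Rightarrow>\<^sub>0 int) \<Rightarrow> 'w set) \<Rightarrow>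
     ('s \<Rightarrow>\<^sub>0 int) \<Rightarrow> ('v \<times> 'w \<Rightarrow>\<^sub>0 'f) set set" where
  "tensor_grading S V grV W grW a =
     (\<lambda>p. p +o tensor_rels V W {}) `
       fspan {bas (v, w) | v w b c. b \<in> Gam S \<and> c \<in> Gam S \<and> b + c = a \<and> v \<in> grV b \<and> w \<in> grW c}"

subsection \<open>Free associative algebras\<close>

text \<open>
  With concatenation as the addition of lists, the convolution product on
  \<open>'k list \<Rightarrow>\<^sub>0 'f\<close> makes it the free associative unital algebra on \<open>'k\<close>.
\<close>

instantiation list :: (type) monoid_add
begin

definition zero_list_def: "(0 :: 'a list) = []"
definition plus_list_def: "(xs :: 'a list) + ys = xs @ ys"

instance
  by standard (simp_all add: zero_list_def plus_list_def)

end

inductive_set two_sided_ideal :: "'a::ring_1 set \<Rightarrow> 'a set \<Rightarrow> 'a set" for A R where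
  zero: "0 \<in> two_sided_ideal A R"
| gen: "r \<in> R \<Longrightarrow> r \<in> two_sided_ideal A R"
| add: "p \<in> two_sided_ideal A R \<Longrightarrow> q \<in> two_sided_ideal A R \<Longrightarrow> p + q \<in> two_sided_ideal A R"
| left: "a \<in> A \<Longrightarrow> p \<in> two_sided_ideal A R \<Longrightarrow> a * p \<in> two_sided_ideal A R"
| right: "a \<in> A \<Longrightarrow> p \<in> two_sided_ideal A R \<Longrightarrow> p * a \<in> two_sided_ideal A R"


section \<open>Lie algebras\<close>

context vector_space
begin

text \<open>
  Trace of an endomorphism \<open>T\<close> of finite rank of a subspace \<open>V\<close> that need not be finite
  dimensional: only finitely many diagonal entries are nonzero, and their sum does not
  depend on the basis.
\<close>

definition trace_on :: "'b set \<Rightarrow> ('b \<Rightarrow> 'b) \<Rightarrow> 'a" where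
  "trace_on V T =
     (let E = (SOME E. independent E \<and> span E = V)
      in \<Sum>e | e \<in> E \<and> representation E (T e) e \<noteq> 0. representation E (T e) e)"

end

locale lie_algebra = vector_space scale
  for scale :: "'f::field \<Rightarrow> 'k::ab_group_add \<Rightarrow> 'k" +
  fixes bracket :: "'k \<Rightarrow> 'k \<Rightarrow> 'k"
  assumes bracket_add_left: "bracket (x + y) z = bracket x z + bracket y z"
    and bracket_add_right: "bracket x (y + z) = bracket x y + bracket x z"
    and bracket_scale_left: "bracket (scale c x) y = scale c (bracket x y)"
    and bracket_scale_right: "bracket x (scale c y) = scale c (bracket x y)"
    and bracket_self: "bracket x x = 0"
    and jacobi: "bracket x (bracket y z) + bracket y (bracket z x) + bracket z (bracket x y) = 0"
begin

definition lie_subalgebra :: "'k set \<Rightarrow> bool" where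
  "lie_subalgebra L \<longleftrightarrow> subspace L \<and> (\<forall>x\<in>L. \<forall>y\<in>L. bracket x y \<in> L)"

text \<open>
  The enveloping algebra of the subalgebra \<open>L\<close> is the free associative algebra on the set
  \<open>L\<close> modulo the relations making the generators linear in \<open>L\<close> and turning brackets into
  commutators. \<open>env_in L\<close> is the canonical map from \<open>L\<close>.
\<close>

definition env_gens :: "'k set \<Rightarrow> ('k list \<Rightarrow>\<^sub>0 'f) set" where
  "env_gens L =
     {bas [x + y] - bas [x] - bas [y] | x y. x \<in> L \<and> y \<in> L} \<union>
     {bas [scale c x] - fscale c (bas [x]) | c x. x \<in> L} \<union>
     {bas [x] * bas [y] - bas [y] * bas [x] - bas [bracket x y] | x y. x \<in> L \<and> y \<in> L}"

definition env_ideal :: "'k set \<Rightarrow> ('k list \<Rightarrow>\<^sub>0 'f) set" where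
  "env_ideal L = two_sided_ideal (free_on (lists L)) (env_gens L)"

definition env :: "'k set \<Rightarrow> ('f, ('k list \<Rightarrow>\<^sub>0 'f) set) module" where
  "env L = \<lparr>
     carrier = (\<lambda>p. p +o env_ideal L) ` free_on (lists L),
     mult = (\<lambda>X Y. X * Y + env_ideal L),
     one = 1 +o env_ideal L,
     zero = env_ideal L,
     add = (\<lambda>X Y. X + Y),
     smult = (\<lambda>c X. fscale c ` X + env_ideal L)\<rparr>"

definition env_in :: "'k set \<Rightarrow> 'k \<Rightarrow> ('k list \<Rightarrow>\<^sub>0 'f) set" where
  "env_in L x = bas [x] +o env_ideal L"

text \<open>
  The homomorphism from \<open>env L\<close> to the enveloping algebra of the whole Lie algebra induced by
  inclusion; it enlarges \<open>p +o env_ideal L\<close> to \<open>p +o env_ideal UNIV\<close>.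
\<close>

definition env_incl :: "('k list \<Rightarrow>\<^sub>0 'f) set \<Rightarrow> ('k list \<Rightarrow>\<^sub>0 'f) set" where
  "env_incl X = X + env_ideal UNIV"

text \<open>
  The tensor product of two left \<open>env L\<close>-modules, on which elements of \<open>L\<close> act by the
  Leibniz rule.
\<close>

definition tensor_action ::
    "'k set \<Rightarrow> ('f, 'v) module \<Rightarrow> (('k list \<Rightarrow>\<^sub>0 'f) set \<Rightarrow> 'v \<Rightarrow> 'v) \<Rightarrow>
     ('f, 'w) module \<Rightarrow> (('k list \<Rightarrow>\<^sub>0 'f) set \<Rightarrow> 'w \<Rightarrow> 'w) \<Rightarrow>
     ('k list \<Rightarrow>\<^sub>0 'f) set \<Rightarrow> ('v \<times> 'w \<Rightarrow>\<^sub>0 'f) set \<Rightarrow> ('v \<times> 'w \<Rightarrow>\<^sub>0 'f) set" where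
  "tensor_action L V \<rho> W \<sigma> = (THE \<tau>. left_action (env L) (tensor V W {}) \<tau> \<and>
     (\<forall>x\<in>L. \<forall>v\<in>carrier V. \<forall>w\<in>carrier W.
        \<tau> (env_in L x) (tens V W {} v w) =
          tens V W {} (\<rho> (env_in L x) v) w \<oplus>\<^bsub>tensor V W {}\<^esub> tens V W {} v (\<sigma> (env_in L x) w)))"

end


section \<open>Triangularly graded Lie algebras\<close>

locale graded_lie_algebra = lie_algebra scale bracket
  for scale :: "'f::field \<Rightarrow> 'k::ab_group_add \<Rightarrow> 'k" and bracket :: "'k \<Rightarrow> 'k \<Rightarrow> 'k" +
  fixes S :: "'s set" and gr :: "('s \<Rightarrow>\<^sub>0 int) \<Rightarrow> 'k set"
  assumes countable_S: "countable S"
    and gr_subspace: "a \<in> Gam S \<Longrightarrow> subspace (gr a)"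
    and gr_direct_sum:
      "\<exists>!c :: ('s \<Rightarrow>\<^sub>0 int) \<Rightarrow>\<^sub>0 'k. Poly_Mapping.keys c \<subseteq> Gam S \<and>
         (\<forall>a\<in>Gam S. Poly_Mapping.lookup c a \<in> gr a) \<and>
         x = (\<Sum>a\<in>Poly_Mapping.keys c. Poly_Mapping.lookup c a)"
    and gr_bracket: "a \<in> Gam S \<Longrightarrow> b \<in> Gam S \<Longrightarrow> x \<in> gr a \<Longrightarrow> y \<in> gr b \<Longrightarrow> bracket x y \<in> gr (a + b)"
begin

definition component :: "('s \<Rightarrow>\<^sub>0 int) \<Rightarrow> 'k \<Rightarrow> 'k" where
  "component a x = Poly_Mapping.lookup
     (THE c. Poly_Mapping.keys c \<subseteq> Gam S \<and> (\<forall>a\<in>Gam S. Poly_Mapping.lookup c a \<in> gr a) \<and>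
        x = (\<Sum>a\<in>Poly_Mapping.keys c. Poly_Mapping.lookup c a)) a"

definition zgr :: "int \<Rightarrow> 'k set" where
  "zgr i = span (\<Union>{gr a | a. a \<in> Gam S \<and> ht a = i})"

definition k_lt :: "'k set" where
  "k_lt = span (\<Union>i\<in>{..<0}. zgr i)"

definition k_ge :: "'k set" where
  "k_ge = span (\<Union>i\<in>{0..}. zgr i)"

definition env_grading :: "'k set \<Rightarrow> ('s \<Rightarrow>\<^sub>0 int) \<Rightarrow> ('k list \<Rightarrow>\<^sub>0 'f) set set" where
  "env_grading L a = (\<lambda>p. p +o env_ideal L) `
     fspan {bas w | w ds. w \<in> lists L \<and> ds \<in> lists (Gam S) \<and>
       list_all2 (\<lambda>x d. x \<in> gr d) w ds \<and> sum_list ds = a}"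

text \<open>Characters are only considered on the zero component; their values elsewhere are irrelevant.\<close>

definition character :: "('k \<Rightarrow> 'f) \<Rightarrow> bool" where
  "character \<gamma> \<longleftrightarrow>
     (\<forall>x\<in>zgr 0. \<forall>y\<in>zgr 0. \<gamma> (x + y) = \<gamma> x + \<gamma> y \<and> \<gamma> (bracket x y) = 0) \<and>
     (\<forall>c. \<forall>x\<in>zgr 0. \<gamma> (scale c x) = c * \<gamma> x)"

definition semi_infinite :: "('k \<Rightarrow> 'f) \<Rightarrow> bool" where
  "semi_infinite \<gamma> \<longleftrightarrow> character \<gamma> \<and>
     (\<forall>X\<in>zgr 1. \<forall>Y\<in>zgr (-1).
        \<gamma> (bracket X Y) = trace_on (zgr 0) (\<lambda>Z. bracket X (bracket Y Z)))"

abbreviation U where "U \<equiv> env UNIV"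
abbreviation N where "N \<equiv> env k_lt"
abbreviation B where "B \<equiv> env k_ge"

definition N_dual :: "('f, ('k list \<Rightarrow>\<^sub>0 'f) set \<Rightarrow> 'f) module" where
  "N_dual = map_space N base_field (graded_hom S N (env_grading k_lt) base_field base_grading)"

definition dual_right ::
    "(('k list \<Rightarrow>\<^sub>0 'f) set \<Rightarrow> 'f) \<Rightarrow> ('k list \<Rightarrow>\<^sub>0 'f) set \<Rightarrow> (('k list \<Rightarrow>\<^sub>0 'f) set \<Rightarrow> 'f)" where
  "dual_right f n = (\<lambda>u\<in>carrier N. f (n \<otimes>\<^bsub>N\<^esub> u))"

text \<open>
  The maps \<open>psi\<close> and \<open>phi\<close> below are the unique linear maps with the given values. In a
  triangularly graded Lie algebra both are bijective, so that \<open>inv_into\<close> transports the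
  right action on \<open>NU\<close> and the left action on \<open>Hom_B\<close> to \<open>NB\<close>.
\<close>

abbreviation NB where "NB \<equiv> tensor N_dual B {}"
abbreviation NB_tens where "NB_tens \<equiv> tens N_dual B {}"

definition bal_NU where
  "bal_NU = balanced_rels N_dual U N dual_right (\<lambda>n u. env_incl n \<otimes>\<^bsub>U\<^esub> u)"

abbreviation NU where "NU \<equiv> tensor N_dual U bal_NU"
abbreviation NU_tens where "NU_tens \<equiv> tens N_dual U bal_NU"

definition NU_right where
  "NU_right v = (THE h. h \<in> lin_maps NU NU \<and>
     (\<forall>f\<in>carrier N_dual. \<forall>u\<in>carrier U. h (NU_tens f u) = NU_tens f (u \<otimes>\<^bsub>U\<^esub> v)))"

definition psi where
  "psi = (THE h. h \<in> lin_maps NB NU \<and>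
     (\<forall>f\<in>carrier N_dual. \<forall>b\<in>carrier B. h (NB_tens f b) = NU_tens f (env_incl b)))"

definition right_act where
  "right_act x v = inv_into (carrier NB) psi (NU_right v (psi x))"

definition kg_action :: "('k \<Rightarrow> 'f) \<Rightarrow> ('k list \<Rightarrow>\<^sub>0 'f) set \<Rightarrow> 'f \<Rightarrow> 'f" where
  "kg_action \<gamma> = (THE \<rho>. left_action B base_field \<rho> \<and>
     (\<forall>x\<in>k_ge. \<forall>c. \<rho> (env_in k_ge x) c = \<gamma> (component 0 x) * c))"

abbreviation kgB where "kgB \<equiv> tensor base_field B {}"
abbreviation kgB_tens where "kgB_tens \<equiv> tens base_field B {}"

definition kgB_grading where
  "kgB_grading = tensor_grading S base_field base_grading B (env_grading k_ge)"

definition kgB_action where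
  "kgB_action \<gamma> = tensor_action k_ge base_field (kg_action \<gamma>) B (\<lambda>a b. a \<otimes>\<^bsub>B\<^esub> b)"

definition Hom_B where
  "Hom_B \<gamma> = map_space U kgB
     {h \<in> graded_hom S U (env_grading UNIV) kgB kgB_grading.
        \<forall>b\<in>carrier B. \<forall>u\<in>carrier U. h (env_incl b \<otimes>\<^bsub>U\<^esub> u) = kgB_action \<gamma> b (h u)}"

definition Hom_B_left where
  "Hom_B_left u h = (\<lambda>u'\<in>carrier U. h (u' \<otimes>\<^bsub>U\<^esub> u))"

definition phi where
  "phi \<gamma> = (THE h. h \<in> lin_maps NB (Hom_B \<gamma>) \<and>
     (\<forall>f\<in>carrier N_dual. \<forall>b\<in>carrier B. \<forall>b'\<in>carrier B. \<forall>n\<in>carrier N.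
        h (NB_tens f b) (env_incl b' \<otimes>\<^bsub>U\<^esub> env_incl n) = kgB_action \<gamma> b' (kgB_tens (f n) b)))"

definition left_act where
  "left_act \<gamma> u x = inv_into (carrier NB) (phi \<gamma>) (Hom_B_left u (phi \<gamma> x))"

end

locale triangular_lie_algebra = graded_lie_algebra scale bracket S gr
  for scale :: "'f::field \<Rightarrow> 'k::ab_group_add \<Rightarrow> 'k" and bracket :: "'k \<Rightarrow> 'k \<Rightarrow> 'k"
    and S :: "'s set" and gr :: "('s \<Rightarrow>\<^sub>0 int) \<Rightarrow> 'k set" +
  assumes mixed_degrees:
      "a \<in> Gam S \<Longrightarrow> \<exists>s. Poly_Mapping.lookup a s > 0 \<Longrightarrow> \<exists>s. Poly_Mapping.lookup a s < 0 \<Longrightarrow> gr a = {0}"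
    and negative_finite_dim:
      "a \<in> Gam S \<Longrightarrow> ht a < 0 \<Longrightarrow> \<exists>E. finite E \<and> span E = gr a"
    and generated: "lie_subalgebra hull (zgr 1 \<union> zgr 0 \<union> zgr (-1)) = UNIV"

end

(*
  Right multiplication by B commutes with the left action by B-linearity, and k is generated in
  heights -1, 0, 1, so it suffices to compare L_X R_Y and R_Y L_X on f (x) 1 for X of height
  -1, 0, 1 and Y of height -1. For X of height 0 or 1 and a word w in k_<, one has in U

    w X = X w - sum_i [X, w_i]_0 (w without w_i) - D(w)    with D(w) in N,

  which gives L_X (f (x) 1) explicitly. Expanding the functionals involved in a finite dual
  family of N, the two composites differ by (tr(ad_X ad_Y | k^0) - gamma([X,Y])) f (x) 1; the
  trace appears because f(n) [X,[Y,Z]] is an explicit finite rank function of Z in k^0.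
  Maps out of U are obtained by coinduction along k = k_< + k_>=, which avoids PBW.
*)

theory Submission
  imports Defs
begin

text \<open>Both actions are pulled back along \<open>psi\<close> and \<open>phi\<close>, so these
  maps must be shown bijective before anything can be computed. The inverse of \<open>psi\<close> is
  itself a map out of U. For \<open>phi\<close> the decisive point is one of signs: N lives in
  degrees with coordinates at most 0, B in degrees with coordinates at least 0. A homogeneous
  B-linear map can then be nonzero only on words of N in a finite box of degrees, and N is finite
  dimensional in each of them. So finite dual families suffice, although neither N nor k^0 need be
  finite dimensional.

  The trace arises as follows. Moving Y past L_X (f \<otimes> 1) corrects the elements [X, w_i]_0
  twice: by their brackets with Y inside D(Y w), and by the action of Y on the B-factors of the
  expansion. The difference of the two corrections has the form sum_i l_i(v_i), where z -> sum_i
  l_i(z) v_i is f(w) times the map z -> [X, [Y, z]]_0 on k^0.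

  Elements f \<otimes> 1 are enough because f \<otimes> b = (f \<otimes> 1) b.\<close>

abbreviation (input) lookup where "lookup \<equiv> Poly_Mapping.lookup"
abbreviation (input) keys where "keys \<equiv> Poly_Mapping.keys"
abbreviation (input) single where "single \<equiv> Poly_Mapping.single"

section \<open>Linear algebra\<close>

text \<open>Linear extension from basis vectors. The scalar action \<open>s\<close> is an argument
  because the target varies: free spaces with \<open>fscale\<close>, coefficient functions with
  \<open>gscale\<close>, and the Lie algebra itself.\<close>

definition flin :: "('f::field \<Rightarrow> 'b \<Rightarrow> 'b) \<Rightarrow> ('x \<Rightarrow> 'b) \<Rightarrow> ('x \<Rightarrow>\<^sub>0 'f) \<Rightarrow> 'b::ab_group_add" where
  "flin s k p = (\<Sum>x\<in>keys p. s (lookup p x) (k x))"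

context vector_space
begin

text \<open>Take x - q x for a linear projection \<open>q\<close> onto \<open>R\<close>. The image
  is a model of the quotient by \<open>R\<close> inside the original type, which is what
  \<open>vspace_embedding\<close> needs.\<close>

lemma exists_endomorphism_with_kernel:
  assumes "subspace R"
  shows "\<exists>p. (\<forall>x y. p (x + y) = p x + p y) \<and> (\<forall>c x. p (scale c x) = scale c (p x)) \<and>
    (\<forall>x. p x = 0 \<longleftrightarrow> x \<in> R)"
proof -
  interpret P: vector_space_pair scale scale ..
  obtain C where C: "C \<subseteq> R" "independent C" "R \<subseteq> span C"
    using maximal_independent_subset by blast
  define q where "q = P.construct C id"
  have lq: "Vector_Spaces.linear scale scale q"
    unfolding q_def by (rule P.linear_construct[OF C(2)])
  then interpret q: Vector_Spaces.linear scale scale q .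
  have id: "q x = x" if "x \<in> span C" for x
    by (rule P.linear_eq_on[OF lq _ that, where g = "\<lambda>x. x"])
       (simp_all add: q_def P.construct_basis[OF C(2)] module_hom_ident)
  have rg: "q x \<in> span C" for x
    using P.construct_in_span[OF C(2), of id x] by (simp add: q_def)
  have R: "span C = R"
    using C assms by (metis span_subspace)
  have "x - q x = 0 \<longleftrightarrow> x \<in> R" for x
    using id[of x] rg[of x] R by auto
  thus ?thesis
    by (intro exI[of _ "\<lambda>x. x - q x"]) (simp add: q.add q.scale algebra_simps)
qed

lemma flin_superset:
  fixes p :: "'x \<Rightarrow>\<^sub>0 'a" and k :: "'x \<Rightarrow> 'b"
  assumes "finite A" "keys p \<subseteq> A"
  shows "flin scale k p = (\<Sum>x\<in>A. scale (lookup p x) (k x))"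
  unfolding flin_def
  by (rule sum.mono_neutral_left) (use assms in \<open>auto simp: in_keys_iff\<close>)

lemma flin_add: "flin scale k (p + q) = flin scale k p + flin scale k q"
proof -
  let ?A = "keys p \<union> keys q"
  have "keys (p + q) \<subseteq> ?A"
    by (rule keys_add)
  thus ?thesis
    by (simp add: flin_superset[where A = ?A] lookup_add scale_left_distrib sum.distrib)
qed

lemma flin_bas [simp]: "flin scale k (bas x) = k x"
  by (simp add: flin_def)

lemma flin_zero [simp]: "flin scale k 0 = 0"
  by (simp add: flin_def)

end

lemma lookup_fscale [simp]: "lookup (fscale c p) x = c * lookup p x"
  by (simp add: fscale_def Poly_Mapping.map.rep_eq when_def)

interpretation fs: vector_space "fscale :: 'f::field \<Rightarrow> ('x \<Rightarrow>\<^sub>0 'f) \<Rightarrow> 'x \<Rightarrow>\<^sub>0 'f"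
  by standard (auto intro!: poly_mapping_eqI simp: lookup_add algebra_simps)

lemma keys_fscale: "keys (fscale c p) \<subseteq> keys p"
  by (auto simp: in_keys_iff)

lemma (in vector_space) flin_scale: "flin scale k (fscale c p) = scale c (flin scale k p)"
  by (subst flin_superset[OF finite_keys keys_fscale])
     (simp add: flin_def scale_sum_right)

lemma fscale_mult_left: "fscale c (p :: 'a::monoid_add \<Rightarrow>\<^sub>0 'f::field) * q = fscale c (p * q)"
  by (simp add: fscale_def mult_map_scale_conv_mult mult.assoc)

lemma fscale_mult_right: "(p :: 'a::monoid_add \<Rightarrow>\<^sub>0 'f::field) * fscale c q = fscale c (p * q)"
proof -
  \<comment> \<open>The exponent monoid need not be commutative, but its neutral element commutes
    with everything, so scalars sitting at exponent 0 are central.\<close>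
  have "p * single 0 c = single 0 c * p"
  proof (rule poly_mapping_eqI)
    fix k :: 'a
    have "(\<Sum>b. (c when b = 0) when k = a + b) = (c when k = a)" for a
    proof -
      have "(\<Sum>b. (c when b = 0) when k = a + b) = (\<Sum>b. (c when k = a + b) when b = 0)"
        by (rule Sum_any.cong) (simp add: when_def)
      thus ?thesis
        by simp
    qed
    thus "lookup (p * single 0 c) k =
        lookup (single 0 c * p) k"
      by (simp add: lookup_mult lookup_single mult.commute when_mult mult_when
          Sum_any_when_dependent_prod_right)
  qed
  thus ?thesis
    by (simp add: fscale_def mult_map_scale_conv_mult mult.assoc[symmetric])
qed

section \<open>Vector spaces given as records, and their embedding into free spaces\<close>

definition vspace :: "('f::field, 'v) module \<Rightarrow> bool" where
  "vspace V \<longleftrightarrow> abelian_group V \<and> (\<forall>c. \<forall>x\<in>carrier V. c \<odot>\<^bsub>V\<^esub> x \<in> carrier V) \<and>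
    (\<forall>c. \<forall>x\<in>carrier V. \<forall>y\<in>carrier V. c \<odot>\<^bsub>V\<^esub> (x \<oplus>\<^bsub>V\<^esub> y) = c \<odot>\<^bsub>V\<^esub> x \<oplus>\<^bsub>V\<^esub> c \<odot>\<^bsub>V\<^esub> y) \<and>
    (\<forall>c d. \<forall>x\<in>carrier V. (c + d) \<odot>\<^bsub>V\<^esub> x = c \<odot>\<^bsub>V\<^esub> x \<oplus>\<^bsub>V\<^esub> d \<odot>\<^bsub>V\<^esub> x) \<and>
    (\<forall>c d. \<forall>x\<in>carrier V. (c * d) \<odot>\<^bsub>V\<^esub> x = c \<odot>\<^bsub>V\<^esub> (d \<odot>\<^bsub>V\<^esub> x)) \<and>
    (\<forall>x\<in>carrier V. 1 \<odot>\<^bsub>V\<^esub> x = x)"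

lemma vspaceI:
  assumes "\<And>x y. x \<in> carrier V \<Longrightarrow> y \<in> carrier V \<Longrightarrow> x \<oplus>\<^bsub>V\<^esub> y \<in> carrier V"
    and "\<zero>\<^bsub>V\<^esub> \<in> carrier V"
    and "\<And>c x. x \<in> carrier V \<Longrightarrow> c \<odot>\<^bsub>V\<^esub> x \<in> carrier V"
    and "\<And>x y z. \<lbrakk>x \<in> carrier V; y \<in> carrier V; z \<in> carrier V\<rbrakk> \<Longrightarrow>
      (x \<oplus>\<^bsub>V\<^esub> y) \<oplus>\<^bsub>V\<^esub> z = x \<oplus>\<^bsub>V\<^esub> (y \<oplus>\<^bsub>V\<^esub> z)"
    and "\<And>x y. x \<in> carrier V \<Longrightarrow> y \<in> carrier V \<Longrightarrow> x \<oplus>\<^bsub>V\<^esub> y = y \<oplus>\<^bsub>V\<^esub> x"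
    and "\<And>x. x \<in> carrier V \<Longrightarrow> \<zero>\<^bsub>V\<^esub> \<oplus>\<^bsub>V\<^esub> x = x"
    and "\<And>x. x \<in> carrier V \<Longrightarrow> (-1) \<odot>\<^bsub>V\<^esub> x \<oplus>\<^bsub>V\<^esub> x = \<zero>\<^bsub>V\<^esub>"
    and "\<And>c x y. x \<in> carrier V \<Longrightarrow> y \<in> carrier V \<Longrightarrow> c \<odot>\<^bsub>V\<^esub> (x \<oplus>\<^bsub>V\<^esub> y) = c \<odot>\<^bsub>V\<^esub> x \<oplus>\<^bsub>V\<^esub> c \<odot>\<^bsub>V\<^esub> y"
    and "\<And>c d x. x \<in> carrier V \<Longrightarrow> (c + d) \<odot>\<^bsub>V\<^esub> x = c \<odot>\<^bsub>V\<^esub> x \<oplus>\<^bsub>V\<^esub> d \<odot>\<^bsub>V\<^esub> x"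
    and "\<And>c d x. x \<in> carrier V \<Longrightarrow> (c * d) \<odot>\<^bsub>V\<^esub> x = c \<odot>\<^bsub>V\<^esub> (d \<odot>\<^bsub>V\<^esub> x)"
    and "\<And>x. x \<in> carrier V \<Longrightarrow> 1 \<odot>\<^bsub>V\<^esub> x = x"
  shows "vspace V"
  unfolding vspace_def
proof (intro conjI)
  show "abelian_group V"
  proof (rule abelian_groupI)
    fix x assume "x \<in> carrier V"
    thus "\<exists>y\<in>carrier V. y \<oplus>\<^bsub>V\<^esub> x = \<zero>\<^bsub>V\<^esub>"
      by (intro bexI[of _ "(-1) \<odot>\<^bsub>V\<^esub> x"] assms)
  qed (rule assms; assumption)+
qed (intro allI ballI; rule assms; assumption)+

lemma vspaceD:
  assumes "vspace V"
  shows vspace_abelian: "abelian_group V"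
    and vspace_add_closed: "\<And>x y. x \<in> carrier V \<Longrightarrow> y \<in> carrier V \<Longrightarrow> x \<oplus>\<^bsub>V\<^esub> y \<in> carrier V"
    and vspace_zero_closed: "\<zero>\<^bsub>V\<^esub> \<in> carrier V"
    and vspace_smult_closed: "\<And>c x. x \<in> carrier V \<Longrightarrow> c \<odot>\<^bsub>V\<^esub> x \<in> carrier V"
    and vspace_smult_add: "\<And>c x y. x \<in> carrier V \<Longrightarrow> y \<in> carrier V \<Longrightarrow>
      c \<odot>\<^bsub>V\<^esub> (x \<oplus>\<^bsub>V\<^esub> y) = c \<odot>\<^bsub>V\<^esub> x \<oplus>\<^bsub>V\<^esub> c \<odot>\<^bsub>V\<^esub> y"
    and vspace_add_smult: "\<And>c d x. x \<in> carrier V \<Longrightarrow> (c + d) \<odot>\<^bsub>V\<^esub> x = c \<odot>\<^bsub>V\<^esub> x \<oplus>\<^bsub>V\<^esub> d \<odot>\<^bsub>V\<^esub> x"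
    and vspace_mult_smult: "\<And>c d x. x \<in> carrier V \<Longrightarrow> (c * d) \<odot>\<^bsub>V\<^esub> x = c \<odot>\<^bsub>V\<^esub> (d \<odot>\<^bsub>V\<^esub> x)"
    and vspace_one_smult: "\<And>x. x \<in> carrier V \<Longrightarrow> 1 \<odot>\<^bsub>V\<^esub> x = x"
proof -
  show "abelian_group V"
    using assms by (simp add: vspace_def)
  then interpret abelian_group V .
  show "\<And>x y. x \<in> carrier V \<Longrightarrow> y \<in> carrier V \<Longrightarrow> x \<oplus>\<^bsub>V\<^esub> y \<in> carrier V" "\<zero>\<^bsub>V\<^esub> \<in> carrier V"
    by simp_all
qed (use assms in \<open>simp_all add: vspace_def\<close>)

lemma subspace_free_on: "fs.subspace (free_on X :: ('x \<Rightarrow>\<^sub>0 'f::field) set)"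
proof (rule fs.subspaceI)
  show "x + y \<in> free_on X" if "x \<in> free_on X" "y \<in> free_on X" for x y :: "'x \<Rightarrow>\<^sub>0 'f"
    using that keys_add[of x y] by (auto simp: free_on_def)
  show "fscale c x \<in> free_on X" if "x \<in> free_on X" for c and x :: "'x \<Rightarrow>\<^sub>0 'f"
    using that keys_fscale[of c x] by (auto simp: free_on_def)
qed (simp add: free_on_def)

text \<open>\<open>V\<close> is the quotient of the free space on its elements by the kernel of
  evaluation, and an endomorphism of the free space with exactly this kernel turns the quotient into
  a subspace. Records thereby embed into a type with class instances, where sums and
  \<open>algebra_simps\<close> are available.\<close>

lemma vspace_embedding:
  fixes V :: "('f::field, 'v) module"
  assumes V: "vspace V"
  shows "\<exists>e :: 'v \<Rightarrow> ('v \<Rightarrow>\<^sub>0 'f). inj_on e (carrier V) \<and>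
    (\<forall>x\<in>carrier V. \<forall>y\<in>carrier V. e (x \<oplus>\<^bsub>V\<^esub> y) = e x + e y) \<and>
    (\<forall>c. \<forall>x\<in>carrier V. e (c \<odot>\<^bsub>V\<^esub> x) = fscale c (e x))"
proof -
  interpret A: abelian_group V by (rule vspace_abelian[OF V])
  note [simp] = vspace_smult_closed[OF V]
  have zero: "0 \<odot>\<^bsub>V\<^esub> x = \<zero>\<^bsub>V\<^esub>" if "x \<in> carrier V" for x
  proof -
    have "0 \<odot>\<^bsub>V\<^esub> x \<oplus>\<^bsub>V\<^esub> 0 \<odot>\<^bsub>V\<^esub> x = 0 \<odot>\<^bsub>V\<^esub> x"
      using vspace_add_smult[OF V that, of 0 0] by simp
    thus ?thesis
      using that by (metis A.add.r_cancel_one vspace_smult_closed[OF V])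
  qed
  have smult_zero: "c \<odot>\<^bsub>V\<^esub> \<zero>\<^bsub>V\<^esub> = \<zero>\<^bsub>V\<^esub>" for c
    using vspace_mult_smult[OF V A.zero_closed, of c 0] zero[OF A.zero_closed] by simp
  define ev where "ev p = (\<Oplus>\<^bsub>V\<^esub>v\<in>keys p. lookup p v \<odot>\<^bsub>V\<^esub> v)" for p
  have ev_sup: "ev p = (\<Oplus>\<^bsub>V\<^esub>v\<in>X. lookup p v \<odot>\<^bsub>V\<^esub> v)"
    if "finite X" "keys p \<subseteq> X" "X \<subseteq> carrier V" for p X
    unfolding ev_def
    by (rule A.add.finprod_mono_neutral_cong_left) (use that zero in \<open>auto simp: in_keys_iff subset_iff\<close>)
  have ev_add: "ev (p + q) = ev p \<oplus>\<^bsub>V\<^esub> ev q" if "p \<in> free_on (carrier V)" "q \<in> free_on (carrier V)" for p q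
  proof -
    let ?X = "keys p \<union> keys q"
    have X: "finite ?X" "keys p \<subseteq> ?X" "keys q \<subseteq> ?X"
      "keys (p + q) \<subseteq> ?X" "?X \<subseteq> carrier V"
      using that keys_add[of p q] by (auto simp: free_on_def)
    have "ev (p + q) = (\<Oplus>\<^bsub>V\<^esub>v\<in>?X. lookup p v \<odot>\<^bsub>V\<^esub> v \<oplus>\<^bsub>V\<^esub> lookup q v \<odot>\<^bsub>V\<^esub> v)"
      unfolding ev_sup[OF X(1,4,5)]
      by (rule A.finsum_cong') (use X(5) in \<open>auto simp: lookup_add subset_iff vspace_add_smult[OF V]\<close>)
    also have "\<dots> = ev p \<oplus>\<^bsub>V\<^esub> ev q"
      unfolding ev_sup[OF X(1,2,5)] ev_sup[OF X(1,3,5)]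
      by (rule A.finsum_addf) (use X(5) in \<open>auto simp: subset_iff\<close>)
    finally show ?thesis .
  qed
  have ev_scale: "ev (fscale c p) = c \<odot>\<^bsub>V\<^esub> ev p" if "p \<in> free_on (carrier V)" for c p
  proof -
    have fs: "(\<Oplus>\<^bsub>V\<^esub>v\<in>X. c \<odot>\<^bsub>V\<^esub> (g v)) = c \<odot>\<^bsub>V\<^esub> (\<Oplus>\<^bsub>V\<^esub>v\<in>X. g v)"
      if "finite X" "g \<in> X \<rightarrow> carrier V" for X and g :: "'v \<Rightarrow> 'v"
      using that by (induction X) (auto simp: smult_zero vspace_smult_add[OF V] Pi_iff)
    have X: "keys p \<subseteq> carrier V"
      using that by (auto simp: free_on_def)
    have "ev (fscale c p) = (\<Oplus>\<^bsub>V\<^esub>v\<in>keys p. c \<odot>\<^bsub>V\<^esub> (lookup p v \<odot>\<^bsub>V\<^esub> v))"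
      unfolding ev_sup[OF finite_keys keys_fscale X]
      by (rule A.finsum_cong') (use X in \<open>auto simp: vspace_mult_smult[OF V] subset_iff\<close>)
    also have "\<dots> = c \<odot>\<^bsub>V\<^esub> ev p"
      unfolding ev_def by (rule fs) (use X in auto)
    finally show ?thesis .
  qed
  have ev_bas: "ev (bas v) = v" if "v \<in> carrier V" for v
    using that vspace_one_smult[OF V that] by (simp add: ev_def)
  have ev_zero: "ev 0 = \<zero>\<^bsub>V\<^esub>"
    by (simp add: ev_def)
  have bf: "(bas v :: 'v \<Rightarrow>\<^sub>0 'f) \<in> free_on (carrier V)" if "v \<in> carrier V" for v :: 'v
    using that by (simp add: free_on_def)
  note fsub = subspace_free_on[of "carrier V"]
  \<comment> \<open>\<open>ev\<close> evaluates formal combinations inside \<open>V\<close>;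
    \<open>K\<close> is the space of all linear relations among its elements.\<close>
  define K where "K = {p \<in> free_on (carrier V). ev p = \<zero>\<^bsub>V\<^esub>}"
  have "fs.subspace K"
    by (rule fs.subspaceI)
       (simp_all add: K_def ev_add ev_scale ev_zero smult_zero fs.subspace_add[OF fsub]
          fs.subspace_scale[OF fsub] fs.subspace_0[OF fsub])
  then obtain \<pi> :: "('v \<Rightarrow>\<^sub>0 'f) \<Rightarrow> ('v \<Rightarrow>\<^sub>0 'f)" where \<pi>: "\<And>x y. \<pi> (x + y) = \<pi> x + \<pi> y" "\<And>c x. \<pi> (fscale c x) = fscale c (\<pi> x)"
    "\<And>x. \<pi> x = 0 \<longleftrightarrow> x \<in> K"
    using fs.exists_endomorphism_with_kernel by metis
  have mon: "\<pi> p = \<pi> q \<longleftrightarrow> ev p = ev q" if pq: "p \<in> free_on (carrier V)" "q \<in> free_on (carrier V)" for p q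
  proof -
    have m: "fscale (-1) q \<in> free_on (carrier V)"
      using pq fsub fs.subspace_scale by blast
    have evc: "ev r \<in> carrier V" if "r \<in> free_on (carrier V)" for r
      unfolding ev_def by (rule A.finsum_closed) (use that in \<open>auto simp: free_on_def\<close>)
    have neg: "(-1) \<odot>\<^bsub>V\<^esub> x = \<ominus>\<^bsub>V\<^esub> x" if "x \<in> carrier V" for x
    proof -
      have "(-1) \<odot>\<^bsub>V\<^esub> x \<oplus>\<^bsub>V\<^esub> x = \<zero>\<^bsub>V\<^esub>"
        using vspace_add_smult[OF V that, of "-1" 1] zero[OF that] vspace_one_smult[OF V that] by simp
      thus ?thesis
        using that by (metis A.minus_equality vspace_smult_closed[OF V])
    qed
    have "\<pi> p = \<pi> q \<longleftrightarrow> \<pi> (p + fscale (-1) q) = 0"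
      unfolding \<pi>(1,2) by simp
    also have "\<dots> \<longleftrightarrow> ev p \<oplus>\<^bsub>V\<^esub> (\<ominus>\<^bsub>V\<^esub> ev q) = \<zero>\<^bsub>V\<^esub>"
      using pq m fs.subspace_add[OF fsub pq(1) m]
      by (simp only: \<pi>(3) K_def fs.subspace_add ev_add ev_scale neg evc mem_Collect_eq simp_thms)
    also have "\<dots> \<longleftrightarrow> ev p = ev q"
      using evc[OF pq(1)] evc[OF pq(2)]
      by (metis A.add.inv_closed A.add.inv_equality A.add.inv_inv A.add.r_inv)
    finally show ?thesis .
  qed
  show ?thesis
  proof (intro exI[of _ "\<lambda>v. \<pi> (bas v)"] conjI ballI allI)
    show "inj_on (\<lambda>v. \<pi> (bas v)) (carrier V)"
      by (rule inj_onI) (simp add: mon bf ev_bas)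
  next
    fix x y assume xy: "x \<in> carrier V" "y \<in> carrier V"
    have "\<pi> (bas (x \<oplus>\<^bsub>V\<^esub> y)) = \<pi> (bas x + bas y)"
      using xy by (subst mon) (auto simp: bf fs.subspace_add[OF fsub] ev_bas ev_add)
    thus "\<pi> (bas (x \<oplus>\<^bsub>V\<^esub> y)) = \<pi> (bas x) + \<pi> (bas y)"
      by (simp add: \<pi>(1))
  next
    fix c x assume x: "x \<in> carrier V"
    have "\<pi> (bas (c \<odot>\<^bsub>V\<^esub> x)) = \<pi> (fscale c (bas x))"
      using x by (subst mon) (auto simp: bf fs.subspace_scale[OF fsub] ev_bas ev_scale)
    thus "\<pi> (bas (c \<odot>\<^bsub>V\<^esub> x)) = fscale c (\<pi> (bas x))"
      by (simp add: \<pi>(2))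
  qed
qed

definition emb :: "('f::field, 'v) module \<Rightarrow> 'v \<Rightarrow> ('v \<Rightarrow>\<^sub>0 'f)" where
  "emb V = (SOME e. inj_on e (carrier V) \<and>
    (\<forall>x\<in>carrier V. \<forall>y\<in>carrier V. e (x \<oplus>\<^bsub>V\<^esub> y) = e x + e y) \<and>
    (\<forall>c. \<forall>x\<in>carrier V. e (c \<odot>\<^bsub>V\<^esub> x) = fscale c (e x)))"

lemma
  assumes V: "vspace V"
  shows emb_inj: "\<And>x y. x \<in> carrier V \<Longrightarrow> y \<in> carrier V \<Longrightarrow> emb V x = emb V y \<longleftrightarrow> x = y"
    and emb_add: "\<And>x y. x \<in> carrier V \<Longrightarrow> y \<in> carrier V \<Longrightarrow> emb V (x \<oplus>\<^bsub>V\<^esub> y) = emb V x + emb V y"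
    and emb_smult: "\<And>c x. x \<in> carrier V \<Longrightarrow> emb V (c \<odot>\<^bsub>V\<^esub> x) = fscale c (emb V x)"
  using someI_ex[OF vspace_embedding[OF V], folded emb_def] by (auto dest: inj_onD)

lemma emb_zero: "vspace V \<Longrightarrow> emb V \<zero>\<^bsub>V\<^esub> = 0"
proof -
  assume V: "vspace V"
  interpret abelian_group V by (rule vspace_abelian[OF V])
  show ?thesis
    using emb_add[OF V zero_closed zero_closed] by simp
qed

text \<open>The usual way to an identity in an abstract carrier: apply the embedding, simplify both
  sides in the free space, and come back by injectivity on the carrier.\<close>

lemma emb_eqD: "\<lbrakk>vspace V; emb V x = emb V y; x \<in> carrier V; y \<in> carrier V\<rbrakk> \<Longrightarrow> x = y"
  using emb_inj[of V x y] by simp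

lemma emb_finsum:
  assumes V: "vspace V" and "finite A" "\<And>a. a \<in> A \<Longrightarrow> g a \<in> carrier V"
  shows "finsum V g A \<in> carrier V \<and> emb V (finsum V g A) = (\<Sum>a\<in>A. emb V (g a))"
proof -
  interpret A: abelian_group V by (rule vspace_abelian[OF V])
  show ?thesis
    using assms(2,3) by (induction A) (auto simp: emb_add[OF V] emb_zero[OF V] Pi_iff)
qed

lemma subspace_emb: "vspace V \<Longrightarrow> fs.subspace (emb V ` carrier V)"
  by (rule fs.subspaceI)
     (auto simp: emb_zero[symmetric] vspace_zero_closed vspace_add_closed vspace_smult_closed
        simp flip: emb_add emb_smult)

definition unemb :: "('f::field, 'v) module \<Rightarrow> ('v \<Rightarrow>\<^sub>0 'f) \<Rightarrow> 'v" where
  "unemb V = inv_into (carrier V) (emb V)"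

lemma unemb_closed: "w \<in> emb V ` carrier V \<Longrightarrow> unemb V w \<in> carrier V"
  and emb_unemb: "w \<in> emb V ` carrier V \<Longrightarrow> emb V (unemb V w) = w"
  by (simp_all add: unemb_def inv_into_into f_inv_into_f)

lemma unemb_emb: "vspace V \<Longrightarrow> v \<in> carrier V \<Longrightarrow> unemb V (emb V v) = v"
  by (meson emb_inj emb_unemb image_eqI unemb_closed)

lemma base_field_simps [simp]: "carrier base_field = UNIV" "x \<oplus>\<^bsub>base_field\<^esub> y = x + y"
  "\<zero>\<^bsub>base_field\<^esub> = 0" "c \<odot>\<^bsub>base_field\<^esub> x = c * x"
  by (simp_all add: base_field_def)

lemma vspace_base: "vspace (base_field :: ('f::field, 'f) module)"
  by (rule vspaceI) (simp_all add: distrib_left distrib_right)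

subsection \<open>Linear maps\<close>

lemma lin_mapsI:
  assumes "h \<in> extensional (carrier V)" "\<And>x. x \<in> carrier V \<Longrightarrow> h x \<in> carrier W"
    "\<And>x y. x \<in> carrier V \<Longrightarrow> y \<in> carrier V \<Longrightarrow> h (x \<oplus>\<^bsub>V\<^esub> y) = h x \<oplus>\<^bsub>W\<^esub> h y"
    "\<And>c x. x \<in> carrier V \<Longrightarrow> h (c \<odot>\<^bsub>V\<^esub> x) = c \<odot>\<^bsub>W\<^esub> h x"
  shows "h \<in> lin_maps V W"
  using assms by (auto simp: lin_maps_def PiE_iff)

lemma restrict_linI:
  assumes "vspace V" "\<And>x. x \<in> carrier V \<Longrightarrow> h x \<in> carrier W"
    "\<And>x y. x \<in> carrier V \<Longrightarrow> y \<in> carrier V \<Longrightarrow> h (x \<oplus>\<^bsub>V\<^esub> y) = h x \<oplus>\<^bsub>W\<^esub> h y"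
    "\<And>c x. x \<in> carrier V \<Longrightarrow> h (c \<odot>\<^bsub>V\<^esub> x) = c \<odot>\<^bsub>W\<^esub> h x"
  shows "(\<lambda>x\<in>carrier V. h x) \<in> lin_maps V W"
  using assms by (intro lin_mapsI) (auto simp: vspace_add_closed vspace_smult_closed)

lemma lin_mapsD:
  assumes "h \<in> lin_maps V W"
  shows lin_maps_ext: "h \<in> extensional (carrier V)"
    and lin_closed: "\<And>x. x \<in> carrier V \<Longrightarrow> h x \<in> carrier W"
    and lin_add: "\<And>x y. x \<in> carrier V \<Longrightarrow> y \<in> carrier V \<Longrightarrow> h (x \<oplus>\<^bsub>V\<^esub> y) = h x \<oplus>\<^bsub>W\<^esub> h y"
    and lin_smult: "\<And>c x. x \<in> carrier V \<Longrightarrow> h (c \<odot>\<^bsub>V\<^esub> x) = c \<odot>\<^bsub>W\<^esub> h x"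
  using assms unfolding lin_maps_def PiE_def by blast+

lemma vspace_zero_smult: "vspace V \<Longrightarrow> x \<in> carrier V \<Longrightarrow> 0 \<odot>\<^bsub>V\<^esub> x = \<zero>\<^bsub>V\<^esub>"
  by (rule emb_eqD) (auto simp: vspace_smult_closed vspace_zero_closed emb_smult emb_zero)

lemma lin_zero:
  assumes "vspace V" "vspace W" "h \<in> lin_maps V W"
  shows "h \<zero>\<^bsub>V\<^esub> = \<zero>\<^bsub>W\<^esub>"
  using lin_smult[OF assms(3), of "\<zero>\<^bsub>V\<^esub>" 0] lin_closed[OF assms(3), of "\<zero>\<^bsub>V\<^esub>"]
  by (simp add: assms(1,2) vspace_zero_closed vspace_zero_smult)

lemma lin_maps_comp:
  assumes "vspace V" "g \<in> lin_maps W Z" "h \<in> lin_maps V W"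
  shows "(\<lambda>x\<in>carrier V. g (h x)) \<in> lin_maps V Z"
  using assms by (intro restrict_linI) (auto simp: lin_add lin_closed lin_smult)

lemma map_space_simps [simp]: "carrier (map_space V W H) = H"
  "\<zero>\<^bsub>map_space V W H\<^esub> = (\<lambda>x\<in>carrier V. \<zero>\<^bsub>W\<^esub>)"
  "g \<oplus>\<^bsub>map_space V W H\<^esub> h = (\<lambda>x\<in>carrier V. g x \<oplus>\<^bsub>W\<^esub> h x)"
  "c \<odot>\<^bsub>map_space V W H\<^esub> h = (\<lambda>x\<in>carrier V. c \<odot>\<^bsub>W\<^esub> h x)"
  by (auto simp: map_space_def)

lemma vspace_map_space:
  assumes W: "vspace W" and H: "H \<subseteq> carrier V \<rightarrow>\<^sub>E carrier W"
    "(\<lambda>x\<in>carrier V. \<zero>\<^bsub>W\<^esub>) \<in> H"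
    "\<And>g h. g \<in> H \<Longrightarrow> h \<in> H \<Longrightarrow> (\<lambda>x\<in>carrier V. g x \<oplus>\<^bsub>W\<^esub> h x) \<in> H"
    "\<And>c h. h \<in> H \<Longrightarrow> (\<lambda>x\<in>carrier V. c \<odot>\<^bsub>W\<^esub> h x) \<in> H"
  shows "vspace (map_space V W H)"
proof -
  interpret W: abelian_group W by (rule vspace_abelian[OF W])
  have Hc: "h x \<in> carrier W" if "h \<in> H" "x \<in> carrier V" for h x
    using H(1) that by auto
  have ext: "g = h" if "g \<in> extensional (carrier V)" "h \<in> extensional (carrier V)"
    "\<And>x. x \<in> carrier V \<Longrightarrow> emb W (g x) = emb W (h x)"
    "\<And>x. x \<in> carrier V \<Longrightarrow> g x \<in> carrier W" "\<And>x. x \<in> carrier V \<Longrightarrow> h x \<in> carrier W" for g h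
    using that emb_inj[OF W] by (intro extensionalityI[OF that(1,2)]) blast
  have He: "h \<in> extensional (carrier V)" if "h \<in> H" for h
    using H(1) that by (auto simp: PiE_iff)
  note [simp] = emb_add[OF W] emb_smult[OF W] emb_zero[OF W] vspace_smult_closed[OF W] Hc He
  show ?thesis
  proof (rule vspaceI, unfold map_space_simps)
  qed ((rule H; assumption) | (rule ext; simp add: H(2-4) algebra_simps))+
qed

lemma lin_maps_subspace:
  assumes V: "vspace V" and W: "vspace W"
  shows "(\<lambda>x\<in>carrier V. \<zero>\<^bsub>W\<^esub>) \<in> lin_maps V W"
    and "\<And>g h. g \<in> lin_maps V W \<Longrightarrow> h \<in> lin_maps V W \<Longrightarrow> (\<lambda>x\<in>carrier V. g x \<oplus>\<^bsub>W\<^esub> h x) \<in> lin_maps V W"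
    and "\<And>c h. h \<in> lin_maps V W \<Longrightarrow> (\<lambda>x\<in>carrier V. c \<odot>\<^bsub>W\<^esub> h x) \<in> lin_maps V W"
  by (rule restrict_linI[OF V];
      (auto simp: lin_closed W vspace_add_closed vspace_zero_closed vspace_smult_closed V; fail)?;
      rule emb_eqD[OF W];
      auto simp: lin_closed lin_add lin_smult W V vspace_add_closed vspace_zero_closed
        vspace_smult_closed emb_add emb_smult emb_zero algebra_simps)+

lemma vspace_lin_maps:
  assumes "vspace V" "vspace W"
  shows "vspace (map_space V W (lin_maps V W))"
  using lin_maps_subspace[OF assms]
  by (intro vspace_map_space[OF assms(2)]) (auto simp: lin_maps_def)

subsection \<open>Quotients\<close>

lemma subspace_set_plus: "fs.subspace R \<Longrightarrow> R + R = R"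
  using set_zero_plus2[of R R] fs.subspace_0[of R]
  by (auto elim!: set_plus_elim intro: fs.subspace_add)

lemma coset_eq_iff: "fs.subspace R \<Longrightarrow> p +o R = q +o R \<longleftrightarrow> p - q \<in> R"
proof
  assume R: "fs.subspace R" and "p +o R = q +o R"
  moreover have "p \<in> p +o R"
    using set_plus_intro2[OF fs.subspace_0[OF R], of p] by simp
  ultimately show "p - q \<in> R"
    using set_plus_imp_minus by blast
next
  assume R: "fs.subspace R" and d: "p - q \<in> R"
  have "x \<in> p +o R \<longleftrightarrow> x \<in> q +o R" for x
    unfolding set_minus_plus[symmetric]
    using fs.subspace_add[OF R, of "x - p" "p - q"] fs.subspace_diff[OF R, of "x - q" "p - q"] d by auto
  thus "p +o R = q +o R"
    by blast
qed

lemma coset_zero: "fs.subspace R \<Longrightarrow> r \<in> R \<Longrightarrow> r +o R = R"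
  using coset_eq_iff[of R r 0] by simp

lemma coset_add: "fs.subspace R \<Longrightarrow> (p +o R) + (q +o R) = (p + q) +o R"
  by (simp add: set_plus_rearrange subspace_set_plus)

lemma coset_smult:
  assumes R: "fs.subspace R"
  shows "fscale c ` (p +o R) + R = fscale c p +o R"
proof (intro equalityI subsetI)
  fix x assume "x \<in> fscale c ` (p +o R) + R"
  then obtain r r' where "r \<in> R" "r' \<in> R" "x = fscale c (p + r) + r'"
    by (auto simp: set_plus_def elt_set_plus_def)
  thus "x \<in> fscale c p +o R"
    by (auto simp: elt_set_plus_def fs.scale_right_distrib add.assoc
        intro!: bexI[of _ "fscale c r + r'"] fs.subspace_add[OF R] fs.subspace_scale[OF R])
next
  fix x assume "x \<in> fscale c p +o R"
  then obtain r where "r \<in> R" "x = fscale c p + r"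
    by (auto simp: elt_set_plus_def)
  thus "x \<in> fscale c ` (p +o R) + R"
    using set_plus_intro2[OF fs.subspace_0[OF R], of p] by auto
qed

text \<open>Common shape of \<open>tensor\<close> and \<open>env\<close>: \<open>P\<close> consists
  of the representatives and \<open>R\<close> of the relations. Lifting of maps is proved once for
  this shape.\<close>

definition is_quot :: "('f::field, ('x \<Rightarrow>\<^sub>0 'f) set) module \<Rightarrow> ('x \<Rightarrow>\<^sub>0 'f) set \<Rightarrow> ('x \<Rightarrow>\<^sub>0 'f) set \<Rightarrow> bool" where
  "is_quot Q P R \<longleftrightarrow> fs.subspace P \<and> fs.subspace R \<and> carrier Q = (\<lambda>p. p +o R) ` P \<and> \<zero>\<^bsub>Q\<^esub> = R \<and>
     (\<forall>X Y. X \<oplus>\<^bsub>Q\<^esub> Y = X + Y) \<and> (\<forall>c X. c \<odot>\<^bsub>Q\<^esub> X = fscale c ` X + R)"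

definition quot_map :: "('x \<Rightarrow>\<^sub>0 'f::field) set \<Rightarrow> ('x \<Rightarrow>\<^sub>0 'f) set \<Rightarrow> (('x \<Rightarrow>\<^sub>0 'f) \<Rightarrow> 'w) \<Rightarrow> ('x \<Rightarrow>\<^sub>0 'f) set \<Rightarrow> 'w" where
  "quot_map P R k = (\<lambda>X\<in>(\<lambda>p. p +o R) ` P. k (SOME p. p \<in> P \<and> X = p +o R))"

context
  fixes Q :: "('f::field, ('x \<Rightarrow>\<^sub>0 'f) set) module" and P R
  assumes Q: "is_quot Q P R"
begin

lemma quot_sub: "fs.subspace P" "fs.subspace R"
  and quot_carrier: "carrier Q = (\<lambda>p. p +o R) ` P"
  and quot_zero: "\<zero>\<^bsub>Q\<^esub> = 0 +o R"
  using Q by (auto simp: is_quot_def)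

lemma quot_add: "(p +o R) \<oplus>\<^bsub>Q\<^esub> (q +o R) = (p + q) +o R"
  using Q by (simp add: is_quot_def coset_add)

lemma quot_smult: "c \<odot>\<^bsub>Q\<^esub> (p +o R) = fscale c p +o R"
  using Q by (simp add: is_quot_def coset_smult)

lemma quot_closed: "p \<in> P \<Longrightarrow> p +o R \<in> carrier Q"
  by (simp add: quot_carrier)

lemma quot_cases: "X \<in> carrier Q \<Longrightarrow> (\<And>p. p \<in> P \<Longrightarrow> X = p +o R \<Longrightarrow> thesis) \<Longrightarrow> thesis"
  by (auto simp: quot_carrier)

lemma vspace_quot: "vspace Q"
  by (rule vspaceI; (elim quot_cases)?; hypsubst?)
     (simp_all only: quot_add quot_smult quot_zero quot_closed fs.subspace_add[OF quot_sub(1)]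
       fs.subspace_scale[OF quot_sub(1)] fs.subspace_0[OF quot_sub(1)] ac_simps
       add_0_left add_0_right fs.scale_right_distrib fs.scale_left_distrib fs.scale_scale fs.scale_one
       fs.scale_minus_left add.left_inverse add.right_inverse)

lemma quot_map_coset:
  assumes "p \<in> P" "\<And>p q. \<lbrakk>p \<in> P; q \<in> P; p - q \<in> R\<rbrakk> \<Longrightarrow> k p = k q"
  shows "quot_map P R k (p +o R) = k p"
proof -
  let ?q = "SOME q. q \<in> P \<and> p +o R = q +o R"
  have "?q \<in> P \<and> p +o R = ?q +o R"
    by (rule someI[of _ p]) (use assms in auto)
  hence "k ?q = k p"
    using assms coset_eq_iff[OF quot_sub(2)] by metis
  thus ?thesis
    using assms(1) by (auto simp: quot_map_def)
qed

lemma quot_lift: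
  assumes W: "vspace W" and k: "\<And>p. p \<in> P \<Longrightarrow> k p \<in> carrier W"
    "\<And>p q. p \<in> P \<Longrightarrow> q \<in> P \<Longrightarrow> k (p + q) = k p \<oplus>\<^bsub>W\<^esub> k q"
    "\<And>c p. p \<in> P \<Longrightarrow> k (fscale c p) = c \<odot>\<^bsub>W\<^esub> k p"
    "\<And>r. r \<in> P \<Longrightarrow> r \<in> R \<Longrightarrow> k r = \<zero>\<^bsub>W\<^esub>"
  shows "quot_map P R k \<in> lin_maps Q W" "p \<in> P \<Longrightarrow> quot_map P R k (p +o R) = k p"
proof -
  have wd: "k p = k q" if pq: "p \<in> P" "q \<in> P" "p - q \<in> R" for p q
  proof -
    have d: "p - q \<in> P"
      by (rule fs.subspace_diff[OF quot_sub(1) pq(1,2)])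
    have "k p = k q \<oplus>\<^bsub>W\<^esub> k (p - q)"
      using k(2)[OF pq(2) d] by simp
    thus ?thesis
      using k(4)[OF d pq(3)] k(1)[OF pq(2)] W
      by (auto intro!: emb_eqD[OF W] simp: emb_add[OF W] emb_zero[OF W] vspace_zero_closed[OF W] vspace_add_closed[OF W])
  qed
  note c = quot_map_coset[OF _ wd]
  show "quot_map P R k \<in> lin_maps Q W"
  proof (rule lin_mapsI)
    show "quot_map P R k \<in> extensional (carrier Q)"
      by (simp add: quot_map_def quot_carrier)
  qed (elim quot_cases; simp add: c quot_add quot_smult k fs.subspace_add[OF quot_sub(1)] fs.subspace_scale[OF quot_sub(1)])+
  show "p \<in> P \<Longrightarrow> quot_map P R k (p +o R) = k p"
    by (rule c)
qed

end

text \<open>Meant for maps given by \<open>flin\<close> into the embedded copy of \<open>W\<close>: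
  their linearity is automatic, and only the range and the vanishing on relations remain to be
  checked.\<close>

lemma quot_lift_emb:
  assumes Q: "is_quot Q P R" and W: "vspace W"
    and l: "\<And>p q. p \<in> P \<Longrightarrow> q \<in> P \<Longrightarrow> l (p + q) = l p + l q"
      "\<And>c p. p \<in> P \<Longrightarrow> l (fscale c p) = fscale c (l p)"
      "\<And>p. p \<in> P \<Longrightarrow> l p \<in> emb W ` carrier W"
      "\<And>r. r \<in> P \<Longrightarrow> r \<in> R \<Longrightarrow> l r = 0"
  shows "quot_map P R (\<lambda>p. unemb W (l p)) \<in> lin_maps Q W"
    and "p \<in> P \<Longrightarrow> quot_map P R (\<lambda>p. unemb W (l p)) (p +o R) = unemb W (l p)"
proof -
  define k where "k p = unemb W (l p)" for p
  have k: "k p \<in> carrier W" "emb W (k p) = l p" if "p \<in> P" for p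
    using l(3)[OF that] by (auto simp: k_def unemb_closed emb_unemb)
  note P = fs.subspace_add[OF quot_sub(1)[OF Q]] fs.subspace_scale[OF quot_sub(1)[OF Q]]
  have ka: "k (p + q) = k p \<oplus>\<^bsub>W\<^esub> k q" if "p \<in> P" "q \<in> P" for p q
    by (rule emb_eqD[OF W]) (simp_all add: that P k l emb_add[OF W] vspace_add_closed[OF W])
  have ks: "k (fscale c p) = c \<odot>\<^bsub>W\<^esub> k p" if "p \<in> P" for c p
    by (rule emb_eqD[OF W]) (simp_all add: that P k l emb_smult[OF W] vspace_smult_closed[OF W])
  have kz: "k r = \<zero>\<^bsub>W\<^esub>" if "r \<in> P" "r \<in> R" for r
    by (rule emb_eqD[OF W]) (simp_all add: that k l emb_zero[OF W] vspace_zero_closed[OF W])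
  note * = quot_lift[OF Q W, of k, OF k(1) ka ks kz]
  have "quot_map P R k \<in> lin_maps Q W \<and> (\<forall>p\<in>P. quot_map P R k (p +o R) = k p)"
    by (intro conjI ballI *)
  thus "quot_map P R (\<lambda>p. unemb W (l p)) \<in> lin_maps Q W"
    and "p \<in> P \<Longrightarrow> quot_map P R (\<lambda>p. unemb W (l p)) (p +o R) = unemb W (l p)"
    by (simp_all add: k_def[abs_def])
qed

lemma free_on_span: "(free_on X :: ('x \<Rightarrow>\<^sub>0 'f::field) set) = fspan (bas ` X)"
proof (intro equalityI subsetI)
  fix p :: "'x \<Rightarrow>\<^sub>0 'f" assume p: "p \<in> free_on X"
  have "p = (\<Sum>x\<in>keys p. fscale (lookup p x) (bas x))"
    by (rule poly_mapping_eqI) (auto simp: lookup_sum lookup_single when_def in_keys_iff if_distrib[of "(*) _"] cong: if_cong)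
  also have "\<dots> \<in> fspan (bas ` X)"
    by (rule fs.span_sum, rule fs.span_scale, rule fs.span_base) (use p in \<open>auto simp: free_on_def\<close>)
  finally show "p \<in> fspan (bas ` X)" .
next
  have "fspan (bas ` X) \<subseteq> (free_on X :: ('x \<Rightarrow>\<^sub>0 'f) set)"
    by (rule fs.span_minimal[OF _ subspace_free_on]) (auto simp: free_on_def)
  thus "p \<in> fspan (bas ` X) \<Longrightarrow> p \<in> free_on X" for p :: "'x \<Rightarrow>\<^sub>0 'f"
    by blast
qed

lemma bas_free_on: "x \<in> X \<Longrightarrow> bas x \<in> free_on X"
  by (simp add: free_on_def)

lemma free_on_induct [consumes 1, case_names zero bas add scale]:
  fixes p :: "'x \<Rightarrow>\<^sub>0 'f::field"
  assumes "p \<in> free_on X" "Q 0" "\<And>x. x \<in> X \<Longrightarrow> Q (bas x)"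
    "\<And>p q. \<lbrakk>p \<in> free_on X; q \<in> free_on X; Q p; Q q\<rbrakk> \<Longrightarrow> Q (p + q)"
    "\<And>c p. p \<in> free_on X \<Longrightarrow> Q p \<Longrightarrow> Q (fscale c p)"
  shows "Q p"
proof -
  have "p \<in> {p \<in> free_on X. Q p}"
    using assms(1) unfolding free_on_span
    by (rule fs.span_subspace_induct[OF _ fs.subspaceI])
       (use assms in \<open>auto simp: bas_free_on fs.subspace_0[OF subspace_free_on] fs.subspace_add[OF subspace_free_on]
          fs.subspace_scale[OF subspace_free_on] simp flip: free_on_span\<close>)
  thus ?thesis
    by simp
qed

subsection \<open>The universal property of tensor products\<close>

definition bilin :: "('f::field, 'v) module \<Rightarrow> ('f, 'w) module \<Rightarrow> ('f, 'z) module \<Rightarrow> ('v \<Rightarrow> 'w \<Rightarrow> 'z) \<Rightarrow> bool" where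
  "bilin V W Z \<beta> \<longleftrightarrow> (\<forall>v\<in>carrier V. \<forall>w\<in>carrier W. \<beta> v w \<in> carrier Z) \<and>
     (\<forall>v\<in>carrier V. \<forall>v'\<in>carrier V. \<forall>w\<in>carrier W. \<beta> (v \<oplus>\<^bsub>V\<^esub> v') w = \<beta> v w \<oplus>\<^bsub>Z\<^esub> \<beta> v' w) \<and>
     (\<forall>v\<in>carrier V. \<forall>w\<in>carrier W. \<forall>w'\<in>carrier W. \<beta> v (w \<oplus>\<^bsub>W\<^esub> w') = \<beta> v w \<oplus>\<^bsub>Z\<^esub> \<beta> v w') \<and>
     (\<forall>c. \<forall>v\<in>carrier V. \<forall>w\<in>carrier W. \<beta> (c \<odot>\<^bsub>V\<^esub> v) w = c \<odot>\<^bsub>Z\<^esub> \<beta> v w) \<and>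
     (\<forall>c. \<forall>v\<in>carrier V. \<forall>w\<in>carrier W. \<beta> v (c \<odot>\<^bsub>W\<^esub> w) = c \<odot>\<^bsub>Z\<^esub> \<beta> v w)"

lemma bilinI:
  assumes "\<And>v w. v \<in> carrier V \<Longrightarrow> w \<in> carrier W \<Longrightarrow> \<beta> v w \<in> carrier Z"
    "\<And>v v' w. \<lbrakk>v \<in> carrier V; v' \<in> carrier V; w \<in> carrier W\<rbrakk> \<Longrightarrow> \<beta> (v \<oplus>\<^bsub>V\<^esub> v') w = \<beta> v w \<oplus>\<^bsub>Z\<^esub> \<beta> v' w"
    "\<And>v w w'. \<lbrakk>v \<in> carrier V; w \<in> carrier W; w' \<in> carrier W\<rbrakk> \<Longrightarrow> \<beta> v (w \<oplus>\<^bsub>W\<^esub> w') = \<beta> v w \<oplus>\<^bsub>Z\<^esub> \<beta> v w'"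
    "\<And>c v w. v \<in> carrier V \<Longrightarrow> w \<in> carrier W \<Longrightarrow> \<beta> (c \<odot>\<^bsub>V\<^esub> v) w = c \<odot>\<^bsub>Z\<^esub> \<beta> v w"
    "\<And>c v w. v \<in> carrier V \<Longrightarrow> w \<in> carrier W \<Longrightarrow> \<beta> v (c \<odot>\<^bsub>W\<^esub> w) = c \<odot>\<^bsub>Z\<^esub> \<beta> v w"
  shows "bilin V W Z \<beta>"
  unfolding bilin_def by (intro conjI allI ballI; rule assms; assumption)

lemma bilinD:
  assumes "bilin V W Z \<beta>" "v \<in> carrier V" "w \<in> carrier W"
  shows bilin_closed: "\<beta> v w \<in> carrier Z"
    and bilin_add_left: "v' \<in> carrier V \<Longrightarrow> \<beta> (v \<oplus>\<^bsub>V\<^esub> v') w = \<beta> v w \<oplus>\<^bsub>Z\<^esub> \<beta> v' w"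
    and bilin_add_right: "w' \<in> carrier W \<Longrightarrow> \<beta> v (w \<oplus>\<^bsub>W\<^esub> w') = \<beta> v w \<oplus>\<^bsub>Z\<^esub> \<beta> v w'"
    and bilin_smult_left: "\<beta> (c \<odot>\<^bsub>V\<^esub> v) w = c \<odot>\<^bsub>Z\<^esub> \<beta> v w"
    and bilin_smult_right: "\<beta> v (c \<odot>\<^bsub>W\<^esub> w) = c \<odot>\<^bsub>Z\<^esub> \<beta> v w"
  using assms unfolding bilin_def by blast+

lemma is_quot_tensor:
  "is_quot (tensor V W E) (free_on (carrier V \<times> carrier W)) (tensor_rels V W E)"
  by (simp add: is_quot_def tensor_def subspace_free_on tensor_rels_def)

lemmas vspace_tensor = vspace_quot[OF is_quot_tensor]

lemma tens_rel:
  assumes "p - q \<in> bilinear_rels V W \<union> E"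
  shows "p +o tensor_rels V W E = q +o tensor_rels V W E"
  using assms by (simp add: coset_eq_iff tensor_rels_def fs.span_base)

lemma bilin_tens: "bilin V W (tensor V W E) (tens V W E)"
proof (rule bilinI)
  show "tens V W E v w \<in> carrier (tensor V W E)" if "v \<in> carrier V" "w \<in> carrier W" for v w
    unfolding tens_def by (rule quot_closed[OF is_quot_tensor]) (use that in \<open>simp add: free_on_def\<close>)
qed (unfold tens_def quot_add[OF is_quot_tensor] quot_smult[OF is_quot_tensor];
     rule tens_rel; unfold bilinear_rels_def diff_diff_eq[symmetric]; blast)+

lemmas tens_closed = bilin_closed[OF bilin_tens]

lemma tensor_induct [consumes 3, case_names zero tens add]:
  assumes "X \<in> carrier (tensor V W E)" "vspace V" "vspace W" "Q \<zero>\<^bsub>tensor V W E\<^esub>"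
    "\<And>v w. v \<in> carrier V \<Longrightarrow> w \<in> carrier W \<Longrightarrow> Q (tens V W E v w)"
    "\<And>X Y. \<lbrakk>X \<in> carrier (tensor V W E); Y \<in> carrier (tensor V W E); Q X; Q Y\<rbrakk> \<Longrightarrow> Q (X \<oplus>\<^bsub>tensor V W E\<^esub> Y)"
  shows "Q X"
proof -
  note q = is_quot_tensor[of V W E]
  obtain p where p: "p \<in> free_on (carrier V \<times> carrier W)" "X = p +o tensor_rels V W E"
    using quot_cases[OF q assms(1)] by blast
  \<comment> \<open>Claimed for all multiples of \<open>p\<close>, since \<open>Q\<close> is not
    assumed stable under scalars: a multiple of a pure tensor is again pure, the scalar being
    absorbed by the first factor.\<close>
  have "\<forall>c. Q (fscale c p +o tensor_rels V W E)"
    using p(1)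
  proof (induction rule: free_on_induct)
    case (bas x)
    then obtain v w where x: "x = (v, w)" "v \<in> carrier V" "w \<in> carrier W"
      by auto
    have "fscale c (bas x) +o tensor_rels V W E = tens V W E (c \<odot>\<^bsub>V\<^esub> v) w" for c
      using bilin_smult_left[OF bilin_tens[of V W E] x(2,3), of c]
      by (simp add: x(1) tens_def quot_smult[OF q])
    thus ?case
      using assms(5) x assms(2) by (auto simp: vspace_smult_closed)
  next
    case (add p r)
    have "Q ((fscale c p +o tensor_rels V W E) \<oplus>\<^bsub>tensor V W E\<^esub> (fscale c r +o tensor_rels V W E))" for c
      by (rule assms(6); (rule quot_closed[OF q] add.IH[rule_format])?)
         (use add.hyps in \<open>auto intro: fs.subspace_scale[OF subspace_free_on]\<close>)
    thus ?case
      by (simp add: fs.scale_right_distrib quot_add[OF q])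
  qed (use assms(4) in \<open>simp_all add: quot_zero[OF q]\<close>)
  thus ?thesis
    using p(2) by (metis fs.scale_one)
qed

text \<open>Universal property. The extra relations \<open>E\<close> are asked to be differences of
  two pure tensors on which \<open>\<beta>\<close> agrees, which is the form of
  \<open>balanced_rels\<close>; for the plain tensor product the condition is void.\<close>

lemma tensor_lift:
  assumes V: "vspace V" and W: "vspace W" and Z: "vspace Z" and \<beta>: "bilin V W Z \<beta>"
    and E: "\<And>e. e \<in> E \<Longrightarrow> \<exists>v w v' w'. v \<in> carrier V \<and> v' \<in> carrier V \<and> w \<in> carrier W \<and> w' \<in> carrier W \<and>
      e = bas (v, w) - bas (v', w') \<and> \<beta> v w = \<beta> v' w'"
  shows "\<exists>h\<in>lin_maps (tensor V W E) Z. \<forall>v\<in>carrier V. \<forall>w\<in>carrier W. h (tens V W E v w) = \<beta> v w"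
proof -
  let ?P = "free_on (carrier V \<times> carrier W)" and ?R = "tensor_rels V W E"
  define l where "l = flin fscale (\<lambda>(v, w). emb Z (\<beta> v w))"
  note l = fs.flin_add fs.flin_scale
  have lin: "l (p + q) = l p + l q" "l (fscale c p) = fscale c (l p)" "l 0 = 0" for p q c
    by (auto simp: l_def fs.flin_add fs.flin_scale)
  have ldiff: "l (p - q) = l p - l q" for p q
    using lin(1)[of "p - q" q] by (simp add: algebra_simps)
  have lb: "l (bas (v, w)) = emb Z (\<beta> v w)" for v w
    by (simp add: l_def)
  have lc: "l p \<in> emb Z ` carrier Z" if "p \<in> ?P" for p
    using that
  proof (induction rule: free_on_induct)
    case (bas x)
    thus ?case
      by (cases x) (auto simp: lb bilin_closed[OF \<beta>])
  qed (auto simp: lin fs.subspace_0[OF subspace_emb[OF Z]] fs.subspace_add[OF subspace_emb[OF Z]]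
        fs.subspace_scale[OF subspace_emb[OF Z]])
  have lR: "l r = 0" if "r \<in> ?R" for r
  proof -
    have "?R \<subseteq> {r. l r = 0}"
      unfolding tensor_rels_def
    proof (rule fs.span_minimal)
      show "fs.subspace {r. l r = 0}"
        by (rule fs.subspaceI) (auto simp: lin)
      show "bilinear_rels V W \<union> E \<subseteq> {r. l r = 0}"
        unfolding bilinear_rels_def
        by (auto simp: ldiff lin lb bilinD[OF \<beta>] emb_add[OF Z] emb_smult[OF Z] dest!: E)
    qed
    thus ?thesis
      using that by blast
  qed
  let ?h = "quot_map ?P ?R (\<lambda>p. unemb Z (l p))"
  have "?h \<in> lin_maps (tensor V W E) Z" "\<forall>p\<in>?P. ?h (p +o ?R) = unemb Z (l p)"
    using quot_lift_emb[OF is_quot_tensor[of V W E] Z, of l] lin lc lR by auto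
  moreover have "unemb Z (l (bas (v, w))) = \<beta> v w" if "v \<in> carrier V" "w \<in> carrier W" for v w
    using that by (simp add: lb unemb_emb[OF Z] bilin_closed[OF \<beta>])
  ultimately show ?thesis
    by (intro bexI[of _ ?h]) (auto simp: tens_def free_on_def)
qed

lemma tensor_lin_maps_eqI:
  assumes V: "vspace V" and W: "vspace W" and Z: "vspace Z"
    and h: "h \<in> lin_maps (tensor V W E) Z" "g \<in> lin_maps (tensor V W E) Z"
    and "\<And>v w. v \<in> carrier V \<Longrightarrow> w \<in> carrier W \<Longrightarrow> h (tens V W E v w) = g (tens V W E v w)"
  shows "h = g"
proof (rule extensionalityI[OF lin_maps_ext[OF h(1)] lin_maps_ext[OF h(2)]])
  fix X assume "X \<in> carrier (tensor V W E)"
  thus "h X = g X"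
    using V W
    by (induction rule: tensor_induct)
       (use assms(6) in \<open>auto simp: lin_add[OF h(1)] lin_add[OF h(2)] lin_zero[OF vspace_tensor Z h(1)]
         lin_zero[OF vspace_tensor Z h(2)]\<close>)
qed

text \<open>Turns definite descriptions over pure tensors, such as those of \<open>psi\<close> and
  \<open>NU_right\<close>, into usable specifications: existence by \<open>tensor_lift\<close>,
  uniqueness because pure tensors span.\<close>

lemma tensor_THE:
  assumes V: "vspace V" and W: "vspace W" and Z: "vspace Z" and \<beta>: "bilin V W Z \<beta>"
    and E: "\<And>e. e \<in> E \<Longrightarrow> \<exists>v w v' w'. v \<in> carrier V \<and> v' \<in> carrier V \<and> w \<in> carrier W \<and> w' \<in> carrier W \<and>
      e = bas (v, w) - bas (v', w') \<and> \<beta> v w = \<beta> v' w'"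
    and h: "h = (THE h. h \<in> lin_maps (tensor V W E) Z \<and>
      (\<forall>v\<in>carrier V. \<forall>w\<in>carrier W. h (tens V W E v w) = \<beta> v w))"
  shows "h \<in> lin_maps (tensor V W E) Z"
    and "\<And>v w. v \<in> carrier V \<Longrightarrow> w \<in> carrier W \<Longrightarrow> h (tens V W E v w) = \<beta> v w"
proof -
  have "\<exists>!h. h \<in> lin_maps (tensor V W E) Z \<and>
      (\<forall>v\<in>carrier V. \<forall>w\<in>carrier W. h (tens V W E v w) = \<beta> v w)"
    using tensor_lift[OF V W Z \<beta>, of E] E by (auto intro!: tensor_lin_maps_eqI[OF V W Z])
  from theI'[OF this, folded h]
  show "h \<in> lin_maps (tensor V W E) Z"
    and "\<And>v w. v \<in> carrier V \<Longrightarrow> w \<in> carrier W \<Longrightarrow> h (tens V W E v w) = \<beta> v w"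
    by auto
qed

section \<open>Enveloping algebras\<close>

lemma bas_mult: "bas xs * bas ys = (bas (xs @ ys) :: 'k list \<Rightarrow>\<^sub>0 'f::field)"
  by (simp add: mult_single plus_list_def)

lemma bas_Nil: "(bas [] :: 'k list \<Rightarrow>\<^sub>0 'f::field) = 1"
  using single_one[where 'a = "'k list"] by (simp add: zero_list_def)

lemma free_on_lists_mult:
  assumes "p \<in> free_on (lists L)" "q \<in> free_on (lists L)"
  shows "p * q \<in> (free_on (lists L) :: ('k list \<Rightarrow>\<^sub>0 'f::field) set)"
  using assms keys_mult[of p q] by (fastforce simp: free_on_def plus_list_def)

lemma free_on_lists_one: "1 \<in> (free_on (lists L) :: ('k list \<Rightarrow>\<^sub>0 'f::field) set)"
  unfolding bas_Nil[symmetric] by (rule bas_free_on) simp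

lemma free_on_mono: "X \<subseteq> Y \<Longrightarrow> free_on X \<subseteq> free_on Y"
  by (auto simp: free_on_def)

lemma free_on_UNIV [simp]: "free_on UNIV = UNIV"
  by (auto simp: free_on_def)

lemmas free_on_closed = fs.subspace_0[OF subspace_free_on] fs.subspace_add[OF subspace_free_on]
  fs.subspace_scale[OF subspace_free_on] fs.subspace_diff[OF subspace_free_on]
  fs.subspace_neg[OF subspace_free_on] free_on_lists_mult free_on_lists_one

lemma fspan_mult_closed:
  assumes "p \<in> fspan G" "q \<in> fspan H" "\<And>g h. g \<in> G \<Longrightarrow> h \<in> H \<Longrightarrow> g * h \<in> fspan K"
  shows "p * q \<in> (fspan K :: ('a::monoid_add \<Rightarrow>\<^sub>0 'f::field) set)"
proof -
  have *: "g * q \<in> fspan K" if "g \<in> G" for g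
    using assms(2) by (induction rule: fs.span_induct_alt)
      (simp_all add: distrib_left fscale_mult_right fs.span_zero fs.span_add fs.span_scale assms(3) that)
  show ?thesis
    using assms(1) by (induction rule: fs.span_induct_alt)
      (simp_all add: distrib_right fscale_mult_left fs.span_zero fs.span_add fs.span_scale *)
qed

context lie_algebra
begin

abbreviation (input) U_mult (infixl "\<cdot>" 70) where "u \<cdot> v \<equiv> u \<otimes>\<^bsub>env UNIV\<^esub> v"

abbreviation cl :: "'k set \<Rightarrow> ('k list \<Rightarrow>\<^sub>0 'f) \<Rightarrow> ('k list \<Rightarrow>\<^sub>0 'f) set" where
  "cl L p \<equiv> p +o env_ideal L"

abbreviation FA :: "'k set \<Rightarrow> ('k list \<Rightarrow>\<^sub>0 'f) set" where
  "FA L \<equiv> free_on (lists L)"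

lemma subspace_ideal: "fs.subspace (env_ideal L)"
proof (rule fs.subspaceI)
  show "fscale c p \<in> env_ideal L" if "p \<in> env_ideal L" for c p
  proof -
    have "fscale c 1 * p \<in> env_ideal L"
      using that unfolding env_ideal_def by (intro two_sided_ideal.left free_on_closed)
    thus ?thesis
      by (simp add: fscale_mult_left)
  qed
qed (auto simp: env_ideal_def intro: two_sided_ideal.intros)

lemmas ideal_closed = fs.subspace_0[OF subspace_ideal] fs.subspace_add[OF subspace_ideal]
  fs.subspace_scale[OF subspace_ideal] fs.subspace_diff[OF subspace_ideal]
  fs.subspace_neg[OF subspace_ideal]

lemma env_ideal_left: "a \<in> FA L \<Longrightarrow> p \<in> env_ideal L \<Longrightarrow> a * p \<in> env_ideal L"
  and env_ideal_right: "a \<in> FA L \<Longrightarrow> p \<in> env_ideal L \<Longrightarrow> p * a \<in> env_ideal L"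
  and env_ideal_gen: "g \<in> env_gens L \<Longrightarrow> g \<in> env_ideal L"
  by (auto simp: env_ideal_def intro: two_sided_ideal.intros)

lemma env_gens_cases [consumes 1, case_names add scale bracket]:
  assumes "g \<in> env_gens L"
    "\<And>x y. \<lbrakk>x \<in> L; y \<in> L; g = bas [x + y] - bas [x] - bas [y]\<rbrakk> \<Longrightarrow> thesis"
    "\<And>c x. x \<in> L \<Longrightarrow> g = bas [scale c x] - fscale c (bas [x]) \<Longrightarrow> thesis"
    "\<And>x y. \<lbrakk>x \<in> L; y \<in> L; g = bas [x] * bas [y] - bas [y] * bas [x] - bas [bracket x y]\<rbrakk> \<Longrightarrow> thesis"
  shows thesis
  using assms(1) unfolding env_gens_def by (elim UnE CollectE exE conjE) (erule (2) assms(2) assms(3) assms(4) | erule (1) assms(3))+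

lemma env_gens_mono: "L \<subseteq> M \<Longrightarrow> env_gens L \<subseteq> env_gens M"
  unfolding env_gens_def by blast

lemma env_ideal_mono:
  assumes "L \<subseteq> M"
  shows "env_ideal L \<subseteq> env_ideal M"
proof
  fix p assume "p \<in> env_ideal L"
  hence "p \<in> two_sided_ideal (FA L) (env_gens L)"
    by (simp add: env_ideal_def)
  thus "p \<in> env_ideal M"
    unfolding env_ideal_def
    by induction (use env_gens_mono[OF assms] free_on_mono[OF lists_mono[OF assms]] in \<open>auto intro: two_sided_ideal.intros\<close>)
qed

lemma env_gens_sub: "lie_subalgebra L \<Longrightarrow> g \<in> env_gens L \<Longrightarrow> g \<in> FA L"
  by (erule env_gens_cases)
     (auto simp: lie_subalgebra_def subspace_add subspace_scale bas_free_on intro!: free_on_closed)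

lemma env_ideal_sub:
  assumes "lie_subalgebra L"
  shows "env_ideal L \<subseteq> FA L"
proof
  fix p assume "p \<in> env_ideal L"
  hence "p \<in> two_sided_ideal (FA L) (env_gens L)"
    by (simp add: env_ideal_def)
  thus "p \<in> FA L"
    by induction (use env_gens_sub[OF assms] in \<open>auto intro: free_on_closed\<close>)
qed

text \<open>A linear map kills the ideal as soon as it kills every generator flanked by two words.
  This is the form in which maps out of an enveloping algebra are checked below.\<close>

lemma env_ideal_span:
  "env_ideal L = fspan {bas u * g * bas w | u w g. u \<in> lists L \<and> w \<in> lists L \<and> g \<in> env_gens L}"
  (is "_ = fspan ?G")
proof (intro equalityI subsetI)
  fix p assume "p \<in> env_ideal L"
  hence "p \<in> two_sided_ideal (FA L) (env_gens L)"
    by (simp add: env_ideal_def)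
  thus "p \<in> fspan ?G"
  proof induction
    case (gen r)
    hence "bas [] * r * bas [] \<in> ?G"
      by blast
    thus ?case
      by (simp add: bas_Nil fs.span_base)
  next
    case (left a p)
    show ?case
    proof (rule fspan_mult_closed[OF left(1)[unfolded free_on_span] left(3)])
      fix b h :: "'k list \<Rightarrow>\<^sub>0 'f" assume "b \<in> bas ` lists L" "h \<in> ?G"
      then obtain x u w g where *: "x \<in> lists L" "u \<in> lists L" "w \<in> lists L" "g \<in> env_gens L"
        "b = bas x" "h = bas u * g * bas w"
        by auto
      hence "b * h = bas (x @ u) * g * bas w" "x @ u \<in> lists L"
        by (simp_all add: bas_mult[symmetric] mult.assoc)
      thus "b * h \<in> fspan ?G"
        using * by (intro fs.span_base) blast
    qed
  next
    case (right a p)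
    show ?case
    proof (rule fspan_mult_closed[OF right(3) right(1)[unfolded free_on_span]])
      fix b h :: "'k list \<Rightarrow>\<^sub>0 'f" assume "b \<in> bas ` lists L" "h \<in> ?G"
      then obtain x u w g where *: "x \<in> lists L" "u \<in> lists L" "w \<in> lists L" "g \<in> env_gens L"
        "b = bas x" "h = bas u * g * bas w"
        by auto
      hence "h * b = bas u * g * bas (w @ x)" "w @ x \<in> lists L"
        by (simp_all add: bas_mult[symmetric] mult.assoc)
      thus "h * b \<in> fspan ?G"
        using * by (intro fs.span_base) blast
    qed
  qed (auto intro: fs.span_zero fs.span_add)
next
  have "fspan ?G \<subseteq> env_ideal L"
    by (rule fs.span_minimal[OF _ subspace_ideal])
       (auto intro: env_ideal_left env_ideal_right env_ideal_gen bas_free_on)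
  thus "p \<in> fspan ?G \<Longrightarrow> p \<in> env_ideal L" for p
    by blast
qed

lemma is_quot_env: "is_quot (env L) (FA L) (env_ideal L)"
  by (simp add: is_quot_def env_def subspace_free_on subspace_ideal)

lemmas vspace_env = vspace_quot[OF is_quot_env]
lemmas env_add_closed = vspace_add_closed[OF vspace_env]
lemmas env_smult_closed = vspace_smult_closed[OF vspace_env]
lemmas env_zero_closed = vspace_zero_closed[OF vspace_env]
lemmas env_add = quot_add[OF is_quot_env]
lemmas env_smult = quot_smult[OF is_quot_env]
lemmas env_zero = quot_zero[OF is_quot_env]
lemmas env_closed = quot_closed[OF is_quot_env]
lemmas env_cases = quot_cases[OF is_quot_env]

lemma cl_eq_iff: "cl L p = cl L q \<longleftrightarrow> p - q \<in> env_ideal L"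
  by (rule coset_eq_iff[OF subspace_ideal])

text \<open>The setwise product of two cosets need not be a coset, which is why \<open>env\<close>
  adds the ideal. In the expansion of representatives, the product of two elements of the ideal is
  controlled by the inclusion of the ideal in \<open>FA L\<close>, and that inclusion comes from
  \<open>L\<close> being a subalgebra.\<close>

lemma env_mult:
  assumes L: "lie_subalgebra L" and pq: "p \<in> FA L" "q \<in> FA L"
  shows "cl L p \<otimes>\<^bsub>env L\<^esub> cl L q = cl L (p * q)"
proof -
  have "cl L p * cl L q + env_ideal L = cl L (p * q)"
  proof (intro equalityI subsetI)
    fix x assume "x \<in> cl L p * cl L q + env_ideal L"
    then obtain i j k where ijk: "i \<in> env_ideal L" "j \<in> env_ideal L" "k \<in> env_ideal L"
      and x: "x = (p + i) * (q + j) + k"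
      by (auto elim!: set_plus_elim set_times_elim simp: elt_set_plus_def)
    have "i * (q + j) = i * q + i * j" "(p + i) * (q + j) = p * q + (i * q + p * j + i * j)"
      by (simp_all add: algebra_simps)
    moreover have "i * j \<in> env_ideal L"
      using ijk env_ideal_sub[OF L] env_ideal_left by blast
    moreover have "i * q \<in> env_ideal L" "p * j \<in> env_ideal L"
      using ijk pq by (simp_all add: env_ideal_left env_ideal_right)
    ultimately show "x \<in> cl L (p * q)"
      using ijk(3) unfolding x
      by (auto simp: elt_set_plus_def add.assoc intro!: bexI[of _ "i * q + (p * j + (i * j + k))"] ideal_closed)
  next
    fix x assume "x \<in> cl L (p * q)"
    then obtain k where "k \<in> env_ideal L" "x = p * q + k"
      by (auto simp: elt_set_plus_def)
    moreover have "p \<in> cl L p" "q \<in> cl L q"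
      using set_plus_intro2[OF ideal_closed(1)] by (metis add_0_right)+
    ultimately show "x \<in> cl L p * cl L q + env_ideal L"
      by (auto intro!: set_plus_intro set_times_intro)
  qed
  thus ?thesis
    by (simp add: env_def)
qed

lemma env_one: "\<one>\<^bsub>env L\<^esub> = cl L 1"
  by (simp add: env_def)

lemma env_in_closed: "x \<in> L \<Longrightarrow> env_in L x \<in> carrier (env L)"
  unfolding env_in_def by (rule env_closed) (simp add: bas_free_on)

lemma env_mult_closed:
  "\<lbrakk>lie_subalgebra L; X \<in> carrier (env L); Y \<in> carrier (env L)\<rbrakk> \<Longrightarrow> X \<otimes>\<^bsub>env L\<^esub> Y \<in> carrier (env L)"
  by (elim env_cases) (simp add: env_mult env_closed free_on_closed)

lemma env_one_closed: "\<one>\<^bsub>env L\<^esub> \<in> carrier (env L)"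
  by (simp add: env_one env_closed free_on_closed)

lemma env_mult_assoc:
  "\<lbrakk>lie_subalgebra L; X \<in> carrier (env L); Y \<in> carrier (env L); Z \<in> carrier (env L)\<rbrakk> \<Longrightarrow>
    X \<otimes>\<^bsub>env L\<^esub> Y \<otimes>\<^bsub>env L\<^esub> Z = X \<otimes>\<^bsub>env L\<^esub> (Y \<otimes>\<^bsub>env L\<^esub> Z)"
  by (elim env_cases) (simp add: env_mult free_on_closed mult.assoc)

lemma env_one_left: "lie_subalgebra L \<Longrightarrow> X \<in> carrier (env L) \<Longrightarrow> \<one>\<^bsub>env L\<^esub> \<otimes>\<^bsub>env L\<^esub> X = X"
  and env_one_right: "lie_subalgebra L \<Longrightarrow> X \<in> carrier (env L) \<Longrightarrow> X \<otimes>\<^bsub>env L\<^esub> \<one>\<^bsub>env L\<^esub> = X"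
  by (elim env_cases; simp add: env_mult env_one free_on_closed)+

lemma bilin_env_mult:
  assumes L: "lie_subalgebra L"
  shows "bilin (env L) (env L) (env L) (\<lambda>X Y. X \<otimes>\<^bsub>env L\<^esub> Y)"
  by (rule bilinI; elim env_cases)
     (simp_all add: env_mult[OF L] env_add env_smult env_closed free_on_closed distrib_left distrib_right
       fscale_mult_left fscale_mult_right)

lemma env_incl_cl: "env_incl (cl L p) = cl UNIV p"
proof -
  have "env_ideal L + env_ideal UNIV \<subseteq> env_ideal UNIV + env_ideal UNIV"
    by (rule set_plus_mono2[OF env_ideal_mono]) simp_all
  hence "env_ideal L + env_ideal UNIV = env_ideal UNIV"
    using set_zero_plus2[OF ideal_closed(1)[of L], of "env_ideal UNIV"]
    by (simp add: subspace_set_plus[OF subspace_ideal])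
  thus ?thesis
    by (simp add: env_incl_def set_plus_rearrange3)
qed

lemma sub_U: "lie_subalgebra UNIV"
  by (simp add: lie_subalgebra_def)

lemma incl_closed: "X \<in> carrier (env L) \<Longrightarrow> env_incl X \<in> carrier (env UNIV)"
  by (elim env_cases) (simp add: env_incl_cl env_closed)

lemma env_incl_add: "X \<in> carrier (env L) \<Longrightarrow> Y \<in> carrier (env L) \<Longrightarrow>
    env_incl (X \<oplus>\<^bsub>env L\<^esub> Y) = env_incl X \<oplus>\<^bsub>env UNIV\<^esub> env_incl Y"
  by (elim env_cases) (simp add: env_incl_cl env_add)

lemma env_incl_smult: "X \<in> carrier (env L) \<Longrightarrow> env_incl (c \<odot>\<^bsub>env L\<^esub> X) = c \<odot>\<^bsub>env UNIV\<^esub> env_incl X"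
  by (elim env_cases) (simp add: env_incl_cl env_smult)

lemma env_incl_mult: "\<lbrakk>lie_subalgebra L; X \<in> carrier (env L); Y \<in> carrier (env L)\<rbrakk> \<Longrightarrow>
    env_incl (X \<otimes>\<^bsub>env L\<^esub> Y) = env_incl X \<cdot> env_incl Y"
  by (elim env_cases) (simp add: env_incl_cl env_mult sub_U)

lemma env_incl_one: "env_incl \<one>\<^bsub>env L\<^esub> = \<one>\<^bsub>env UNIV\<^esub>"
  by (simp add: env_one env_incl_cl)

lemma env_incl_in: "env_incl (env_in L x) = env_in UNIV x"
  by (simp add: env_in_def env_incl_cl)

lemma env_in_rels:
  assumes "x \<in> L" "y \<in> L"
  shows env_in_add: "env_in L (x + y) = env_in L x \<oplus>\<^bsub>env L\<^esub> env_in L y"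
    and env_in_scale: "env_in L (scale c x) = c \<odot>\<^bsub>env L\<^esub> env_in L x"
proof -
  have "bas [x + y] - bas [x] - bas [y] \<in> env_ideal L" "bas [scale c x] - fscale c (bas [x]) \<in> env_ideal L"
    using assms by (intro env_ideal_gen; unfold env_gens_def; blast)+
  thus "env_in L (x + y) = env_in L x \<oplus>\<^bsub>env L\<^esub> env_in L y"
    "env_in L (scale c x) = c \<odot>\<^bsub>env L\<^esub> env_in L x"
    by (simp_all add: env_in_def env_add env_smult cl_eq_iff diff_diff_eq)
qed

lemma env_in_bracket:
  assumes "lie_subalgebra L" "x \<in> L" "y \<in> L"
  shows "env_in L x \<otimes>\<^bsub>env L\<^esub> env_in L y = env_in L y \<otimes>\<^bsub>env L\<^esub> env_in L x \<oplus>\<^bsub>env L\<^esub> env_in L (bracket x y)"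
proof -
  have "bas [x] * bas [y] - bas [y] * bas [x] - bas [bracket x y] \<in> env_ideal L"
    using assms by (intro env_ideal_gen; unfold env_gens_def; blast)
  thus ?thesis
    using assms by (simp add: env_in_def env_mult env_add cl_eq_iff bas_free_on diff_diff_eq)
qed

lemma env_induct [consumes 2, case_names zero one step add smult]:
  assumes "X \<in> carrier (env L)" "lie_subalgebra L" "Q \<zero>\<^bsub>env L\<^esub>" "Q \<one>\<^bsub>env L\<^esub>"
    "\<And>x X. \<lbrakk>x \<in> L; X \<in> carrier (env L); Q X\<rbrakk> \<Longrightarrow> Q (env_in L x \<otimes>\<^bsub>env L\<^esub> X)"
    "\<And>X Y. \<lbrakk>X \<in> carrier (env L); Y \<in> carrier (env L); Q X; Q Y\<rbrakk> \<Longrightarrow> Q (X \<oplus>\<^bsub>env L\<^esub> Y)"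
    "\<And>c X. X \<in> carrier (env L) \<Longrightarrow> Q X \<Longrightarrow> Q (c \<odot>\<^bsub>env L\<^esub> X)"
  shows "Q X"
proof -
  obtain p where p: "p \<in> FA L" "X = cl L p"
    using env_cases[OF assms(1)] by blast
  have w: "Q (cl L (bas w))" if "w \<in> lists L" for w
    using that
  proof (induction w)
    case Nil
    thus ?case
      using assms(4) by (simp add: env_one bas_Nil)
  next
    case (Cons x w)
    have "Q (env_in L x \<otimes>\<^bsub>env L\<^esub> cl L (bas w))"
      by (rule assms(5)) (use Cons in \<open>auto intro!: env_closed bas_free_on\<close>)
    thus ?case
      using Cons.hyps assms(2) by (simp add: env_in_def env_mult bas_free_on bas_mult)
  qed
  have "Q (cl L p)"
    using p(1)
  proof (induction rule: free_on_induct)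
    case (add p q)
    thus ?case
      using assms(6)[OF env_closed[OF add(1)] env_closed[OF add(2)]] by (simp add: env_add)
  next
    case (scale c p)
    thus ?case
      using assms(7)[OF env_closed[OF scale(1)]] by (simp add: env_smult)
  qed (use assms(3) w in \<open>simp_all add: env_zero\<close>)
  thus ?thesis
    by (simp add: p(2))
qed

end

section \<open>Representations of a Lie algebra as modules over its enveloping algebra\<close>

lemma left_actionI:
  assumes "\<rho> \<in> extensional (carrier A)" "\<And>a. a \<in> carrier A \<Longrightarrow> \<rho> a \<in> lin_maps V V"
    "\<And>a b x. \<lbrakk>a \<in> carrier A; b \<in> carrier A; x \<in> carrier V\<rbrakk> \<Longrightarrow> \<rho> (a \<oplus>\<^bsub>A\<^esub> b) x = \<rho> a x \<oplus>\<^bsub>V\<^esub> \<rho> b x"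
    "\<And>a b x. \<lbrakk>a \<in> carrier A; b \<in> carrier A; x \<in> carrier V\<rbrakk> \<Longrightarrow> \<rho> (a \<otimes>\<^bsub>A\<^esub> b) x = \<rho> a (\<rho> b x)"
    "\<And>c a x. a \<in> carrier A \<Longrightarrow> x \<in> carrier V \<Longrightarrow> \<rho> (c \<odot>\<^bsub>A\<^esub> a) x = c \<odot>\<^bsub>V\<^esub> \<rho> a x"
    "\<And>x. x \<in> carrier V \<Longrightarrow> \<rho> \<one>\<^bsub>A\<^esub> x = x"
  shows "left_action A V \<rho>"
  unfolding left_action_def PiE_iff
  by (intro conjI ballI allI assms) assumption+

lemma left_actionD:
  assumes "left_action A V \<rho>"
  shows left_action_ext: "\<rho> \<in> extensional (carrier A)"
    and left_action_lin: "\<And>a. a \<in> carrier A \<Longrightarrow> \<rho> a \<in> lin_maps V V"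
    and left_action_add: "\<And>a b x. \<lbrakk>a \<in> carrier A; b \<in> carrier A; x \<in> carrier V\<rbrakk> \<Longrightarrow> \<rho> (a \<oplus>\<^bsub>A\<^esub> b) x = \<rho> a x \<oplus>\<^bsub>V\<^esub> \<rho> b x"
    and left_action_mult: "\<And>a b x. \<lbrakk>a \<in> carrier A; b \<in> carrier A; x \<in> carrier V\<rbrakk> \<Longrightarrow> \<rho> (a \<otimes>\<^bsub>A\<^esub> b) x = \<rho> a (\<rho> b x)"
    and left_action_smult: "\<And>c a x. a \<in> carrier A \<Longrightarrow> x \<in> carrier V \<Longrightarrow> \<rho> (c \<odot>\<^bsub>A\<^esub> a) x = c \<odot>\<^bsub>V\<^esub> \<rho> a x"
    and left_action_one: "\<And>x. x \<in> carrier V \<Longrightarrow> \<rho> \<one>\<^bsub>A\<^esub> x = x"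
  by (rule assms[unfolded left_action_def PiE_iff, THEN conjunct1, THEN conjunct2]
      assms[unfolded left_action_def PiE_iff, THEN conjunct1, THEN conjunct1, THEN bspec]
      assms[unfolded left_action_def PiE_iff, THEN conjunct2, THEN conjunct1, rule_format, THEN conjunct1]
      assms[unfolded left_action_def PiE_iff, THEN conjunct2, THEN conjunct1, rule_format, THEN conjunct2]
      assms[unfolded left_action_def PiE_iff, THEN conjunct2, THEN conjunct2, THEN conjunct1, rule_format]
      assms[unfolded left_action_def PiE_iff, THEN conjunct2, THEN conjunct2, THEN conjunct2, rule_format]; assumption)+

lemma left_action_closed: "\<lbrakk>left_action A V \<rho>; a \<in> carrier A; x \<in> carrier V\<rbrakk> \<Longrightarrow> \<rho> a x \<in> carrier V"
  by (rule lin_closed[OF left_action_lin])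

context lie_algebra
begin

definition lie_rep :: "'k set \<Rightarrow> ('f, 'v) module \<Rightarrow> ('k \<Rightarrow> 'v \<Rightarrow> 'v) \<Rightarrow> bool" where
  "lie_rep L V T \<longleftrightarrow> (\<forall>x\<in>L. T x \<in> lin_maps V V) \<and>
    (\<forall>x\<in>L. \<forall>y\<in>L. \<forall>v\<in>carrier V. T (x + y) v = T x v \<oplus>\<^bsub>V\<^esub> T y v) \<and>
    (\<forall>c. \<forall>x\<in>L. \<forall>v\<in>carrier V. T (scale c x) v = c \<odot>\<^bsub>V\<^esub> T x v) \<and>
    (\<forall>x\<in>L. \<forall>y\<in>L. \<forall>v\<in>carrier V. T x (T y v) = T y (T x v) \<oplus>\<^bsub>V\<^esub> T (bracket x y) v)"

lemma lie_repI:
  assumes "\<And>x. x \<in> L \<Longrightarrow> T x \<in> lin_maps V V"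
    "\<And>x y v. \<lbrakk>x \<in> L; y \<in> L; v \<in> carrier V\<rbrakk> \<Longrightarrow> T (x + y) v = T x v \<oplus>\<^bsub>V\<^esub> T y v"
    "\<And>c x v. x \<in> L \<Longrightarrow> v \<in> carrier V \<Longrightarrow> T (scale c x) v = c \<odot>\<^bsub>V\<^esub> T x v"
    "\<And>x y v. \<lbrakk>x \<in> L; y \<in> L; v \<in> carrier V\<rbrakk> \<Longrightarrow> T x (T y v) = T y (T x v) \<oplus>\<^bsub>V\<^esub> T (bracket x y) v"
  shows "lie_rep L V T"
  unfolding lie_rep_def by (intro conjI ballI allI assms) assumption+

lemma lie_repD:
  assumes "lie_rep L V T"
  shows lie_rep_lin: "\<And>x. x \<in> L \<Longrightarrow> T x \<in> lin_maps V V"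
    and lie_rep_add: "\<And>x y v. \<lbrakk>x \<in> L; y \<in> L; v \<in> carrier V\<rbrakk> \<Longrightarrow> T (x + y) v = T x v \<oplus>\<^bsub>V\<^esub> T y v"
    and lie_rep_scale: "\<And>c x v. x \<in> L \<Longrightarrow> v \<in> carrier V \<Longrightarrow> T (scale c x) v = c \<odot>\<^bsub>V\<^esub> T x v"
    and lie_rep_bracket: "\<And>x y v. \<lbrakk>x \<in> L; y \<in> L; v \<in> carrier V\<rbrakk> \<Longrightarrow>
      T x (T y v) = T y (T x v) \<oplus>\<^bsub>V\<^esub> T (bracket x y) v"
  by (rule assms[unfolded lie_rep_def, THEN conjunct1, THEN bspec]
      assms[unfolded lie_rep_def, THEN conjunct2, THEN conjunct1, rule_format]
      assms[unfolded lie_rep_def, THEN conjunct2, THEN conjunct2, THEN conjunct1, rule_format]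
      assms[unfolded lie_rep_def, THEN conjunct2, THEN conjunct2, THEN conjunct2, rule_format]; assumption)+

lemma lie_rep_closed: "\<lbrakk>lie_rep L V T; x \<in> L; v \<in> carrier V\<rbrakk> \<Longrightarrow> T x v \<in> carrier V"
  by (rule lin_closed[OF lie_rep_lin])

lemma left_action_env_eqI:
  assumes L: "lie_subalgebra L" and V: "vspace V" and \<tau>: "left_action (env L) V \<tau>" "left_action (env L) V \<sigma>"
    and gen: "\<And>x v. x \<in> L \<Longrightarrow> v \<in> carrier V \<Longrightarrow> \<tau> (env_in L x) v = \<sigma> (env_in L x) v"
  shows "\<tau> = \<sigma>"
proof (rule extensionalityI[OF left_action_ext[OF \<tau>(1)] left_action_ext[OF \<tau>(2)]])
  fix X assume X: "X \<in> carrier (env L)"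
  have "\<forall>v\<in>carrier V. \<tau> X v = \<sigma> X v"
    using X L
  proof (induction rule: env_induct)
    case zero
    have z: "\<tau> \<zero>\<^bsub>env L\<^esub> v = \<zero>\<^bsub>V\<^esub>" if "left_action (env L) V \<tau>" "v \<in> carrier V" for \<tau> v
      using left_action_smult[OF that(1) env_zero_closed that(2), of 0]
        left_action_closed[OF that(1) env_zero_closed that(2)]
      by (simp add: vspace_zero_smult[OF V] vspace_zero_smult[OF vspace_env] env_zero_closed)
    show ?case
      by (simp add: z[OF \<tau>(1)] z[OF \<tau>(2)])
  next
    case (step x X)
    thus ?case
      by (simp add: left_action_mult[OF \<tau>(1)] left_action_mult[OF \<tau>(2)] env_in_closed gen
          left_action_closed[OF \<tau>(2)])
  qed (simp_all add: left_action_one[OF \<tau>(1)] left_action_one[OF \<tau>(2)] left_action_add[OF \<tau>(1)]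
      left_action_add[OF \<tau>(2)] left_action_smult[OF \<tau>(1)] left_action_smult[OF \<tau>(2)])
  thus "\<tau> X = \<sigma> X"
    using lin_maps_ext[OF left_action_lin[OF \<tau>(1) X]] lin_maps_ext[OF left_action_lin[OF \<tau>(2) X]]
    by (auto intro: extensionalityI)
qed

text \<open>Universal property of the enveloping algebra: a word acts by composing the operators of
  its letters, and each generator of the ideal acts by zero since \<open>T\<close> respects sums,
  scalars and brackets. Sums are formed in the embedded copy of \<open>V\<close>, hence the detour
  through \<open>unemb\<close>.\<close>

lemma lie_rep_extends_ex:
  assumes L: "lie_subalgebra L" and V: "vspace V" and T: "lie_rep L V T"
  shows "\<exists>\<tau>. left_action (env L) V \<tau> \<and> (\<forall>x\<in>L. \<forall>v\<in>carrier V. \<tau> (env_in L x) v = T x v)"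
proof -
  note [simp] = emb_add[OF V] emb_smult[OF V] emb_zero[OF V] vspace_add_closed[OF V]
    vspace_smult_closed[OF V] vspace_zero_closed[OF V]
  have wc: "foldr T w v \<in> carrier V" if "w \<in> lists L" "v \<in> carrier V" for w v
    using that by (induction w) (auto simp: lie_rep_closed[OF T])
  have wadd: "foldr T w (v \<oplus>\<^bsub>V\<^esub> v') = foldr T w v \<oplus>\<^bsub>V\<^esub> foldr T w v'"
    if "w \<in> lists L" "v \<in> carrier V" "v' \<in> carrier V" for w v v'
    using that by (induction w) (auto simp: wc lin_add[OF lie_rep_lin[OF T]])
  have wsm: "foldr T w (c \<odot>\<^bsub>V\<^esub> v) = c \<odot>\<^bsub>V\<^esub> foldr T w v"
    if "w \<in> lists L" "v \<in> carrier V" for w v c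
    using that by (induction w) (auto simp: wc lin_smult[OF lie_rep_lin[OF T]])
  define a where "a v = flin fscale (\<lambda>w. emb V (foldr T w v))" for v
  have a: "a v (p + q) = a v p + a v q" "a v (fscale c p) = fscale c (a v p)" "a v 0 = 0"
    "a v (bas w) = emb V (foldr T w v)" for v p q c w
    by (simp_all add: a_def fs.flin_add fs.flin_scale)
  have ac: "a v p \<in> emb V ` carrier V" if "p \<in> FA L" "v \<in> carrier V" for p v
    using that(1) by (induction rule: free_on_induct)
      (auto simp: a wc that(2) subspace_emb[OF V] fs.subspace_0 fs.subspace_add fs.subspace_scale)
  define act where "act p v = unemb V (a v p)" for p v
  have act: "act p v \<in> carrier V" "emb V (act p v) = a v p" if "p \<in> FA L" "v \<in> carrier V" for p v
    using ac[OF that] by (auto simp: act_def unemb_closed emb_unemb)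
  have act_bas: "act (bas w) v = foldr T w v" if "w \<in> lists L" "v \<in> carrier V" for w v
    using that by (simp add: act_def a unemb_emb[OF V] wc)
  have act_zero: "act 0 v = \<zero>\<^bsub>V\<^esub>" if "v \<in> carrier V" for v
    by (rule emb_eqD[OF V]) (simp_all add: act that free_on_closed a)
  have act_add: "act (p + q) v = act p v \<oplus>\<^bsub>V\<^esub> act q v" if "p \<in> FA L" "q \<in> FA L" "v \<in> carrier V" for p q v
    by (rule emb_eqD[OF V]) (simp_all add: act that free_on_closed a)
  have act_scale: "act (fscale c p) v = c \<odot>\<^bsub>V\<^esub> act p v" if "p \<in> FA L" "v \<in> carrier V" for p c v
    by (rule emb_eqD[OF V]) (simp_all add: act that free_on_closed a)
  have act_lin1: "act p (v \<oplus>\<^bsub>V\<^esub> v') = act p v \<oplus>\<^bsub>V\<^esub> act p v'"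
    if p: "p \<in> FA L" and v: "v \<in> carrier V" "v' \<in> carrier V" for p v v'
    using p
  proof (induction rule: free_on_induct)
    case (add p q)
    show ?case
      by (rule emb_eqD[OF V]) (simp_all add: add act_add v act free_on_closed ac_simps)
  next
    case (scale c p)
    show ?case
      by (rule emb_eqD[OF V]) (simp_all add: scale act_scale v act free_on_closed fs.scale_right_distrib)
  next
    case zero
    show ?case
      by (rule emb_eqD[OF V]) (simp_all add: act_zero v)
  qed (simp_all add: act_bas v wadd)
  have act_lin2: "act p (d \<odot>\<^bsub>V\<^esub> v) = d \<odot>\<^bsub>V\<^esub> act p v"
    if p: "p \<in> FA L" and v: "v \<in> carrier V" for p v d
    using p
  proof (induction rule: free_on_induct)
    case (add p q)
    show ?case
      by (rule emb_eqD[OF V]) (simp_all add: add act_add v act free_on_closed fs.scale_right_distrib)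
  next
    case (scale c p)
    show ?case
      by (rule emb_eqD[OF V]) (simp_all add: scale act_scale v act free_on_closed mult.commute)
  next
    case zero
    show ?case
      by (rule emb_eqD[OF V]) (simp_all add: act_zero v)
  qed (simp_all add: act_bas v wsm)
  have act_mult: "act (p * q) v = act p (act q v)"
    if p: "p \<in> FA L" and q: "q \<in> FA L" and v: "v \<in> carrier V" for p q v
    using p
  proof (induction rule: free_on_induct)
    case (bas w)
    have bw: "bas w \<in> FA L"
      by (rule bas_free_on[OF bas])
    show ?case
      using q
    proof (induction rule: free_on_induct)
      case (bas u)
      thus ?case
        using \<open>w \<in> lists L\<close> v by (simp add: bas_mult act_bas wc)
    next
      case (add p q)
      thus ?case
        using bw by (simp add: distrib_left act_add act_lin1 act free_on_closed v)
    next
      case (scale c p)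
      thus ?case
        using bw by (simp add: fscale_mult_right act_scale act_lin2 act free_on_closed v)
    next
      case zero
      have "act (bas w) \<zero>\<^bsub>V\<^esub> = \<zero>\<^bsub>V\<^esub>"
        using act_lin2[OF bw, of "\<zero>\<^bsub>V\<^esub>" 0] act(1)[OF bw, of "\<zero>\<^bsub>V\<^esub>"]
        by (simp add: vspace_zero_smult[OF V])
      thus ?case
        by (simp add: act_zero v)
    qed
  next
    case (add p p')
    thus ?case
      by (simp add: distrib_right act_add act free_on_closed v q)
  next
    case (scale c p)
    thus ?case
      by (simp add: fscale_mult_left act_scale act free_on_closed v q)
  qed (simp add: act_zero act v q)
  have act_gen: "act g v = \<zero>\<^bsub>V\<^esub>" if "g \<in> env_gens L" "v \<in> carrier V" for g v
  proof -
    have av: "a v (p - q) = a v p - a v q" for p q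
      using a(1)[of v "p - q" q] by (simp add: algebra_simps)
    have "emb V (act g v) = 0"
      using that(1)
    proof (cases rule: env_gens_cases)
      case (add x y)
      thus ?thesis
        using that by (simp add: act env_gens_sub[OF L] av a lie_rep_add[OF T] lie_rep_closed[OF T])
    next
      case (scale c x)
      thus ?thesis
        using that by (simp add: act env_gens_sub[OF L] av a lie_rep_scale[OF T] lie_rep_closed[OF T])
    next
      case (bracket x y)
      moreover have "bracket x y \<in> L"
        using L bracket by (simp add: lie_subalgebra_def)
      ultimately show ?thesis
        using that by (simp add: act env_gens_sub[OF L] av a bas_mult lie_rep_bracket[OF T, of x y] lie_rep_closed[OF T])
    qed
    thus ?thesis
      using that act(1)[OF env_gens_sub[OF L that(1)] that(2)] by (intro emb_eqD[OF V]) simp_all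
  qed
  have act_ideal: "act r v = \<zero>\<^bsub>V\<^esub>" if "r \<in> env_ideal L" "v \<in> carrier V" for r v
  proof -
    have "env_ideal L \<subseteq> {r \<in> FA L. act r v = \<zero>\<^bsub>V\<^esub>}"
      unfolding env_ideal_span
    proof (rule fs.span_minimal)
      have z: "c \<odot>\<^bsub>V\<^esub> \<zero>\<^bsub>V\<^esub> = \<zero>\<^bsub>V\<^esub>" "\<zero>\<^bsub>V\<^esub> \<oplus>\<^bsub>V\<^esub> \<zero>\<^bsub>V\<^esub> = \<zero>\<^bsub>V\<^esub>" for c
        by (rule emb_eqD[OF V]; simp)+
      show "fs.subspace {r \<in> FA L. act r v = \<zero>\<^bsub>V\<^esub>}"
        by (rule fs.subspaceI) (use that z in \<open>auto simp: act_zero act_add act_scale intro: free_on_closed\<close>)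
      have "act (bas u * g * bas w) v = \<zero>\<^bsub>V\<^esub>" "bas u * g * bas w \<in> FA L"
        if "u \<in> lists L" "w \<in> lists L" "g \<in> env_gens L" for u w g
      proof -
        have "act (bas u) \<zero>\<^bsub>V\<^esub> = \<zero>\<^bsub>V\<^esub>"
          using act_lin2[OF bas_free_on[OF that(1)], of "\<zero>\<^bsub>V\<^esub>" 0] act(1)[OF bas_free_on[OF that(1)], of "\<zero>\<^bsub>V\<^esub>"]
          by (simp add: vspace_zero_smult[OF V])
        thus "act (bas u * g * bas w) v = \<zero>\<^bsub>V\<^esub>" "bas u * g * bas w \<in> FA L"
          using that \<open>v \<in> carrier V\<close>
          by (simp_all add: act_mult bas_free_on free_on_closed env_gens_sub[OF L] act act_gen)
      qed
      thus "{bas u * g * bas w |u w g. u \<in> lists L \<and> w \<in> lists L \<and> g \<in> env_gens L} \<subseteq> {r \<in> FA L. act r v = \<zero>\<^bsub>V\<^esub>}"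
        by blast
    qed
    thus ?thesis
      using that by blast
  qed
  define \<tau> where "\<tau> = (\<lambda>X\<in>carrier (env L). \<lambda>v\<in>carrier V. quot_map (FA L) (env_ideal L) (\<lambda>p. act p v) X)"
  have \<tau>: "\<tau> (cl L p) v = act p v" if "p \<in> FA L" "v \<in> carrier V" for p v
    using quot_lift(2)[OF is_quot_env[of L] V, of "\<lambda>p. act p v"] that
    by (simp add: \<tau>_def env_closed act act_add act_scale act_ideal)
  have \<tau>r: "\<tau> (cl L p) = (\<lambda>v\<in>carrier V. act p v)" if "p \<in> FA L" for p
    using \<tau>[OF that] that by (auto simp: \<tau>_def env_closed)
  have "left_action (env L) V \<tau>"
  proof (rule left_actionI)
    show "\<tau> \<in> extensional (carrier (env L))"
      by (simp add: \<tau>_def)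
    show "\<tau> X \<in> lin_maps V V" if "X \<in> carrier (env L)" for X
      using that by (rule env_cases)
        (auto simp: \<tau>r act act_lin1 act_lin2 intro!: restrict_linI[OF V])
    show "\<tau> \<one>\<^bsub>env L\<^esub> v = v" if "v \<in> carrier V" for v
      using that act_bas[of "[]" v] by (simp add: env_one \<tau> free_on_closed bas_Nil)
  qed (elim env_cases; simp add: env_add env_mult[OF L] env_smult \<tau> free_on_closed act act_add act_scale act_mult)+
  moreover have "\<tau> (env_in L x) v = T x v" if "x \<in> L" "v \<in> carrier V" for x v
    using that by (simp add: env_in_def \<tau> bas_free_on act_bas)
  ultimately show ?thesis
    by blast
qed

lemma lie_rep_THE:
  assumes L: "lie_subalgebra L" and V: "vspace V" and T: "lie_rep L V T"
    and \<tau>: "\<tau> = (THE \<tau>. left_action (env L) V \<tau> \<and> (\<forall>x\<in>L. \<forall>v\<in>carrier V. \<tau> (env_in L x) v = T x v))"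
  shows "left_action (env L) V \<tau>" "\<And>x v. x \<in> L \<Longrightarrow> v \<in> carrier V \<Longrightarrow> \<tau> (env_in L x) v = T x v"
proof -
  have "\<exists>!\<tau>. left_action (env L) V \<tau> \<and> (\<forall>x\<in>L. \<forall>v\<in>carrier V. \<tau> (env_in L x) v = T x v)"
    using lie_rep_extends_ex[OF L V T] by (auto intro: left_action_env_eqI[OF L V])
  from theI'[OF this, folded \<tau>]
  show "left_action (env L) V \<tau>" "\<And>x v. x \<in> L \<Longrightarrow> v \<in> carrier V \<Longrightarrow> \<tau> (env_in L x) v = T x v"
    by auto
qed

end

subsection \<open>Coinduction from a complementary subalgebra\<close>

context lie_algebra
begin

lemma bracket_zero_left [simp]: "bracket 0 x = 0"
  using bracket_add_left[of 0 0 x] by simp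

lemma bracket_zero_right [simp]: "bracket x 0 = 0"
  using bracket_add_right[of x 0 0] by simp

lemma bracket_antisym: "bracket y x = - bracket x y"
proof -
  have "bracket x y + bracket y x = 0"
    using bracket_self[of "x + y", unfolded bracket_add_left bracket_add_right]
    by (simp only: bracket_self add_0_left add_0_right add.commute)
  thus ?thesis
    by (simp add: eq_neg_iff_add_eq_0 add.commute)
qed

lemma bracket_minus_right: "bracket x (- y) = - bracket x y"
  using bracket_add_right[of x y "- y"] by (simp add: eq_neg_iff_add_eq_0 add.commute)

lemma bracket_derivation: "bracket x (bracket y z) = bracket (bracket x y) z + bracket y (bracket x z)"
  using jacobi[of x y z] bracket_antisym[of z "bracket x y"] bracket_antisym[of x z]
  by (simp add: bracket_minus_right algebra_simps)

text \<open>
  For \<open>k = a \<oplus> b\<close>, a \<open>b\<close>-module \<open>W\<close> and \<open>g\<close> in \<open>Hom(U(a), W)\<close>, the element \<open>z\<close> acts on \<open>g\<close> as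
  if \<open>g\<close> were the restriction of a \<open>b\<close>-linear map on the whole enveloping algebra, by
  \<open>(zg)(n) = g(nz)\<close>; the recursion moves \<open>z\<close> to the front of \<open>n\<close>, where it splits as
  \<open>px z + py z\<close>. Words in \<open>a\<close> are stored in reverse order.
\<close>

primrec coact :: "('k \<Rightarrow> 'k) \<Rightarrow> ('k \<Rightarrow> 'k) \<Rightarrow> ('k \<Rightarrow> 'w \<Rightarrow> 'w) \<Rightarrow> 'k list \<Rightarrow> 'k \<Rightarrow> ('k list \<Rightarrow> 'w) \<Rightarrow> 'w::ab_group_add" where
  "coact px py T [] z g = g [px z] + T (py z) (g [])"
| "coact px py T (x # r) z g = coact px py T r z (\<lambda>s. g (x # s)) + coact px py T r (bracket x z) g"

end

text \<open>The values of \<open>coact\<close> are added with the type class operation, so the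
  module is given as a subspace \<open>Wc\<close> of a free space, the image of an embedding;
  \<open>T\<close> is controlled on \<open>Wc\<close> only. The maps \<open>px\<close> and
  \<open>py\<close> are the projections of the decomposition into \<open>a\<close> and
  \<open>b\<close>.\<close>

locale complementary_module = lie_algebra scale bracket
  for scale :: "'f::field \<Rightarrow> 'k::ab_group_add \<Rightarrow> 'k" and bracket :: "'k \<Rightarrow> 'k \<Rightarrow> 'k" +
  fixes a b :: "'k set" and px py :: "'k \<Rightarrow> 'k" and T :: "'k \<Rightarrow> ('y \<Rightarrow>\<^sub>0 'f) \<Rightarrow> ('y \<Rightarrow>\<^sub>0 'f)"
    and Wc :: "('y \<Rightarrow>\<^sub>0 'f) set"
  assumes a: "lie_subalgebra a" and b: "lie_subalgebra b"
    and px: "\<And>z. px z \<in> a" and py: "\<And>z. py z \<in> b" and split: "\<And>z. px z + py z = z"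
    and px_add: "\<And>z z'. px (z + z') = px z + px z'" and px_scale: "\<And>c z. px (scale c z) = scale c (px z)"
    and px_in: "\<And>x. x \<in> a \<Longrightarrow> px x = x" and px_zero: "\<And>y. y \<in> b \<Longrightarrow> px y = 0"
    and Wc: "fs.subspace Wc"
    and T_Wc: "\<And>y w. y \<in> b \<Longrightarrow> w \<in> Wc \<Longrightarrow> T y w \<in> Wc"
    and T_add: "\<And>y w w'. \<lbrakk>y \<in> b; w \<in> Wc; w' \<in> Wc\<rbrakk> \<Longrightarrow> T y (w + w') = T y w + T y w'"
    and T_scale: "\<And>y c w. y \<in> b \<Longrightarrow> w \<in> Wc \<Longrightarrow> T y (fscale c w) = fscale c (T y w)"
    and T_add_left: "\<And>y y' w. \<lbrakk>y \<in> b; y' \<in> b; w \<in> Wc\<rbrakk> \<Longrightarrow> T (y + y') w = T y w + T y' w"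
    and T_scale_left: "\<And>y c w. y \<in> b \<Longrightarrow> w \<in> Wc \<Longrightarrow> T (scale c y) w = fscale c (T y w)"
    and T_bracket: "\<And>y y' w. \<lbrakk>y \<in> b; y' \<in> b; w \<in> Wc\<rbrakk> \<Longrightarrow> T y (T y' w) = T y' (T y w) + T (bracket y y') w"
begin

text \<open>These are the functions on words that induce a linear map on the enveloping algebra of
  \<open>a\<close> with values in \<open>Wc\<close>. Lists are stored reversed, so
  \<open>q @ y # x # r\<close> stands for the product of rev r, x, y and rev q, and the second
  relation reads xy = yx + [x, y]. Vanishing outside \<open>lists a\<close> makes equality of
  functions the right equality.\<close>

definition good :: "('k list \<Rightarrow> ('y \<Rightarrow>\<^sub>0 'f)) \<Rightarrow> bool" where
  "good g \<longleftrightarrow> (\<forall>r. g r \<in> Wc) \<and> (\<forall>r. r \<notin> lists a \<longrightarrow> g r = 0) \<and>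
    (\<forall>q\<in>lists a. \<forall>r\<in>lists a. \<forall>x\<in>a. \<forall>y\<in>a. g (q @ (x + y) # r) = g (q @ x # r) + g (q @ y # r) \<and>
       g (q @ y # x # r) = g (q @ x # y # r) + g (q @ bracket x y # r)) \<and>
    (\<forall>q\<in>lists a. \<forall>r\<in>lists a. \<forall>c. \<forall>x\<in>a. g (q @ scale c x # r) = fscale c (g (q @ x # r)))"

lemma goodD:
  assumes "good g"
  shows good_Wc: "g r \<in> Wc"
    and good_out: "r \<notin> lists a \<Longrightarrow> g r = 0"
    and good_add: "\<lbrakk>q \<in> lists a; r \<in> lists a; x \<in> a; y \<in> a\<rbrakk> \<Longrightarrow> g (q @ (x + y) # r) = g (q @ x # r) + g (q @ y # r)"
    and good_bracket: "\<lbrakk>q \<in> lists a; r \<in> lists a; x \<in> a; y \<in> a\<rbrakk> \<Longrightarrow>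
      g (q @ y # x # r) = g (q @ x # y # r) + g (q @ bracket x y # r)"
    and good_scale: "\<lbrakk>q \<in> lists a; r \<in> lists a; x \<in> a\<rbrakk> \<Longrightarrow> g (q @ scale c x # r) = fscale c (g (q @ x # r))"
  using assms unfolding good_def by blast+

lemmas good_add0 = good_add[of _ "[]", simplified]
lemmas good_bracket0 = good_bracket[of _ "[]", simplified]
lemmas good_scale0 = good_scale[of _ "[]", simplified]

lemma a_closed: "x \<in> a \<Longrightarrow> y \<in> a \<Longrightarrow> bracket x y \<in> a" "x \<in> a \<Longrightarrow> y \<in> a \<Longrightarrow> x + y \<in> a"
    "x \<in> a \<Longrightarrow> scale c x \<in> a" "0 \<in> a"
  using a by (auto simp: lie_subalgebra_def subspace_def)

lemma b_closed: "x \<in> b \<Longrightarrow> y \<in> b \<Longrightarrow> bracket x y \<in> b" "x \<in> b \<Longrightarrow> y \<in> b \<Longrightarrow> x + y \<in> b"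
    "x \<in> b \<Longrightarrow> scale c x \<in> b" "0 \<in> b"
  using b by (auto simp: lie_subalgebra_def subspace_def)

lemma py_lin: "py (z + z') = py z + py z'" "py (scale c z) = scale c (py z)"
  "x \<in> a \<Longrightarrow> py x = 0" "y \<in> b \<Longrightarrow> py y = y"
proof -
  have p: "py z = z - px z" for z
    using split[of z] by (metis add_diff_cancel_left')
  show "py (z + z') = py z + py z'" "py (scale c z) = scale c (py z)"
    "x \<in> a \<Longrightarrow> py x = 0" "y \<in> b \<Longrightarrow> py y = y"
    by (simp_all add: p px_add px_scale px_in px_zero scale_right_diff_distrib)
qed

lemmas Wc_closed = fs.subspace_add[OF Wc] fs.subspace_scale[OF Wc] fs.subspace_0[OF Wc] T_Wc

lemma T_zero: "w \<in> Wc \<Longrightarrow> T 0 w = 0"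
  using T_scale_left[of 0 w 0] b_closed(4) by simp

lemma good_shift:
  assumes g: "good g" and x: "x \<in> a"
  shows "good (\<lambda>s. g (x # s))"
  unfolding good_def
proof (intro conjI ballI allI impI)
  fix q r y z assume *: "q \<in> lists a" "r \<in> lists a" "y \<in> a" "z \<in> a"
  have q: "x # q \<in> lists a" using * x by simp
  show "g (x # q @ (y + z) # r) = g (x # q @ y # r) + g (x # q @ z # r)"
    using good_add[OF g q *(2-4)] by simp
  show "g (x # q @ z # y # r) = g (x # q @ y # z # r) + g (x # q @ bracket y z # r)"
    using good_bracket[OF g q *(2-4)] by simp
next
  fix q r y c assume *: "q \<in> lists a" "r \<in> lists a" "y \<in> a"
  have q: "x # q \<in> lists a" using * x by simp
  show "g (x # q @ scale c y # r) = fscale c (g (x # q @ y # r))"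
    using good_scale[OF g q *(2,3)] by simp
qed (use good_Wc[OF g] good_out[OF g] in auto)

abbreviation "A \<equiv> coact px py T"

lemma A_Wc: "(\<And>s. g s \<in> Wc) \<Longrightarrow> A r z g \<in> Wc"
  by (induction r arbitrary: z g) (auto intro!: Wc_closed simp: py)

lemma A_add: "(\<And>s. g s \<in> Wc) \<Longrightarrow> (\<And>s. g' s \<in> Wc) \<Longrightarrow> A r z (\<lambda>s. g s + g' s) = A r z g + A r z g'"
proof (induction r arbitrary: z g g')
  case (Cons x r)
  show ?case
    using Cons.IH[of "\<lambda>s. g (x # s)" "\<lambda>s. g' (x # s)" z] Cons.IH[of g g' "bracket x z"] Cons.prems
    by (simp add: algebra_simps)
qed (simp add: T_add py algebra_simps)

lemma A_scale: "(\<And>s. g s \<in> Wc) \<Longrightarrow> A r z (\<lambda>s. fscale c (g s)) = fscale c (A r z g)"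
proof (induction r arbitrary: z g)
  case (Cons x r)
  show ?case
    using Cons.IH[of "\<lambda>s. g (x # s)" z] Cons.IH[of g "bracket x z"] Cons.prems
    by (simp add: fs.scale_right_distrib)
qed (simp add: T_scale py fs.scale_right_distrib)

lemma A_cong: "r \<in> lists a \<Longrightarrow> (\<And>s. s \<in> lists a \<Longrightarrow> g s = g' s) \<Longrightarrow> A r z g = A r z g'"
proof (induction r arbitrary: z g g')
  case (Cons x r)
  have "A r z (\<lambda>s. g (x # s)) = A r z (\<lambda>s. g' (x # s))" "A r (bracket x z) g = A r (bracket x z) g'"
    by (rule Cons.IH; use Cons.prems in simp)+
  thus ?case
    by simp
qed (simp add: px)

lemma A_add_elt: "good g \<Longrightarrow> r \<in> lists a \<Longrightarrow> A r (z + z') g = A r z g + A r z' g"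
proof (induction r arbitrary: z z' g)
  case Nil
  have "g [px z + px z'] = g [px z] + g [px z']"
    using good_add0[OF Nil(1) _ px px, of "[]"] by simp
  thus ?case
    by (simp add: px_add py_lin T_add_left py good_Wc[OF Nil(1)] algebra_simps)
next
  case (Cons x r)
  show ?case
    using Cons.IH[OF good_shift[OF Cons.prems(1)], of x] Cons.IH[OF Cons.prems(1)] Cons.prems(2)
    by (simp add: bracket_add_right algebra_simps)
qed

lemma A_scale_elt: "good g \<Longrightarrow> r \<in> lists a \<Longrightarrow> A r (scale c z) g = fscale c (A r z g)"
proof (induction r arbitrary: z g)
  case Nil
  have "g [scale c (px z)] = fscale c (g [px z])"
    using good_scale0[OF Nil(1) _ px, of "[]"] by simp
  thus ?case
    by (simp add: px_scale py_lin T_scale_left py good_Wc[OF Nil(1)] fs.scale_right_distrib)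
next
  case (Cons x r)
  show ?case
    using Cons.IH[OF good_shift[OF Cons.prems(1)], of x] Cons.IH[OF Cons.prems(1)] Cons.prems(2)
    by (simp add: bracket_scale_right fs.scale_right_distrib)
qed

text \<open>(xg)(n) = g(nx) for x in \<open>a\<close>, and nx is the stored word with x in front.
  The recursion moves x past the last letter of n and adds the bracket term; one commutator relation
  of \<open>good\<close> puts this together to nx again.\<close>

lemma A_in: "\<lbrakk>good g; x \<in> a; r \<in> lists a\<rbrakk> \<Longrightarrow> A r x g = g (x # r)"
proof (induction r arbitrary: x g)
  case (Cons y r)
  have "A (y # r) x g = g (y # x # r) + g (bracket y x # r)"
    using Cons.IH[OF good_shift[OF Cons.prems(1)], of y x] Cons.IH[OF Cons.prems(1), of "bracket y x"] Cons.prems(2,3)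
    by (simp add: a_closed)
  thus ?case
    using good_bracket0[OF Cons.prems(1), of r y x] Cons.prems(2,3) by simp
qed (simp add: px_in py_lin T_zero good_Wc)

definition opr :: "'k \<Rightarrow> ('k list \<Rightarrow> ('y \<Rightarrow>\<^sub>0 'f)) \<Rightarrow> 'k list \<Rightarrow> ('y \<Rightarrow>\<^sub>0 'f)" where
  "opr z g = (\<lambda>r. if r \<in> lists a then A r z g else 0)"

lemma opr_Wc: "good g \<Longrightarrow> opr z g s \<in> Wc"
  by (simp add: opr_def A_Wc good_Wc Wc_closed)

lemma opr_Cons: "good g \<Longrightarrow> x \<in> a \<Longrightarrow> opr z g (x # s) = opr z (\<lambda>s. g (x # s)) s + opr (bracket x z) g s"
  by (simp add: opr_def)

text \<open>With the two linearity lemmas this says that \<open>opr\<close> is a representation of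
  the whole Lie algebra. On the empty word it combines \<open>good\<close> for the
  \<open>a\<close>-parts, the representation \<open>T\<close> for the \<open>b\<close>-parts and
  bilinearity for the mixed terms; a further letter is handled by the derivation property of the
  bracket with it.\<close>

lemma A_opr_comm: "good g \<Longrightarrow> r \<in> lists a \<Longrightarrow>
   A r z (opr z' g) = A r z' (opr z g) + A r (bracket z z') g"
proof (induction r arbitrary: z z' g)
  case Nil
  note g = Nil(1) and gW [simp] = good_Wc[OF Nil(1)]
  define x y x' y' where xy: "x = px z" "y = py z" "x' = px z'" "y' = py z'"
  have mem: "x \<in> a" "x' \<in> a" "y \<in> b" "y' \<in> b" and z: "z = x + y" "z' = x' + y'"
    by (simp_all add: xy px py split)
  have 1: "A [] z (opr z' g) = g [x, x'] + T y' (g [x]) + A [] (bracket x z') g + (T y (g [x']) + T y (T y' (g [])))"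
    using mem by (simp add: opr_def xy[symmetric] T_add Wc_closed algebra_simps)
  have 2: "A [] z' (opr z g) = g [x', x] + T y (g [x']) + A [] (bracket x' z) g + (T y' (g [x]) + T y' (T y (g [])))"
    using mem by (simp add: opr_def xy[symmetric] T_add Wc_closed algebra_simps)
  have 3: "g [x, x'] = g [x', x] + A [] (bracket x' x) g"
    using good_bracket0[OF g, of "[]" x' x] mem A_in[OF g, of "bracket x' x" "[]"] by (simp add: a_closed)
  have 4: "T y (T y' (g [])) = T y' (T y (g [])) + A [] (bracket y y') g"
  proof -
    have "g [0] = 0"
      using good_scale0[OF g, of "[]" 0 0] by (simp add: a_closed)
    thus ?thesis
      using T_bracket[OF mem(3,4) gW] by (simp add: px_zero py_lin b_closed mem)
  qed
  \<comment> \<open>By antisymmetry both sides reduce to the bracket of z with y'.\<close>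
  have "bracket x' x + bracket x z' + bracket y y' = bracket x' z + bracket z z'"
    by (simp add: z bracket_add_left bracket_add_right bracket_antisym[of x' y] bracket_antisym[of x' x])
  hence "A [] (bracket x' x) g + A [] (bracket x z') g + A [] (bracket y y') g = A [] (bracket x' z) g + A [] (bracket z z') g"
    using A_add_elt[OF g, of "[]"] by (simp del: coact.simps) (metis)
  thus ?case
    unfolding 1 2 3 4 by (simp add: algebra_simps del: coact.simps)
next
  case (Cons x r)
  note g = Cons.prems(1)
  have x: "x \<in> a" and r: "r \<in> lists a"
    using Cons.prems by auto
  note gx = good_shift[OF g x]
  have exp: "A (x # r) z (opr z' g) = A r z (opr z' (\<lambda>s. g (x # s))) + A r z (opr (bracket x z') g) + A r (bracket x z) (opr z' g)"
    for z z'
    using A_add[of "opr z' (\<lambda>s. g (x # s))" "opr (bracket x z') g" r z]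
    by (simp add: opr_Cons[OF g x] opr_Wc[OF gx] opr_Wc[OF g])
  have j: "bracket x (bracket z z') = bracket z (bracket x z') + bracket (bracket x z) z'"
    using bracket_derivation[of x z z'] by (simp add: add.commute)
  have c: "A (x # r) (bracket z z') g = A r (bracket z z') (\<lambda>s. g (x # s)) + (A r (bracket z (bracket x z')) g + A r (bracket (bracket x z) z') g)"
    by (simp add: j A_add_elt[OF g r])
  show ?case
    unfolding exp c using Cons.IH[OF gx r, of z z'] Cons.IH[OF g r, of z "bracket x z'"] Cons.IH[OF g r, of "bracket x z" z']
    by (simp add: algebra_simps)
qed

text \<open>\<open>opr z\<close> must not leave the maps on the enveloping algebra of
  \<open>a\<close>. The prefix \<open>q\<close> is peeled off by the recursion of
  \<open>coact\<close>; at the empty prefix a relation passes either to \<open>g\<close> or to the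
  argument \<open>z\<close>, where the commutator relation becomes the Jacobi identity.\<close>

lemma good_opr:
  assumes "good g"
  shows "good (opr z g)"
proof -
  have add: "A (q @ (x + y) # r) z g = A (q @ x # r) z g + A (q @ y # r) z g"
    if "good g" "q \<in> lists a" "r \<in> lists a" "x \<in> a" "y \<in> a" for q r x y z g
    using that(2,1)
  proof (induction q arbitrary: z g)
    case Nil
    have "A r z (\<lambda>s. g ((x + y) # s)) = A r z (\<lambda>s. g (x # s) + g (y # s))"
      by (rule A_cong[OF that(3)]) (use good_add0[OF Nil] that in simp)
    thus ?case
      by (simp add: A_add good_Wc[OF Nil] bracket_add_left A_add_elt[OF Nil that(3)] algebra_simps)
  next
    case (Cons p q)
    show ?case
      using Cons.IH[OF good_shift[OF Cons.prems Cons.hyps(1)], of z] Cons.IH[OF Cons.prems, of "bracket p z"]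
      by (simp add: algebra_simps)
  qed
  have scl: "A (q @ scale c x # r) z g = fscale c (A (q @ x # r) z g)"
    if "good g" "q \<in> lists a" "r \<in> lists a" "x \<in> a" for q r x c z g
    using that(2,1)
  proof (induction q arbitrary: z g)
    case Nil
    have "A r z (\<lambda>s. g (scale c x # s)) = A r z (\<lambda>s. fscale c (g (x # s)))"
      by (rule A_cong[OF that(3)]) (use good_scale0[OF Nil] that in simp)
    thus ?case
      by (simp add: A_scale good_Wc[OF Nil] bracket_scale_left A_scale_elt[OF Nil that(3)] fs.scale_right_distrib)
  next
    case (Cons p q)
    show ?case
      using Cons.IH[OF good_shift[OF Cons.prems Cons.hyps(1)], of z] Cons.IH[OF Cons.prems, of "bracket p z"]
      by (simp add: fs.scale_right_distrib)
  qed
  have br: "A (q @ y # x # r) z g = A (q @ x # y # r) z g + A (q @ bracket x y # r) z g"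
    if "good g" "q \<in> lists a" "r \<in> lists a" "x \<in> a" "y \<in> a" for q r x y z g
    using that(2,1)
  proof (induction q arbitrary: z g)
    case Nil
    have 1: "A r z (\<lambda>s. g (y # x # s)) = A r z (\<lambda>s. g (x # y # s) + g (bracket x y # s))"
      by (rule A_cong[OF that(3)], rule good_bracket0[OF Nil _ that(4,5)])
    have 2: "A r (bracket x (bracket y z)) g = A r (bracket (bracket x y) z) g + A r (bracket y (bracket x z)) g"
      by (simp add: bracket_derivation[of x y z] A_add_elt[OF Nil that(3)])
    show ?case
      by (simp add: 1 2 A_add good_Wc[OF Nil] algebra_simps)
  next
    case (Cons p q)
    show ?case
      using Cons.IH[OF good_shift[OF Cons.prems Cons.hyps(1)], of z] Cons.IH[OF Cons.prems, of "bracket p z"]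
      by (simp add: algebra_simps)
  qed
  show ?thesis
    unfolding good_def
  proof (intro conjI allI ballI impI)
    fix q r x y assume "q \<in> lists a" "r \<in> lists a" "x \<in> a" "y \<in> a"
    thus "opr z g (q @ (x + y) # r) = opr z g (q @ x # r) + opr z g (q @ y # r)"
      "opr z g (q @ y # x # r) = opr z g (q @ x # y # r) + opr z g (q @ bracket x y # r)"
      using add[OF assms] br[OF assms, of q r x y z] by (simp_all add: opr_def a_closed)
  next
    show "opr z g r \<in> Wc" for r
      by (rule opr_Wc[OF assms])
  qed (use scl[OF assms] in \<open>simp_all add: opr_def a_closed\<close>)
qed

lemma opr_lin:
  assumes "good g"
  shows "opr (z + z') g = (\<lambda>s. opr z g s + opr z' g s)"
    and "opr (scale c z) g = (\<lambda>s. fscale c (opr z g s))"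
    and "opr z (opr z' g) = (\<lambda>s. opr z' (opr z g) s + opr (bracket z z') g s)"
proof -
  have "opr (z + z') g s = opr z g s + opr z' g s" "opr (scale c z) g s = fscale c (opr z g s)" for s
    by (cases "s \<in> lists a";
        simp only: opr_def if_True if_False A_add_elt[OF assms] A_scale_elt[OF assms] add_0_left fs.scale_zero_right)+
  thus "opr (z + z') g = (\<lambda>s. opr z g s + opr z' g s)" "opr (scale c z) g = (\<lambda>s. fscale c (opr z g s))"
    by auto
  show "opr z (opr z' g) = (\<lambda>s. opr z' (opr z g) s + opr (bracket z z') g s)"
  proof (rule ext)
    show "opr z (opr z' g) s = opr z' (opr z g) s + opr (bracket z z') g s" for s
      using A_opr_comm[OF assms, of s z z']
      by (cases "s \<in> lists a")
         (simp_all only: opr_def[of z "opr z' g"] opr_def[of z' "opr z g"] opr_def[of "bracket z z'" g] if_True if_False add_0_left)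
  qed
qed

definition opw :: "'k list \<Rightarrow> ('k list \<Rightarrow> ('y \<Rightarrow>\<^sub>0 'f)) \<Rightarrow> 'k list \<Rightarrow> ('y \<Rightarrow>\<^sub>0 'f)" where
  "opw w = foldr opr w"

lemma good_opw: "good g \<Longrightarrow> good (opw w g)"
  by (induction w) (auto simp: opw_def good_opr)

lemma opw_lin:
  assumes "good g" "good g'"
  shows "opw w (\<lambda>s. g s + g' s) = (\<lambda>s. opw w g s + opw w g' s)"
    and "opw w (\<lambda>s. fscale c (g s)) = (\<lambda>s. fscale c (opw w g s))"
proof -
  have "opr z (\<lambda>s. g s + g' s) = (\<lambda>s. opr z g s + opr z g' s)" "opr z (\<lambda>s. fscale c (g s)) = (\<lambda>s. fscale c (opr z g s))"
    if "good g" "good g'" for z g g'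
    by (auto simp: opr_def A_add A_scale good_Wc[OF that(1)] good_Wc[OF that(2)])
  note * = this[OF good_opw[OF assms(1)] good_opw[OF assms(2)]]
  show "opw w (\<lambda>s. g s + g' s) = (\<lambda>s. opw w g s + opw w g' s)"
    by (induction w) (simp_all add: opw_def *(1)[unfolded opw_def])
  show "opw w (\<lambda>s. fscale c (g s)) = (\<lambda>s. fscale c (opw w g s))"
    by (induction w) (simp_all add: opw_def *(2)[unfolded opw_def])
qed

lemma opw_append: "opw (u @ w) g = opw u (opw w g)"
  by (simp add: opw_def)

lemma opw_Cons: "opw (z # w) g = opr z (opw w g)"
  by (simp add: opw_def)

text \<open>The three kinds of generators in \<open>env_gens UNIV\<close>, flanked by words, act by
  zero. Hence w -> (w g)(1) descends to the enveloping algebra of the whole Lie algebra.\<close>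

lemma opw_rels:
  assumes "good g"
  shows "opw (u @ (x + y) # w) g s = opw (u @ x # w) g s + opw (u @ y # w) g s"
    and "opw (u @ scale c x # w) g s = fscale c (opw (u @ x # w) g s)"
    and "opw (u @ x # y # w) g s = opw (u @ y # x # w) g s + opw (u @ bracket x y # w) g s"
  using assms
  by (simp_all add: opw_append opw_Cons opr_lin(1,2) opr_lin(3)[of "opw w g" x y] opw_lin good_opw good_opr)

lemma opw_in: "\<lbrakk>good g; w \<in> lists a; r \<in> lists a\<rbrakk> \<Longrightarrow> opw w g r = g (rev w @ r)"
proof (induction w arbitrary: r)
  case (Cons x w)
  thus ?case
    using A_in[OF good_opw[OF Cons.prems(1)], of x r w] by (simp add: opw_Cons opr_def)
qed (simp add: opw_def)

text \<open>At the empty word nothing has to be passed, so \<open>b\<close> acts through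
  \<open>T\<close>: this is the \<open>b\<close>-linearity of the coinduced map.\<close>

lemma opw_left: "good g \<Longrightarrow> y \<in> b \<Longrightarrow> opw (y # w) g [] = T y (opw w g [])"
  using good_scale0[OF good_opw[of g w], of "[]" 0 0]
  by (simp add: opw_Cons opr_def px_zero py_lin a_closed)

end

context lie_algebra
begin

text \<open>The map is h(u) = (u g)(1), for the action of u on Hom(U(a), W) constructed above. That
  every linear map on U(a) extends to a \<open>b\<close>-linear map on U is a consequence of PBW;
  here it is obtained from a representation instead of a basis.\<close>

theorem coinduction_ex:
  assumes a: "lie_subalgebra a" and b: "lie_subalgebra b" and dec: "\<And>z. \<exists>x\<in>a. z - x \<in> b" and disj: "a \<inter> b \<subseteq> {0}"
    and W: "vspace W" and T: "lie_rep b W T" and g: "g \<in> lin_maps (env a) W"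
  shows "\<exists>h\<in>lin_maps (env UNIV) W.
    (\<forall>y\<in>b. \<forall>X\<in>carrier (env UNIV). h (env_in UNIV y \<cdot> X) = T y (h X)) \<and>
    (\<forall>X\<in>carrier (env a). h (env_incl X) = g X)"
proof -
  have sa: "subspace a" and sb: "subspace b"
    using a b by (auto simp: lie_subalgebra_def)
  define px where "px z = (SOME x. x \<in> a \<and> z - x \<in> b)" for z
  have px: "px z \<in> a" "z - px z \<in> b" for z
    using someI_ex[of "\<lambda>x. x \<in> a \<and> z - x \<in> b"] dec[of z] by (auto simp: px_def)
  have pxI: "px z = x" if "x \<in> a" "z - x \<in> b" for z x
  proof -
    have "px z - x \<in> a" "(z - x) - (z - px z) \<in> b"
      by (rule subspace_diff[OF sa px(1) that(1)], rule subspace_diff[OF sb that(2) px(2)])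
    thus ?thesis
      using disj by auto
  qed
  define Wc where "Wc = emb W ` carrier W"
  define T' where "T' y w = emb W (T y (unemb W w))" for y w
  note [simp] = emb_add[OF W] emb_smult[OF W] emb_zero[OF W] vspace_add_closed[OF W] vspace_smult_closed[OF W]
    vspace_zero_closed[OF W] unemb_emb[OF W] lie_rep_closed[OF T]
  have Wc: "fs.subspace Wc"
    unfolding Wc_def by (rule subspace_emb[OF W])
  interpret C: complementary_module scale bracket a b px "\<lambda>z. z - px z" T' Wc
  proof unfold_locales
    show "px (z + z') = px z + px z'" for z z'
      by (rule pxI) (use subspace_add[OF sb px(2)[of z] px(2)[of z']] in \<open>auto simp: px subspace_add[OF sa] algebra_simps\<close>)
    show "px (scale c z) = scale c (px z)" for c z
      by (rule pxI) (use subspace_scale[OF sb px(2)[of z], of c] in \<open>auto simp: px subspace_scale[OF sa] scale_right_diff_distrib\<close>)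
    show "x \<in> a \<Longrightarrow> px x = x" "y \<in> b \<Longrightarrow> px y = 0" for x y
      by (auto intro!: pxI simp: subspace_0[OF sa] subspace_0[OF sb])
    fix y y' w w' c assume y: "y \<in> b" "y' \<in> b" and w: "w \<in> Wc" "w' \<in> Wc"
    obtain v v' where v: "v \<in> carrier W" "v' \<in> carrier W" "w = emb W v" "w' = emb W v'"
      using w by (auto simp: Wc_def)
    have u: "unemb W (emb W v + emb W v') = v \<oplus>\<^bsub>W\<^esub> v'" "unemb W (fscale c (emb W v)) = c \<odot>\<^bsub>W\<^esub> v"
      using v by (simp_all flip: emb_add[OF W] emb_smult[OF W])
    show "T' y w \<in> Wc"
      using v y by (simp add: T'_def Wc_def)
    show "T' y (w + w') = T' y w + T' y w'" "T' y (fscale c w) = fscale c (T' y w)"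
      using y v lin_add[OF lie_rep_lin[OF T y(1)] v(1,2)] lin_smult[OF lie_rep_lin[OF T y(1)] v(1)]
      by (simp_all add: T'_def u)
    show "T' (y + y') w = T' y w + T' y' w" "T' (scale c y) w = fscale c (T' y w)"
      using y v by (simp_all add: T'_def lie_rep_add[OF T] lie_rep_scale[OF T])
    show "T' y (T' y' w) = T' y' (T' y w) + T' (bracket y y') w"
      using y v b by (simp add: T'_def lie_rep_bracket[OF T, of y y'] lie_subalgebra_def)
  qed (use a b px Wc in auto)
  define gg where "gg p = emb W (g (cl a p))" for p
  have gc: "g (cl a p) \<in> carrier W" if "p \<in> FA a" for p
    using lin_closed[OF g env_closed[OF that]] .
  have gg: "gg (p + q) = gg p + gg q" "gg (fscale c p) = fscale c (gg p)" "gg p \<in> Wc"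
    if "p \<in> FA a" "q \<in> FA a" for p q c
    using that lin_add[OF g env_closed env_closed, of p q] lin_smult[OF g env_closed, of p c]
    by (simp_all add: gg_def env_add env_smult gc Wc_def)
  have gg_cong: "gg p = gg q" if "p - q \<in> env_ideal a" for p q
    using that by (simp add: gg_def cl_eq_iff[THEN iffD2])
  \<comment> \<open>The reversal matches the storage convention of \<open>coact\<close>.\<close>
  define G where "G r = (if r \<in> lists a then gg (bas (rev r)) else 0)" for r
  have good: "C.good G"
    unfolding C.good_def
  proof (intro conjI allI ballI impI)
    show "G r \<in> Wc" for r
      using gg(3)[of "bas (rev r)" "bas (rev r)"] by (cases "r \<in> lists a") (simp_all add: G_def bas_free_on in_lists_conv_set fs.subspace_0[OF Wc])
    fix q r assume qr: "q \<in> lists a" "r \<in> lists a"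
    have i: "bas (rev r) * s * bas (rev q) \<in> env_ideal a" if "s \<in> env_ideal a" for s
      by (rule env_ideal_right[OF bas_free_on env_ideal_left[OF bas_free_on that]])
         (use qr in \<open>simp_all add: in_lists_conv_set\<close>)
    have bs: "bas (rev r @ w @ rev q) = bas (rev r) * bas w * (bas (rev q) :: 'k list \<Rightarrow>\<^sub>0 'f)" for w
      by (simp add: bas_mult)
    have fa: "bas (rev r @ w @ rev q) \<in> FA a" if "w \<in> lists a" for w
      by (rule bas_free_on) (use qr that in \<open>auto simp: in_lists_conv_set\<close>)
    fix x assume x: "x \<in> a"
    {
      fix y assume y: "y \<in> a"
      have xy: "x + y \<in> a" "bracket x y \<in> a"
        using a x y by (auto simp: lie_subalgebra_def subspace_add)
      have "bas [x + y] - bas [x] - bas [y] \<in> env_ideal a"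
        "bas [x] * bas [y] - bas [y] * bas [x] - bas [bracket x y] \<in> env_ideal a"
        by (rule env_ideal_gen, unfold env_gens_def, use x y in blast)+
      from this[THEN i]
      have "gg (bas (rev r @ [x + y] @ rev q)) = gg (bas (rev r @ [x] @ rev q) + bas (rev r @ [y] @ rev q))"
        "gg (bas (rev r @ [x, y] @ rev q)) = gg (bas (rev r @ [y, x] @ rev q) + bas (rev r @ [bracket x y] @ rev q))"
        by (intro gg_cong; simp only: bs; simp add: algebra_simps bas_mult)+
      thus "G (q @ (x + y) # r) = G (q @ x # r) + G (q @ y # r)"
        "G (q @ y # x # r) = G (q @ x # y # r) + G (q @ bracket x y # r)"
        using qr x y xy fa[of "[x]"] fa[of "[y]"] fa[of "[bracket x y]"] fa[of "[y, x]"] by (simp_all add: G_def gg in_lists_conv_set)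
    }
    show "G (q @ scale c x # r) = fscale c (G (q @ x # r))" for c
    proof -
      have "bas [scale c x] - fscale c (bas [x]) \<in> env_ideal a"
        by (rule env_ideal_gen, unfold env_gens_def, use x in blast)
      from this[THEN i]
      have "gg (bas (rev r @ [scale c x] @ rev q)) = gg (fscale c (bas (rev r @ [x] @ rev q)))"
        by (intro gg_cong; simp only: bs; simp add: algebra_simps fscale_mult_left fscale_mult_right)
      thus ?thesis
        using qr x fa[of "[x]"] sa by (simp add: G_def gg subspace_scale in_lists_conv_set)
    qed
  qed (simp add: G_def)
  define H where "H = flin fscale (\<lambda>w. C.opw w G [])"
  have H: "H (p + q) = H p + H q" "H (fscale c p) = fscale c (H p)" "H 0 = 0" "H (bas w) = C.opw w G []" for p q c w
    by (simp_all add: H_def fs.flin_add fs.flin_scale)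
  have Hd: "H (p - q) = H p - H q" for p q
    using H(1)[of "p - q" q] by (simp add: algebra_simps)
  have Hc: "H p \<in> Wc" for p
    unfolding H_def flin_def
    by (intro fs.subspace_sum fs.subspace_scale Wc C.good_Wc[OF C.good_opw[OF good]])
  have Hi: "H r = 0" if "r \<in> env_ideal UNIV" for r
  proof -
    have "env_ideal UNIV \<subseteq> {r. H r = 0}"
      unfolding env_ideal_span
    proof (rule fs.span_minimal)
      show "fs.subspace {r. H r = 0}"
        by (rule fs.subspaceI) (simp_all add: H)
      have "H (bas u * g * bas w) = 0" if "g \<in> env_gens UNIV" for u w g
        using that
      proof (cases rule: env_gens_cases)
        case (add x y)
        show ?thesis
          unfolding add(3) using C.opw_rels(1)[OF good, of u x y w "[]"] by (simp add: algebra_simps bas_mult H Hd)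
      next
        case (scale c x)
        show ?thesis
          unfolding scale(2) using C.opw_rels(2)[OF good, of u c x w "[]"]
          by (simp add: algebra_simps bas_mult H Hd fscale_mult_left fscale_mult_right)
      next
        case (bracket x y)
        show ?thesis
          unfolding bracket(3) using C.opw_rels(3)[OF good, of u x y w "[]"] by (simp add: algebra_simps bas_mult H Hd)
      qed
      thus "{bas u * g * bas w |u w g. u \<in> lists UNIV \<and> w \<in> lists UNIV \<and> g \<in> env_gens UNIV} \<subseteq> {r. H r = 0}"
        by auto
    qed
    thus ?thesis
      using that by blast
  qed
  define h where "h = quot_map (FA UNIV) (env_ideal UNIV) (\<lambda>p. unemb W (H p))"
  have h: "h \<in> lin_maps (env UNIV) W" and hv: "h (cl UNIV p) = unemb W (H p)" for p
    using quot_lift_emb[OF is_quot_env[of UNIV] W, of H] H Hc Hi unfolding Wc_def h_def by auto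
  have HT: "H (bas [y] * p) = T' y (H p)" if "y \<in> b" for y p
  proof -
    have "p \<in> free_on UNIV"
      by simp
    thus ?thesis
    proof (induction rule: free_on_induct)
      case (bas w)
      thus ?case
        using C.opw_left[OF good that, of w] by (simp add: bas_mult H)
    next
      case zero
      thus ?case
        using C.T_scale[OF that fs.subspace_0[OF Wc], of 0] by (simp add: H)
    qed (simp_all add: distrib_left fscale_mult_right H C.T_add C.T_scale that Hc)
  qed
  have Hg: "H p = gg p" if "p \<in> FA a" for p
    using that
  proof (induction rule: free_on_induct)
    case (bas w)
    thus ?case
      using C.opw_in[OF good bas, of "[]"] by (simp add: H G_def in_lists_conv_set)
  next
    case zero
    thus ?case
      using gg(2)[of 0 0 0] by (simp add: H free_on_closed)
  qed (simp_all add: H gg)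
  show ?thesis
  proof (intro bexI[OF _ h] conjI ballI)
    fix y X assume y: "y \<in> b" and "X \<in> carrier (env UNIV)"
    then obtain p where X: "X = cl UNIV p"
      by (auto elim: env_cases)
    have "unemb W (H p) \<in> carrier W"
      using Hc[of p] by (auto simp: Wc_def unemb_closed)
    thus "h (env_in UNIV y \<cdot> X) = T y (h X)"
      using y by (simp add: X env_in_def env_mult sub_U hv HT T'_def)
  next
    fix X assume "X \<in> carrier (env a)"
    thus "h (env_incl X) = g X"
      by (rule env_cases) (simp add: env_incl_cl hv Hg gg_def gc)
  qed
qed

end

section \<open>Gradings\<close>

lemma ht_superset:
  assumes "finite A" "keys a \<subseteq> A"
  shows "ht a = (\<Sum>s\<in>A. lookup a s)"
  unfolding ht_def by (rule sum.mono_neutral_left) (use assms in \<open>auto simp: in_keys_iff\<close>)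

lemma ht_add: "ht (a + b) = ht a + ht b"
  using keys_add[of a b]
  by (simp add: ht_superset[where A = "keys a \<union> keys b"] lookup_add sum.distrib)

lemma ht_zero [simp]: "ht 0 = 0"
  by (simp add: ht_def)

lemma Gam_closed: "0 \<in> Gam S" "a \<in> Gam S \<Longrightarrow> b \<in> Gam S \<Longrightarrow> a + b \<in> Gam S"
  "a \<in> Gam S \<Longrightarrow> - a \<in> Gam S" "a \<in> Gam S \<Longrightarrow> b \<in> Gam S \<Longrightarrow> a - b \<in> Gam S"
proof -
  show add: "a \<in> Gam S \<Longrightarrow> b \<in> Gam S \<Longrightarrow> a + b \<in> Gam S" for a b :: "'a \<Rightarrow>\<^sub>0 int"
    using keys_add[of a b] by (auto simp: Gam_def)
  show minus: "a \<in> Gam S \<Longrightarrow> - a \<in> Gam S" for a :: "'a \<Rightarrow>\<^sub>0 int"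
    by (auto simp: Gam_def in_keys_iff)
  show "a \<in> Gam S \<Longrightarrow> b \<in> Gam S \<Longrightarrow> a - b \<in> Gam S"
    using add[OF _ minus[of b], of a] by simp
qed (simp add: Gam_def)

lemma sum_lookup_superset:
  fixes c :: "'x \<Rightarrow>\<^sub>0 'y::comm_monoid_add"
  assumes "finite A" "keys c \<subseteq> A"
  shows "(\<Sum>a\<in>keys c. lookup c a) = (\<Sum>a\<in>A. lookup c a)"
  by (rule sum.mono_neutral_left) (use assms in \<open>auto simp: in_keys_iff\<close>)

section \<open>Components, and subspaces given by a condition on degrees\<close>

context graded_lie_algebra
begin

definition dec :: "'k \<Rightarrow> (('s \<Rightarrow>\<^sub>0 int) \<Rightarrow>\<^sub>0 'k)" where
  "dec x = (THE c. keys c \<subseteq> Gam S \<and> (\<forall>a\<in>Gam S. lookup c a \<in> gr a) \<and>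
        x = (\<Sum>a\<in>keys c. lookup c a))"

lemma component_dec: "component a x = lookup (dec x) a"
  by (simp add: component_def dec_def)

lemma dec: "keys (dec x) \<subseteq> Gam S" "a \<in> Gam S \<Longrightarrow> component a x \<in> gr a"
    "x = (\<Sum>a\<in>keys (dec x). component a x)"
  using theI'[OF gr_direct_sum[of x], folded dec_def] unfolding component_dec by blast+

lemma decI:
  assumes "keys c \<subseteq> Gam S" "\<And>a. a \<in> Gam S \<Longrightarrow> lookup c a \<in> gr a"
    "x = (\<Sum>a\<in>keys c. lookup c a)"
  shows "dec x = c"
  unfolding dec_def by (rule the1_equality[OF gr_direct_sum]) (use assms in blast)

lemma gr_zero: "a \<in> Gam S \<Longrightarrow> 0 \<in> gr a"
  using gr_subspace subspace_0 by blast

lemma component_add: "component a (x + y) = component a x + component a y"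
proof -
  let ?A = "keys (dec x) \<union> keys (dec y)"
  have k: "keys (dec x + dec y) \<subseteq> ?A"
    by (rule keys_add)
  have "dec (x + y) = dec x + dec y"
  proof (rule decI)
    show "keys (dec x + dec y) \<subseteq> Gam S"
      using k dec(1)[of x] dec(1)[of y] by blast
    show "lookup (dec x + dec y) a \<in> gr a" if "a \<in> Gam S" for a
      using dec(2)[OF that] gr_subspace[OF that] by (simp add: lookup_add component_dec subspace_add)
    have "x = (\<Sum>a\<in>?A. lookup (dec x) a)" "y = (\<Sum>a\<in>?A. lookup (dec y) a)"
      using dec(3)[of x] dec(3)[of y] unfolding component_dec
      by (simp_all add: sum_lookup_superset[of ?A])
    thus "x + y = (\<Sum>a\<in>keys (dec x + dec y). lookup (dec x + dec y) a)"
      by (subst sum_lookup_superset[OF _ k]) (simp_all add: lookup_add sum.distrib)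
  qed
  thus ?thesis
    by (simp add: component_dec lookup_add)
qed

lemma component_gr:
  assumes d: "d \<in> Gam S" and x: "x \<in> gr d"
  shows "component a x = (if a = d then x else 0)"
proof -
  have "dec x = single d x"
    by (rule decI) (use d x gr_zero in \<open>auto simp: lookup_single when_def\<close>)
  thus ?thesis
    by (simp add: component_dec lookup_single when_def)
qed

lemma component_zero [simp]: "component a 0 = 0"
  using component_add[of a 0 0] by simp

lemma component_sum: "component a (sum f A) = (\<Sum>i\<in>A. component a (f i))"
  by (induction A rule: infinite_finite_induct) (simp_all add: component_add)

lemma component_outside: "a \<notin> Gam S \<Longrightarrow> component a x = 0"
  using dec(1)[of x] by (auto simp: component_dec in_keys_iff)

lemma component_scale: "component a (scale c x) = scale c (component a x)"
proof -
  have "component a (scale c x) = component a (\<Sum>b\<in>keys (dec x). scale c (component b x))"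
    by (subst dec(3)[of x]) (simp only: scale_sum_right)
  also have "\<dots> = (\<Sum>b\<in>keys (dec x). if a = b then scale c (component b x) else 0)"
    unfolding component_sum
    by (rule sum.cong) (use dec gr_subspace in \<open>auto simp: component_gr subspace_scale subset_iff\<close>)
  also have "\<dots> = scale c (component a x)"
    by (auto simp: component_dec in_keys_iff)
  finally show ?thesis .
qed

text \<open>\<open>zgr i\<close>, \<open>k_lt\<close> and \<open>k_ge\<close> are all of this form,
  so closure properties of brackets reduce to implications between conditions on degrees, see
  \<open>supp_sub_bracket\<close>.\<close>

definition supp_sub :: "(('s \<Rightarrow>\<^sub>0 int) \<Rightarrow> bool) \<Rightarrow> 'k set" where
  "supp_sub P = {x. \<forall>a. component a x \<noteq> 0 \<longrightarrow> P a}"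

lemma supp_subD: "x \<in> supp_sub P \<Longrightarrow> \<not> P a \<Longrightarrow> component a x = 0"
  by (auto simp: supp_sub_def)

lemma subspace_supp_sub: "subspace (supp_sub P)"
proof (rule subspaceI)
  show "x + y \<in> supp_sub P" if "x \<in> supp_sub P" "y \<in> supp_sub P" for x y
  proof -
    have "P a" if "component a x + component a y \<noteq> 0" for a
    proof -
      have "component a x \<noteq> 0 \<or> component a y \<noteq> 0"
        using that by auto
      thus ?thesis
        using \<open>x \<in> supp_sub P\<close> \<open>y \<in> supp_sub P\<close> by (auto simp: supp_sub_def)
    qed
    thus ?thesis
      by (simp add: supp_sub_def component_add)
  qed
qed (auto simp: supp_sub_def component_scale)

lemma gr_supp_sub: "\<lbrakk>d \<in> Gam S; x \<in> gr d; x = 0 \<or> P d\<rbrakk> \<Longrightarrow> x \<in> supp_sub P"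
  by (auto simp: supp_sub_def component_gr)

lemma component_supp_sub: "x \<in> supp_sub P \<Longrightarrow> component a x \<in> supp_sub P"
  using dec(2)[of a x] by (cases "a \<in> Gam S") (auto simp: component_outside supp_sub_def component_gr)

lemma span_gr: "span (\<Union>{gr a | a. a \<in> Gam S \<and> P a}) = supp_sub P"
proof (intro equalityI subsetI)
  have "span (\<Union>{gr a | a. a \<in> Gam S \<and> P a}) \<subseteq> supp_sub P"
    by (rule span_minimal[OF _ subspace_supp_sub]) (auto intro: gr_supp_sub)
  thus "x \<in> span (\<Union>{gr a | a. a \<in> Gam S \<and> P a}) \<Longrightarrow> x \<in> supp_sub P" for x
    by blast
  fix x assume x: "x \<in> supp_sub P"
  have "component a x \<in> span (\<Union>{gr a | a. a \<in> Gam S \<and> P a})" for a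
  proof (cases "a \<in> Gam S \<and> P a")
    case True
    thus ?thesis
      by (intro span_base) (use dec(2)[of a x] in blast)
  next
    case False
    hence "component a x = 0"
      using supp_subD[OF x] component_outside by blast
    thus ?thesis
      by (simp add: span_zero)
  qed
  thus "x \<in> span (\<Union>{gr a | a. a \<in> Gam S \<and> P a})"
    by (subst dec(3)[of x]) (rule span_sum)
qed

lemma zgr_eq: "zgr i = supp_sub (\<lambda>a. ht a = i)"
  unfolding zgr_def by (rule span_gr)

lemma span_zgr: "span (\<Union>i\<in>I. zgr i) = supp_sub (\<lambda>a. ht a \<in> I)"
proof -
  have "span (\<Union>i\<in>I. zgr i) \<subseteq> supp_sub (\<lambda>a. ht a \<in> I)"
    by (rule span_minimal[OF _ subspace_supp_sub]) (auto simp: zgr_eq supp_sub_def)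
  moreover have "supp_sub (\<lambda>a. ht a \<in> I) \<subseteq> span (\<Union>i\<in>I. zgr i)"
    unfolding span_gr[symmetric]
  proof (rule span_minimal[OF _ subspace_span], rule subsetI)
    fix x assume "x \<in> \<Union>{gr a | a. a \<in> Gam S \<and> ht a \<in> I}"
    then obtain a where "x \<in> gr a" "a \<in> Gam S" "ht a \<in> I"
      by auto
    thus "x \<in> span (\<Union>i\<in>I. zgr i)"
      by (intro span_base UN_I[of "ht a"]) (auto simp: zgr_eq intro: gr_supp_sub)
  qed
  ultimately show ?thesis
    by blast
qed

lemma k_lt_eq: "k_lt = supp_sub (\<lambda>a. ht a < 0)" and k_ge_eq: "k_ge = supp_sub (\<lambda>a. ht a \<ge> 0)"
  unfolding k_lt_def k_ge_def span_zgr by simp_all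

text \<open>The homogeneous case provides membership in \<open>supp_sub P\<close> and not
  \<open>P d\<close>: a zero element may be listed in a degree that violates
  \<open>P\<close>.\<close>

lemma supp_sub_induct [consumes 1, case_names homogeneous add]:
  assumes "x \<in> supp_sub P" "\<And>d y. \<lbrakk>d \<in> Gam S; y \<in> gr d; y \<in> supp_sub P\<rbrakk> \<Longrightarrow> Q y"
    "\<And>y z. \<lbrakk>y \<in> supp_sub P; z \<in> supp_sub P; Q y; Q z\<rbrakk> \<Longrightarrow> Q (y + z)"
  shows "Q x"
proof -
  have z: "Q 0"
    by (rule assms(2)[OF Gam_closed(1) gr_zero[OF Gam_closed(1)]]) (rule subspace_0[OF subspace_supp_sub])
  have "Q (\<Sum>a\<in>A. component a x) \<and> (\<Sum>a\<in>A. component a x) \<in> supp_sub P" if "finite A" "A \<subseteq> Gam S" for A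
    using that
  proof (induction A)
    case (insert a A)
    have "Q (component a x)"
      by (rule assms(2)[of a]) (use insert assms(1) dec(2) in \<open>auto intro: component_supp_sub\<close>)
    thus ?case
      using insert component_supp_sub[OF assms(1)]
      by (auto intro!: assms(3) subspace_add[OF subspace_supp_sub])
  qed (simp add: z subspace_0[OF subspace_supp_sub])
  from this[OF finite_keys[of "dec x"] dec(1)] show ?thesis
    using dec(3)[of x] by simp
qed

lemma supp_sub_bracket:
  assumes "\<And>d e. P d \<Longrightarrow> Q e \<Longrightarrow> R (d + e)" "x \<in> supp_sub P" "y \<in> supp_sub Q"
  shows "bracket x y \<in> supp_sub R"
  using assms(2)
proof (induction rule: supp_sub_induct)
  case (homogeneous d x)
  note x = this
  show ?case
    using assms(3)
  proof (induction rule: supp_sub_induct)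
    case (homogeneous e y)
    have "x = 0 \<or> P d" "y = 0 \<or> Q e"
      using supp_subD[OF x(3), of d] supp_subD[OF homogeneous(3), of e] x homogeneous
      by (auto simp: component_gr)
    thus ?case
      using gr_bracket[OF x(1) homogeneous(1) x(2) homogeneous(2)] x homogeneous assms(1)
      by (intro gr_supp_sub[of "d + e"]) (auto intro: Gam_closed)
  next
    case (add y z)
    thus ?case
      by (simp add: bracket_add_right subspace_add[OF subspace_supp_sub])
  qed
next
  case (add y z)
  thus ?case
    by (simp add: bracket_add_left subspace_add[OF subspace_supp_sub])
qed

lemma lie_subalgebra_supp_sub:
  "(\<And>d e. P d \<Longrightarrow> P e \<Longrightarrow> P (d + e)) \<Longrightarrow> lie_subalgebra (supp_sub P)"
  unfolding lie_subalgebra_def by (auto simp: subspace_supp_sub intro: supp_sub_bracket)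

lemma sub_N: "lie_subalgebra k_lt" and sub_B: "lie_subalgebra k_ge"
  unfolding k_lt_eq k_ge_eq by (auto intro!: lie_subalgebra_supp_sub simp: ht_add)

lemma gr_k: "d \<in> Gam S \<Longrightarrow> gr d \<subseteq> k_lt \<or> gr d \<subseteq> k_ge"
  unfolding k_lt_eq k_ge_eq by (cases "ht d < 0") (auto intro: gr_supp_sub)

lemma k_split: "\<exists>x\<in>k_lt. z - x \<in> k_ge" "\<exists>x\<in>k_ge. z - x \<in> k_lt"
proof -
  have "\<exists>x\<in>k_lt. \<exists>y\<in>k_ge. z = x + y"
  proof -
    have "z \<in> supp_sub (\<lambda>_. True)"
      by (simp add: supp_sub_def)
    thus ?thesis
    proof (induction rule: supp_sub_induct)
      case (homogeneous d y)
      hence "y \<in> k_lt \<or> y \<in> k_ge"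
        using gr_k by blast
      moreover have "0 \<in> k_lt" "0 \<in> k_ge"
        unfolding k_lt_eq k_ge_eq by (rule subspace_0[OF subspace_supp_sub])+
      ultimately show ?case
        by (metis add.left_neutral add.right_neutral)
    next
      case (add y z)
      then obtain x1 y1 x2 y2 where "x1 \<in> k_lt" "y1 \<in> k_ge" "y = x1 + y1" "x2 \<in> k_lt" "y2 \<in> k_ge" "z = x2 + y2"
        by blast
      thus ?case
        unfolding k_lt_eq k_ge_eq
        by (intro bexI[of _ "x1 + x2"] bexI[of _ "y1 + y2"])
           (auto simp: algebra_simps intro: subspace_add[OF subspace_supp_sub])
    qed
  qed
  thus "\<exists>x\<in>k_lt. z - x \<in> k_ge" "\<exists>x\<in>k_ge. z - x \<in> k_lt"
    by (metis add_diff_cancel_left' add_diff_cancel_right')+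
qed

lemma k_disjoint: "k_lt \<inter> k_ge \<subseteq> {0}"
proof
  fix x assume x: "x \<in> k_lt \<inter> k_ge"
  have "component a x = 0" for a
    using x supp_subD[of x _ a] unfolding k_lt_eq k_ge_eq by (cases "ht a < 0") auto
  thus "x \<in> {0}"
    using dec(3)[of x] by simp
qed

subsection \<open>Homogeneous words\<close>

text \<open>The degree is not determined by the word, because 0 belongs to every
  \<open>gr d\<close>. For a subalgebra \<open>L\<close> a word containing the letter 0 lies in the
  ideal, so the ambiguity disappears in the enveloping algebra.\<close>

definition hw :: "'k set \<Rightarrow> ('s \<Rightarrow>\<^sub>0 int) \<Rightarrow> 'k list \<Rightarrow> bool" where
  "hw L d w \<longleftrightarrow> w \<in> lists L \<and> (\<exists>ds\<in>lists (Gam S). list_all2 (\<lambda>x d. x \<in> gr d) w ds \<and> sum_list ds = d)"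

lemma env_grading_eq: "env_grading L d = cl L ` fspan {bas w | w. hw L d w}"
  unfolding env_grading_def hw_def by (rule arg_cong[of _ _ "\<lambda>A. cl L ` fspan A"]) auto

lemma hw_Nil: "hw L 0 []"
  by (auto simp: hw_def intro!: bexI[of _ "[]"])

lemma hw_Cons:
  assumes "x \<in> L" "x \<in> gr d" "d \<in> Gam S" "hw L e w"
  shows "hw L (d + e) (x # w)"
proof -
  obtain ds where "ds \<in> lists (Gam S)" "list_all2 (\<lambda>x d. x \<in> gr d) w ds" "sum_list ds = e"
    using assms(4) by (auto simp: hw_def)
  thus ?thesis
    using assms by (auto simp: hw_def intro!: bexI[of _ "d # ds"])
qed

lemma hw_induct [consumes 1, case_names Nil Cons]:
  assumes "hw L d w" "Q 0 []"
    "\<And>x d e w. \<lbrakk>x \<in> L; x \<in> gr d; d \<in> Gam S; hw L e w; Q e w\<rbrakk> \<Longrightarrow> Q (d + e) (x # w)"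
  shows "Q d w"
proof -
  obtain ds where ds: "w \<in> lists L" "ds \<in> lists (Gam S)" "sum_list ds = d" "list_all2 (\<lambda>x d. x \<in> gr d) w ds"
    using assms(1) by (auto simp: hw_def)
  from ds(4,1-3) show ?thesis
  proof (induction w ds arbitrary: d rule: list_all2_induct)
    case (Cons x w d' ds)
    have "hw L (sum_list ds) w"
      using Cons by (auto simp: hw_def)
    hence "Q (d' + sum_list ds) (x # w)"
      by (intro assms(3)) (use Cons in auto)
    thus ?case
      using Cons.prems by auto
  qed (use assms(2) in auto)
qed

lemma hw_append: "hw L d u \<Longrightarrow> hw L e w \<Longrightarrow> hw L (d + e) (u @ w)"
  by (induction rule: hw_induct) (auto simp: add.assoc intro: hw_Cons)

lemma hw_mono: "hw L d w \<Longrightarrow> L \<subseteq> M \<Longrightarrow> hw M d w"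
  by (auto simp: hw_def)

lemma hw_Gam: "hw L d w \<Longrightarrow> d \<in> Gam S"
  by (induction rule: hw_induct) (auto intro: Gam_closed)

lemma hw_lists: "hw L d w \<Longrightarrow> w \<in> lists L"
  by (simp add: hw_def)

text \<open>Modulo the additivity relations each letter is the sum of its components, and a product
  of such sums expands into homogeneous words. The form \<open>supp_sub P\<close> of the subalgebra
  guarantees that it contains the components of its elements.\<close>

lemma FA_homogeneous:
  assumes L: "lie_subalgebra (supp_sub P)" and "p \<in> FA (supp_sub P)"
  shows "p \<in> fspan ({bas w | w d. hw (supp_sub P) d w} \<union> env_ideal (supp_sub P))"
    (is "_ \<in> fspan (?H \<union> ?I)")
proof -
  let ?L = "supp_sub P"
  have letter: "bas [x] \<in> fspan ({bas [y] | y d. y \<in> ?L \<and> d \<in> Gam S \<and> y \<in> gr d} \<union> ?I)" if "x \<in> ?L" for x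
    using that
  proof (induction rule: supp_sub_induct)
    case (homogeneous d y)
    thus ?case
      by (intro fs.span_base) blast
  next
    case (add y z)
    have "bas [y + z] - bas [y] - bas [z] \<in> ?I"
      by (rule env_ideal_gen) (use add(1,2) in \<open>unfold env_gens_def, blast\<close>)
    hence "(bas [y + z] - bas [y] - bas [z]) + (bas [y] + bas [z]) \<in> fspan ({bas [y] | y d. y \<in> ?L \<and> d \<in> Gam S \<and> y \<in> gr d} \<union> ?I)"
      by (intro fs.span_add add.IH fs.span_base) blast
    thus ?case
      by (simp add: algebra_simps)
  qed
  have word: "bas w \<in> fspan (?H \<union> ?I)" if "w \<in> lists ?L" for w
    using that
  proof (induction w)
    case Nil
    thus ?case
      by (intro fs.span_base) (use hw_Nil in blast)
  next
    case (Cons x w)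
    have I: "g \<in> ?I \<Longrightarrow> g \<in> FA ?L" for g
      using env_ideal_sub[OF L] by blast
    have "bas [x] * bas w \<in> fspan (?H \<union> ?I)"
    proof (rule fspan_mult_closed[OF letter[OF Cons.hyps(1)] Cons.IH])
      fix g h assume g: "g \<in> {bas [y] | y d. y \<in> ?L \<and> d \<in> Gam S \<and> y \<in> gr d} \<union> ?I" and h: "h \<in> ?H \<union> ?I"
      have fa: "g \<in> FA ?L" "h \<in> FA ?L"
        using g h I by (auto dest!: hw_lists simp: in_lists_conv_set intro!: bas_free_on)
      consider y d w e where "g = bas [y]" "y \<in> ?L" "d \<in> Gam S" "y \<in> gr d" "h = bas w" "hw ?L e w"
        | "g \<in> ?I" | "h \<in> ?I"
        using g h by blast
      thus "g * h \<in> fspan (?H \<union> ?I)"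
      proof cases
        case 1
        hence "hw ?L (d + e) (y # w)" "g * h = bas (y # w)"
          by (simp_all add: hw_Cons bas_mult)
        thus ?thesis
          by (intro fs.span_base) blast
      next
        case 2
        thus ?thesis
          by (intro fs.span_base UnI2 env_ideal_right fa)
      next
        case 3
        thus ?thesis
          by (intro fs.span_base UnI2 env_ideal_left fa)
      qed
    qed
    thus ?case
      by (simp add: bas_mult)
  qed
  show ?thesis
    using assms(2)
    by (induction rule: free_on_induct)
       ((rule fs.span_zero) | (rule word, assumption) | (rule fs.span_add, assumption, assumption) | (rule fs.span_scale, assumption))+
qed

lemma fspan_ideal_mult:
  assumes "p \<in> fspan (G \<union> env_ideal UNIV)" "\<And>g. g \<in> G \<Longrightarrow> a * g \<in> fspan (K \<union> env_ideal UNIV)"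
  shows "a * p \<in> fspan (K \<union> env_ideal UNIV)"
proof -
  have a: "a \<in> fspan {a}"
    by (rule fs.span_base) simp
  show ?thesis
  proof (rule fspan_mult_closed[OF a assms(1)])
    fix x g assume "x \<in> {a}" and g: "g \<in> G \<union> env_ideal UNIV"
    thus "x * g \<in> fspan (K \<union> env_ideal UNIV)"
      using assms(2)[of g] fs.span_base[of "a * g" "K \<union> env_ideal UNIV"] by (auto simp: env_ideal_left)
  qed
qed

text \<open>The spanning half of PBW with control of degrees: U is spanned by products of a word in
  \<open>a\<close> and a word in \<open>b\<close>. It is used for \<open>k_lt\<close> and
  \<open>k_ge\<close> in both orders.\<close>

lemma straighten:
  assumes ab: "\<And>d. d \<in> Gam S \<Longrightarrow> gr d \<subseteq> a \<or> gr d \<subseteq> b" and w: "hw UNIV d w"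
  shows "bas w \<in> fspan ({bas u * bas v | u v d1 d2. hw a d1 u \<and> hw b d2 v \<and> d1 + d2 = d} \<union> env_ideal UNIV)"
proof -
  define M where "M d = {bas u * bas v :: 'k list \<Rightarrow>\<^sub>0 'f | u v d1 d2. hw a d1 u \<and> hw b d2 v \<and> d1 + d2 = d}" for d
  have MI: "bas u * bas v \<in> fspan (M d \<union> env_ideal UNIV)" if "hw a d1 u" "hw b d2 v" "d1 + d2 = d" for u v d1 d2 d
    by (rule fs.span_base) (use that in \<open>auto simp: M_def\<close>)
  have left: "bas [y] * p \<in> fspan (M (e + d) \<union> env_ideal UNIV)"
    if "y \<in> a" "y \<in> gr e" "e \<in> Gam S" "p \<in> fspan (M d \<union> env_ideal UNIV)" for y e d p
  proof (rule fspan_ideal_mult[OF that(4)])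
    fix g assume "g \<in> M d"
    then obtain u v d1 d2 where g: "g = bas u * bas v" "hw a d1 u" "hw b d2 v" "d1 + d2 = d"
      by (auto simp: M_def)
    thus "bas [y] * g \<in> fspan (M (e + d) \<union> env_ideal UNIV)"
      using MI[OF hw_Cons[OF that(1-3) g(2)] g(3), of "e + d"] by (simp add: bas_mult add.assoc)
  qed
  \<comment> \<open>Induction on the \<open>a\<close>-word with the homogeneous letter z arbitrary:
    passing z over y leaves the single letter [z, y], which may lie in \<open>a\<close> or in
    \<open>b\<close>.\<close>
  have gen: "bas [z] * (bas u * bas v) \<in> fspan (M (d0 + d1 + d2) \<union> env_ideal UNIV)"
    if "hw a d1 u" "hw b d2 v" "z \<in> gr d0" "d0 \<in> Gam S" for z d0 u v d1 d2
    using that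
  proof (induction arbitrary: z d0 rule: hw_induct)
    case (Nil z d0)
    then consider "z \<in> a" | "z \<in> b"
      using ab by blast
    thus ?case
    proof cases
      case 1
      thus ?thesis
        using MI[OF hw_Cons[OF 1 Nil(2,3) hw_Nil] Nil(1)] by (simp add: bas_mult)
    next
      case 2
      thus ?thesis
        using MI[OF hw_Nil hw_Cons[OF 2 Nil(2,3,1)]] by (simp add: bas_mult)
    qed
  next
    case (Cons y e d1 u z d0)
    note prems = Cons.prems
    show ?case
    proof (cases "z \<in> a")
      case True
      thus ?thesis
        using MI[OF hw_Cons[OF True prems(2,3) hw_Cons[OF Cons.hyps]] prems(1)] by (simp add: bas_mult)
    next
      case False
      have "bas [z] * (bas u * bas v) \<in> fspan (M (d0 + d1 + d2) \<union> env_ideal UNIV)"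
        by (rule Cons.IH[OF prems])
      note 1 = left[OF Cons.hyps(1-3) this]
      have 2: "bas [bracket z y] * (bas u * bas v) \<in> fspan (M (d0 + e + d1 + d2) \<union> env_ideal UNIV)"
        by (rule Cons.IH) (use prems Cons.hyps in \<open>auto intro: gr_bracket Gam_closed\<close>)
      have "(bas [z] * bas [y] - bas [y] * bas [z] - bas [bracket z y]) * (bas u * bas v) \<in> env_ideal UNIV"
        by (rule env_ideal_right, simp, rule env_ideal_gen) (unfold env_gens_def, blast)
      hence "(bas [z] * bas [y] - bas [y] * bas [z] - bas [bracket z y]) * (bas u * bas v) +
          bas [y] * (bas [z] * (bas u * bas v)) + bas [bracket z y] * (bas u * bas v) \<in> fspan (M (d0 + (e + d1) + d2) \<union> env_ideal UNIV)"
        using 1 2 by (intro fs.span_add) (auto intro: fs.span_base simp: ac_simps)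
      thus ?thesis
        by (simp add: algebra_simps bas_mult)
    qed
  qed
  have "bas w \<in> fspan (M d \<union> env_ideal UNIV)"
    using w
  proof (induction rule: hw_induct)
    case Nil
    show ?case
      using MI[OF hw_Nil hw_Nil] by (simp add: bas_mult)
  next
    case (Cons x d e w)
    have "bas [x] * bas w \<in> fspan (M (d + e) \<union> env_ideal UNIV)"
    proof (rule fspan_ideal_mult[OF Cons.IH])
      fix g assume "g \<in> M e"
      then obtain u v d1 d2 where "g = bas u * bas v" "hw a d1 u" "hw b d2 v" "d1 + d2 = e"
        by (auto simp: M_def)
      thus "bas [x] * g \<in> fspan (M (d + e) \<union> env_ideal UNIV)"
        using gen[of d1 u d2 v x d] Cons.hyps by (auto simp: add.assoc)
    qed
    thus ?case
      by (simp add: bas_mult)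
  qed
  thus ?thesis
    by (simp add: M_def)
qed

end

subsection \<open>Homogeneous components in enveloping algebras\<close>

lemma poly_mapping_sum_single:
  "(q :: 'x \<Rightarrow>\<^sub>0 'y::comm_monoid_add) = (\<Sum>k\<in>keys q. single k (lookup q k))"
  by (rule poly_mapping_eqI) (auto simp: lookup_sum lookup_single when_def in_keys_iff)

lemma mult_sum_single:
  "(q :: 'x::monoid_add \<Rightarrow>\<^sub>0 'y::semiring_0) * r = (\<Sum>k\<in>keys q. \<Sum>l\<in>keys r.
     single (k + l) (lookup q k * lookup r l))"
  by (subst poly_mapping_sum_single[of q], subst poly_mapping_sum_single[of r])
     (simp add: sum_distrib_left sum_distrib_right mult_single, rule sum.swap)

text \<open>Scalars enter as constants in degree 0. Compatibility with a product is then
  associativity, together with the centrality of these constants.\<close>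

definition gscale :: "'f::field \<Rightarrow> ('g::comm_monoid_add \<Rightarrow>\<^sub>0 ('x::monoid_add \<Rightarrow>\<^sub>0 'f)) \<Rightarrow> ('g \<Rightarrow>\<^sub>0 ('x \<Rightarrow>\<^sub>0 'f))" where
  "gscale c q = single 0 (fscale c 1) * q"

lemma lookup_gscale: "lookup (gscale c q) b = fscale c (lookup q b)"
  by (simp add: gscale_def Poly_Mapping.map.rep_eq when_def fscale_mult_left flip: mult_map_scale_conv_mult)

interpretation gs: vector_space "gscale :: 'f::field \<Rightarrow> ('g::comm_monoid_add \<Rightarrow>\<^sub>0 ('x::monoid_add \<Rightarrow>\<^sub>0 'f)) \<Rightarrow> _"
  by standard (rule poly_mapping_eqI,
      simp add: lookup_gscale lookup_add fs.scale_left_distrib fs.scale_right_distrib)+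

lemma gscale_mult_left: "gscale c q * r = gscale c (q * r)"
  by (simp add: gscale_def mult.assoc)

lemma gscale_mult_right: "q * gscale c r = gscale c (q * r)"
proof -
  have "q * single 0 (fscale c 1) = single 0 (fscale c 1) * q"
    by (subst (1 2) poly_mapping_sum_single[of q])
       (simp add: sum_distrib_left sum_distrib_right mult_single fscale_mult_left fscale_mult_right)
  thus ?thesis
    by (simp add: gscale_def mult.assoc[symmetric])
qed

context graded_lie_algebra
begin

text \<open>
  The coaction \<open>U \<rightarrow> U \<otimes> k[\<Gamma>]\<close> of the grading on words: an element of \<open>U \<otimes> k[\<Gamma>]\<close> is a
  finitely supported function on \<open>\<Gamma>\<close>.
\<close>

definition coaction1 :: "'k \<Rightarrow> (('s \<Rightarrow>\<^sub>0 int) \<Rightarrow>\<^sub>0 ('k list \<Rightarrow>\<^sub>0 'f))" where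
  "coaction1 x = (\<Sum>d\<in>keys (dec x). single d (bas [component d x]))"

definition coaction :: "('k list \<Rightarrow>\<^sub>0 'f) \<Rightarrow> (('s \<Rightarrow>\<^sub>0 int) \<Rightarrow>\<^sub>0 ('k list \<Rightarrow>\<^sub>0 'f))" where
  "coaction = flin gscale (\<lambda>w. prod_list (map coaction1 w))"

definition prj :: "('s \<Rightarrow>\<^sub>0 int) \<Rightarrow> ('k list \<Rightarrow>\<^sub>0 'f) \<Rightarrow> ('k list \<Rightarrow>\<^sub>0 'f)" where
  "prj b p = lookup (coaction p) b"

lemma coaction_simps: "coaction (p + q) = coaction p + coaction q" "coaction (fscale c p) = gscale c (coaction p)"
  "coaction 0 = 0" "coaction (bas w) = prod_list (map coaction1 w)"
  by (simp_all add: coaction_def gs.flin_add gs.flin_scale)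

lemma coaction_diff: "coaction (p - q) = coaction p - coaction q"
  using coaction_simps(1)[of "p - q" q] by (simp add: algebra_simps)

lemma coaction_mult: "coaction (p * q) = coaction p * coaction q"
proof -
  have p: "p \<in> free_on UNIV" and q: "q \<in> free_on UNIV"
    by simp_all
  have *: "coaction (bas w * q) = coaction (bas w) * coaction q" for w
    using q by (induction rule: free_on_induct)
      (simp_all add: coaction_simps bas_mult distrib_left fscale_mult_right gscale_mult_right)
  show ?thesis
    using p by (induction rule: free_on_induct)
      (simp_all add: coaction_simps(1-3) * distrib_right fscale_mult_left gscale_mult_left)
qed

lemma lookup_coaction1:
  "lookup (coaction1 x) d = (if component d x = 0 then 0 else bas [component d x])"
  by (auto simp: coaction1_def lookup_sum lookup_single when_def component_dec in_keys_iff)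

definition coeffs_in :: "('k list \<Rightarrow>\<^sub>0 'f) set \<Rightarrow> (('s \<Rightarrow>\<^sub>0 int) \<Rightarrow>\<^sub>0 ('k list \<Rightarrow>\<^sub>0 'f)) set" where
  "coeffs_in C = {q. \<forall>b. lookup q b \<in> C}"

lemma coeffs_in_subspace:
  assumes "fs.subspace C"
  shows "0 \<in> coeffs_in C" "q \<in> coeffs_in C \<Longrightarrow> r \<in> coeffs_in C \<Longrightarrow> q + r \<in> coeffs_in C"
    "q \<in> coeffs_in C \<Longrightarrow> r \<in> coeffs_in C \<Longrightarrow> q - r \<in> coeffs_in C" "q \<in> coeffs_in C \<Longrightarrow> gscale c q \<in> coeffs_in C"
  using assms by (auto simp: coeffs_in_def lookup_add lookup_minus lookup_gscale fs.subspace_0 fs.subspace_add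
      fs.subspace_diff fs.subspace_scale)

lemma coeffs_in_mult:
  assumes "fs.subspace C" "q \<in> coeffs_in C1" "r \<in> coeffs_in C2" "\<And>x y. x \<in> C1 \<Longrightarrow> y \<in> C2 \<Longrightarrow> x * y \<in> C"
  shows "q * r \<in> coeffs_in C"
proof -
  have "lookup (q * r) b \<in> C" for b
    unfolding mult_sum_single[of q r] lookup_sum lookup_single
    using assms by (auto intro!: fs.subspace_sum simp: when_def fs.subspace_0 coeffs_in_def)
  thus ?thesis
    by (simp add: coeffs_in_def)
qed

context
  fixes P and L
  defines "L \<equiv> supp_sub P"
  assumes L: "lie_subalgebra L"
begin

lemmas CI = coeffs_in_subspace[OF subspace_ideal[of L]]
lemmas CF = coeffs_in_subspace[OF subspace_free_on[of "lists L"]]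

lemma CI_mult: "q \<in> coeffs_in (FA L) \<Longrightarrow> r \<in> coeffs_in (env_ideal L) \<Longrightarrow> q * r \<in> coeffs_in (env_ideal L)"
    "q \<in> coeffs_in (FA L) \<Longrightarrow> r \<in> coeffs_in (env_ideal L) \<Longrightarrow> r * q \<in> coeffs_in (env_ideal L)"
  by (rule coeffs_in_mult[OF subspace_ideal]; assumption?; simp add: env_ideal_left env_ideal_right)+

lemma CF_mult: "q \<in> coeffs_in (FA L) \<Longrightarrow> r \<in> coeffs_in (FA L) \<Longrightarrow> q * r \<in> coeffs_in (FA L)"
  by (rule coeffs_in_mult[OF subspace_free_on]; assumption?; simp add: free_on_closed)

lemma bas_zero_ideal: "bas (u @ 0 # w) \<in> env_ideal L" if "u \<in> lists L" "w \<in> lists L"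
proof -
  have "0 \<in> L"
    using L by (simp add: lie_subalgebra_def subspace_0)
  hence "bas [scale 0 0] - fscale 0 (bas [0]) \<in> env_ideal L"
    by (intro env_ideal_gen) (unfold env_gens_def, blast)
  hence "bas u * bas [0] * bas w \<in> env_ideal L"
    using that by (intro env_ideal_left env_ideal_right bas_free_on) simp_all
  thus ?thesis
    by (simp add: bas_mult)
qed

lemma component_L: "x \<in> L \<Longrightarrow> component d x \<in> L"
  unfolding L_def by (rule component_supp_sub)

text \<open>Equality fails when the component vanishes: the coefficient is then 0 and not the letter
  0, and the two differ by an element of the ideal.\<close>

lemma coaction1_cong: "x \<in> L \<Longrightarrow> lookup (coaction1 x) d - bas [component d x] \<in> env_ideal L"
  using bas_zero_ideal[of "[]" "[]"] by (auto simp: lookup_coaction1 ideal_closed)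

lemma coaction1_CF: "x \<in> L \<Longrightarrow> coaction1 x \<in> coeffs_in (FA L)"
  by (auto simp: coeffs_in_def lookup_coaction1 free_on_closed component_L intro!: bas_free_on)

lemma coaction_CF:
  assumes "p \<in> FA L"
  shows "coaction p \<in> coeffs_in (FA L)"
  using assms
proof (induction rule: free_on_induct)
  case (bas w)
  thus ?case
  proof (induction w)
    case Nil
    thus ?case
      by (auto simp: coaction_simps coeffs_in_def lookup_one when_def free_on_closed)
  qed (simp add: coaction_simps CF_mult coaction1_CF)
qed (simp_all add: coaction_simps CF)

lemma coaction1_lin:
  assumes "x \<in> L" "y \<in> L"
  shows "coaction1 (x + y) - coaction1 x - coaction1 y \<in> coeffs_in (env_ideal L)"
    and "coaction1 (scale c x) - gscale c (coaction1 x) \<in> coeffs_in (env_ideal L)"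
proof -
  have xy: "x + y \<in> L" "scale c x \<in> L"
    using L assms by (auto simp: lie_subalgebra_def subspace_add subspace_scale)
  {
    fix d
    let ?l = "\<lambda>x. lookup (coaction1 x) d" and ?c = "component d"
    have g: "bas [?c x + ?c y] - bas [?c x] - bas [?c y] \<in> env_ideal L"
      "bas [scale c (?c x)] - fscale c (bas [?c x]) \<in> env_ideal L"
      using component_L[OF assms(1), of d] component_L[OF assms(2), of d]
      by (intro env_ideal_gen; unfold env_gens_def; blast)+
    have "(?l (x + y) - bas [?c (x + y)]) - (?l x - bas [?c x]) - (?l y - bas [?c y]) +
        (bas [?c x + ?c y] - bas [?c x] - bas [?c y]) \<in> env_ideal L"
      by (intro ideal_closed coaction1_cong assms xy g)
    hence "?l (x + y) - ?l x - ?l y \<in> env_ideal L"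
      by (simp add: component_add algebra_simps)
    moreover have "(?l (scale c x) - bas [?c (scale c x)]) - fscale c (?l x - bas [?c x]) +
        (bas [scale c (?c x)] - fscale c (bas [?c x])) \<in> env_ideal L"
      by (intro ideal_closed coaction1_cong assms xy g)
    hence "?l (scale c x) - fscale c (?l x) \<in> env_ideal L"
      by (simp add: component_scale algebra_simps)
    moreover note calculation
  }
  thus "coaction1 (x + y) - coaction1 x - coaction1 y \<in> coeffs_in (env_ideal L)"
    and "coaction1 (scale c x) - gscale c (coaction1 x) \<in> coeffs_in (env_ideal L)"
    by (auto simp: coeffs_in_def lookup_minus lookup_gscale)
qed

lemma coaction1_homogeneous:
  assumes "x \<in> L" "x \<in> gr d" "d \<in> Gam S"
  shows "coaction1 x - single d (bas [x]) \<in> coeffs_in (env_ideal L)"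
  using bas_zero_ideal[of "[]" "[]"] assms
  by (auto simp: coeffs_in_def lookup_minus lookup_coaction1 lookup_single when_def component_gr
      ideal_closed)

text \<open>For homogeneous x and y all three terms sit, up to the ideal, in the single degree d +
  e, where the claim is the commutator relation. Additivity in both arguments reduces to that
  case.\<close>

lemma coaction1_bracket:
  assumes "x \<in> L" "y \<in> L"
  shows "coaction1 x * coaction1 y - coaction1 y * coaction1 x - coaction1 (bracket x y) \<in> coeffs_in (env_ideal L)"
proof -
  define E where "E x y = coaction1 x * coaction1 y - coaction1 y * coaction1 x - coaction1 (bracket x y)" for x y
  have br: "bracket x y \<in> L" if "x \<in> L" "y \<in> L" for x y
    using L that by (simp add: lie_subalgebra_def)
  have Eadd: "E (x + x') y \<in> coeffs_in (env_ideal L)"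
    if "x \<in> L" "x' \<in> L" "y \<in> L" "E x y \<in> coeffs_in (env_ideal L)" "E x' y \<in> coeffs_in (env_ideal L)" for x x' y
  proof -
    let ?r = "coaction1 (x + x') - coaction1 x - coaction1 x'"
    have "E x y + E x' y + ?r * coaction1 y - coaction1 y * ?r
        - (coaction1 (bracket x y + bracket x' y) - coaction1 (bracket x y) - coaction1 (bracket x' y)) \<in> coeffs_in (env_ideal L)"
      by (intro CI CI_mult coaction1_lin coaction1_CF br that)
    thus ?thesis
      by (simp add: E_def bracket_add_left algebra_simps)
  qed
  \<comment> \<open>Additivity is proved in the first argument only; antisymmetry makes it serve for
    the second one.\<close>
  have anti: "E y x \<in> coeffs_in (env_ideal L)" if "x \<in> L" "y \<in> L" "E x y \<in> coeffs_in (env_ideal L)" for x y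
  proof -
    have "coaction1 (scale (-1) (bracket x y)) - gscale (-1) (coaction1 (bracket x y)) \<in> coeffs_in (env_ideal L)"
      by (rule coaction1_lin(2)[OF br br]) (use that in auto)
    hence "coaction1 (bracket y x) + coaction1 (bracket x y) \<in> coeffs_in (env_ideal L)"
      by (simp add: bracket_antisym[of y x])
    from CI(3)[OF CI(3)[OF CI(1) that(3)] this] show ?thesis
      by (simp add: E_def algebra_simps)
  qed
  have "E x y \<in> coeffs_in (env_ideal L)"
    using assms(1) unfolding L_def
  proof (induction rule: supp_sub_induct)
    case (homogeneous d x)
    note x = this[folded L_def]
    have "E y x \<in> coeffs_in (env_ideal L)"
      using assms(2) unfolding L_def
    proof (induction rule: supp_sub_induct)
      case (homogeneous e y)
      note y = this[folded L_def]
      let ?x = "single d (bas [x])" and ?y = "single e (bas [y])"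
      have xy: "bracket y x \<in> gr (e + d)" "e + d \<in> Gam S"
        using gr_bracket[OF y(1) x(1) y(2) x(2)] x(1) y(1) by (auto intro: Gam_closed)
      have sc: "single b q \<in> coeffs_in C" if "q \<in> C" "0 \<in> C" for b q C
        using that by (simp add: coeffs_in_def lookup_single when_def)
      have "bas [y] * bas [x] - bas [x] * bas [y] - bas [bracket y x] \<in> env_ideal L"
        using x(3) y(3) by (intro env_ideal_gen) (unfold env_gens_def, blast)
      hence "single (e + d) (bas [y] * bas [x] - bas [x] * bas [y] - bas [bracket y x]) \<in> coeffs_in (env_ideal L)"
        by (rule sc) (rule ideal_closed)
      hence 1: "?y * ?x - ?x * ?y - single (e + d) (bas [bracket y x]) \<in> coeffs_in (env_ideal L)"
        by (simp add: mult_single single_diff add.commute)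
      have mem: "?x \<in> coeffs_in (FA L)"
        by (rule sc) (use x(3) in \<open>auto intro: bas_free_on free_on_closed\<close>)
      have "(coaction1 y - ?y) * ?x + coaction1 y * (coaction1 x - ?x) - (?x * (coaction1 y - ?y) + (coaction1 x - ?x) * coaction1 y)
          - (coaction1 (bracket y x) - single (e + d) (bas [bracket y x]))
          + (?y * ?x - ?x * ?y - single (e + d) (bas [bracket y x])) \<in> coeffs_in (env_ideal L)"
        by (intro CI CI_mult coaction1_homogeneous coaction1_CF mem 1 x y xy br)
      thus ?case
        by (simp add: E_def algebra_simps flip: L_def)
    next
      case (add y z)
      have "E (y + z) x \<in> coeffs_in (env_ideal L)"
        by (rule Eadd) (use add x in \<open>simp_all add: L_def\<close>)
      thus ?case
        by (simp add: L_def)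
    qed
    thus ?case
      using anti x assms(2) unfolding L_def by blast
  next
    case (add x z)
    have "E (x + z) y \<in> coeffs_in (env_ideal L)"
      by (rule Eadd) (use add assms(2) in \<open>simp_all add: L_def\<close>)
    thus ?case
      by (simp add: L_def)
  qed
  thus ?thesis
    by (simp add: E_def)
qed

text \<open>The coaction is multiplicative, and its values on generators have just been treated. So
  the degree projections \<open>prj\<close> descend to \<open>env L\<close>: homogeneous components
  exist there without a basis of ordered monomials.\<close>

lemma coaction_ideal:
  assumes "r \<in> env_ideal L"
  shows "coaction r \<in> coeffs_in (env_ideal L)"
proof -
  have g: "coaction g \<in> coeffs_in (env_ideal L)" if "g \<in> env_gens L" for g
    using that
  proof (cases rule: env_gens_cases)
    case (add x y)
    show ?thesis
      unfolding add(3) using coaction1_lin(1)[OF add(1,2)] by (simp add: coaction_diff coaction_simps)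
  next
    case (scale c x)
    show ?thesis
      unfolding scale(2) using coaction1_lin(2)[OF scale(1,1), of c] by (simp add: coaction_diff coaction_simps)
  next
    case (bracket x y)
    show ?thesis
      unfolding bracket(3) using coaction1_bracket[OF bracket(1,2)] by (simp add: coaction_diff coaction_simps coaction_mult)
  qed
  have "env_ideal L \<subseteq> {r. coaction r \<in> coeffs_in (env_ideal L)}"
    unfolding env_ideal_span[of L]
  proof (rule fs.span_minimal, fold env_ideal_span)
    show "fs.subspace {r. coaction r \<in> coeffs_in (env_ideal L)}"
      by (rule fs.subspaceI) (auto simp: coaction_simps CI)
    have "coaction (bas u * g * bas w) \<in> coeffs_in (env_ideal L)"
      if "u \<in> lists L" "w \<in> lists L" "g \<in> env_gens L" for u g w
      unfolding coaction_mult
      by (intro CI_mult(2) CI_mult(1) coaction_CF g bas_free_on that)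
    thus "{bas u * g * bas w |u w g. u \<in> lists L \<and> w \<in> lists L \<and> g \<in> env_gens L}
        \<subseteq> {r. coaction r \<in> coeffs_in (env_ideal L)}"
      by auto
  qed
  thus ?thesis
    using assms by blast
qed

lemma coaction_hw: "hw L d w \<Longrightarrow> coaction (bas w) - single d (bas w) \<in> coeffs_in (env_ideal L)"
proof (induction rule: hw_induct)
  case Nil
  have "coaction 1 = 1"
    using coaction_simps(4)[of "[]"] by (simp add: bas_Nil)
  thus ?case
    by (simp add: bas_Nil CI)
next
  case (Cons x d e w)
  have mem: "single d (bas [x]) \<in> coeffs_in (FA L)"
    using Cons(1) by (auto simp: coeffs_in_def lookup_single when_def intro!: bas_free_on free_on_closed)
  have "(coaction1 x - single d (bas [x])) * coaction (bas w) +
      single d (bas [x]) * (coaction (bas w) - single e (bas w)) \<in> coeffs_in (env_ideal L)"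
    by (intro CI(2) CI_mult(2)[OF coaction_CF coaction1_homogeneous] CI_mult(1)[OF mem Cons(5)]
        Cons(1-3) bas_free_on hw_lists[OF Cons(4)])
  thus ?case
    by (simp add: coaction_simps left_diff_distrib right_diff_distrib mult_single[of d _ e] bas_mult)
qed

lemma prj_FA: "p \<in> FA L \<Longrightarrow> prj b p \<in> FA L"
  and prj_ideal: "p \<in> env_ideal L \<Longrightarrow> prj b p \<in> env_ideal L"
  using coaction_CF coaction_ideal by (auto simp: prj_def coeffs_in_def)

lemma prj_hw: "hw L d w \<Longrightarrow> prj b (bas w) - (if b = d then bas w else 0) \<in> env_ideal L"
  using coaction_hw[of d w] by (auto simp: prj_def coeffs_in_def lookup_minus lookup_single when_def split: if_splits)

end

lemma prj_lin: "prj b (p + q) = prj b p + prj b q" "prj b (fscale c p) = fscale c (prj b p)"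
  by (simp_all add: prj_def coaction_simps lookup_add lookup_gscale)

end

section \<open>Finite dimensionality of the graded pieces of N\<close>

context triangular_lie_algebra
begin

lemma gr_sign:
  assumes "a \<in> Gam S" "x \<in> gr a" "x \<noteq> 0"
  shows "(\<forall>s. lookup a s \<ge> 0) \<or> (\<forall>s. lookup a s \<le> 0)"
  using mixed_degrees[OF assms(1)] assms(2,3) by (metis not_le singletonD)

lemma ht_sum_zero: "ht a = 0 \<Longrightarrow> (\<forall>s. lookup a s \<ge> 0) \<or> (\<forall>s. lookup a s \<le> 0) \<Longrightarrow> a = 0"
proof -
  assume h: "ht a = 0" and "(\<forall>s. lookup a s \<ge> 0) \<or> (\<forall>s. lookup a s \<le> 0)"
  then consider "\<forall>s. lookup a s \<ge> 0" | "\<forall>s. - lookup a s \<ge> 0"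
    by auto
  hence "\<forall>s\<in>keys a. lookup a s = 0"
  proof cases
    case 1
    thus ?thesis
      using h sum_nonneg_eq_0_iff[OF finite_keys[of a], of "lookup a"] by (simp add: ht_def)
  next
    case 2
    thus ?thesis
      using h sum_nonneg_eq_0_iff[OF finite_keys[of a], of "\<lambda>s. - lookup a s"]
      by (simp add: ht_def sum_negf)
  qed
  thus "a = 0"
    by (intro poly_mapping_eqI) (metis in_keys_iff lookup_zero)
qed

text \<open>The degree of a nonzero homogeneous element has no coordinates of opposite sign; if they
  sum to 0, all of them vanish.\<close>

lemma zgr_0: "zgr 0 = gr 0"
proof -
  have "component a x = 0" if "x \<in> zgr 0" "a \<noteq> 0" for a x
  proof (rule ccontr)
    assume nz: "component a x \<noteq> 0"
    hence "a \<in> Gam S" "ht a = 0"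
      using component_outside that(1) by (auto simp: zgr_eq supp_sub_def)
    thus False
      using ht_sum_zero gr_sign[OF _ dec(2) nz] that(2) by blast
  qed
  hence k: "keys (dec x) \<subseteq> {0}" if "x \<in> zgr 0" for x
    using that by (auto simp: in_keys_iff component_dec)
  have "x = component 0 x" if "x \<in> zgr 0" for x
  proof -
    have "x = (\<Sum>a\<in>keys (dec x). component a x)"
      by (rule dec(3))
    also have "\<dots> = (\<Sum>a\<in>{0}. component a x)"
      by (rule sum.mono_neutral_left) (use k[OF that] in \<open>auto simp: component_dec in_keys_iff\<close>)
    finally show ?thesis
      by simp
  qed
  thus ?thesis
    using dec(2)[OF Gam_closed(1)] by (auto simp: zgr_eq intro: gr_supp_sub Gam_closed) metis
qed

definition below :: "('s \<Rightarrow>\<^sub>0 int) \<Rightarrow> ('s \<Rightarrow>\<^sub>0 int) \<Rightarrow> bool" where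
  "below a b \<longleftrightarrow> (\<forall>s. lookup a s \<le> lookup b s)"

text \<open>\<open>S\<close> may be infinite, but a degree between \<open>b\<close> and 0 is
  supported on the finite set \<open>keys b\<close>.\<close>

lemma finite_between: "finite {d. below b d \<and> below d 0}"
proof -
  let ?V = "\<Union>s\<in>keys b. {lookup b s..0}"
  let ?F = "{f. \<forall>s. (s \<in> keys b \<longrightarrow> f s \<in> ?V) \<and> (s \<notin> keys b \<longrightarrow> f s = 0)}"
  have "finite ?F"
    by (rule finite_set_of_finite_funs) auto
  moreover have "lookup ` {d. below b d \<and> below d 0} \<subseteq> ?F"
  proof (intro image_subsetI CollectI allI conjI impI)
    fix d s assume "d \<in> {d. below b d \<and> below d 0}"
    hence d: "lookup b s \<le> lookup d s" "lookup d s \<le> 0"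
      by (auto simp: below_def)
    thus "s \<in> keys b \<Longrightarrow> lookup d s \<in> ?V"
      by auto
    show "s \<notin> keys b \<Longrightarrow> lookup d s = 0"
      using d by (simp add: in_keys_iff)
  qed
  ultimately have "finite (lookup ` {d. below b d \<and> below d 0})"
    by (rule rev_finite_subset)
  thus ?thesis
    by (rule finite_imageD) (simp add: inj_on_def lookup_inject)
qed

lemma sub_k_lt: "lie_subalgebra (supp_sub (\<lambda>a. ht a < 0))"
  using sub_N by (simp add: k_lt_eq)

lemma gr_k_lt: "d \<in> Gam S \<Longrightarrow> ht d < 0 \<Longrightarrow> gr d \<subseteq> k_lt"
  unfolding k_lt_eq by (auto intro: gr_supp_sub)

text \<open>A letter of a word outside the ideal is nonzero of negative height, so its degree has
  coordinates at most 0. Hence the degrees of all letters lie in the box between \<open>d\<close>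
  and 0, the length is at most \<open>- ht d\<close>, and a set \<open>E\<close> spanning the pieces
  in the box yields all such words.\<close>

lemma hw_k_lt_bound:
  assumes "hw k_lt d w" "E \<subseteq> k_lt"
    "\<And>e. \<lbrakk>e \<in> Gam S; below d e; below e 0; ht e < 0\<rbrakk> \<Longrightarrow> gr e \<subseteq> span E"
  shows "bas w \<in> env_ideal k_lt \<or> (below d 0 \<and> ht d \<le> - int (length w) \<and>
     bas w \<in> fspan (bas ` {u \<in> lists E. length u = length w} \<union> env_ideal k_lt))"
  using assms
proof (induction rule: hw_induct)
  case Nil
  thus ?case
    by (auto simp: below_def intro!: fs.span_base)
next
  case (Cons x d e w)
  note I = env_ideal_sub[OF sub_N]
  have b: "bas (x # w) = bas [x] * bas w"
    by (simp add: bas_mult)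
  show ?case
  proof (cases "x = 0 \<or> bas w \<in> env_ideal k_lt")
    case True
    hence "bas (x # w) \<in> env_ideal k_lt"
    proof
      assume "x = 0"
      thus ?thesis
        using bas_zero_ideal[OF sub_k_lt, of "[]" w] hw_lists[OF Cons.hyps(4)] by (simp add: k_lt_eq)
    next
      assume "bas w \<in> env_ideal k_lt"
      thus ?thesis
        unfolding b by (intro env_ideal_left bas_free_on) (use Cons.hyps in auto)
    qed
    thus ?thesis
      by simp
  next
    case False
    have hd: "ht d < 0"
    proof (rule ccontr)
      assume "\<not> ht d < 0"
      hence "component d x = 0"
        using Cons.hyps(1) by (intro supp_subD[of x "\<lambda>a. ht a < 0"]) (auto simp: k_lt_eq)
      thus False
        using False Cons.hyps by (simp add: component_gr)
    qed
    have bd: "below d 0"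
    proof -
      have "\<not> (\<forall>s. lookup d s \<ge> 0)"
        using hd sum_nonneg[of "keys d" "lookup d"] by (auto simp: ht_def)
      thus ?thesis
        using gr_sign[OF Cons.hyps(3,2)] False by (auto simp: below_def)
    qed
    \<comment> \<open>The box of the tail is contained in the box of the whole word, since d has
      coordinates at most 0.\<close>
    have lower: "gr e' \<subseteq> span E" if "e' \<in> Gam S" "below e e'" "below e' 0" "ht e' < 0" for e'
      by (rule Cons.prems(2)) (use that bd in \<open>auto simp: below_def lookup_add intro: order_trans[OF add_decreasing]\<close>)
    have "below e 0 \<and> ht e \<le> - int (length w) \<and>
       bas w \<in> fspan (bas ` {u \<in> lists E. length u = length w} \<union> env_ideal k_lt)"
      using Cons.IH[OF Cons.prems(1) lower] False by blast
    hence e: "below e 0" "ht e \<le> - int (length w)"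
      "bas w \<in> fspan (bas ` {u \<in> lists E. length u = length w} \<union> env_ideal k_lt)"
      by auto
    have "below (d + e) d"
      using e(1) by (simp add: below_def lookup_add)
    hence x: "x \<in> span E"
      using Cons.prems(2)[of d] Cons.hyps bd hd by blast
    have sb: "subspace k_lt"
      using sub_N by (simp add: lie_subalgebra_def)
    have "x \<in> k_lt \<and> bas [x] \<in> fspan (bas ` {u \<in> lists E. length u = 1} \<union> env_ideal k_lt)"
      using x
    proof (induction rule: span_induct_alt)
      case base
      show ?case
        using bas_zero_ideal[OF sub_k_lt, of "[]" "[]"] subspace_0[OF sb] by (auto simp: k_lt_eq intro: fs.span_base)
    next
      case (step c x y)
      have xy: "x \<in> k_lt" "scale c x \<in> k_lt" "y \<in> k_lt"
        using Cons.prems(1) step subspace_scale[OF sb] by auto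
      have "bas [scale c x + y] - bas [scale c x] - bas [y] \<in> env_ideal k_lt"
        "bas [scale c x] - fscale c (bas [x]) \<in> env_ideal k_lt"
        using xy by (intro env_ideal_gen; unfold env_gens_def; blast)+
      hence "(bas [scale c x + y] - bas [scale c x] - bas [y]) + (bas [scale c x] - fscale c (bas [x])) +
          fscale c (bas [x]) + bas [y] \<in> fspan (bas ` {u \<in> lists E. length u = 1} \<union> env_ideal k_lt)"
        using step by (intro fs.span_add fs.span_scale) (auto intro!: fs.span_base)
      thus ?case
        using xy subspace_add[OF sb] by simp
    qed
    hence letter: "bas [x] \<in> fspan (bas ` {u \<in> lists E. length u = 1} \<union> env_ideal k_lt)"
      by simp
    have "bas [x] * bas w \<in> fspan (bas ` {u \<in> lists E. length u = length (x # w)} \<union> env_ideal k_lt)"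
    proof (rule fspan_mult_closed[OF letter e(3)])
      fix g h assume g: "g \<in> bas ` {u \<in> lists E. length u = 1} \<union> env_ideal k_lt"
        and h: "h \<in> bas ` {u \<in> lists E. length u = length w} \<union> env_ideal k_lt"
      have fa: "g \<in> FA k_lt" "h \<in> FA k_lt"
        using g h I Cons.prems(1) by (auto intro!: bas_free_on)
      consider u v where "g = bas u" "h = bas v" "u \<in> lists E" "v \<in> lists E" "length u = 1" "length v = length w"
        | "g \<in> env_ideal k_lt" | "h \<in> env_ideal k_lt"
        using g h by blast
      thus "g * h \<in> fspan (bas ` {u \<in> lists E. length u = length (x # w)} \<union> env_ideal k_lt)"
      proof cases
        case 1
        hence "g * h = bas (u @ v)" "u @ v \<in> {u \<in> lists E. length u = length (x # w)}"
          by (auto simp: bas_mult)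
        thus ?thesis
          by (intro fs.span_base) blast
      next
        case 2
        thus ?thesis
          by (intro fs.span_base UnI2 env_ideal_right fa)
      next
        case 3
        thus ?thesis
          by (intro fs.span_base UnI2 env_ideal_left fa)
      qed
    qed
    moreover have "below (d + e) 0" "ht (d + e) \<le> - int (length (x # w))"
      using bd e hd by (auto simp: below_def lookup_add ht_add intro: add_nonpos_nonpos)
    ultimately show ?thesis
      unfolding b by blast
  qed
qed

lemma finite_spanning_words:
  assumes b: "b \<in> Gam S"
  shows "\<exists>G. finite G \<and> G \<subseteq> FA k_lt \<and> (\<forall>w. hw k_lt b w \<longrightarrow> bas w \<in> fspan (G \<union> env_ideal k_lt))"
proof -
  let ?D = "{d. d \<in> Gam S \<and> below b d \<and> below d 0 \<and> ht d < 0}"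
  have "\<forall>d\<in>?D. \<exists>E. finite E \<and> span E = gr d"
    using negative_finite_dim by blast
  from bchoice[OF this] obtain E where E: "\<And>d. d \<in> ?D \<Longrightarrow> finite (E d) \<and> span (E d) = gr d"
    by blast
  define EE where "EE = (\<Union>d\<in>?D. E d)"
  have fin: "finite EE"
    unfolding EE_def
  proof (rule finite_UN_I)
    show "finite ?D"
      by (rule finite_subset[OF _ finite_between[of b]]) auto
  qed (use E in blast)
  have sub: "EE \<subseteq> k_lt"
    unfolding EE_def using E gr_k_lt span_superset by fast
  have cov: "gr e \<subseteq> span EE" if "e \<in> Gam S" "below b e" "below e 0" "ht e < 0" for e
    using E[of e] that span_mono[of "E e" EE] unfolding EE_def by blast
  \<comment> \<open>The length bound comes from the fact that each letter of a word outside the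
    ideal lowers the height by at least 1.\<close>
  define G where "G = (bas ` {u. set u \<subseteq> EE \<and> length u \<le> nat (- ht b)} :: ('k list \<Rightarrow>\<^sub>0 'f) set)"
  have "bas w \<in> fspan (G \<union> env_ideal k_lt)" if w: "hw k_lt b w" for w
  proof (cases "bas w \<in> env_ideal k_lt")
    case True
    thus ?thesis
      by (intro fs.span_base) simp
  next
    case False
    hence *: "ht b \<le> - int (length w)"
      "bas w \<in> fspan (bas ` {u \<in> lists EE. length u = length w} \<union> env_ideal k_lt)"
      using hw_k_lt_bound[OF w sub cov] by blast+
    have "bas ` {u \<in> lists EE. length u = length w} \<subseteq> G"
      using *(1) by (auto simp: G_def)
    thus ?thesis
      using *(2) fs.span_mono[of "bas ` {u \<in> lists EE. length u = length w} \<union> env_ideal k_lt" "G \<union> env_ideal k_lt"] by blast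
  qed
  moreover have "finite G"
    unfolding G_def by (intro finite_imageI finite_lists_length_le fin)
  moreover have "G \<subseteq> FA k_lt"
    using sub by (auto simp: G_def intro!: bas_free_on)
  ultimately show ?thesis
    by blast
qed

text \<open>A basis \<open>E0\<close> of the ideal is extended to \<open>E\<close> by finitely many
  elements \<open>J\<close> that span the degrees in \<open>F\<close> modulo the ideal. The
  functional of j is the coordinate at j of the part of its argument in degrees \<open>F\<close>; it
  kills the ideal, which is the span of \<open>E0\<close>.\<close>

lemma dual_basis:
  assumes F: "finite F" "F \<subseteq> Gam S"
  shows "\<exists>J f. finite J \<and> J \<subseteq> FA k_lt \<and>
    (\<forall>j\<in>J. (\<forall>p\<in>FA k_lt. \<forall>q\<in>FA k_lt. f j (p + q) = f j p + f j q) \<and> (\<forall>c. \<forall>p\<in>FA k_lt. f j (fscale c p) = c * f j p) \<and>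
      (\<forall>r\<in>env_ideal k_lt. f j r = 0) \<and> (\<forall>c w. c \<notin> F \<longrightarrow> hw k_lt c w \<longrightarrow> f j (bas w) = 0)) \<and>
    (\<forall>p\<in>FA k_lt. p - (\<Sum>j\<in>J. fscale (f j p) j) \<in> fspan ({bas w | w c. c \<notin> F \<and> hw k_lt c w} \<union> env_ideal k_lt))"
proof -
  let ?I = "env_ideal k_lt"
  note I = env_ideal_sub[OF sub_N]
  obtain G where G: "\<And>b. b \<in> F \<Longrightarrow> finite (G b) \<and> G b \<subseteq> FA k_lt \<and> (\<forall>w. hw k_lt b w \<longrightarrow> bas w \<in> fspan (G b \<union> ?I))"
    using finite_spanning_words F(2) by (metis subsetD)
  define GG where "GG = (\<Union>b\<in>F. G b)"
  have GG: "finite GG" "GG \<subseteq> FA k_lt"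
    using G F by (auto simp: GG_def)
  have cov: "bas w \<in> fspan (GG \<union> ?I)" if "b \<in> F" "hw k_lt b w" for b w
    using G[OF that(1)] that fs.span_mono[of "G b \<union> ?I" "GG \<union> ?I"] by (auto simp: GG_def)
  obtain E0 where E0: "E0 \<subseteq> ?I" "fs.independent E0" "?I \<subseteq> fspan E0"
    using fs.maximal_independent_subset by blast
  obtain E where E: "E0 \<subseteq> E" "E \<subseteq> E0 \<union> GG" "fs.independent E" "E0 \<union> GG \<subseteq> fspan E"
    using fs.maximal_independent_subset_extend[OF Un_upper1 E0(2), of GG] by blast
  have E0I: "fspan E0 = ?I"
    using E0 fs.span_subspace[OF E0(1,3) subspace_ideal] by simp
  have spE: "fspan (GG \<union> ?I) \<subseteq> fspan E"
  proof (rule fs.span_minimal[OF _ fs.subspace_span])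
    show "GG \<union> ?I \<subseteq> fspan E"
      using E(1,4) E0(3) fs.span_mono[OF E(1)] by blast
  qed
  define J where "J = E - E0"
  have J: "finite J" "J \<subseteq> FA k_lt"
    using E(2) GG finite_subset[of J GG] by (auto simp: J_def)
  define q where "q p = (\<Sum>b\<in>F. prj b p)" for p
  have q: "q (p + p') = q p + q p'" "q (fscale c p) = fscale c (q p)" for p p' c
    by (simp_all add: q_def prj_lin sum.distrib fs.scale_sum_right)
  have qI: "q r \<in> ?I" if "r \<in> ?I" for r
    unfolding q_def using that prj_ideal[OF sub_k_lt]
    by (auto intro!: fs.subspace_sum[OF subspace_ideal] simp: k_lt_eq)
  have qw: "q (bas w) - (if d \<in> F then bas w else 0) \<in> ?I" if "hw k_lt d w" for d w
  proof -
    have "(\<Sum>b\<in>F. prj b (bas w) - (if b = d then bas w else 0)) \<in> ?I"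
      using that prj_hw[OF sub_k_lt, of d w]
      by (auto intro!: fs.subspace_sum[OF subspace_ideal] simp: k_lt_eq)
    thus ?thesis
      using F(1) by (simp add: q_def sum_subtractf)
  qed
  have hom: "p \<in> fspan ({bas w | w d. hw k_lt d w} \<union> ?I)" if "p \<in> FA k_lt" for p
    using FA_homogeneous[OF sub_k_lt] that by (simp add: k_lt_eq)
  have qE: "q p \<in> fspan E" if "p \<in> FA k_lt" for p
  proof -
    have "fspan ({bas w | w d. hw k_lt d w} \<union> ?I) \<subseteq> {p. q p \<in> fspan (GG \<union> ?I)}"
    proof (rule fs.span_minimal)
      show "fs.subspace {p. q p \<in> fspan (GG \<union> ?I)}"
        using q(2)[of 0 0] by (intro fs.subspaceI) (auto simp: q fs.span_add fs.span_scale fs.span_zero)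
      have "q (bas w) \<in> fspan (GG \<union> ?I)" if "hw k_lt d w" for d w
      proof -
        have "(q (bas w) - (if d \<in> F then bas w else 0)) + (if d \<in> F then bas w else 0) \<in> fspan (GG \<union> ?I)"
          using qw[OF that] cov[OF _ that] by (intro fs.span_add) (auto intro: fs.span_base fs.span_zero)
        thus ?thesis
          by simp
      qed
      thus "{bas w | w d. hw k_lt d w} \<union> ?I \<subseteq> {p. q p \<in> fspan (GG \<union> ?I)}"
        using qI by (auto intro: fs.span_base)
    qed
    thus ?thesis
      using hom[OF that] spE by blast
  qed
  define f where "f j p = fs.representation E (q p) j" for j p
  have repI: "fs.representation E r j = 0" if "r \<in> ?I" "j \<in> J" for r j
    using fs.representation_extend[OF E(3) _ E(1), of r] that fs.representation_ne_zero[of E0 r j]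
    by (auto simp: E0I J_def)
  have f: "f j (p + p') = f j p + f j p'" "f j (fscale c p) = c * f j p" if "p \<in> FA k_lt" "p' \<in> FA k_lt" for j p p' c
    using that by (simp_all add: f_def q fs.representation_add[OF E(3)] fs.representation_scale[OF E(3)] qE)
  have fI: "f j r = 0" if "r \<in> ?I" "j \<in> J" for r j
    using repI[OF qI] that by (simp add: f_def)
  have fout: "f j (bas w) = 0" if "c \<notin> F" "hw k_lt c w" "j \<in> J" for j c w
    using repI[of "q (bas w)" j] qw[OF that(2)] that by (simp add: f_def)
  have rest: "x - (\<Sum>j\<in>J. fscale (fs.representation E x j) j) \<in> ?I" if "x \<in> fspan E" for x
  proof -
    let ?r = "fs.representation E x"
    let ?K = "{b. ?r b \<noteq> 0}"
    have K: "finite ?K" "?K \<subseteq> E"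
      using fs.finite_representation fs.representation_ne_zero by auto
    have "x = (\<Sum>b\<in>?K. fscale (?r b) b)"
      using fs.sum_nonzero_representation_eq[OF E(3) that] by simp
    also have "\<dots> = (\<Sum>b\<in>?K \<inter> E0. fscale (?r b) b) + (\<Sum>b\<in>?K - E0. fscale (?r b) b)"
      by (rule sum.Int_Diff[OF K(1)])
    also have "(\<Sum>b\<in>?K - E0. fscale (?r b) b) = (\<Sum>j\<in>J. fscale (?r j) j)"
      by (rule sum.mono_neutral_left) (use J K in \<open>auto simp: J_def\<close>)
    finally have "x - (\<Sum>j\<in>J. fscale (?r j) j) = (\<Sum>b\<in>?K \<inter> E0. fscale (?r b) b)"
      by (simp add: algebra_simps)
    also have "\<dots> \<in> ?I"
      using E0(1) by (auto intro!: fs.subspace_sum[OF subspace_ideal] ideal_closed)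
    finally show ?thesis .
  qed
  let ?Z = "fspan ({bas w | w c. c \<notin> F \<and> hw k_lt c w} \<union> ?I)"
  have decomp: "p - (\<Sum>j\<in>J. fscale (f j p) j) \<in> ?Z" if "p \<in> FA k_lt" for p
  proof -
    have "fspan ({bas w | w d. hw k_lt d w} \<union> ?I) \<subseteq> {p \<in> FA k_lt. p - (\<Sum>j\<in>J. fscale (f j p) j) \<in> ?Z}"
    proof (rule fs.span_minimal)
      show "fs.subspace {p \<in> FA k_lt. p - (\<Sum>j\<in>J. fscale (f j p) j) \<in> ?Z}"
      proof (rule fs.subspaceI)
        fix p p' c assume pp: "p \<in> {p \<in> FA k_lt. p - (\<Sum>j\<in>J. fscale (f j p) j) \<in> ?Z}"
        hence "fscale c (p - (\<Sum>j\<in>J. fscale (f j p) j)) \<in> ?Z"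
          by (auto intro: fs.span_scale)
        thus "fscale c p \<in> {p \<in> FA k_lt. p - (\<Sum>j\<in>J. fscale (f j p) j) \<in> ?Z}"
          using pp by (auto simp: f free_on_closed fs.scale_right_diff_distrib fs.scale_sum_right)
        assume pp': "p' \<in> {p \<in> FA k_lt. p - (\<Sum>j\<in>J. fscale (f j p) j) \<in> ?Z}"
        hence "(p - (\<Sum>j\<in>J. fscale (f j p) j)) + (p' - (\<Sum>j\<in>J. fscale (f j p') j)) \<in> ?Z"
          using pp by (auto intro: fs.span_add)
        thus "p + p' \<in> {p \<in> FA k_lt. p - (\<Sum>j\<in>J. fscale (f j p) j) \<in> ?Z}"
          using pp pp' by (auto simp: f free_on_closed fs.scale_left_distrib sum.distrib algebra_simps)
      qed (use f(2)[of 0 0 _ 0] in \<open>auto simp: free_on_closed fs.span_zero\<close>)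
      have "bas w - (\<Sum>j\<in>J. fscale (f j (bas w)) j) \<in> ?Z" if w: "hw k_lt d w" for d w
      proof (cases "d \<in> F")
        case True
        have r: "q (bas w) - (\<Sum>j\<in>J. fscale (f j (bas w)) j) \<in> ?I"
          using rest[OF qE[OF bas_free_on[OF hw_lists[OF w]]]] by (simp add: f_def)
        have "q (bas w) - bas w \<in> ?I"
          using qw[OF w] True by simp
        from ideal_closed(4)[OF r this]
        have "bas w - (\<Sum>j\<in>J. fscale (f j (bas w)) j) \<in> ?I"
          by simp
        thus ?thesis
          by (intro fs.span_base) simp
      next
        case False
        thus ?thesis
          using fout[OF False w] w by (auto intro!: fs.span_base)
      qed
      moreover have "r - (\<Sum>j\<in>J. fscale (f j r) j) \<in> ?Z" if "r \<in> ?I" for r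
        using fI[OF that] that by (simp add: fs.span_base)
      ultimately show "{bas w | w d. hw k_lt d w} \<union> ?I \<subseteq> {p \<in> FA k_lt. p - (\<Sum>j\<in>J. fscale (f j p) j) \<in> ?Z}"
        using I by (auto intro!: bas_free_on dest: hw_lists)
    qed
    thus ?thesis
      using hom[OF that] by blast
  qed
  show ?thesis
    by (rule exI[of _ J], rule exI[of _ f]) (use J f fI fout decomp in blast)
qed

end

section \<open>The restricted dual\<close>

lemma finsum_base_field: "finite A \<Longrightarrow> finsum base_field g A = sum g A"
proof -
  interpret abelian_group "base_field :: ('f::field, 'f) module"
    by (rule vspace_abelian[OF vspace_base])
  show "finite A \<Longrightarrow> finsum base_field g A = sum g A" for g :: "'a \<Rightarrow> 'f"
    by (induction rule: finite_induct) (auto simp: finsum_insert)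
qed

context triangular_lie_algebra
begin

text \<open>The support is measured by degrees of arguments, so a functional of degree a is
  supported at -a. The zero \<open>z\<close> of the target is a parameter because the targets are
  \<open>base_field\<close> and \<open>kgB\<close>.\<close>

definition vanish_off :: "((('k list \<Rightarrow>\<^sub>0 'f) set) \<Rightarrow> 'w) \<Rightarrow> 'w \<Rightarrow> ('s \<Rightarrow>\<^sub>0 int) set \<Rightarrow> bool" where
  "vanish_off f z F \<longleftrightarrow> (\<forall>c w. c \<notin> F \<longrightarrow> hw k_lt c w \<longrightarrow> f (cl k_lt (bas w)) = z)"

lemma vanish_offD: "\<lbrakk>vanish_off f z F; c \<notin> F; hw k_lt c w\<rbrakk> \<Longrightarrow> f (cl k_lt (bas w)) = z"
  by (auto simp: vanish_off_def)

lemma vanish_off_mono: "vanish_off f z F \<Longrightarrow> F \<subseteq> F' \<Longrightarrow> vanish_off f z F'"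
  by (auto simp: vanish_off_def)

lemma hw_FA: "hw L d w \<Longrightarrow> bas w \<in> FA L"
  by (rule bas_free_on[OF hw_lists])

lemma hw_closed: "hw L d w \<Longrightarrow> cl L (bas w) \<in> carrier (env L)"
  by (rule env_closed[OF hw_FA])

lemmas k_lt_induct [consumes 1, case_names homogeneous add] =
  supp_sub_induct[where P = "\<lambda>a. ht a < 0", folded k_lt_eq]
lemmas k_ge_induct [consumes 1, case_names homogeneous add] =
  supp_sub_induct[where P = "\<lambda>a. ht a \<ge> 0", folded k_ge_eq]

lemmas k_lt_homogeneous = FA_homogeneous[OF sub_k_lt, folded k_lt_eq]
lemmas prj_k_lt = prj_ideal[OF sub_k_lt, folded k_lt_eq] prj_FA[OF sub_k_lt, folded k_lt_eq] prj_hw[OF sub_k_lt, folded k_lt_eq]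

lemma N_lin: 
  assumes "f \<in> lin_maps N V" "vspace V"
  shows "p \<in> FA k_lt \<Longrightarrow> q \<in> FA k_lt \<Longrightarrow> f (cl k_lt (p + q)) = f (cl k_lt p) \<oplus>\<^bsub>V\<^esub> f (cl k_lt q)"
    and "p \<in> FA k_lt \<Longrightarrow> f (cl k_lt (fscale c p)) = c \<odot>\<^bsub>V\<^esub> f (cl k_lt p)"
    and "p \<in> env_ideal k_lt \<Longrightarrow> f (cl k_lt p) = \<zero>\<^bsub>V\<^esub>"
    and "p \<in> FA k_lt \<Longrightarrow> f (cl k_lt p) \<in> carrier V"
    and "f (env_ideal k_lt) = \<zero>\<^bsub>V\<^esub>"
  using lin_add[OF assms(1) env_closed env_closed, of p q] lin_smult[OF assms(1) env_closed, of p c]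
    lin_zero[OF vspace_env assms(2,1)] lin_closed[OF assms(1) env_closed]
  by (simp_all add: env_add env_smult env_zero coset_zero[OF subspace_ideal])

lemma N_eqI:
  assumes "f \<in> lin_maps N V" "g \<in> lin_maps N V" "vspace V" "\<And>c w. hw k_lt c w \<Longrightarrow> f (cl k_lt (bas w)) = g (cl k_lt (bas w))"
  shows "f = g"
proof (rule extensionalityI[OF lin_maps_ext[OF assms(1)] lin_maps_ext[OF assms(2)]])
  note l = N_lin[OF assms(1,3)] N_lin[OF assms(2,3)]
  fix X assume "X \<in> carrier N"
  then obtain p where p: "p \<in> FA k_lt" "X = cl k_lt p"
    by (rule env_cases)
  have "fspan ({bas w | w d. hw k_lt d w} \<union> env_ideal k_lt) \<subseteq> {p \<in> FA k_lt. f (cl k_lt p) = g (cl k_lt p)}"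
    by (rule fs.span_minimal)
       (use env_ideal_sub[OF sub_N] l assms(4) in
        \<open>auto intro!: fs.subspaceI simp: hw_FA free_on_closed ideal_closed\<close>)
  thus "f X = g X"
    using k_lt_homogeneous[OF p(1)] p(2) by blast
qed

lemma hom_deg_dual:
  assumes f: "f \<in> lin_maps N base_field" and b: "b \<in> Gam S"
  shows "\<exists>g\<in>hom_deg S N (env_grading k_lt) base_field base_grading (- b).
    \<forall>c w. hw k_lt c w \<longrightarrow> g (cl k_lt (bas w)) = (if c = b then f (cl k_lt (bas w)) else 0)"
proof -
  note l = N_lin[OF f vspace_base, unfolded base_field_simps]
  let ?k = "\<lambda>p. f (cl k_lt (prj b p))"
  have q: "quot_map (FA k_lt) (env_ideal k_lt) ?k \<in> lin_maps N base_field"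
    "\<And>p. p \<in> FA k_lt \<Longrightarrow> quot_map (FA k_lt) (env_ideal k_lt) ?k (cl k_lt p) = ?k p"
    by (rule quot_lift[OF is_quot_env vspace_base]; simp add: prj_lin prj_k_lt l)+
  define g where "g = quot_map (FA k_lt) (env_ideal k_lt) ?k"
  note g = q[folded g_def]
  note lg = N_lin[OF g(1) vspace_base, unfolded base_field_simps]
  have gw: "g (cl k_lt (bas w)) = (if c = b then f (cl k_lt (bas w)) else 0)" if w: "hw k_lt c w" for c w
  proof -
    have "g (cl k_lt (bas w)) = f (cl k_lt (prj b (bas w)))"
      using g(2)[of "bas w"] hw_lists[OF w] by (simp add: bas_free_on)
    also have "cl k_lt (prj b (bas w)) = cl k_lt (if b = c then bas w else 0)"
      using prj_k_lt(3)[OF w, of b] by (simp add: cl_eq_iff)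
    finally show ?thesis
      using l(3)[of 0] by (auto simp: ideal_closed)
  qed
  have "g ` env_grading k_lt c \<subseteq> base_grading (- b + c)" for c
  proof (cases "c = b")
    case False
    have "fspan {bas w | w. hw k_lt c w} \<subseteq> {p \<in> FA k_lt. g (cl k_lt p) = 0}"
      by (rule fs.span_minimal)
         (use lg gw False in \<open>auto intro!: fs.subspaceI simp: hw_FA free_on_closed ideal_closed\<close>)
    thus ?thesis
      by (auto simp: env_grading_eq base_grading_def)
  qed (auto simp: base_grading_def)
  hence "g \<in> hom_deg S N (env_grading k_lt) base_field base_grading (- b)"
    using g(1) by (simp add: hom_deg_def)
  thus ?thesis
    using gw by blast
qed

text \<open>Working description of the restricted dual: linear functionals on N that are nonzero in
  finitely many degrees only. For the converse the homogeneous parts are cut out by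
  \<open>prj\<close>, through \<open>hom_deg_dual\<close>.\<close>

lemma N_dual_iff:
  "f \<in> carrier N_dual \<longleftrightarrow> f \<in> lin_maps N base_field \<and> (\<exists>F. finite F \<and> F \<subseteq> Gam S \<and> vanish_off f 0 F)"
proof
  assume "f \<in> carrier N_dual"
  then obtain A g where A: "finite A" "A \<subseteq> Gam S"
    and g: "\<And>a. a \<in> A \<Longrightarrow> g a \<in> hom_deg S N (env_grading k_lt) base_field base_grading a"
    and f': "f = (\<lambda>x\<in>carrier N. \<Oplus>\<^bsub>base_field\<^esub>a\<in>A. g a x)"
    unfolding N_dual_def map_space_simps graded_hom_def by blast
  have f: "f = (\<lambda>x\<in>carrier N. \<Sum>a\<in>A. g a x)"
    unfolding f' by (simp add: finsum_base_field A)
  have gl: "g a \<in> lin_maps N base_field" if "a \<in> A" for a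
    using g[OF that] by (simp add: hom_deg_def)
  have "f \<in> lin_maps N base_field"
    unfolding f
    by (rule restrict_linI[OF vspace_env])
       (auto simp: lin_add[OF gl] lin_smult[OF gl] sum.distrib sum_distrib_left)
  moreover have "vanish_off f 0 (uminus ` A)"
    unfolding vanish_off_def
  proof (intro allI impI)
    fix c w assume c: "c \<notin> uminus ` A" and w: "hw k_lt c w"
    have "g a (cl k_lt (bas w)) = 0" if "a \<in> A" for a
    proof -
      have "a + c \<noteq> 0"
        using c that by (metis add.commute add_eq_0_iff image_eqI)
      moreover have "cl k_lt (bas w) \<in> env_grading k_lt c"
        unfolding env_grading_eq by (intro imageI fs.span_base) (use w in blast)
      moreover have "g a ` env_grading k_lt c \<subseteq> base_grading (a + c)"
        using g[OF that] hw_Gam[OF w] by (simp add: hom_deg_def)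
      ultimately show ?thesis
        by (auto simp: base_grading_def)
    qed
    thus "f (cl k_lt (bas w)) = 0"
      using hw_lists[OF w] by (simp add: f env_closed bas_free_on)
  qed
  ultimately show "f \<in> lin_maps N base_field \<and> (\<exists>F. finite F \<and> F \<subseteq> Gam S \<and> vanish_off f 0 F)"
    using A Gam_closed(3) by (intro conjI exI[of _ "uminus ` A"]) auto
next
  assume "f \<in> lin_maps N base_field \<and> (\<exists>F. finite F \<and> F \<subseteq> Gam S \<and> vanish_off f 0 F)"
  then obtain F where f: "f \<in> lin_maps N base_field" and F: "finite F" "F \<subseteq> Gam S" "vanish_off f 0 F"
    by blast
  from hom_deg_dual[OF f] obtain g where
    g: "\<And>b. b \<in> Gam S \<Longrightarrow> g b \<in> hom_deg S N (env_grading k_lt) base_field base_grading (- b)"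
    "\<And>b c w. b \<in> Gam S \<Longrightarrow> hw k_lt c w \<Longrightarrow> g b (cl k_lt (bas w)) = (if c = b then f (cl k_lt (bas w)) else 0)"
    by metis
  have gl: "g b \<in> lin_maps N base_field" if "b \<in> F" for b
    using g(1)[of b] F(2) that by (auto simp: hom_deg_def)
  have "f = (\<lambda>x\<in>carrier N. \<Sum>b\<in>F. g b x)"
  proof (rule N_eqI[OF f _ vspace_base])
    show "(\<lambda>x\<in>carrier N. \<Sum>b\<in>F. g b x) \<in> lin_maps N base_field"
      by (rule restrict_linI[OF vspace_env])
         (auto simp: lin_add[OF gl] lin_smult[OF gl] sum.distrib sum_distrib_left)
    fix c w assume w: "hw k_lt c w"
    have "(\<Sum>b\<in>F. g b (cl k_lt (bas w))) = (\<Sum>b\<in>F. if c = b then f (cl k_lt (bas w)) else 0)"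
      by (rule sum.cong) (use g(2)[OF _ w] F(2) in auto)
    thus "f (cl k_lt (bas w)) = (\<lambda>x\<in>carrier N. \<Sum>b\<in>F. g b x) (cl k_lt (bas w))"
      using hw_lists[OF w] F(1) vanish_offD[OF F(3) _ w] by (simp add: env_closed bas_free_on)
  qed
  hence "f = (\<lambda>x\<in>carrier N. \<Oplus>\<^bsub>base_field\<^esub>a\<in>uminus ` F. g (- a) x)"
    by (simp add: finsum_base_field F(1) sum.reindex)
  thus "f \<in> carrier N_dual"
    unfolding N_dual_def map_space_simps graded_hom_def
    using F g(1) Gam_closed(3) by (intro CollectI exI[of _ "uminus ` F"] exI[of _ "\<lambda>a. g (- a)"]) auto
qed

lemma N_dual_lin: "f \<in> carrier N_dual \<Longrightarrow> f \<in> lin_maps N base_field"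
  by (simp add: N_dual_iff)

lemma N_dual_simps: "\<zero>\<^bsub>N_dual\<^esub> = (\<lambda>x\<in>carrier N. 0)" "f \<oplus>\<^bsub>N_dual\<^esub> g = (\<lambda>x\<in>carrier N. f x + g x)"
    "c \<odot>\<^bsub>N_dual\<^esub> f = (\<lambda>x\<in>carrier N. c * f x)"
  by (simp_all add: N_dual_def)

lemma vspace_N_dual: "vspace N_dual"
proof -
  have "vspace (map_space N base_field (carrier N_dual))"
  proof (rule vspace_map_space[OF vspace_base])
    show "carrier N_dual \<subseteq> carrier N \<rightarrow>\<^sub>E carrier base_field"
      by (auto simp: N_dual_iff lin_maps_def)
    show "(\<lambda>x\<in>carrier N. \<zero>\<^bsub>base_field\<^esub>) \<in> carrier N_dual"
      unfolding N_dual_iff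
      by (intro conjI lin_maps_subspace vspace_env vspace_base exI[of _ "{}"])
         (auto simp: vanish_off_def hw_closed)
    fix f assume f: "f \<in> carrier N_dual"
    then obtain F where F: "finite F" "F \<subseteq> Gam S" "vanish_off f 0 F"
      by (auto simp: N_dual_iff)
    show "(\<lambda>x\<in>carrier N. c \<odot>\<^bsub>base_field\<^esub> f x) \<in> carrier N_dual" for c
      unfolding N_dual_iff
      by (intro conjI lin_maps_subspace vspace_env vspace_base exI[of _ F] N_dual_lin f F)
         (use F(3) in \<open>auto simp: vanish_off_def hw_closed\<close>)
    fix g assume g: "g \<in> carrier N_dual"
    then obtain F' where F': "finite F'" "F' \<subseteq> Gam S" "vanish_off g 0 F'"
      by (auto simp: N_dual_iff)
    show "(\<lambda>x\<in>carrier N. f x \<oplus>\<^bsub>base_field\<^esub> g x) \<in> carrier N_dual"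
      unfolding N_dual_iff
      by (intro conjI lin_maps_subspace vspace_env vspace_base exI[of _ "F \<union> F'"] N_dual_lin f g finite_UnI Un_least F F')
         (use F(3) F'(3) in \<open>auto simp: vanish_off_def hw_closed\<close>)
  qed
  thus ?thesis
    by (simp add: N_dual_def)
qed

lemma N_dualI:
  assumes k: "\<And>p q. p \<in> FA k_lt \<Longrightarrow> q \<in> FA k_lt \<Longrightarrow> k (p + q) = k p + k q"
    "\<And>c p. p \<in> FA k_lt \<Longrightarrow> k (fscale c p) = c * k p" "\<And>r. r \<in> env_ideal k_lt \<Longrightarrow> k r = 0"
    and F: "finite F" "F \<subseteq> Gam S" "\<And>c w. c \<notin> F \<Longrightarrow> hw k_lt c w \<Longrightarrow> k (bas w) = 0"
  shows "quot_map (FA k_lt) (env_ideal k_lt) k \<in> carrier N_dual"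
    and "p \<in> FA k_lt \<Longrightarrow> quot_map (FA k_lt) (env_ideal k_lt) k (cl k_lt p) = k p"
    and "vanish_off (quot_map (FA k_lt) (env_ideal k_lt) k) 0 F"
proof -
  note q = quot_lift[OF is_quot_env[of k_lt] vspace_base, of k, unfolded base_field_simps, OF UNIV_I k(1,2,3)]
  show v: "p \<in> FA k_lt \<Longrightarrow> quot_map (FA k_lt) (env_ideal k_lt) k (cl k_lt p) = k p" for p
    by (rule q(2))
  show "vanish_off (quot_map (FA k_lt) (env_ideal k_lt) k) 0 F"
    unfolding vanish_off_def
  proof (intro allI impI)
    fix c w assume c: "c \<notin> F" "hw k_lt c w"
    thus "quot_map (FA k_lt) (env_ideal k_lt) k (cl k_lt (bas w)) = 0"
      using v[of "bas w"] hw_lists[OF c(2)] F(3)[OF c] by (simp add: bas_free_on)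
  qed
  thus "quot_map (FA k_lt) (env_ideal k_lt) k \<in> carrier N_dual"
    unfolding N_dual_iff using q(1) F by auto
qed

lemma N_dual_eqI:
  "f \<in> carrier N_dual \<Longrightarrow> g \<in> carrier N_dual \<Longrightarrow> (\<And>p. p \<in> FA k_lt \<Longrightarrow> f (cl k_lt p) = g (cl k_lt p)) \<Longrightarrow> f = g"
  by (rule N_eqI[OF N_dual_lin N_dual_lin vspace_base]) (auto simp: hw_FA)

lemmas N_dual_fun = N_lin[OF N_dual_lin vspace_base, unfolded base_field_simps]

lemma dual_right_cl:
  "n \<in> FA k_lt \<Longrightarrow> p \<in> FA k_lt \<Longrightarrow> dual_right f (cl k_lt n) (cl k_lt p) = f (cl k_lt (n * p))"
  by (simp add: dual_right_def env_closed env_mult[OF sub_N])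

lemma dual_right_lin:
  assumes f: "f \<in> carrier N_dual" and n: "n \<in> carrier N"
  shows "dual_right f n \<in> lin_maps N base_field"
  unfolding dual_right_def
  using n by (intro restrict_linI[OF vspace_env])
   (auto simp: lin_add[OF N_dual_lin[OF f]] lin_smult[OF N_dual_lin[OF f]]
     env_mult_closed[OF sub_N] bilin_add_right[OF bilin_env_mult[OF sub_N]]
     bilin_smult_right[OF bilin_env_mult[OF sub_N]])

text \<open>(f x)(w) = f(x w), and x w has degree d + c for w of degree c, so the support moves by
  -d.\<close>

lemma dual_right_homogeneous:
  assumes f: "f \<in> carrier N_dual" "vanish_off f 0 F" and x: "x \<in> k_lt" "x \<in> gr d" "d \<in> Gam S"
  shows "vanish_off (dual_right f (env_in k_lt x)) 0 ((\<lambda>c. c - d) ` F)"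
  unfolding vanish_off_def
proof (intro allI impI)
  fix c w assume c: "c \<notin> (\<lambda>c. c - d) ` F" and w: "hw k_lt c w"
  have "d + c \<notin> F"
  proof
    assume "d + c \<in> F"
    hence "(d + c) - d \<in> (\<lambda>c. c - d) ` F"
      by (rule imageI)
    thus False
      using c by simp
  qed
  thus "dual_right f (env_in k_lt x) (cl k_lt (bas w)) = 0"
    using vanish_offD[OF f(2) _ hw_Cons[OF x w]] hw_lists[OF w] x(1)
    by (simp add: env_in_def dual_right_cl bas_free_on bas_mult)
qed

lemma dual_right_add_elt:
  assumes f: "f \<in> carrier N_dual" and n: "n \<in> carrier N" "m \<in> carrier N"
  shows "dual_right f (n \<oplus>\<^bsub>N\<^esub> m) = dual_right f n \<oplus>\<^bsub>N_dual\<^esub> dual_right f m"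
  unfolding dual_right_def N_dual_simps
  by (rule restrict_ext)
     (use n in \<open>simp add: bilin_add_left[OF bilin_env_mult[OF sub_N]] lin_add[OF N_dual_lin[OF f]]
        env_mult_closed[OF sub_N]\<close>)

lemma dual_right_smult_elt:
  assumes f: "f \<in> carrier N_dual" and n: "n \<in> carrier N"
  shows "dual_right f (c \<odot>\<^bsub>N\<^esub> n) = c \<odot>\<^bsub>N_dual\<^esub> dual_right f n"
  unfolding dual_right_def N_dual_simps
  by (rule restrict_ext)
     (use n in \<open>simp add: bilin_smult_left[OF bilin_env_mult[OF sub_N]] lin_smult[OF N_dual_lin[OF f]]
        env_mult_closed[OF sub_N]\<close>)

lemma dual_right_mult:
  assumes n: "n \<in> carrier N" "m \<in> carrier N"
  shows "dual_right f (n \<otimes>\<^bsub>N\<^esub> m) = dual_right (dual_right f n) m"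
  unfolding dual_right_def
  by (rule restrict_ext) (use n in \<open>simp add: env_mult_assoc[OF sub_N] env_mult_closed[OF sub_N]\<close>)

lemma dual_right_one:
  assumes "f \<in> carrier N_dual"
  shows "dual_right f \<one>\<^bsub>N\<^esub> = f"
  using lin_maps_ext[OF N_dual_lin[OF assms]]
  by (auto simp: dual_right_def env_one_left[OF sub_N] intro!: extensionalityI[of _ "carrier N"])

lemma dual_right_zero: "f \<in> carrier N_dual \<Longrightarrow> dual_right f \<zero>\<^bsub>N\<^esub> = \<zero>\<^bsub>N_dual\<^esub>"
proof -
  assume f: "f \<in> carrier N_dual"
  have "dual_right f (0 \<odot>\<^bsub>N\<^esub> \<zero>\<^bsub>N\<^esub>) = 0 \<odot>\<^bsub>N_dual\<^esub> dual_right f \<zero>\<^bsub>N\<^esub>"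
    by (rule dual_right_smult_elt[OF f env_zero_closed])
  thus ?thesis
    by (simp add: vspace_zero_smult[OF vspace_env] env_zero_closed N_dual_simps)
qed

lemma dual_right_in_closed:
  assumes f: "f \<in> carrier N_dual" and x: "x \<in> k_lt"
  shows "dual_right f (env_in k_lt x) \<in> carrier N_dual"
  using x
proof (induction rule: k_lt_induct)
  case (homogeneous d x)
  obtain F where F: "finite F" "F \<subseteq> Gam S" "vanish_off f 0 F"
    using f by (auto simp: N_dual_iff)
  show ?case
    unfolding N_dual_iff
    using dual_right_lin[OF f env_in_closed[OF homogeneous(3)]] dual_right_homogeneous[OF f F(3) homogeneous(3,2,1)] F homogeneous(1)
    by (intro conjI exI[of _ "(\<lambda>c. c - d) ` F"]) (auto intro: Gam_closed)
next
  case (add y z)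
  thus ?case
    using f by (simp add: env_in_add dual_right_add_elt env_in_closed vspace_add_closed[OF vspace_N_dual])
qed

lemma dual_right_closed:
  assumes "f \<in> carrier N_dual" and n: "n \<in> carrier N"
  shows "dual_right f n \<in> carrier N_dual"
proof -
  have "\<forall>f\<in>carrier N_dual. dual_right f n \<in> carrier N_dual"
    using n sub_N
    by (induction rule: env_induct)
       (auto simp: dual_right_zero vspace_zero_closed[OF vspace_N_dual] dual_right_one dual_right_mult env_in_closed
          dual_right_in_closed dual_right_add_elt dual_right_smult_elt vspace_add_closed[OF vspace_N_dual]
          vspace_smult_closed[OF vspace_N_dual])
  thus ?thesis
    using assms(1) by blast
qed

lemma dual_right_add: "n \<in> carrier N \<Longrightarrow> dual_right (f \<oplus>\<^bsub>N_dual\<^esub> g) n = dual_right f n \<oplus>\<^bsub>N_dual\<^esub> dual_right g n"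
  and dual_right_smult: "n \<in> carrier N \<Longrightarrow> dual_right (c \<odot>\<^bsub>N_dual\<^esub> f) n = c \<odot>\<^bsub>N_dual\<^esub> dual_right f n"
  by (auto simp: dual_right_def N_dual_simps env_mult_closed[OF sub_N] intro!: restrict_ext)

text \<open>Consequence of \<open>straighten\<close>: U is spanned by products of an element of
  \<open>env a\<close> and one of \<open>env b\<close>. The order N before B serves the tensor
  product over N, the order B before N serves B-linear maps.\<close>

lemma U_induct:
  assumes ab: "\<And>d. d \<in> Gam S \<Longrightarrow> gr d \<subseteq> a \<or> gr d \<subseteq> b" and X: "X \<in> carrier U"
    and add: "\<And>X Y. \<lbrakk>X \<in> carrier U; Y \<in> carrier U; Q X; Q Y\<rbrakk> \<Longrightarrow> Q (X \<oplus>\<^bsub>U\<^esub> Y)"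
    and smult: "\<And>c X. X \<in> carrier U \<Longrightarrow> Q X \<Longrightarrow> Q (c \<odot>\<^bsub>U\<^esub> X)"
    and mult: "\<And>m n. m \<in> carrier (env a) \<Longrightarrow> n \<in> carrier (env b) \<Longrightarrow> Q (env_incl m \<cdot> env_incl n)"
  shows "Q X"
proof -
  obtain p where p: "X = cl UNIV p"
    using X by (auto elim: env_cases)
  have c: "cl UNIV q \<in> carrier U" for q
    by (rule env_closed) simp
  have sub: "fs.subspace {p. Q (cl UNIV p)}"
  proof (rule fs.subspaceI)
    have "Q (cl UNIV 1)"
      using mult[OF env_one_closed env_one_closed]
      by (simp add: env_incl_one env_one_left[OF sub_U] env_one_closed) (simp add: env_one)
    thus "0 \<in> {p. Q (cl UNIV p)}"
      using smult[OF c, of 1 0] by (simp add: env_smult)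
    show "x + y \<in> {p. Q (cl UNIV p)}" if "x \<in> {p. Q (cl UNIV p)}" "y \<in> {p. Q (cl UNIV p)}" for x y
      using add[OF c c, of x y] that by (simp add: env_add)
    show "fscale k x \<in> {p. Q (cl UNIV p)}" if "x \<in> {p. Q (cl UNIV p)}" for k x
      using smult[OF c, of x k] that by (simp add: env_smult)
  qed
  have "supp_sub (\<lambda>_. True) = UNIV"
    by (auto simp: supp_sub_def)
  hence "p \<in> fspan ({bas w | w d. hw UNIV d w} \<union> env_ideal UNIV)"
    using FA_homogeneous[of "\<lambda>_. True" p] sub_U by simp
  moreover have "fspan ({bas w | w d. hw UNIV d w} \<union> env_ideal UNIV) \<subseteq> {p. Q (cl UNIV p)}"
  proof (rule fs.span_minimal[OF _ sub])
    have I: "r \<in> {p. Q (cl UNIV p)}" if "r \<in> env_ideal UNIV" for r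
      using fs.subspace_0[OF sub] that cl_eq_iff[of r UNIV 0] by simp
    have "bas w \<in> {p. Q (cl UNIV p)}" if w: "hw UNIV d w" for w d
    proof -
      have "fspan ({bas u * bas v | u v d1 d2. hw a d1 u \<and> hw b d2 v \<and> d1 + d2 = d} \<union> env_ideal UNIV) \<subseteq> {p. Q (cl UNIV p)}"
      proof (rule fs.span_minimal[OF _ sub], rule Un_least)
        show "{bas u * bas v | u v d1 d2. hw a d1 u \<and> hw b d2 v \<and> d1 + d2 = d} \<subseteq> {p. Q (cl UNIV p)}"
        proof clarify
          fix u v d1 d2 assume "hw a d1 u" "hw b d2 v"
          hence "cl a (bas u) \<in> carrier (env a)" "cl b (bas v) \<in> carrier (env b)"
            by (simp_all add: env_closed bas_free_on hw_lists)
          from mult[OF this] show "Q (cl UNIV (bas u * bas v))"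
            by (simp add: env_incl_cl env_mult sub_U)
        qed
      qed (use I in blast)
      thus ?thesis
        using straighten[OF ab w] by blast
    qed
    thus "{bas w | w d. hw UNIV d w} \<union> env_ideal UNIV \<subseteq> {p. Q (cl UNIV p)}"
      using I by blast
  qed
  ultimately show ?thesis
    unfolding p by blast
qed

end

section \<open>The right action\<close>

context triangular_lie_algebra
begin

lemmas vspace_NB = vspace_tensor[of N_dual B "{}"]
lemmas NB_add_closed = vspace_add_closed[OF vspace_NB]
lemmas NB_smult_closed = vspace_smult_closed[OF vspace_NB]
lemmas NB_zero_closed = vspace_zero_closed[OF vspace_NB]
lemmas vspace_NU = vspace_tensor[of N_dual U bal_NU]

lemma gr_lt_ge: "d \<in> Gam S \<Longrightarrow> gr d \<subseteq> k_lt \<or> gr d \<subseteq> k_ge" "d \<in> Gam S \<Longrightarrow> gr d \<subseteq> k_ge \<or> gr d \<subseteq> k_lt"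
  using gr_k by blast+

lemma NU_bal:
  assumes "f \<in> carrier N_dual" "n \<in> carrier N" "u \<in> carrier U"
  shows "NU_tens (dual_right f n) u = NU_tens f (env_incl n \<cdot> u)"
  unfolding tens_def
  by (rule tens_rel) (use assms in \<open>unfold bal_NU_def balanced_rels_def, blast\<close>)

lemma U_mult_closed: "u \<in> carrier U \<Longrightarrow> v \<in> carrier U \<Longrightarrow> u \<cdot> v \<in> carrier U"
  by (rule env_mult_closed[OF sub_U])

lemma NU_right:
  assumes v: "v \<in> carrier U"
  shows "NU_right v \<in> lin_maps NU NU"
    and "\<And>f u. f \<in> carrier N_dual \<Longrightarrow> u \<in> carrier U \<Longrightarrow> NU_right v (NU_tens f u) = NU_tens f (u \<cdot> v)"
proof -
  let ?\<beta> = "\<lambda>f u. NU_tens f (u \<cdot> v)"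
  have b: "bilin N_dual U NU ?\<beta>"
    by (rule bilinI)
       (simp_all add: v U_mult_closed bilin_add_left[OF bilin_env_mult[OF sub_U]] bilin_smult_left[OF bilin_env_mult[OF sub_U]]
         bilinD[OF bilin_tens])
  have e: "\<exists>f u f' u'. f \<in> carrier N_dual \<and> f' \<in> carrier N_dual \<and> u \<in> carrier U \<and> u' \<in> carrier U \<and>
      e = bas (f, u) - bas (f', u') \<and> ?\<beta> f u = ?\<beta> f' u'" if e: "e \<in> bal_NU" for e
  proof -
    obtain f n u where "f \<in> carrier N_dual" "n \<in> carrier N" "u \<in> carrier U"
      "e = bas (dual_right f n, u) - bas (f, env_incl n \<cdot> u)"
      using e unfolding bal_NU_def balanced_rels_def by blast
    thus ?thesis
      using v by (intro exI[of _ "dual_right f n"] exI[of _ u] exI[of _ f] exI[of _ "env_incl n \<cdot> u"])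
        (simp add: dual_right_closed U_mult_closed incl_closed NU_bal env_mult_assoc[OF sub_U])
  qed
  note * = tensor_THE[OF vspace_N_dual vspace_env vspace_NU b e, OF _ NU_right_def]
  show "NU_right v \<in> lin_maps NU NU"
    and "\<And>f u. f \<in> carrier N_dual \<Longrightarrow> u \<in> carrier U \<Longrightarrow> NU_right v (NU_tens f u) = NU_tens f (u \<cdot> v)"
    using * by blast+
qed

lemma psi: "psi \<in> lin_maps NB NU"
    "\<And>f b. f \<in> carrier N_dual \<Longrightarrow> b \<in> carrier B \<Longrightarrow> psi (NB_tens f b) = NU_tens f (env_incl b)"
proof -
  have b: "bilin N_dual B NU (\<lambda>f b. NU_tens f (env_incl b))"
    by (rule bilinI) (simp_all add: incl_closed env_incl_add env_incl_smult bilinD[OF bilin_tens])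
  note * = tensor_THE[OF vspace_N_dual vspace_env vspace_NU b _ psi_def]
  show "psi \<in> lin_maps NB NU"
    "\<And>f b. f \<in> carrier N_dual \<Longrightarrow> b \<in> carrier B \<Longrightarrow> psi (NB_tens f b) = NU_tens f (env_incl b)"
    using * by blast+
qed

text \<open>Precomposing with the right action of N on \<open>N_dual\<close> gives a left action on
  Hom(\<open>N_dual\<close>, \<open>NB\<close>). This is the module from which the inverse of
  \<open>psi\<close> is coinduced.\<close>

lemma hom_NB_lie_rep:
  "lie_rep k_lt (map_space N_dual NB (lin_maps N_dual NB)) (\<lambda>y. \<lambda>E\<in>lin_maps N_dual NB. \<lambda>f\<in>carrier N_dual. E (dual_right f (env_in k_lt y)))"
  (is "lie_rep _ ?W ?T")
proof (rule lie_repI)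
  note in_c [simp] = env_in_closed[of _ k_lt] dual_right_closed
  note vs [simp] = vspace_add_closed[OF vspace_N_dual] vspace_smult_closed[OF vspace_N_dual]
  have Tc: "(\<lambda>f\<in>carrier N_dual. E (dual_right f (env_in k_lt y))) \<in> lin_maps N_dual NB"
    if "y \<in> k_lt" "E \<in> lin_maps N_dual NB" for y E
    by (rule restrict_linI[OF vspace_N_dual])
       (use that in \<open>simp_all add: lin_mapsD[OF that(2)] dual_right_add dual_right_smult\<close>)
  have W: "vspace ?W"
    by (rule vspace_lin_maps[OF vspace_N_dual vspace_NB])
  have sub: "(\<lambda>x\<in>carrier N_dual. E x \<oplus>\<^bsub>NB\<^esub> E' x) \<in> lin_maps N_dual NB" "(\<lambda>x\<in>carrier N_dual. c \<odot>\<^bsub>NB\<^esub> E x) \<in> lin_maps N_dual NB"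
    if "E \<in> lin_maps N_dual NB" "E' \<in> lin_maps N_dual NB" for E E' c
    using lin_maps_subspace[OF vspace_N_dual vspace_NB] that by blast+
  show "?T y \<in> lin_maps ?W ?W" if "y \<in> k_lt" for y
    by (rule lin_mapsI) (auto simp: Tc sub that intro!: restrict_ext)
  show "?T (x + y) E = ?T x E \<oplus>\<^bsub>?W\<^esub> ?T y E" if "x \<in> k_lt" "y \<in> k_lt" "E \<in> carrier ?W" for x y E
    using that by (auto simp: env_in_add dual_right_add_elt lin_add[of E] intro!: restrict_ext)
  show "?T (scale c x) E = c \<odot>\<^bsub>?W\<^esub> ?T x E" if "x \<in> k_lt" "E \<in> carrier ?W" for c x E
    using that by (auto simp: env_in_scale dual_right_smult_elt lin_smult[of E] intro!: restrict_ext)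
  show "?T x (?T y E) = ?T y (?T x E) \<oplus>\<^bsub>?W\<^esub> ?T (bracket x y) E" if xy: "x \<in> k_lt" "y \<in> k_lt" "E \<in> carrier ?W" for x y E
  proof -
    have br: "bracket x y \<in> k_lt"
      using sub_N xy by (simp add: lie_subalgebra_def)
    have "dual_right (dual_right f (env_in k_lt x)) (env_in k_lt y) =
        dual_right (dual_right f (env_in k_lt y)) (env_in k_lt x) \<oplus>\<^bsub>N_dual\<^esub> dual_right f (env_in k_lt (bracket x y))"
      if f: "f \<in> carrier N_dual" for f
      using xy br f
      by (simp add: env_in_bracket[OF sub_N xy(1,2)] dual_right_add_elt env_mult_closed[OF sub_N] flip: dual_right_mult)
    thus ?thesis
      using xy br by (auto simp: Tc lin_add[of E] intro!: restrict_ext)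
  qed
qed

text \<open>Coinduction with exchanged roles: the map b -> (f -> f \<otimes> b) on B extends to U
  linearly over \<open>k_lt\<close>, and this linearity is the balancing relation over N. The result
  is the inverse of \<open>psi\<close> on pure tensors.\<close>

lemma induced_map:
  "\<exists>h. bilin N_dual U NB h \<and> (\<forall>f\<in>carrier N_dual. \<forall>b\<in>carrier B. h f (env_incl b) = NB_tens f b) \<and>
     (\<forall>f\<in>carrier N_dual. \<forall>n\<in>carrier N. \<forall>u\<in>carrier U. h f (env_incl n \<cdot> u) = h (dual_right f n) u)"
proof -
  let ?W = "map_space N_dual NB (lin_maps N_dual NB)"
  let ?T = "\<lambda>y. \<lambda>E\<in>lin_maps N_dual NB. \<lambda>f\<in>carrier N_dual. E (dual_right f (env_in k_lt y))"
  let ?g = "\<lambda>b\<in>carrier B. \<lambda>f\<in>carrier N_dual. NB_tens f b"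
  have W: "vspace ?W"
    by (rule vspace_lin_maps[OF vspace_N_dual vspace_NB])
  note t = bilinD[OF bilin_tens[of N_dual B "{}"]]
  have gl: "(\<lambda>f\<in>carrier N_dual. NB_tens f b) \<in> lin_maps N_dual NB" if "b \<in> carrier B" for b
    by (rule restrict_linI[OF vspace_N_dual]) (simp_all add: t that)
  have g: "?g \<in> lin_maps B ?W"
    by (rule restrict_linI[OF vspace_env]) (auto simp: gl t intro!: restrict_ext)
  have dj: "k_ge \<inter> k_lt \<subseteq> {0}"
    using k_disjoint by blast
  obtain h where h: "h \<in> lin_maps U ?W"
    "\<forall>y\<in>k_lt. \<forall>X\<in>carrier U. h (env_in UNIV y \<cdot> X) = ?T y (h X)"
    "\<forall>X\<in>carrier B. h (env_incl X) = ?g X"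
    using coinduction_ex[OF sub_B sub_N k_split(2) dj W hom_NB_lie_rep g] by (elim bexE conjE)
  have hX: "h X \<in> lin_maps N_dual NB" if "X \<in> carrier U" for X
    using lin_closed[OF h(1) that] by simp
  have hadd: "h (X \<oplus>\<^bsub>U\<^esub> Y) f = h X f \<oplus>\<^bsub>NB\<^esub> h Y f" "h (c \<odot>\<^bsub>U\<^esub> X) f = c \<odot>\<^bsub>NB\<^esub> h X f"
    if "X \<in> carrier U" "Y \<in> carrier U" "f \<in> carrier N_dual" for X Y f c
    using that by (simp_all add: lin_add[OF h(1)] lin_smult[OF h(1)])
  have hz: "h \<zero>\<^bsub>U\<^esub> f = \<zero>\<^bsub>NB\<^esub>" if "f \<in> carrier N_dual" for f
    using lin_zero[OF vspace_env W h(1)] that by simp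
  have "bilin N_dual U NB (\<lambda>f u. h u f)"
    by (rule bilinI) (simp_all add: hadd lin_mapsD[OF hX])
  moreover have "h (env_incl n \<cdot> u) f = h u (dual_right f n)" if f: "f \<in> carrier N_dual" and n: "n \<in> carrier N" and u: "u \<in> carrier U" for f n u
  proof -
    have "\<forall>f\<in>carrier N_dual. \<forall>u\<in>carrier U. h (env_incl n \<cdot> u) f = h u (dual_right f n)"
      using n sub_N
    proof (induction rule: env_induct)
      case zero
      have "env_incl \<zero>\<^bsub>N\<^esub> \<cdot> u = \<zero>\<^bsub>U\<^esub>" if "u \<in> carrier U" for u
        using that by (elim env_cases) (simp add: env_zero env_incl_cl env_mult[OF sub_U] del: set_zero_plus)
      thus ?case
        by (simp add: hz dual_right_zero lin_zero[OF vspace_N_dual vspace_NB hX])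
    next
      case one
      thus ?case
        by (simp add: env_incl_one env_one_left[OF sub_U] dual_right_one)
    next
      case (step x X)
      thus ?case
        by (simp add: env_incl_mult[OF sub_N] env_in_closed env_incl_in env_mult_assoc[OF sub_U] incl_closed h(2)
            U_mult_closed hX dual_right_closed dual_right_mult)
    next
      case (add X Y)
      thus ?case
        by (simp add: env_incl_add bilin_add_left[OF bilin_env_mult[OF sub_U]] incl_closed hadd U_mult_closed
            dual_right_add_elt lin_add[OF hX] dual_right_closed)
    next
      case (smult c X)
      thus ?case
        by (simp add: env_incl_smult bilin_smult_left[OF bilin_env_mult[OF sub_U]] incl_closed hadd U_mult_closed
            dual_right_smult_elt lin_smult[OF hX] dual_right_closed)
    qed
    thus ?thesis
      using f u by blast
  qed
  moreover have "h (env_incl b) f = NB_tens f b" if "f \<in> carrier N_dual" "b \<in> carrier B" for f b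
    using that by (simp add: h(3))
  ultimately show ?thesis
    by (intro exI[of _ "\<lambda>f u. h u f"]) blast
qed

lemma psi_inverse:
  "\<exists>k\<in>lin_maps NU NB. (\<forall>x\<in>carrier NB. k (psi x) = x) \<and> (\<forall>z\<in>carrier NU. psi (k z) = z)"
proof -
  obtain h where h: "bilin N_dual U NB h" "\<And>f b. f \<in> carrier N_dual \<Longrightarrow> b \<in> carrier B \<Longrightarrow> h f (env_incl b) = NB_tens f b"
    "\<And>f n u. \<lbrakk>f \<in> carrier N_dual; n \<in> carrier N; u \<in> carrier U\<rbrakk> \<Longrightarrow> h f (env_incl n \<cdot> u) = h (dual_right f n) u"
    using induced_map by blast
  have e: "\<exists>f u f' u'. f \<in> carrier N_dual \<and> f' \<in> carrier N_dual \<and> u \<in> carrier U \<and> u' \<in> carrier U \<and>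
      e = bas (f, u) - bas (f', u') \<and> h f u = h f' u'" if e: "e \<in> bal_NU" for e
  proof -
    obtain f n u where "f \<in> carrier N_dual" "n \<in> carrier N" "u \<in> carrier U"
      "e = bas (dual_right f n, u) - bas (f, env_incl n \<cdot> u)"
      using e unfolding bal_NU_def balanced_rels_def by blast
    thus ?thesis
      by (intro exI[of _ "dual_right f n"] exI[of _ u] exI[of _ f] exI[of _ "env_incl n \<cdot> u"])
        (simp add: dual_right_closed U_mult_closed incl_closed h(3))
  qed
  obtain k where k: "k \<in> lin_maps NU NB" "\<And>f u. f \<in> carrier N_dual \<Longrightarrow> u \<in> carrier U \<Longrightarrow> k (NU_tens f u) = h f u"
    using tensor_lift[OF vspace_N_dual vspace_env vspace_NB h(1), of bal_NU] e by blast
  have 1: "k (psi x) = x" if "x \<in> carrier NB" for x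
    using that vspace_N_dual vspace_env
  proof (induction rule: tensor_induct)
    case zero
    thus ?case
      by (simp add: lin_zero[OF vspace_NB vspace_NU psi(1)] lin_zero[OF vspace_NU vspace_NB k(1)])
  next
    case (tens f b)
    thus ?case
      by (simp add: psi(2) k(2) incl_closed h(2))
  next
    case (add X Y)
    thus ?case
      by (simp add: lin_add[OF psi(1)] lin_add[OF k(1)] lin_closed[OF psi(1)])
  qed
  \<comment> \<open>Only products nb in U need be tested, and there f \<otimes> nb = fn \<otimes> b
    already comes from \<open>NB\<close>.\<close>
  have ind: "psi (k (NU_tens f u)) = NU_tens f u" if f: "f \<in> carrier N_dual" and u: "u \<in> carrier U" for f u
  proof -
    note t = bilinD[OF bilin_tens[of N_dual U bal_NU] f]
    show ?thesis
      using gr_lt_ge(1) u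
    proof (rule U_induct)
      fix n b assume nb: "n \<in> carrier N" "b \<in> carrier B"
      have "NU_tens f (env_incl n \<cdot> env_incl b) = NU_tens (dual_right f n) (env_incl b)"
        using NU_bal[OF f nb(1) incl_closed[OF nb(2)]] by simp
      thus "psi (k (NU_tens f (env_incl n \<cdot> env_incl b))) = NU_tens f (env_incl n \<cdot> env_incl b)"
        using nb f by (simp add: k(2) dual_right_closed incl_closed h(2) psi(2))
    qed (simp_all add: t lin_add[OF k(1)] lin_add[OF psi(1)] lin_smult[OF k(1)] lin_smult[OF psi(1)]
        lin_closed[OF k(1)])
  qed
  have "psi (k z) = z" if "z \<in> carrier NU" for z
    using that vspace_N_dual vspace_env
  proof (induction rule: tensor_induct)
    case zero
    thus ?case
      by (simp add: lin_zero[OF vspace_NB vspace_NU psi(1)] lin_zero[OF vspace_NU vspace_NB k(1)])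
  next
    case (add X Y)
    thus ?case
      by (simp add: lin_add[OF psi(1)] lin_add[OF k(1)] lin_closed[OF k(1)])
  qed (rule ind)
  thus ?thesis
    using k(1) 1 by blast
qed

lemma psi_eq: "\<lbrakk>x \<in> carrier NB; y \<in> carrier NB; psi x = psi y\<rbrakk> \<Longrightarrow> x = y"
  using psi_inverse by metis

lemma right_act:
  assumes "v \<in> carrier U" "x \<in> carrier NB"
  shows right_act_closed: "right_act x v \<in> carrier NB"
    and psi_right_act: "psi (right_act x v) = NU_right v (psi x)"
proof -
  have z: "NU_right v (psi x) \<in> carrier NU"
    using lin_closed[OF NU_right(1)[OF assms(1)] lin_closed[OF psi(1) assms(2)]] .
  obtain k where k: "k \<in> lin_maps NU NB" "\<forall>z\<in>carrier NU. psi (k z) = z"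
    using psi_inverse by blast
  have "NU_right v (psi x) \<in> psi ` carrier NB"
    using k z lin_closed[OF k(1) z] by (metis image_eqI)
  thus "right_act x v \<in> carrier NB" "psi (right_act x v) = NU_right v (psi x)"
    unfolding right_act_def by (rule inv_into_into, rule f_inv_into_f)
qed

lemma right_act_eqI: "\<lbrakk>v \<in> carrier U; x \<in> carrier NB; y \<in> carrier NB; NU_right v (psi x) = psi y\<rbrakk> \<Longrightarrow> right_act x v = y"
  by (rule psi_eq) (simp_all add: right_act_closed psi_right_act)

lemma right_act_tens:
  "\<lbrakk>v \<in> carrier U; f \<in> carrier N_dual; b \<in> carrier B\<rbrakk> \<Longrightarrow>
     psi (right_act (NB_tens f b) v) = NU_tens f (env_incl b \<cdot> v)"
  by (simp add: psi_right_act tens_closed psi(2) NU_right(2) incl_closed)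

lemma right_act_add: "\<lbrakk>v \<in> carrier U; x \<in> carrier NB; y \<in> carrier NB\<rbrakk> \<Longrightarrow>
    right_act (x \<oplus>\<^bsub>NB\<^esub> y) v = right_act x v \<oplus>\<^bsub>NB\<^esub> right_act y v"
  and right_act_smult: "v \<in> carrier U \<Longrightarrow> x \<in> carrier NB \<Longrightarrow> right_act (c \<odot>\<^bsub>NB\<^esub> x) v = c \<odot>\<^bsub>NB\<^esub> right_act x v"
  by (rule right_act_eqI; simp add: NB_add_closed NB_smult_closed right_act_closed
      psi_right_act lin_add[OF psi(1)] lin_smult[OF psi(1)] lin_add[OF NU_right(1)]
      lin_smult[OF NU_right(1)] lin_closed[OF psi(1)])+

lemma right_act_lin: "v \<in> carrier U \<Longrightarrow> (\<lambda>x\<in>carrier NB. right_act x v) \<in> lin_maps NB NB"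
  by (rule restrict_linI[OF vspace_NB]) (simp_all add: right_act_closed right_act_add right_act_smult)

lemma right_act_add_elt:
  assumes v: "v \<in> carrier U" "w \<in> carrier U" and x: "x \<in> carrier NB"
  shows "right_act x (v \<oplus>\<^bsub>U\<^esub> w) = right_act x v \<oplus>\<^bsub>NB\<^esub> right_act x w"
    and "right_act x (c \<odot>\<^bsub>U\<^esub> v) = c \<odot>\<^bsub>NB\<^esub> right_act x v"
    and "right_act x (v \<cdot> w) = right_act (right_act x v) w"
proof -
  note cl = env_add_closed env_smult_closed U_mult_closed
  have "NU_right (v \<oplus>\<^bsub>U\<^esub> w) z = NU_right v z \<oplus>\<^bsub>NU\<^esub> NU_right w z \<and> NU_right (c \<odot>\<^bsub>U\<^esub> v) z = c \<odot>\<^bsub>NU\<^esub> NU_right v z \<and>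
      NU_right (v \<cdot> w) z = NU_right w (NU_right v z)" if "z \<in> carrier NU" for z
    using that vspace_N_dual vspace_env
  proof (induction rule: tensor_induct)
    case zero
    have z: "\<zero>\<^bsub>NU\<^esub> \<oplus>\<^bsub>NU\<^esub> \<zero>\<^bsub>NU\<^esub> = \<zero>\<^bsub>NU\<^esub>" "c \<odot>\<^bsub>NU\<^esub> \<zero>\<^bsub>NU\<^esub> = \<zero>\<^bsub>NU\<^esub>"
      by (rule emb_eqD[OF vspace_NU]; simp add: emb_add[OF vspace_NU] emb_smult[OF vspace_NU] emb_zero[OF vspace_NU]
          vspace_zero_closed[OF vspace_NU] vspace_add_closed[OF vspace_NU] vspace_smult_closed[OF vspace_NU])+
    show ?case
      by (simp add: lin_zero[OF vspace_NU vspace_NU NU_right(1)] v cl z)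
  next
    case (tens f u)
    thus ?case
      by (simp add: NU_right(2) v cl bilin_add_right[OF bilin_env_mult[OF sub_U]] bilin_smult_right[OF bilin_env_mult[OF sub_U]]
          bilin_add_right[OF bilin_tens] bilin_smult_right[OF bilin_tens] env_mult_assoc[OF sub_U])
  next
    case (add X Y)
    note n = lin_closed[OF NU_right(1)[OF v(1)] add(1)] lin_closed[OF NU_right(1)[OF v(1)] add(2)]
      lin_closed[OF NU_right(1)[OF v(2)] add(1)] lin_closed[OF NU_right(1)[OF v(2)] add(2)]
    note emb = emb_add[OF vspace_NU] emb_smult[OF vspace_NU] vspace_add_closed[OF vspace_NU] vspace_smult_closed[OF vspace_NU]
    have 1: "(NU_right v X \<oplus>\<^bsub>NU\<^esub> NU_right w X) \<oplus>\<^bsub>NU\<^esub> (NU_right v Y \<oplus>\<^bsub>NU\<^esub> NU_right w Y) =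
        (NU_right v X \<oplus>\<^bsub>NU\<^esub> NU_right v Y) \<oplus>\<^bsub>NU\<^esub> (NU_right w X \<oplus>\<^bsub>NU\<^esub> NU_right w Y)"
      by (rule emb_eqD[OF vspace_NU]) (simp_all add: emb n)
    show ?case
      using add 1 n
      by (simp add: lin_add[OF NU_right(1)] v cl vspace_smult_add[OF vspace_NU])
  qed
  hence z: "NU_right (v \<oplus>\<^bsub>U\<^esub> w) (psi x) = NU_right v (psi x) \<oplus>\<^bsub>NU\<^esub> NU_right w (psi x)"
    "NU_right (c \<odot>\<^bsub>U\<^esub> v) (psi x) = c \<odot>\<^bsub>NU\<^esub> NU_right v (psi x)"
    "NU_right (v \<cdot> w) (psi x) = NU_right w (NU_right v (psi x))"
    using lin_closed[OF psi(1) x] by blast+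
  show "right_act x (v \<oplus>\<^bsub>U\<^esub> w) = right_act x v \<oplus>\<^bsub>NB\<^esub> right_act x w"
    "right_act x (c \<odot>\<^bsub>U\<^esub> v) = c \<odot>\<^bsub>NB\<^esub> right_act x v"
    "right_act x (v \<cdot> w) = right_act (right_act x v) w"
    by (rule right_act_eqI; simp add: v x cl z right_act_closed psi_right_act NB_add_closed
        NB_smult_closed lin_add[OF psi(1)] lin_smult[OF psi(1)])+
qed

lemma right_act_B:
  assumes "f \<in> carrier N_dual" "b \<in> carrier B" "b' \<in> carrier B"
  shows "right_act (NB_tens f b) (env_incl b') = NB_tens f (b \<otimes>\<^bsub>B\<^esub> b')"
  by (rule psi_eq)
     (use assms in \<open>simp_all add: right_act_closed tens_closed incl_closed env_mult_closed[OF sub_B] right_act_tens psi(2)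
        env_incl_mult[OF sub_B]\<close>)

lemma right_act_N:
  assumes "f \<in> carrier N_dual" "n \<in> carrier N"
  shows "right_act (NB_tens f \<one>\<^bsub>B\<^esub>) (env_incl n) = NB_tens (dual_right f n) \<one>\<^bsub>B\<^esub>"
  by (rule psi_eq)
     (use assms NU_bal[OF assms env_one_closed] in \<open>simp_all add: right_act_closed tens_closed incl_closed env_one_closed
        right_act_tens psi(2) dual_right_closed env_incl_one env_one_left[OF sub_U] env_one_right[OF sub_U]\<close>)

end

section \<open>The left action\<close>

lemma left_action_zero:
  assumes "vspace A" "vspace V" "left_action A V \<rho>" "v \<in> carrier V"
  shows "\<rho> \<zero>\<^bsub>A\<^esub> v = \<zero>\<^bsub>V\<^esub>"
  using left_action_smult[OF assms(3) vspace_zero_closed[OF assms(1)] assms(4), of 0]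
    left_action_closed[OF assms(3) vspace_zero_closed[OF assms(1)] assms(4)]
  by (simp add: vspace_zero_smult assms vspace_zero_closed)

section \<open>Graded maps between graded spaces\<close>

definition subspace_family :: "('f::field, 'w) module \<Rightarrow> ('a \<Rightarrow> 'w set) \<Rightarrow> bool" where
  "subspace_family W grW \<longleftrightarrow> (\<forall>a. \<zero>\<^bsub>W\<^esub> \<in> grW a \<and> (\<forall>x\<in>grW a. \<forall>y\<in>grW a. x \<oplus>\<^bsub>W\<^esub> y \<in> grW a) \<and>
     (\<forall>c. \<forall>x\<in>grW a. c \<odot>\<^bsub>W\<^esub> x \<in> grW a))"

lemma hom_deg_subspace:
  assumes V: "vspace V" and W: "vspace W"
    and gr: "subspace_family W grW" and grV: "\<forall>a. grV a \<subseteq> carrier V"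
  shows "(\<lambda>x\<in>carrier V. \<zero>\<^bsub>W\<^esub>) \<in> hom_deg S V grV W grW a"
    and "\<And>g h. g \<in> hom_deg S V grV W grW a \<Longrightarrow> h \<in> hom_deg S V grV W grW a \<Longrightarrow>
      (\<lambda>x\<in>carrier V. g x \<oplus>\<^bsub>W\<^esub> h x) \<in> hom_deg S V grV W grW a"
    and "\<And>c h. h \<in> hom_deg S V grV W grW a \<Longrightarrow> (\<lambda>x\<in>carrier V. c \<odot>\<^bsub>W\<^esub> h x) \<in> hom_deg S V grV W grW a"
proof -
  have gV: "x \<in> carrier V" if "x \<in> grV b" for x b
    using grV that by blast
  note ls = lin_maps_subspace[OF V W]
  note gr = gr[unfolded subspace_family_def, rule_format]
  have gr: "\<zero>\<^bsub>W\<^esub> \<in> grW a" "x \<in> grW a \<Longrightarrow> y \<in> grW a \<Longrightarrow> x \<oplus>\<^bsub>W\<^esub> y \<in> grW a"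
    "x \<in> grW a \<Longrightarrow> c \<odot>\<^bsub>W\<^esub> x \<in> grW a" for a x y c
    using gr by blast+
  show "(\<lambda>x\<in>carrier V. \<zero>\<^bsub>W\<^esub>) \<in> hom_deg S V grV W grW a"
    using ls(1) gr(1) gV by (auto simp: hom_deg_def)
  fix g h c assume h: "h \<in> hom_deg S V grV W grW a"
  show "(\<lambda>x\<in>carrier V. c \<odot>\<^bsub>W\<^esub> h x) \<in> hom_deg S V grV W grW a"
    using h ls(3) gr(3) gV unfolding hom_deg_def by (auto simp: image_subset_iff)
  assume g: "g \<in> hom_deg S V grV W grW a"
  show "(\<lambda>x\<in>carrier V. g x \<oplus>\<^bsub>W\<^esub> h x) \<in> hom_deg S V grV W grW a"
    using g h ls(2) gr(2) gV unfolding hom_deg_def by (auto simp: image_subset_iff)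
qed

lemma graded_hom_lin:
  assumes V: "vspace V" and W: "vspace W" and h: "h \<in> graded_hom S V grV W grW"
  shows "h \<in> lin_maps V W"
proof -
  obtain A g where A: "finite A" "A \<subseteq> Gam S" "\<And>a. a \<in> A \<Longrightarrow> g a \<in> hom_deg S V grV W grW a"
    and h: "h = (\<lambda>x\<in>carrier V. \<Oplus>\<^bsub>W\<^esub>a\<in>A. g a x)"
    using h unfolding graded_hom_def by blast
  have l: "g a \<in> lin_maps V W" if "a \<in> A" for a
    using A(3)[OF that] by (simp add: hom_deg_def)
  have f: "(\<Oplus>\<^bsub>W\<^esub>a\<in>A. g a x) \<in> carrier W \<and> emb W (\<Oplus>\<^bsub>W\<^esub>a\<in>A. g a x) = (\<Sum>a\<in>A. emb W (g a x))" if "x \<in> carrier V" for x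
    by (rule emb_finsum[OF W A(1)]) (rule lin_closed[OF l that])
  show ?thesis
    unfolding h
  proof (rule restrict_linI[OF V])
    fix x y c assume xy: "x \<in> carrier V" "y \<in> carrier V"
    note cl = vspace_add_closed[OF V xy] vspace_smult_closed[OF V xy(1), of c]
    show "(\<Oplus>\<^bsub>W\<^esub>a\<in>A. g a (x \<oplus>\<^bsub>V\<^esub> y)) = (\<Oplus>\<^bsub>W\<^esub>a\<in>A. g a x) \<oplus>\<^bsub>W\<^esub> (\<Oplus>\<^bsub>W\<^esub>a\<in>A. g a y)"
      by (rule emb_eqD[OF W])
         (simp_all add: f xy cl vspace_add_closed[OF W] emb_add[OF W] lin_add[OF l] lin_closed[OF l] sum.distrib)
  next
    fix x y c assume xy: "x \<in> carrier V"
    note cl = vspace_smult_closed[OF V xy(1)]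
    show "(\<Oplus>\<^bsub>W\<^esub>a\<in>A. g a (c \<odot>\<^bsub>V\<^esub> x)) = c \<odot>\<^bsub>W\<^esub> (\<Oplus>\<^bsub>W\<^esub>a\<in>A. g a x)" for c
      by (rule emb_eqD[OF W])
         (simp_all add: f xy cl vspace_smult_closed[OF W] emb_smult[OF W] lin_smult[OF l] lin_closed[OF l] fs.scale_sum_right)
  qed (use f in blast)
qed

lemma hom_deg_graded_hom:
  assumes W: "vspace W" and a: "a \<in> Gam S" and h: "h \<in> hom_deg S V grV W grW a"
  shows "h \<in> graded_hom S V grV W grW"
proof -
  have l: "h \<in> lin_maps V W"
    using h by (simp add: hom_deg_def)
  have "h = (\<lambda>x\<in>carrier V. \<Oplus>\<^bsub>W\<^esub>a\<in>{a}. h x)"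
  proof (rule extensionalityI[OF lin_maps_ext[OF l]])
    fix x assume x: "x \<in> carrier V"
    have "(\<Oplus>\<^bsub>W\<^esub>a\<in>{a}. h x) \<in> carrier W \<and> emb W (\<Oplus>\<^bsub>W\<^esub>a\<in>{a}. h x) = (\<Sum>a\<in>{a}. emb W (h x))"
      by (rule emb_finsum[OF W]) (simp_all add: lin_closed[OF l x])
    thus "h x = (\<lambda>x\<in>carrier V. \<Oplus>\<^bsub>W\<^esub>a\<in>{a}. h x) x"
      using x lin_closed[OF l x] by (auto intro: emb_eqD[OF W])
  qed simp
  thus ?thesis
    unfolding graded_hom_def using a h by (intro CollectI exI[of _ "{a}"] exI[of _ "\<lambda>_. h"]) auto
qed

lemma graded_hom_subspace:
  assumes V: "vspace V" and W: "vspace W"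
    and gr: "subspace_family W grW" and grV: "\<forall>a. grV a \<subseteq> carrier V"
  shows "(\<lambda>x\<in>carrier V. \<zero>\<^bsub>W\<^esub>) \<in> graded_hom S V grV W grW"
    and "\<And>g h. g \<in> graded_hom S V grV W grW \<Longrightarrow> h \<in> graded_hom S V grV W grW \<Longrightarrow>
      (\<lambda>x\<in>carrier V. g x \<oplus>\<^bsub>W\<^esub> h x) \<in> graded_hom S V grV W grW"
    and "\<And>c h. h \<in> graded_hom S V grV W grW \<Longrightarrow> (\<lambda>x\<in>carrier V. c \<odot>\<^bsub>W\<^esub> h x) \<in> graded_hom S V grV W grW"
proof -
  note hs = hom_deg_subspace[OF V W gr grV, where S = S]
  show "(\<lambda>x\<in>carrier V. \<zero>\<^bsub>W\<^esub>) \<in> graded_hom S V grV W grW"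
    by (rule hom_deg_graded_hom[OF W Gam_closed(1) hs(1)])
  fix g h c assume "h \<in> graded_hom S V grV W grW"
  then obtain A h' where A: "finite A" "A \<subseteq> Gam S" "\<And>a. a \<in> A \<Longrightarrow> h' a \<in> hom_deg S V grV W grW a"
    and h: "h = (\<lambda>x\<in>carrier V. \<Oplus>\<^bsub>W\<^esub>a\<in>A. h' a x)"
    unfolding graded_hom_def by blast
  have l: "h' a \<in> lin_maps V W" if "a \<in> A" for a
    using A(3)[OF that] by (simp add: hom_deg_def)
  have f: "(\<Oplus>\<^bsub>W\<^esub>a\<in>A. h' a x) \<in> carrier W \<and> emb W (\<Oplus>\<^bsub>W\<^esub>a\<in>A. h' a x) = (\<Sum>a\<in>A. emb W (h' a x))" if "x \<in> carrier V" for x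
    by (rule emb_finsum[OF W A(1)]) (rule lin_closed[OF l that])
  have "(\<lambda>x\<in>carrier V. c \<odot>\<^bsub>W\<^esub> h x) = (\<lambda>x\<in>carrier V. \<Oplus>\<^bsub>W\<^esub>a\<in>A. (\<lambda>x\<in>carrier V. c \<odot>\<^bsub>W\<^esub> h' a x) x)"
  proof (rule restrict_ext)
    fix x assume x: "x \<in> carrier V"
    have "(\<Oplus>\<^bsub>W\<^esub>a\<in>A. (\<lambda>x\<in>carrier V. c \<odot>\<^bsub>W\<^esub> h' a x) x) \<in> carrier W \<and> emb W (\<Oplus>\<^bsub>W\<^esub>a\<in>A. (\<lambda>x\<in>carrier V. c \<odot>\<^bsub>W\<^esub> h' a x) x)
        = (\<Sum>a\<in>A. emb W ((\<lambda>x\<in>carrier V. c \<odot>\<^bsub>W\<^esub> h' a x) x))"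
      by (rule emb_finsum[OF W A(1)]) (use x in \<open>simp add: vspace_smult_closed[OF W] lin_closed[OF l]\<close>)
    thus "c \<odot>\<^bsub>W\<^esub> h x = (\<Oplus>\<^bsub>W\<^esub>a\<in>A. (\<lambda>x\<in>carrier V. c \<odot>\<^bsub>W\<^esub> h' a x) x)"
      using x by (intro emb_eqD[OF W])
        (simp_all add: h f vspace_smult_closed[OF W] emb_smult[OF W] lin_closed[OF l] fs.scale_sum_right)
  qed
  moreover have "(\<lambda>x\<in>carrier V. c \<odot>\<^bsub>W\<^esub> h' a x) \<in> hom_deg S V grV W grW a" if "a \<in> A" for a
    by (rule hs(3)[OF A(3)[OF that]])
  ultimately show "(\<lambda>x\<in>carrier V. c \<odot>\<^bsub>W\<^esub> h x) \<in> graded_hom S V grV W grW"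
    unfolding graded_hom_def using A(1,2)
    by (intro CollectI exI[of _ A] exI[of _ "\<lambda>a. \<lambda>x\<in>carrier V. c \<odot>\<^bsub>W\<^esub> h' a x"]) simp
  assume "g \<in> graded_hom S V grV W grW"
  then obtain C g' where C: "finite C" "C \<subseteq> Gam S" "\<And>a. a \<in> C \<Longrightarrow> g' a \<in> hom_deg S V grV W grW a"
    and g: "g = (\<lambda>x\<in>carrier V. \<Oplus>\<^bsub>W\<^esub>a\<in>C. g' a x)"
    unfolding graded_hom_def by blast
  have l': "g' a \<in> lin_maps V W" if "a \<in> C" for a
    using C(3)[OF that] by (simp add: hom_deg_def)
  have f': "(\<Oplus>\<^bsub>W\<^esub>a\<in>C. g' a x) \<in> carrier W \<and> emb W (\<Oplus>\<^bsub>W\<^esub>a\<in>C. g' a x) = (\<Sum>a\<in>C. emb W (g' a x))" if "x \<in> carrier V" for x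
    by (rule emb_finsum[OF W C(1)]) (rule lin_closed[OF l' that])
  define z where "z = (\<lambda>x\<in>carrier V. \<zero>\<^bsub>W\<^esub>)"
  \<comment> \<open>The two sums run over different finite sets of degrees; padding with the zero
    map, which belongs to every degree, puts them on the union.\<close>
  define k where "k a = (\<lambda>x\<in>carrier V. (if a \<in> C then g' a else z) x \<oplus>\<^bsub>W\<^esub> (if a \<in> A then h' a else z) x)" for a
  have k: "k a \<in> hom_deg S V grV W grW a" for a
    unfolding k_def by (rule hs(2)) (use A(3) C(3) hs(1) in \<open>auto simp: z_def\<close>)
  have "(\<lambda>x\<in>carrier V. g x \<oplus>\<^bsub>W\<^esub> h x) = (\<lambda>x\<in>carrier V. \<Oplus>\<^bsub>W\<^esub>a\<in>C \<union> A. k a x)"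
  proof (rule restrict_ext)
    fix x assume x: "x \<in> carrier V"
    have kx: "k a x \<in> carrier W" for a
      using k[of a] x by (auto simp: hom_deg_def intro: lin_closed)
    have ke: "emb W (k a x) = (if a \<in> C then emb W (g' a x) else 0) + (if a \<in> A then emb W (h' a x) else 0)" for a
      using x by (simp add: k_def z_def emb_add[OF W] emb_zero[OF W] vspace_zero_closed[OF W] lin_closed[OF l] lin_closed[OF l'])
    have "(\<Oplus>\<^bsub>W\<^esub>a\<in>C \<union> A. k a x) \<in> carrier W \<and> emb W (\<Oplus>\<^bsub>W\<^esub>a\<in>C \<union> A. k a x) = (\<Sum>a\<in>C \<union> A. emb W (k a x))"
      by (rule emb_finsum[OF W]) (use A C kx in auto)
    moreover have "(\<Sum>a\<in>C \<union> A. emb W (k a x)) = (\<Sum>a\<in>C. emb W (g' a x)) + (\<Sum>a\<in>A. emb W (h' a x))"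
    proof -
      have "(\<Sum>a\<in>C \<union> A. if a \<in> C then emb W (g' a x) else 0) = (\<Sum>a\<in>C. emb W (g' a x))"
        "(\<Sum>a\<in>C \<union> A. if a \<in> A then emb W (h' a x) else 0) = (\<Sum>a\<in>A. emb W (h' a x))"
        by (rule sum.mono_neutral_cong_right; use A C in auto)+
      thus ?thesis
        by (simp add: ke sum.distrib)
    qed
    ultimately show "g x \<oplus>\<^bsub>W\<^esub> h x = (\<Oplus>\<^bsub>W\<^esub>a\<in>C \<union> A. k a x)"
      using x by (intro emb_eqD[OF W]) (simp_all add: g h f f' vspace_add_closed[OF W] emb_add[OF W])
  qed
  thus "(\<lambda>x\<in>carrier V. g x \<oplus>\<^bsub>W\<^esub> h x) \<in> graded_hom S V grV W grW"
    unfolding graded_hom_def using A C k by (intro CollectI exI[of _ "C \<union> A"] exI[of _ k]) auto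
qed

section \<open>Tensor products of modules over an enveloping algebra\<close>

context lie_algebra
begin

lemma left_action_lie_rep:
  assumes L: "lie_subalgebra L" and \<tau>: "left_action (env L) V \<tau>"
  shows "lie_rep L V (\<lambda>x. \<tau> (env_in L x))"
proof (rule lie_repI)
  fix x y v assume xy: "x \<in> L" "y \<in> L" and v: "v \<in> carrier V"
  have br: "bracket x y \<in> L"
    using L xy by (simp add: lie_subalgebra_def)
  have "\<tau> (env_in L x \<otimes>\<^bsub>env L\<^esub> env_in L y) v = \<tau> (env_in L y \<otimes>\<^bsub>env L\<^esub> env_in L x \<oplus>\<^bsub>env L\<^esub> env_in L (bracket x y)) v"
    by (simp only: env_in_bracket[OF L xy])
  thus "\<tau> (env_in L x) (\<tau> (env_in L y) v) = \<tau> (env_in L y) (\<tau> (env_in L x) v) \<oplus>\<^bsub>V\<^esub> \<tau> (env_in L (bracket x y)) v"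
    using xy v br
    by (simp add: left_action_mult[OF \<tau>] left_action_add[OF \<tau>] env_in_closed env_mult_closed[OF L])
qed (simp_all add: left_action_lin[OF \<tau>] env_in_closed env_in_add env_in_scale left_action_add[OF \<tau>] left_action_smult[OF \<tau>])

text \<open>\<open>kgB_action\<close> is formed with the unrestricted product of B, whereas a
  \<open>left_action\<close> is extensional. The description evaluates the second action only at
  generators and carrier elements, so the restricted product may replace it.\<close>

lemma tensor_action_cong:
  assumes "\<And>x w. x \<in> L \<Longrightarrow> w \<in> carrier W \<Longrightarrow> \<sigma> (env_in L x) w = \<sigma>' (env_in L x) w"
  shows "tensor_action L V \<rho> W \<sigma> = tensor_action L V \<rho> W \<sigma>'"
  unfolding tensor_action_def by (rule arg_cong[of _ _ The], rule ext) (auto simp: assms)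

text \<open>In the commutator of two Leibniz operators the mixed terms cancel, so these operators
  form a representation of \<open>L\<close>. Uniqueness holds since pure tensors span and the
  generators determine an action.\<close>

lemma tensor_action_THE:
  assumes L: "lie_subalgebra L" and V: "vspace V" and W: "vspace W"
    and \<rho>: "left_action (env L) V \<rho>" and \<sigma>: "left_action (env L) W \<sigma>"
  shows "left_action (env L) (tensor V W {}) (tensor_action L V \<rho> W \<sigma>)"
    and "\<And>x v w. \<lbrakk>x \<in> L; v \<in> carrier V; w \<in> carrier W\<rbrakk> \<Longrightarrow> tensor_action L V \<rho> W \<sigma> (env_in L x) (tens V W {} v w) =
        tens V W {} (\<rho> (env_in L x) v) w \<oplus>\<^bsub>tensor V W {}\<^esub> tens V W {} v (\<sigma> (env_in L x) w)"
proof -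
  let ?X = "tensor V W {}" and ?t = "tens V W {}"
  have X: "vspace ?X"
    by (rule vspace_tensor)
  note R = left_action_lie_rep[OF L \<rho>] and Sg = left_action_lie_rep[OF L \<sigma>]
  note cl = lie_rep_closed[OF R] lie_rep_closed[OF Sg] vspace_add_closed[OF V] vspace_add_closed[OF W]
    vspace_smult_closed[OF V] vspace_smult_closed[OF W]
  note t = bilinD[OF bilin_tens[of V W "{}"]]
  note e = emb_add[OF X] emb_smult[OF X] vspace_add_closed[OF X] vspace_smult_closed[OF X]
  have lei: "bilin V W ?X (\<lambda>v w. ?t (\<rho> (env_in L x) v) w \<oplus>\<^bsub>?X\<^esub> ?t v (\<sigma> (env_in L x) w))" if x: "x \<in> L" for x
    by (rule bilinI; (simp add: cl t e x; fail)?; rule emb_eqD[OF X])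
       (simp_all add: cl t e x lin_add[OF lie_rep_lin[OF R]] lin_add[OF lie_rep_lin[OF Sg]]
          lin_smult[OF lie_rep_lin[OF R]] lin_smult[OF lie_rep_lin[OF Sg]] fs.scale_right_distrib)
  have "\<exists>T\<in>lin_maps ?X ?X. \<forall>v\<in>carrier V. \<forall>w\<in>carrier W. T (?t v w) = ?t (\<rho> (env_in L x) v) w \<oplus>\<^bsub>?X\<^esub> ?t v (\<sigma> (env_in L x) w)"
    if "x \<in> L" for x
    by (rule tensor_lift[OF V W X lei[OF that]]) simp
  then obtain T where T: "\<And>x. x \<in> L \<Longrightarrow> T x \<in> lin_maps ?X ?X"
    "\<And>x v w. \<lbrakk>x \<in> L; v \<in> carrier V; w \<in> carrier W\<rbrakk> \<Longrightarrow> T x (?t v w) = ?t (\<rho> (env_in L x) v) w \<oplus>\<^bsub>?X\<^esub> ?t v (\<sigma> (env_in L x) w)"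
    by metis
  have Lc: "x + y \<in> L" "scale c x \<in> L" "bracket x y \<in> L" if "x \<in> L" "y \<in> L" for x y c
    using L that by (auto simp: lie_subalgebra_def subspace_add subspace_scale)
  note Tc = lin_closed[OF T(1)]
  note lm = lin_add[OF T(1)] lin_zero[OF X X T(1)]
  have rep: "lie_rep L ?X T"
  proof (rule lie_repI)
    fix x y z assume x: "x \<in> L" and y: "y \<in> L" and z: "z \<in> carrier ?X"
    have "emb ?X (T (x + y) z) = emb ?X (T x z \<oplus>\<^bsub>?X\<^esub> T y z) \<and>
       emb ?X (T x (T y z)) = emb ?X (T y (T x z) \<oplus>\<^bsub>?X\<^esub> T (bracket x y) z)"
      using z V W
    proof (induction rule: tensor_induct)
      case zero
      thus ?case
        by (simp add: lm x y Lc e vspace_zero_closed[OF X] emb_zero[OF X])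
    next
      case (add A B)
      thus ?case
        by (simp add: lm x y Lc e Tc algebra_simps)
    next
      case (tens v w)
      have 1: "\<rho> (env_in L x) (\<rho> (env_in L y) v) = \<rho> (env_in L y) (\<rho> (env_in L x) v) \<oplus>\<^bsub>V\<^esub> \<rho> (env_in L (bracket x y)) v"
        "\<sigma> (env_in L x) (\<sigma> (env_in L y) w) = \<sigma> (env_in L y) (\<sigma> (env_in L x) w) \<oplus>\<^bsub>W\<^esub> \<sigma> (env_in L (bracket x y)) w"
        by (rule lie_rep_bracket[OF R x y tens(1)], rule lie_rep_bracket[OF Sg x y tens(2)])
      have 2: "\<rho> (env_in L (x + y)) v = \<rho> (env_in L x) v \<oplus>\<^bsub>V\<^esub> \<rho> (env_in L y) v"
        "\<sigma> (env_in L (x + y)) w = \<sigma> (env_in L x) w \<oplus>\<^bsub>W\<^esub> \<sigma> (env_in L y) w"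
        by (rule lie_rep_add[OF R x y tens(1)], rule lie_rep_add[OF Sg x y tens(2)])
      show ?case
        using tens x y Lc[OF x y] by (simp add: T(2) cl t e lm 1 2 algebra_simps)
    qed
    hence e1: "emb ?X (T (x + y) z) = emb ?X (T x z \<oplus>\<^bsub>?X\<^esub> T y z)"
      and e2: "emb ?X (T x (T y z)) = emb ?X (T y (T x z) \<oplus>\<^bsub>?X\<^esub> T (bracket x y) z)"
      by blast+
    show "T (x + y) z = T x z \<oplus>\<^bsub>?X\<^esub> T y z"
      by (rule emb_eqD[OF X e1]) (use x y z Lc[OF x y] in \<open>simp_all add: Tc e\<close>)
    show "T x (T y z) = T y (T x z) \<oplus>\<^bsub>?X\<^esub> T (bracket x y) z"
      by (rule emb_eqD[OF X e2]) (use x y z Lc[OF x y] in \<open>simp_all add: Tc e\<close>)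
  next
    fix c x z assume x: "x \<in> L" and z: "z \<in> carrier ?X"
    have "emb ?X (T (scale c x) z) = emb ?X (c \<odot>\<^bsub>?X\<^esub> T x z)"
      using z V W
    proof (induction rule: tensor_induct)
      case zero
      thus ?case
        by (simp add: lm x Lc[OF x x] e vspace_zero_closed[OF X] emb_zero[OF X])
    next
      case (add A B)
      thus ?case
        by (simp add: lm x Lc[OF x x] e Tc fs.scale_right_distrib)
    next
      case (tens v w)
      thus ?case
        using x Lc[OF x x] by (simp add: T(2) cl t e lie_rep_scale[OF R] lie_rep_scale[OF Sg] fs.scale_right_distrib)
    qed
    thus "T (scale c x) z = c \<odot>\<^bsub>?X\<^esub> T x z"
      by (rule emb_eqD[OF X]) (use x z Lc[OF x x] in \<open>simp_all add: Tc e\<close>)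
  qed (rule T(1))
  obtain \<tau> where \<tau>: "left_action (env L) ?X \<tau>" "\<And>x z. x \<in> L \<Longrightarrow> z \<in> carrier ?X \<Longrightarrow> \<tau> (env_in L x) z = T x z"
    using lie_rep_extends_ex[OF L X rep] by blast
  have \<tau>t: "\<tau> (env_in L x) (?t v w) = ?t (\<rho> (env_in L x) v) w \<oplus>\<^bsub>?X\<^esub> ?t v (\<sigma> (env_in L x) w)"
    if "x \<in> L" "v \<in> carrier V" "w \<in> carrier W" for x v w
    using that by (simp add: \<tau>(2) T(2) t)
  have "tensor_action L V \<rho> W \<sigma> = \<tau>"
    unfolding tensor_action_def
  proof (rule the_equality)
    fix \<tau>' assume *: "left_action (env L) ?X \<tau>' \<and> (\<forall>x\<in>L. \<forall>v\<in>carrier V. \<forall>w\<in>carrier W.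
        \<tau>' (env_in L x) (?t v w) = ?t (\<rho> (env_in L x) v) w \<oplus>\<^bsub>?X\<^esub> ?t v (\<sigma> (env_in L x) w))"
    have "\<tau>' (env_in L x) = \<tau> (env_in L x)" if x: "x \<in> L" for x
      by (rule tensor_lin_maps_eqI[OF V W X left_action_lin left_action_lin])
         (use * \<tau>(1) x \<tau>t in \<open>auto simp: env_in_closed\<close>)
    thus "\<tau>' = \<tau>"
      using * \<tau>(1) by (intro left_action_env_eqI[OF L X]) auto
  qed (use \<tau>(1) \<tau>t in blast)
  thus "left_action (env L) ?X (tensor_action L V \<rho> W \<sigma>)"
    "\<And>x v w. \<lbrakk>x \<in> L; v \<in> carrier V; w \<in> carrier W\<rbrakk> \<Longrightarrow> tensor_action L V \<rho> W \<sigma> (env_in L x) (?t v w) =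
        ?t (\<rho> (env_in L x) v) w \<oplus>\<^bsub>?X\<^esub> ?t v (\<sigma> (env_in L x) w)"
    using \<tau>(1) \<tau>t by simp_all
qed

end

section \<open>The module \<open>kgB\<close> and the signs of its degrees\<close>

context triangular_lie_algebra
begin

text \<open>The projection of \<open>k_ge\<close> to degree 0 is a homomorphism: with both heights
  nonnegative, d + e = 0 forces height 0 for each, and a degree of height 0 that carries a nonzero
  element is 0.\<close>

lemma component0_bracket:
  assumes "x \<in> k_ge" "y \<in> k_ge"
  shows "component 0 (bracket x y) = bracket (component 0 x) (component 0 y)"
  using assms(1)
proof (induction rule: k_ge_induct)
  case (homogeneous d x)
  note x = this
  show ?case
    using assms(2)
  proof (induction rule: k_ge_induct)
    case (homogeneous e y)
    note y = this
    have b: "bracket x y \<in> gr (d + e)" "d + e \<in> Gam S"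
      using gr_bracket[OF x(1) y(1) x(2) y(2)] x y by (auto intro: Gam_closed)
    have "x = 0 \<or> y = 0 \<or> (d + e = 0 \<longleftrightarrow> d = 0 \<and> e = 0)"
    proof (cases "x = 0 \<or> y = 0 \<or> d + e \<noteq> 0")
      case False
      have "component d x = x" "component e y = y"
        using x y by (simp_all add: component_gr)
      hence "ht d \<ge> 0" "ht e \<ge> 0"
        using x(3) y(3) False unfolding k_ge_eq supp_sub_def by auto
      moreover have "ht d + ht e = 0"
        using False by (simp flip: ht_add)
      ultimately have "ht d = 0" "ht e = 0"
        by auto
      thus ?thesis
        using ht_sum_zero gr_sign[OF x(1,2)] gr_sign[OF y(1,2)] False by blast
    qed auto
    thus ?case
      using x y b by (auto simp: component_gr)
  next
    case (add y z)
    thus ?case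
      by (simp add: bracket_add_right component_add)
  qed
next
  case (add y z)
  thus ?case
    by (simp add: bracket_add_left component_add)
qed

lemma left_action_B: "left_action B B (\<lambda>a\<in>carrier B. \<lambda>b\<in>carrier B. a \<otimes>\<^bsub>B\<^esub> b)"
  by (rule left_actionI)
     (auto simp: env_mult_closed[OF sub_B] bilinD[OF bilin_env_mult[OF sub_B]] env_mult_assoc[OF sub_B] env_one_left[OF sub_B]
       env_one_closed env_add_closed env_smult_closed intro!: restrict_linI[OF vspace_env])


lemmas vspace_kgB = vspace_tensor[of base_field B "{}"]
lemmas kgB_bilin = bilin_tens[of base_field B "{}"]

lemma kgB_tens_closed: "b \<in> carrier B \<Longrightarrow> kgB_tens c b \<in> carrier kgB"
  by (rule tens_closed) simp_all

lemma kgB_rep: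
  assumes "z \<in> carrier kgB"
  shows "\<exists>b\<in>carrier B. z = kgB_tens 1 b"
  using assms vspace_base vspace_env
proof (induction rule: tensor_induct)
  case zero
  have "\<zero>\<^bsub>kgB\<^esub> = kgB_tens 1 \<zero>\<^bsub>B\<^esub>"
    using bilin_smult_right[OF kgB_bilin, of 1 "\<zero>\<^bsub>B\<^esub>" 0] kgB_tens_closed[OF env_zero_closed, of 1]
    by (simp add: vspace_zero_smult[OF vspace_env] vspace_zero_smult[OF vspace_kgB] env_zero_closed)
  thus ?case
    using env_zero_closed by blast
next
  case (tens c b)
  have "kgB_tens c b = kgB_tens 1 (c \<odot>\<^bsub>B\<^esub> b)"
    using bilin_smult_left[OF kgB_bilin, of 1 b c] bilin_smult_right[OF kgB_bilin, of 1 b c] tens by simp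
  thus ?case
    using tens env_smult_closed by blast
next
  case (add X Y)
  then obtain b b' where "b \<in> carrier B" "b' \<in> carrier B" "X = kgB_tens 1 b" "Y = kgB_tens 1 b'"
    by blast
  thus ?case
    using bilin_add_right[OF kgB_bilin, of 1 b b'] env_add_closed by auto
qed

lemma kgB_grading_closed:
  shows "\<zero>\<^bsub>kgB\<^esub> \<in> kgB_grading a" "x \<in> kgB_grading a \<Longrightarrow> y \<in> kgB_grading a \<Longrightarrow> x \<oplus>\<^bsub>kgB\<^esub> y \<in> kgB_grading a"
    "x \<in> kgB_grading a \<Longrightarrow> c \<odot>\<^bsub>kgB\<^esub> x \<in> kgB_grading a"
proof -
  let ?R = "tensor_rels base_field B {}"
  let ?G = "fspan {bas (v, w) | v w b c. b \<in> Gam S \<and> c \<in> Gam S \<and> b + c = a \<and> v \<in> base_grading b \<and> w \<in> env_grading k_ge c}"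
  note q = is_quot_tensor[of base_field B "{}"]
  have g: "kgB_grading a = (\<lambda>p. p +o ?R) ` ?G"
    by (simp add: kgB_grading_def tensor_grading_def)
  have "0 +o ?R \<in> (\<lambda>p. p +o ?R) ` ?G"
    by (rule imageI[OF fs.span_zero])
  thus "\<zero>\<^bsub>kgB\<^esub> \<in> kgB_grading a"
    by (simp only: g quot_zero[OF q])
  show "x \<oplus>\<^bsub>kgB\<^esub> y \<in> kgB_grading a" if "x \<in> kgB_grading a" "y \<in> kgB_grading a"
  proof -
    obtain p p' where "p \<in> ?G" "p' \<in> ?G" "x = p +o ?R" "y = p' +o ?R"
      using \<open>x \<in> _\<close> \<open>y \<in> _\<close> unfolding g by (elim imageE)
    thus ?thesis
      unfolding g by (simp only: quot_add[OF q]) (rule imageI, rule fs.span_add)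
  qed
  show "c \<odot>\<^bsub>kgB\<^esub> x \<in> kgB_grading a" if "x \<in> kgB_grading a"
  proof -
    obtain p where "p \<in> ?G" "x = p +o ?R"
      using \<open>x \<in> _\<close> unfolding g by (elim imageE)
    thus ?thesis
      unfolding g by (simp only: quot_smult[OF q]) (rule imageI, rule fs.span_scale)
  qed
qed

lemma subspace_family_kgB: "subspace_family kgB kgB_grading"
  unfolding subspace_family_def by (simp add: kgB_grading_closed)

lemma env_grading_closed: "X \<in> env_grading L a \<Longrightarrow> X \<in> carrier (env L)"
proof -
  assume "X \<in> env_grading L a"
  moreover have "fspan {bas w | w. hw L a w} \<subseteq> FA L"
    by (rule fs.span_minimal[OF _ subspace_free_on]) (auto intro: hw_FA)
  ultimately show ?thesis
    unfolding env_grading_eq by (auto intro: env_closed)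
qed

lemma tens_kgB_grading:
  assumes "v \<in> base_grading b" "w \<in> env_grading k_ge c" "b \<in> Gam S" "c \<in> Gam S" "b + c = a"
  shows "kgB_tens v w \<in> kgB_grading a"
  unfolding kgB_grading_def tensor_grading_def tens_def
  by (rule imageI, rule fs.span_base) (use assms in blast)

lemma kgB_grading_induct [consumes 1, case_names zero tens add smult]:
  assumes "z \<in> kgB_grading a" "Q \<zero>\<^bsub>kgB\<^esub>"
    "\<And>v w b c. \<lbrakk>b \<in> Gam S; c \<in> Gam S; b + c = a; v \<in> base_grading b; w \<in> env_grading k_ge c\<rbrakk> \<Longrightarrow> Q (kgB_tens v w)"
    "\<And>x y. \<lbrakk>x \<in> carrier kgB; y \<in> carrier kgB; Q x; Q y\<rbrakk> \<Longrightarrow> Q (x \<oplus>\<^bsub>kgB\<^esub> y)"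
    "\<And>c x. x \<in> carrier kgB \<Longrightarrow> Q x \<Longrightarrow> Q (c \<odot>\<^bsub>kgB\<^esub> x)"
  shows "z \<in> carrier kgB \<and> Q z"
proof -
  let ?R = "tensor_rels base_field B {}"
  let ?X = "{bas (v, w) | v w b c. b \<in> Gam S \<and> c \<in> Gam S \<and> b + c = a \<and> v \<in> base_grading b \<and> w \<in> env_grading k_ge c}"
  note q = is_quot_tensor[of base_field B "{}"]
  note K = vspace_kgB
  obtain p where p: "p \<in> fspan ?X" "z = p +o ?R"
    using assms(1) unfolding kgB_grading_def tensor_grading_def by (elim imageE)
  have "fspan ?X \<subseteq> {p. p +o ?R \<in> carrier kgB \<and> Q (p +o ?R)}"
  proof (rule fs.span_minimal)
    show "fs.subspace {p. p +o ?R \<in> carrier kgB \<and> Q (p +o ?R)}"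
    proof (rule fs.subspaceI)
      show "0 \<in> {p. p +o ?R \<in> carrier kgB \<and> Q (p +o ?R)}"
        using assms(2) vspace_zero_closed[OF K] by (simp only: mem_Collect_eq quot_zero[OF q] simp_thms)
      show "x + y \<in> {p. p +o ?R \<in> carrier kgB \<and> Q (p +o ?R)}"
        if "x \<in> {p. p +o ?R \<in> carrier kgB \<and> Q (p +o ?R)}" "y \<in> {p. p +o ?R \<in> carrier kgB \<and> Q (p +o ?R)}" for x y
        using that assms(4)[of "x +o ?R" "y +o ?R"] vspace_add_closed[OF K, of "x +o ?R" "y +o ?R"]
        by (simp add: quot_add[OF q])
      show "fscale c x \<in> {p. p +o ?R \<in> carrier kgB \<and> Q (p +o ?R)}"
        if "x \<in> {p. p +o ?R \<in> carrier kgB \<and> Q (p +o ?R)}" for c x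
        using that assms(5)[of "x +o ?R" c] vspace_smult_closed[OF K, of "x +o ?R" c]
        by (simp add: quot_smult[OF q])
    qed
    show "?X \<subseteq> {p. p +o ?R \<in> carrier kgB \<and> Q (p +o ?R)}"
    proof
      fix x :: "'f \<times> ('k list \<Rightarrow>\<^sub>0 'f) set \<Rightarrow>\<^sub>0 'f" assume "x \<in> ?X"
      then obtain v w b c where *: "b \<in> Gam S" "c \<in> Gam S" "b + c = a" "v \<in> base_grading b" "w \<in> env_grading k_ge c"
        "x = bas (v, w)"
        by blast
      from assms(3)[OF *(1-5)] kgB_tens_closed[OF env_grading_closed[OF *(5)], of v]
      show "x \<in> {p. p +o ?R \<in> carrier kgB \<and> Q (p +o ?R)}"
        by (simp add: *(6) tens_def)
    qed
  qed
  thus ?thesis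
    using p by blast
qed

lemma env_grading_mult:
  assumes "lie_subalgebra L" "x \<in> L" "x \<in> gr d" "d \<in> Gam S" "w \<in> env_grading L c"
  shows "env_in L x \<otimes>\<^bsub>env L\<^esub> w \<in> env_grading L (d + c)"
proof -
  obtain p where p: "p \<in> fspan {bas w | w. hw L c w}" "w = cl L p"
    using assms(5) unfolding env_grading_eq by blast
  have "bas [x] \<in> fspan {bas [x]}"
    by (rule fs.span_base) simp
  hence "bas [x] * p \<in> fspan {bas w | w. hw L (d + c) w}"
    by (rule fspan_mult_closed[OF _ p(1)])
       (clarsimp simp: bas_mult, rule fs.span_base, use hw_Cons[OF assms(2-4)] in blast)
  moreover have "p \<in> FA L"
    using p(1) fs.span_minimal[of "{bas w | w. hw L c w}" "FA L"] subspace_free_on hw_FA by blast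
  ultimately show ?thesis
    using assms(1,2) by (simp add: p(2) env_in_def env_mult bas_free_on env_grading_eq)
qed

lemma hw_k_ge_sign:
  assumes "hw k_ge c w"
  shows "bas w \<in> env_ideal k_ge \<or> below 0 c"
  using assms
proof (induction rule: hw_induct)
  case Nil
  thus ?case
    by (simp add: below_def)
next
  case (Cons x d e w)
  show ?case
  proof (cases "x = 0 \<or> bas w \<in> env_ideal k_ge")
    case True
    have "bas [x] * bas w \<in> env_ideal k_ge"
    proof (cases "x = 0")
      case True
      thus ?thesis
        using bas_zero_ideal[of "\<lambda>a. ht a \<ge> 0" "[]" w] sub_B hw_lists[OF Cons(4)] by (simp add: k_ge_eq bas_mult)
    next
      case False
      thus ?thesis
        using True Cons(1) by (intro env_ideal_left) (auto intro: bas_free_on)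
    qed
    thus ?thesis
      by (simp add: bas_mult)
  next
    case False
    have "component d x = x"
      using Cons by (simp add: component_gr)
    hence "ht d \<ge> 0"
      using Cons(1) False unfolding k_ge_eq supp_sub_def by auto
    hence "below 0 d"
      using gr_sign[OF Cons(3,2)] ht_sum_zero[of d] False sum_nonpos[of "keys d" "lookup d"]
      by (auto simp: below_def ht_def)
    thus ?thesis
      using Cons.IH False by (auto simp: below_def lookup_add)
  qed
qed

text \<open>B lives in degrees with nonnegative coordinates, opposite to N. This is what bounds the
  support of graded B-linear maps in \<open>Hom_B_vanish\<close>.\<close>

lemma kgB_grading_sign:
  assumes "z \<in> kgB_grading a"
  shows "z = \<zero>\<^bsub>kgB\<^esub> \<or> below 0 a"
proof (rule disjCI)
  assume a: "\<not> below 0 a"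
  note K = vspace_kgB
  have zz: "\<zero>\<^bsub>kgB\<^esub> \<oplus>\<^bsub>kgB\<^esub> \<zero>\<^bsub>kgB\<^esub> = \<zero>\<^bsub>kgB\<^esub>" "c \<odot>\<^bsub>kgB\<^esub> \<zero>\<^bsub>kgB\<^esub> = \<zero>\<^bsub>kgB\<^esub>" for c
    by (rule emb_eqD[OF K]; simp add: emb_add[OF K] emb_smult[OF K] emb_zero[OF K]
        vspace_zero_closed[OF K] vspace_add_closed[OF K] vspace_smult_closed[OF K])+
  have "z \<in> carrier kgB \<and> z = \<zero>\<^bsub>kgB\<^esub>"
    using assms
  proof (induction rule: kgB_grading_induct)
    case (tens v w b c)
    have t: "b + c = a" "v \<in> base_grading b" "w \<in> env_grading k_ge c"
      using tens by blast+
    have z0: "kgB_tens 0 w = \<zero>\<^bsub>kgB\<^esub>" "kgB_tens v \<zero>\<^bsub>B\<^esub> = \<zero>\<^bsub>kgB\<^esub>"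
    proof -
      have wc: "w \<in> carrier B"
        by (rule env_grading_closed[OF t(3)])
      show "kgB_tens 0 w = \<zero>\<^bsub>kgB\<^esub>"
        using bilin_smult_left[OF kgB_bilin _ wc, of 0 0] kgB_tens_closed[OF wc, of 0] by (simp add: vspace_zero_smult[OF K])
      show "kgB_tens v \<zero>\<^bsub>B\<^esub> = \<zero>\<^bsub>kgB\<^esub>"
        using bilin_smult_right[OF kgB_bilin, of v "\<zero>\<^bsub>B\<^esub>" 0] kgB_tens_closed[OF env_zero_closed, of v]
        by (simp add: vspace_zero_smult[OF K] vspace_zero_smult[OF vspace_env] env_zero_closed)
    qed
    show ?case
    proof (cases "b = 0")
      case False
      thus ?thesis
        using t(2) z0 by (simp add: base_grading_def)
    next
      case True
      hence c: "\<not> below 0 c"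
        using a t(1) by simp
      have "fspan {bas w | w. hw k_ge c w} \<subseteq> env_ideal k_ge"
        by (rule fs.span_minimal[OF _ subspace_ideal]) (use c hw_k_ge_sign in blast)
      hence "w = \<zero>\<^bsub>B\<^esub>"
        using t(3) unfolding env_grading_eq by (auto simp: env_zero coset_zero[OF subspace_ideal])
      thus ?thesis
        using z0 by simp
    qed
  qed (simp_all add: zz)
  thus "z = \<zero>\<^bsub>kgB\<^esub>"
    by blast
qed

lemma N_finsum_decomp:
  assumes f: "f \<in> carrier N_dual"
  shows "\<exists>F g. finite F \<and> F \<subseteq> Gam S \<and> (\<forall>b\<in>F. g b \<in> carrier N_dual \<and> vanish_off (g b) 0 {b}) \<and> f = finsum N_dual g F"
proof -
  obtain F where F: "finite F" "F \<subseteq> Gam S" "vanish_off f 0 F"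
    using f by (auto simp: N_dual_iff)
  from hom_deg_dual[OF N_dual_lin[OF f]] obtain g where
    g: "\<And>b. b \<in> Gam S \<Longrightarrow> g b \<in> lin_maps N base_field"
    "\<And>b c w. b \<in> Gam S \<Longrightarrow> hw k_lt c w \<Longrightarrow> g b (cl k_lt (bas w)) = (if c = b then f (cl k_lt (bas w)) else 0)"
    unfolding hom_deg_def by (metis (no_types, lifting) mem_Collect_eq)
  have v: "vanish_off (g b) 0 {b}" if "b \<in> Gam S" for b
    using g(2)[OF that] by (simp add: vanish_off_def)
  have gN: "g b \<in> carrier N_dual" if "b \<in> Gam S" for b
    unfolding N_dual_iff using g(1)[OF that] v[OF that] that by (intro conjI exI[of _ "{b}"]) auto
  have ev: "finsum N_dual g A \<in> carrier N_dual \<and> (\<forall>X\<in>carrier N. finsum N_dual g A X = (\<Sum>b\<in>A. g b X))"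
    if "finite A" "A \<subseteq> Gam S" for A
  proof -
    interpret D: abelian_group N_dual
      by (rule vspace_abelian[OF vspace_N_dual])
    show ?thesis
      using that
    proof (induction A)
      case empty
      show ?case
        unfolding D.finsum_empty
        by (intro conjI vspace_zero_closed[OF vspace_N_dual]) (simp add: N_dual_simps)
    next
      case (insert b A)
      have e: "finsum N_dual g (insert b A) = g b \<oplus>\<^bsub>N_dual\<^esub> finsum N_dual g A"
        by (rule D.finsum_insert) (use insert gN in auto)
      show ?case
        unfolding e
        by (intro conjI vspace_add_closed[OF vspace_N_dual]) (use insert gN in \<open>simp_all add: N_dual_simps\<close>)
    qed
  qed
  have "f = finsum N_dual g F"
  proof (rule N_eqI[OF N_dual_lin[OF f] _ vspace_base])
    show "finsum N_dual g F \<in> lin_maps N base_field"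
      using ev[OF F(1,2)] N_dual_lin by blast
    fix c w assume w: "hw k_lt c w"
    have "(\<Sum>b\<in>F. g b (cl k_lt (bas w))) = (\<Sum>b\<in>F. if c = b then f (cl k_lt (bas w)) else 0)"
      by (rule sum.cong) (use g(2)[OF _ w] F(2) in auto)
    thus "f (cl k_lt (bas w)) = finsum N_dual g F (cl k_lt (bas w))"
      using ev[OF F(1,2)] F(1) vanish_offD[OF F(3) _ w] by (simp add: hw_closed[OF w])
  qed
  thus ?thesis
    using F gN v by (intro exI[of _ F] exI[of _ g]) auto
qed

end

lemma lin_maps_finsum:
  assumes V: "vspace V" and W: "vspace W" and L: "L \<in> lin_maps V W"
    and "finite J" "\<And>j. j \<in> J \<Longrightarrow> g j \<in> carrier V"
  shows "finsum V g J \<in> carrier V \<and> emb W (L (finsum V g J)) = (\<Sum>j\<in>J. emb W (L (g j)))"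
proof -
  interpret V: abelian_group V by (rule vspace_abelian[OF V])
  show ?thesis
    using assms(4,5)
  proof (induction J)
    case empty
    thus ?case
      by (simp add: lin_zero[OF V W L] emb_zero[OF W])
  next
    case (insert j J)
    hence "finsum V g (insert j J) = g j \<oplus>\<^bsub>V\<^esub> finsum V g J"
      by (intro V.finsum_insert) auto
    thus ?case
      using insert by (simp add: lin_add[OF L] emb_add[OF W] lin_closed[OF L])
  qed
qed

section \<open>Dual families and the map \<open>phi\<close>\<close>

context triangular_lie_algebra
begin

text \<open>A finite resolution of the identity of N on the degrees in \<open>F\<close>: p equals
  the sum of \<phi>_j(p) j up to words of other degrees and the ideal. The elements j index
  themselves.\<close>

definition dual_family :: "('s \<Rightarrow>\<^sub>0 int) set \<Rightarrow> ('k list \<Rightarrow>\<^sub>0 'f) set \<Rightarrow>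
    (('k list \<Rightarrow>\<^sub>0 'f) \<Rightarrow> ('k list \<Rightarrow>\<^sub>0 'f) set \<Rightarrow> 'f) \<Rightarrow> bool" where
  "dual_family F J \<phi> \<longleftrightarrow> finite J \<and> J \<subseteq> FA k_lt \<and> (\<forall>j\<in>J. \<phi> j \<in> carrier N_dual) \<and>
    (\<forall>p\<in>FA k_lt. p - (\<Sum>j\<in>J. fscale (\<phi> j (cl k_lt p)) j) \<in> fspan ({bas w | w c. c \<notin> F \<and> hw k_lt c w} \<union> env_ideal k_lt))"

lemma dual_family_ex:
  assumes "finite F" "F \<subseteq> Gam S"
  shows "\<exists>J \<phi>. dual_family F J \<phi>"
proof -
  obtain J f where J: "finite J" "J \<subseteq> FA k_lt"
    and f: "\<forall>j\<in>J. (\<forall>p\<in>FA k_lt. \<forall>q\<in>FA k_lt. f j (p + q) = f j p + f j q) \<and> (\<forall>c. \<forall>p\<in>FA k_lt. f j (fscale c p) = c * f j p) \<and>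
      (\<forall>r\<in>env_ideal k_lt. f j r = 0) \<and> (\<forall>c w. c \<notin> F \<longrightarrow> hw k_lt c w \<longrightarrow> f j (bas w) = 0)"
    and d: "\<forall>p\<in>FA k_lt. p - (\<Sum>j\<in>J. fscale (f j p) j) \<in> fspan ({bas w | w c. c \<notin> F \<and> hw k_lt c w} \<union> env_ideal k_lt)"
    using dual_basis[OF assms] by (elim exE conjE)
  define \<phi> where "\<phi> j = quot_map (FA k_lt) (env_ideal k_lt) (f j)" for j
  have \<phi>: "\<phi> j \<in> carrier N_dual" "\<And>p. p \<in> FA k_lt \<Longrightarrow> \<phi> j (cl k_lt p) = f j p" if "j \<in> J" for j
    unfolding \<phi>_def using f that by (auto intro!: N_dualI[where F = F] assms)
  have "p - (\<Sum>j\<in>J. fscale (\<phi> j (cl k_lt p)) j) \<in> fspan ({bas w | w c. c \<notin> F \<and> hw k_lt c w} \<union> env_ideal k_lt)"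
    if p: "p \<in> FA k_lt" for p
  proof -
    have "(\<Sum>j\<in>J. fscale (\<phi> j (cl k_lt p)) j) = (\<Sum>j\<in>J. fscale (f j p) j)"
      by (rule sum.cong) (simp_all add: \<phi>(2) p)
    thus ?thesis
      using d p by simp
  qed
  thus ?thesis
    unfolding dual_family_def using J \<phi> by blast
qed

text \<open>The error term of a dual family consists of words of degrees outside \<open>F\<close>
  and elements of the ideal, none of which \<open>h\<close> sees.\<close>

lemma dual_family_expand:
  assumes D: "dual_family F J \<phi>" and V: "vspace V" and h: "h \<in> lin_maps N V" "vanish_off h \<zero>\<^bsub>V\<^esub> F" and p: "p \<in> FA k_lt"
  shows "emb V (h (cl k_lt p)) = (\<Sum>j\<in>J. fscale (\<phi> j (cl k_lt p)) (emb V (h (cl k_lt j))))"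
proof -
  note l = N_lin[OF h(1) V]
  define k where "k p = emb V (h (cl k_lt p))" for p
  have k: "k (p + q) = k p + k q" "k (fscale c p) = fscale c (k p)" if "p \<in> FA k_lt" "q \<in> FA k_lt" for p q c
    using that by (simp_all add: k_def l emb_add[OF V] emb_smult[OF V])
  have kI: "k r = 0" if "r \<in> env_ideal k_lt" for r
    using that by (simp add: k_def l emb_zero[OF V])
  have ks: "(\<Sum>j\<in>A. fscale (c j) j) \<in> FA k_lt \<and> k (\<Sum>j\<in>A. fscale (c j) j) = (\<Sum>j\<in>A. fscale (c j) (k j))"
    if "finite A" "A \<subseteq> FA k_lt" for A c
    using that by (induction A) (auto simp: k free_on_closed kI[OF ideal_closed(1)])
  let ?s = "\<Sum>j\<in>J. fscale (\<phi> j (cl k_lt p)) j"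
  have s: "?s \<in> FA k_lt" "k ?s = (\<Sum>j\<in>J. fscale (\<phi> j (cl k_lt p)) (k j))"
    using ks[of J "\<lambda>j. \<phi> j (cl k_lt p)"] D by (simp_all add: dual_family_def)
  have "fspan ({bas w | w c. c \<notin> F \<and> hw k_lt c w} \<union> env_ideal k_lt) \<subseteq> {r \<in> FA k_lt. k r = 0}"
  proof (rule fs.span_minimal)
    show "fs.subspace {r \<in> FA k_lt. k r = 0}"
      by (rule fs.subspaceI) (auto simp: k free_on_closed kI[OF ideal_closed(1)])
    show "{bas w | w c. c \<notin> F \<and> hw k_lt c w} \<union> env_ideal k_lt \<subseteq> {r \<in> FA k_lt. k r = 0}"
      using env_ideal_sub[OF sub_N] kI vanish_offD[OF h(2)] emb_zero[OF V] by (auto simp: k_def hw_FA)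
  qed
  hence "k (p - ?s) = 0"
    using D p unfolding dual_family_def by blast
  moreover have "k p = k (p - ?s) + k ?s"
    using k(1)[of "p - ?s" ?s] s(1) p by (simp add: free_on_closed)
  ultimately have "k p = k ?s"
    by simp
  thus ?thesis
    using s(2) by (simp only: k_def)
qed

context
  fixes \<gamma> :: "'k \<Rightarrow> 'f"
  assumes char: "character \<gamma>"
begin

lemma kg_action: "left_action B base_field (kg_action \<gamma>)"
    "x \<in> k_ge \<Longrightarrow> kg_action \<gamma> (env_in k_ge x) c = \<gamma> (component 0 x) * c"
proof -
  have c0: "component 0 x \<in> zgr 0" for x
    using dec(2)[OF Gam_closed(1)] by (simp add: zgr_0)
  have rep: "lie_rep k_ge base_field (\<lambda>x c. \<gamma> (component 0 x) * c)"
  proof (rule lie_repI)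
    fix x y v assume xy: "x \<in> k_ge" "y \<in> k_ge"
    have "\<gamma> (component 0 (bracket x y)) = 0"
      using char c0 xy by (simp add: component0_bracket character_def)
    thus "\<gamma> (component 0 x) * (\<gamma> (component 0 y) * v) =
        \<gamma> (component 0 y) * (\<gamma> (component 0 x) * v) \<oplus>\<^bsub>base_field\<^esub> \<gamma> (component 0 (bracket x y)) * v"
      by simp
    show "\<gamma> (component 0 (x + y)) * v = \<gamma> (component 0 x) * v \<oplus>\<^bsub>base_field\<^esub> \<gamma> (component 0 y) * v"
      using char c0 by (simp add: component_add character_def distrib_right)
  next
    fix c x v
    show "\<gamma> (component 0 (scale c x)) * v = c \<odot>\<^bsub>base_field\<^esub> (\<gamma> (component 0 x) * v)"
      using char c0 by (simp add: component_scale character_def)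
    show "(\<lambda>c. \<gamma> (component 0 x) * c) \<in> lin_maps base_field base_field"
      by (rule lin_mapsI) (simp_all add: distrib_left)
  qed
  have "kg_action \<gamma> = (THE \<rho>. left_action B base_field \<rho> \<and>
     (\<forall>x\<in>k_ge. \<forall>c\<in>carrier base_field. \<rho> (env_in k_ge x) c = \<gamma> (component 0 x) * c))"
    by (simp add: kg_action_def)
  from lie_rep_THE[OF sub_B vspace_base rep this]
  show "left_action B base_field (kg_action \<gamma>)"
    "x \<in> k_ge \<Longrightarrow> kg_action \<gamma> (env_in k_ge x) c = \<gamma> (component 0 x) * c"
    by simp_all
qed

lemma kgB_action: "left_action B kgB (kgB_action \<gamma>)"
  and kgB_action_in: "x \<in> k_ge \<Longrightarrow> b \<in> carrier B \<Longrightarrow> kgB_action \<gamma> (env_in k_ge x) (kgB_tens c b) =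
     kgB_tens (\<gamma> (component 0 x) * c) b \<oplus>\<^bsub>kgB\<^esub> kgB_tens c (env_in k_ge x \<otimes>\<^bsub>B\<^esub> b)"
proof -
  let ?s = "\<lambda>a\<in>carrier B. \<lambda>b\<in>carrier B. a \<otimes>\<^bsub>B\<^esub> b"
  have e: "kgB_action \<gamma> = tensor_action k_ge base_field (kg_action \<gamma>) B ?s"
    unfolding kgB_action_def by (rule tensor_action_cong) (simp add: env_in_closed)
  note t = tensor_action_THE[OF sub_B vspace_base vspace_env kg_action(1) left_action_B, folded e]
  show "left_action B kgB (kgB_action \<gamma>)"
    by (rule t(1))
  show "x \<in> k_ge \<Longrightarrow> b \<in> carrier B \<Longrightarrow> kgB_action \<gamma> (env_in k_ge x) (kgB_tens c b) =
     kgB_tens (\<gamma> (component 0 x) * c) b \<oplus>\<^bsub>kgB\<^esub> kgB_tens c (env_in k_ge x \<otimes>\<^bsub>B\<^esub> b)"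
    using t(2)[of x c b] by (simp add: kg_action(2) env_in_closed)
qed

lemma kgB_action_zero: "b \<in> carrier B \<Longrightarrow> kgB_action \<gamma> b \<zero>\<^bsub>kgB\<^esub> = \<zero>\<^bsub>kgB\<^esub>"
  by (rule lin_zero[OF vspace_kgB vspace_kgB left_action_lin[OF kgB_action]])

lemmas kact_add = lin_add[OF left_action_lin[OF kgB_action]]
lemmas kact_smult = lin_smult[OF left_action_lin[OF kgB_action]]

lemma kgB_action_in_grading:
  assumes x: "x \<in> k_ge" "x \<in> gr d" "d \<in> Gam S" and z: "z \<in> kgB_grading c"
  shows "kgB_action \<gamma> (env_in k_ge x) z \<in> kgB_grading (d + c)"
proof -
  have "z \<in> carrier kgB \<and> kgB_action \<gamma> (env_in k_ge x) z \<in> kgB_grading (d + c)"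
    using z
  proof (induction rule: kgB_grading_induct)
    case zero
    thus ?case
      by (simp add: kgB_action_zero env_in_closed x kgB_grading_closed)
  next
    case (tens v w b e)
    hence t: "b \<in> Gam S" "e \<in> Gam S" "b + e = c" "v \<in> base_grading b" "w \<in> env_grading k_ge e"
      by blast+
    have "\<gamma> 0 = 0"
    proof -
      have "\<gamma> (scale 0 0) = 0 * \<gamma> 0"
        using char subspace_0[OF subspace_supp_sub] unfolding character_def zgr_eq by blast
      thus ?thesis
        by simp
    qed
    \<comment> \<open>For d other than 0 the component of x in degree 0 vanishes and the product is
      0; for d = 0 the degree is unchanged.\<close>
    hence v: "\<gamma> (component 0 x) * v \<in> base_grading (d + b)"
      using t(4) by (auto simp: component_gr[OF x(3,2)] base_grading_def split: if_splits)
    have "kgB_tens (\<gamma> (component 0 x) * v) w \<in> kgB_grading (d + c)"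
      using v t x by (intro tens_kgB_grading[where b = "d + b" and c = e]) (auto intro: Gam_closed simp: add.assoc)
    moreover have "kgB_tens v (env_in k_ge x \<otimes>\<^bsub>B\<^esub> w) \<in> kgB_grading (d + c)"
      using t x env_grading_mult[OF sub_B x t(5)]
      by (intro tens_kgB_grading[where b = b and c = "d + e"]) (auto intro: Gam_closed simp: ac_simps)
    ultimately show ?case
      by (simp add: kgB_action_in x env_grading_closed[OF t(5)] kgB_grading_closed)
  qed (simp_all add: kact_add kact_smult env_in_closed x kgB_grading_closed)
  thus ?thesis
    by blast
qed

lemma kgB_action_grading:
  "\<lbrakk>hw k_ge d u; z \<in> carrier kgB; z \<in> kgB_grading c\<rbrakk> \<Longrightarrow> kgB_action \<gamma> (cl k_ge (bas u)) z \<in> kgB_grading (d + c)"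
proof (induction rule: hw_induct)
  case Nil
  thus ?case
    using left_action_one[OF kgB_action, of z] by (simp add: env_one bas_Nil)
next
  case (Cons x d e w)
  have "cl k_ge (bas (x # w)) = env_in k_ge x \<otimes>\<^bsub>B\<^esub> cl k_ge (bas w)"
    using Cons(1,4) by (simp add: env_in_def env_mult[OF sub_B] bas_free_on hw_FA bas_mult)
  thus ?case
    using Cons kgB_action_in_grading[OF Cons(1-3) Cons.IH]
    by (simp add: left_action_mult[OF kgB_action] env_in_closed hw_closed add.assoc)
qed

definition B_linear :: "(('k list \<Rightarrow>\<^sub>0 'f) set \<Rightarrow> ('f \<times> ('k list \<Rightarrow>\<^sub>0 'f) set \<Rightarrow>\<^sub>0 'f) set) \<Rightarrow> bool" where
  "B_linear h \<longleftrightarrow> (\<forall>b\<in>carrier B. \<forall>u\<in>carrier U. h (env_incl b \<cdot> u) = kgB_action \<gamma> b (h u))"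

lemma B_linearD: "\<lbrakk>B_linear h; b \<in> carrier B; u \<in> carrier U\<rbrakk> \<Longrightarrow> h (env_incl b \<cdot> u) = kgB_action \<gamma> b (h u)"
  by (simp add: B_linear_def)

lemma B_linear_eqI:
  assumes h: "h \<in> lin_maps U kgB" "B_linear h" and g: "g \<in> lin_maps U kgB" "B_linear g"
    and eq: "\<And>n. n \<in> carrier N \<Longrightarrow> h (env_incl n) = g (env_incl n)"
  shows "h = g"
proof (rule extensionalityI[OF lin_maps_ext[OF h(1)] lin_maps_ext[OF g(1)]])
  fix u assume u: "u \<in> carrier U"
  show "h u = g u"
    using gr_lt_ge(2) u
    by (rule U_induct)
       (simp_all add: lin_add[OF h(1)] lin_add[OF g(1)] lin_smult[OF h(1)] lin_smult[OF g(1)]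
         B_linearD[OF h(2)] B_linearD[OF g(2)] incl_closed eq)
qed

text \<open>With \<open>B_linear_eqI\<close> this identifies B-linear maps on U with linear maps on
  N. Coinduction yields linearity for single elements of \<open>k_ge\<close>, which passes to
  products and sums.\<close>

lemma B_linear_extension:
  assumes g: "g \<in> lin_maps N kgB"
  shows "\<exists>h\<in>lin_maps U kgB. B_linear h \<and> (\<forall>n\<in>carrier N. h (env_incl n) = g n)"
proof -
  obtain h where h: "h \<in> lin_maps U kgB"
    "\<forall>y\<in>k_ge. \<forall>X\<in>carrier U. h (env_in UNIV y \<cdot> X) = kgB_action \<gamma> (env_in k_ge y) (h X)"
    "\<forall>X\<in>carrier N. h (env_incl X) = g X"
    using coinduction_ex[OF sub_N sub_B k_split(1) k_disjoint vspace_kgB left_action_lie_rep[OF sub_B kgB_action] g]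
    by (elim bexE conjE)
  have "B_linear h"
    unfolding B_linear_def
  proof (intro ballI)
    fix b u assume b: "b \<in> carrier B" and "u \<in> carrier U"
    have "\<forall>u\<in>carrier U. h (env_incl b \<cdot> u) = kgB_action \<gamma> b (h u)"
      using b sub_B
    proof (induction rule: env_induct)
      case zero
      have "env_incl \<zero>\<^bsub>B\<^esub> \<cdot> u = \<zero>\<^bsub>U\<^esub>" if "u \<in> carrier U" for u
        using that by (elim env_cases) (simp add: env_zero env_incl_cl env_mult[OF sub_U] del: set_zero_plus)
      thus ?case
        by (simp add: lin_zero[OF vspace_env vspace_kgB h(1)] left_action_zero[OF vspace_env vspace_kgB kgB_action] lin_closed[OF h(1)])
    next
      case one
      thus ?case
        by (simp add: env_incl_one env_one_left[OF sub_U] left_action_one[OF kgB_action] lin_closed[OF h(1)])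
    next
      case (step x X)
      thus ?case
        using h(2)
        by (simp add: env_incl_mult[OF sub_B] env_in_closed env_incl_in env_mult_assoc[OF sub_U] incl_closed
            U_mult_closed left_action_mult[OF kgB_action] lin_closed[OF h(1)])
    next
      case (add X Y)
      thus ?case
        by (simp add: env_incl_add bilin_add_left[OF bilin_env_mult[OF sub_U]] incl_closed U_mult_closed
            lin_add[OF h(1)] left_action_add[OF kgB_action] lin_closed[OF h(1)])
    next
      case (smult c X)
      thus ?case
        by (simp add: env_incl_smult bilin_smult_left[OF bilin_env_mult[OF sub_U]] incl_closed U_mult_closed
            lin_smult[OF h(1)] left_action_smult[OF kgB_action] lin_closed[OF h(1)])
    qed
    thus "h (env_incl b \<cdot> u) = kgB_action \<gamma> b (h u)"
      using \<open>u \<in> carrier U\<close> by blast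
  qed
  thus ?thesis
    using h by blast
qed

lemma B_linear_subspace:
  assumes h: "h \<in> lin_maps U kgB" "B_linear h" and g: "g \<in> lin_maps U kgB" "B_linear g"
  shows "B_linear (\<lambda>x\<in>carrier U. h x \<oplus>\<^bsub>kgB\<^esub> g x)" "B_linear (\<lambda>x\<in>carrier U. c \<odot>\<^bsub>kgB\<^esub> h x)" "B_linear (\<lambda>x\<in>carrier U. \<zero>\<^bsub>kgB\<^esub>)"
  unfolding B_linear_def
  by (simp_all add: U_mult_closed incl_closed B_linearD[OF h(2)] B_linearD[OF g(2)] kact_add kact_smult kgB_action_zero
      lin_closed[OF h(1)] lin_closed[OF g(1)])

lemmas graded_hom_U = graded_hom_subspace[OF vspace_env[of UNIV] vspace_kgB subspace_family_kgB, where grV = "env_grading UNIV" and S = S]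

lemma U_grading: "\<forall>a. env_grading UNIV a \<subseteq> carrier U"
  using env_grading_closed by blast

abbreviation "GH \<equiv> graded_hom S U (env_grading UNIV) kgB kgB_grading"

lemma GH_lin: "h \<in> GH \<Longrightarrow> h \<in> lin_maps U kgB"
  by (rule graded_hom_lin[OF vspace_env vspace_kgB])

lemma carrier_Hom_B: "h \<in> carrier (Hom_B \<gamma>) \<longleftrightarrow> h \<in> GH \<and> B_linear h"
  by (auto simp: Hom_B_def B_linear_def)

lemma Hom_B_simps: "h \<oplus>\<^bsub>Hom_B \<gamma>\<^esub> g = (\<lambda>x\<in>carrier U. h x \<oplus>\<^bsub>kgB\<^esub> g x)"
    "c \<odot>\<^bsub>Hom_B \<gamma>\<^esub> h = (\<lambda>x\<in>carrier U. c \<odot>\<^bsub>kgB\<^esub> h x)" "\<zero>\<^bsub>Hom_B \<gamma>\<^esub> = (\<lambda>x\<in>carrier U. \<zero>\<^bsub>kgB\<^esub>)"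
  by (simp_all add: Hom_B_def)

lemma vspace_Hom_B: "vspace (Hom_B \<gamma>)"
proof -
  have "vspace (map_space U kgB (carrier (Hom_B \<gamma>)))"
  proof (rule vspace_map_space[OF vspace_kgB])
    show "carrier (Hom_B \<gamma>) \<subseteq> carrier U \<rightarrow>\<^sub>E carrier kgB"
    proof -
      have "lin_maps U kgB \<subseteq> carrier U \<rightarrow>\<^sub>E carrier kgB"
        unfolding lin_maps_def by blast
      thus ?thesis
        using GH_lin carrier_Hom_B by blast
    qed
    obtain h where h: "h \<in> lin_maps U kgB" "B_linear h"
      using B_linear_extension lin_maps_subspace(1)[OF vspace_env vspace_kgB] by blast
    show "(\<lambda>x\<in>carrier U. \<zero>\<^bsub>kgB\<^esub>) \<in> carrier (Hom_B \<gamma>)"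
      unfolding carrier_Hom_B by (intro conjI graded_hom_U(1)[OF U_grading] B_linear_subspace(3)[OF h h])
    fix h g c assume h: "h \<in> carrier (Hom_B \<gamma>)"
    thus "(\<lambda>x\<in>carrier U. c \<odot>\<^bsub>kgB\<^esub> h x) \<in> carrier (Hom_B \<gamma>)"
      unfolding carrier_Hom_B by (intro conjI graded_hom_U(3)[OF U_grading] B_linear_subspace(2)[of h h]) (auto intro: GH_lin)
    assume g: "g \<in> carrier (Hom_B \<gamma>)"
    thus "(\<lambda>x\<in>carrier U. g x \<oplus>\<^bsub>kgB\<^esub> h x) \<in> carrier (Hom_B \<gamma>)"
      using h unfolding carrier_Hom_B by (intro conjI graded_hom_U(2)[OF U_grading] B_linear_subspace(1)) (auto intro: GH_lin)
  qed
  thus ?thesis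
    by (simp add: Hom_B_def)
qed

lemma Hom_BD:
  assumes "h \<in> carrier (Hom_B \<gamma>)"
  shows Hom_B_lin: "h \<in> lin_maps U kgB" and Hom_B_B_linear: "B_linear h"
  using assms GH_lin by (auto simp: carrier_Hom_B)

text \<open>The value of \<open>phi\<close> at f \<otimes> b, before it is known that
  \<open>phi\<close> exists. It is the unique B-linear extension of n -> f(n) \<otimes> b; that it
  is a finite sum of homogeneous maps is shown separately in \<open>phi0_GH\<close>.\<close>

definition phi0 :: "((('k list \<Rightarrow>\<^sub>0 'f) set) \<Rightarrow> 'f) \<Rightarrow> ('k list \<Rightarrow>\<^sub>0 'f) set \<Rightarrow>
    ('k list \<Rightarrow>\<^sub>0 'f) set \<Rightarrow> ('f \<times> ('k list \<Rightarrow>\<^sub>0 'f) set \<Rightarrow>\<^sub>0 'f) set" where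
  "phi0 f b = (SOME h. h \<in> lin_maps U kgB \<and> B_linear h \<and> (\<forall>n\<in>carrier N. h (env_incl n) = kgB_tens (f n) b))"

lemma phi0:
  assumes f: "f \<in> carrier N_dual" and b: "b \<in> carrier B"
  shows "phi0 f b \<in> lin_maps U kgB" "B_linear (phi0 f b)" "\<And>n. n \<in> carrier N \<Longrightarrow> phi0 f b (env_incl n) = kgB_tens (f n) b"
proof -
  have "(\<lambda>n\<in>carrier N. kgB_tens (f n) b) \<in> lin_maps N kgB"
    by (rule restrict_linI[OF vspace_env])
       (use b bilin_add_left[OF kgB_bilin] bilin_smult_left[OF kgB_bilin] in
         \<open>simp_all add: kgB_tens_closed lin_add[OF N_dual_lin[OF f]] lin_smult[OF N_dual_lin[OF f]]\<close>)
  from B_linear_extension[OF this]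
  have "\<exists>h. h \<in> lin_maps U kgB \<and> B_linear h \<and> (\<forall>n\<in>carrier N. h (env_incl n) = kgB_tens (f n) b)"
    by auto
  from someI_ex[OF this, folded phi0_def]
  show "phi0 f b \<in> lin_maps U kgB" "B_linear (phi0 f b)" "\<And>n. n \<in> carrier N \<Longrightarrow> phi0 f b (env_incl n) = kgB_tens (f n) b"
    by auto
qed

lemma phi0_unique:
  assumes f: "f \<in> carrier N_dual" and b: "b \<in> carrier B" and h: "h \<in> lin_maps U kgB" "B_linear h"
    and eq: "\<And>n. n \<in> carrier N \<Longrightarrow> h (env_incl n) = kgB_tens (f n) b"
  shows "phi0 f b = h"
  by (rule B_linear_eqI[OF phi0(1,2)[OF f b] h]) (simp add: phi0(3)[OF f b] eq)

lemma phi0_lin: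
  assumes f: "f \<in> carrier N_dual" "f' \<in> carrier N_dual" and b: "b \<in> carrier B" "b' \<in> carrier B"
  shows "phi0 (f \<oplus>\<^bsub>N_dual\<^esub> f') b = (\<lambda>x\<in>carrier U. phi0 f b x \<oplus>\<^bsub>kgB\<^esub> phi0 f' b x)"
    and "phi0 f (b \<oplus>\<^bsub>B\<^esub> b') = (\<lambda>x\<in>carrier U. phi0 f b x \<oplus>\<^bsub>kgB\<^esub> phi0 f b' x)"
    and "phi0 (c \<odot>\<^bsub>N_dual\<^esub> f) b = (\<lambda>x\<in>carrier U. c \<odot>\<^bsub>kgB\<^esub> phi0 f b x)"
    and "phi0 f (c \<odot>\<^bsub>B\<^esub> b) = (\<lambda>x\<in>carrier U. c \<odot>\<^bsub>kgB\<^esub> phi0 f b x)"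
proof -
  note cl = vspace_add_closed[OF vspace_N_dual f] vspace_add_closed[OF vspace_env b]
    vspace_smult_closed[OF vspace_N_dual f(1), of c] vspace_smult_closed[OF vspace_env b(1), of c]
  note ls = lin_maps_subspace[OF vspace_env vspace_kgB]
  note p = phi0(1,2)[OF f(1) b(1)] and p' = phi0(1,2)[OF f(2) b(1)] and p'' = phi0(1,2)[OF f(1) b(2)]
  note v = phi0(3)[OF f(1) b(1)] phi0(3)[OF f(2) b(1)] phi0(3)[OF f(1) b(2)]
  have k: "kgB_tens (x + y) b = kgB_tens x b \<oplus>\<^bsub>kgB\<^esub> kgB_tens y b" "kgB_tens (c * x) b = c \<odot>\<^bsub>kgB\<^esub> kgB_tens x b"
    "kgB_tens x (b \<oplus>\<^bsub>B\<^esub> b') = kgB_tens x b \<oplus>\<^bsub>kgB\<^esub> kgB_tens x b'" "kgB_tens x (c \<odot>\<^bsub>B\<^esub> b) = c \<odot>\<^bsub>kgB\<^esub> kgB_tens x b" for x y c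
    using bilin_add_left[OF kgB_bilin, of x b y] bilin_smult_left[OF kgB_bilin, of x b c]
      bilin_add_right[OF kgB_bilin, of x b b'] bilin_smult_right[OF kgB_bilin, of x b c] b by simp_all
  show "phi0 (f \<oplus>\<^bsub>N_dual\<^esub> f') b = (\<lambda>x\<in>carrier U. phi0 f b x \<oplus>\<^bsub>kgB\<^esub> phi0 f' b x)"
    by (rule phi0_unique[OF cl(1) b(1) ls(2)[OF p(1) p'(1)] B_linear_subspace(1)[OF p p']])
       (simp add: incl_closed v N_dual_simps k)
  show "phi0 f (b \<oplus>\<^bsub>B\<^esub> b') = (\<lambda>x\<in>carrier U. phi0 f b x \<oplus>\<^bsub>kgB\<^esub> phi0 f b' x)"
    by (rule phi0_unique[OF f(1) cl(2) ls(2)[OF p(1) p''(1)] B_linear_subspace(1)[OF p p'']])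
       (simp add: incl_closed v k)
  show "phi0 (c \<odot>\<^bsub>N_dual\<^esub> f) b = (\<lambda>x\<in>carrier U. c \<odot>\<^bsub>kgB\<^esub> phi0 f b x)"
    by (rule phi0_unique[OF cl(3) b(1) ls(3)[OF p(1)] B_linear_subspace(2)[OF p p]])
       (simp add: incl_closed v N_dual_simps k)
  show "phi0 f (c \<odot>\<^bsub>B\<^esub> b) = (\<lambda>x\<in>carrier U. c \<odot>\<^bsub>kgB\<^esub> phi0 f b x)"
    by (rule phi0_unique[OF f(1) cl(4) ls(3)[OF p(1)] B_linear_subspace(2)[OF p p]])
       (simp add: incl_closed v k)
qed

text \<open>A functional supported in degree e has degree -e and the word w has degree c, so the map
  has degree c - e. It is tested on words with the letters from \<open>k_ge\<close> in front, where
  B-linearity applies.\<close>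

lemma phi0_homogeneous:
  assumes f: "f \<in> carrier N_dual" "vanish_off f 0 {e}" "e \<in> Gam S" and w: "hw k_ge c w"
  shows "phi0 f (cl k_ge (bas w)) \<in> GH"
proof -
  let ?b = "cl k_ge (bas w)"
  have b: "?b \<in> carrier B"
    by (rule hw_closed[OF w])
  note p = phi0[OF f(1) b]
  have "phi0 f ?b ` env_grading UNIV d \<subseteq> kgB_grading (c - e + d)" for d
  proof -
    have clU: "cl UNIV q \<in> carrier U" for q
      by (rule env_closed) simp
    let ?Q = "{q. phi0 f ?b (cl UNIV q) \<in> kgB_grading (c - e + d)}"
    have sub: "fs.subspace ?Q"
    proof (rule fs.subspaceI)
      have "phi0 f ?b (cl UNIV 0) = \<zero>\<^bsub>kgB\<^esub>"
        using lin_zero[OF vspace_env vspace_kgB p(1)] unfolding env_zero .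
      thus "0 \<in> ?Q"
        by (simp only: mem_Collect_eq kgB_grading_closed)
      show "x + y \<in> ?Q" if "x \<in> ?Q" "y \<in> ?Q" for x y
        using that lin_add[OF p(1) clU clU, of x y] by (simp add: env_add kgB_grading_closed)
      show "fscale a x \<in> ?Q" if "x \<in> ?Q" for a x
        using that lin_smult[OF p(1) clU, of a x] by (simp add: env_smult kgB_grading_closed)
    qed
    have "{bas w | w. hw UNIV d w} \<subseteq> ?Q"
    proof clarify
      fix w' assume w': "hw UNIV d w'"
      have "fspan ({bas u * bas v | u v d1 d2. hw k_ge d1 u \<and> hw k_lt d2 v \<and> d1 + d2 = d} \<union> env_ideal UNIV) \<subseteq> ?Q"
      proof (rule fs.span_minimal[OF _ sub], rule Un_least)
        show "env_ideal UNIV \<subseteq> ?Q"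
        proof
          fix r assume "r \<in> env_ideal UNIV"
          hence "cl UNIV r = \<zero>\<^bsub>U\<^esub>"
            by (simp add: env_zero coset_zero[OF subspace_ideal])
          thus "r \<in> ?Q"
            using lin_zero[OF vspace_env vspace_kgB p(1)] by (simp add: kgB_grading_closed)
        qed
        show "{bas u * bas v | u v d1 d2. hw k_ge d1 u \<and> hw k_lt d2 v \<and> d1 + d2 = d} \<subseteq> ?Q"
        proof clarify
          fix u v d1 d2 assume uv: "hw k_ge d1 u" "hw k_lt d2 v" and d: "d = d1 + d2"
          have e: "cl UNIV (bas u * bas v) = env_incl (cl k_ge (bas u)) \<cdot> env_incl (cl k_lt (bas v))"
            by (simp add: env_incl_cl env_mult[OF sub_U])
          have h: "phi0 f ?b (cl UNIV (bas u * bas v)) = kgB_action \<gamma> (cl k_ge (bas u)) (kgB_tens (f (cl k_lt (bas v))) ?b)"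
            unfolding e using B_linearD[OF p(2) hw_closed[OF uv(1)] incl_closed[OF hw_closed[OF uv(2)]]]
            by (simp add: p(3)[OF hw_closed[OF uv(2)]])
          show "phi0 f ?b (cl UNIV (bas u * bas v)) \<in> kgB_grading (c - e + (d1 + d2))"
          proof (cases "d2 = e")
            case True
            have "?b \<in> env_grading k_ge c"
              unfolding env_grading_eq by (intro imageI fs.span_base) (use w in blast)
            hence "kgB_tens (f (cl k_lt (bas v))) ?b \<in> kgB_grading c"
              by (intro tens_kgB_grading[where b = 0 and c = c]) (auto simp: base_grading_def Gam_closed hw_Gam[OF w])
            hence "kgB_action \<gamma> (cl k_ge (bas u)) (kgB_tens (f (cl k_lt (bas v))) ?b) \<in> kgB_grading (d1 + c)"
              by (rule kgB_action_grading[OF uv(1) kgB_tens_closed[OF b]])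
            thus ?thesis
              unfolding h using True by (simp add: algebra_simps)
          next
            case False
            hence "f (cl k_lt (bas v)) = 0"
              using vanish_offD[OF f(2) _ uv(2)] by simp
            moreover have "kgB_tens 0 ?b = \<zero>\<^bsub>kgB\<^esub>"
              using bilin_smult_left[OF kgB_bilin _ b, of 0 0] kgB_tens_closed[OF b, of 0] by (simp add: vspace_zero_smult[OF vspace_kgB])
            ultimately show ?thesis
              unfolding h by (simp add: kgB_action_zero hw_closed[OF uv(1)] kgB_grading_closed)
          qed
        qed
      qed
      thus "phi0 f ?b (cl UNIV (bas w')) \<in> kgB_grading (c - e + d)"
        using straighten[OF gr_lt_ge(2) w'] by blast
    qed
    hence "fspan {bas w | w. hw UNIV d w} \<subseteq> ?Q"
      by (rule fs.span_minimal[OF _ sub])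
    thus ?thesis
      unfolding env_grading_eq by blast
  qed
  hence "phi0 f ?b \<in> hom_deg S U (env_grading UNIV) kgB kgB_grading (c - e)"
    using p(1) by (simp add: hom_deg_def)
  thus ?thesis
    by (rule hom_deg_graded_hom[OF vspace_kgB Gam_closed(4)[OF hw_Gam[OF w] f(3)]])
qed

text \<open>\<open>phi0\<close> is linear in both arguments, f is a finite sum of homogeneous
  functionals, and b is a combination of homogeneous words modulo the ideal.\<close>

lemma phi0_GH:
  assumes f: "f \<in> carrier N_dual" and b: "b \<in> carrier B"
  shows "phi0 f b \<in> GH"
proof -
  have 1: "phi0 f b \<in> GH" if f: "f \<in> carrier N_dual" "vanish_off f 0 {e}" "e \<in> Gam S" and b: "b \<in> carrier B" for f e b
  proof -
    obtain p where p: "p \<in> FA k_ge" "b = cl k_ge p"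
      using env_cases[OF b] by blast
    have "fspan ({bas w | w d. hw k_ge d w} \<union> env_ideal k_ge) \<subseteq> {p \<in> FA k_ge. phi0 f (cl k_ge p) \<in> GH}"
    proof (rule fs.span_minimal)
      have z: "phi0 f \<zero>\<^bsub>B\<^esub> \<in> GH"
      proof -
        have o: "cl k_ge (bas []) \<in> carrier B"
          by (rule hw_closed[OF hw_Nil])
        have "phi0 f (0 \<odot>\<^bsub>B\<^esub> cl k_ge (bas [])) \<in> GH"
          unfolding phi0_lin(4)[OF f(1) f(1) o o] by (rule graded_hom_U(3)[OF U_grading phi0_homogeneous[OF f hw_Nil]])
        thus ?thesis
          unfolding vspace_zero_smult[OF vspace_env o] .
      qed
      show "fs.subspace {p \<in> FA k_ge. phi0 f (cl k_ge p) \<in> GH}"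
      proof (rule fs.subspaceI)
        show "0 \<in> {p \<in> FA k_ge. phi0 f (cl k_ge p) \<in> GH}"
          using z unfolding env_zero by (simp only: mem_Collect_eq free_on_closed)
        show "x + y \<in> {p \<in> FA k_ge. phi0 f (cl k_ge p) \<in> GH}"
          if "x \<in> {p \<in> FA k_ge. phi0 f (cl k_ge p) \<in> GH}" "y \<in> {p \<in> FA k_ge. phi0 f (cl k_ge p) \<in> GH}" for x y
          using that phi0_lin(2)[OF f(1) f(1) env_closed env_closed, of x y] graded_hom_U(2)[OF U_grading]
          by (simp add: env_add free_on_closed)
        show "fscale c x \<in> {p \<in> FA k_ge. phi0 f (cl k_ge p) \<in> GH}"
          if "x \<in> {p \<in> FA k_ge. phi0 f (cl k_ge p) \<in> GH}" for c x
          using that phi0_lin(4)[OF f(1) f(1) env_closed env_closed, of x x c] graded_hom_U(3)[OF U_grading]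
          by (simp add: env_smult free_on_closed)
      qed
      have "r \<in> {p \<in> FA k_ge. phi0 f (cl k_ge p) \<in> GH}" if "r \<in> env_ideal k_ge" for r
      proof -
        have "cl k_ge r = \<zero>\<^bsub>B\<^esub>"
          using that by (simp add: env_zero coset_zero[OF subspace_ideal])
        thus ?thesis
          using z that env_ideal_sub[OF sub_B] by auto
      qed
      thus "{bas w | w d. hw k_ge d w} \<union> env_ideal k_ge \<subseteq> {p \<in> FA k_ge. phi0 f (cl k_ge p) \<in> GH}"
        using phi0_homogeneous[OF f] by (auto simp: hw_FA)
    qed
    moreover have "lie_subalgebra (supp_sub (\<lambda>a. 0 \<le> ht a))"
      using sub_B by (simp add: k_ge_eq)
    from FA_homogeneous[OF this] have "p \<in> fspan ({bas w | w d. hw k_ge d w} \<union> env_ideal k_ge)"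
      using p(1) by (simp add: k_ge_eq)
    ultimately show ?thesis
      using p(2) by blast
  qed
  obtain F g where F: "finite F" "F \<subseteq> Gam S" "\<forall>b\<in>F. g b \<in> carrier N_dual \<and> vanish_off (g b) 0 {b}" "f = finsum N_dual g F"
    using N_finsum_decomp[OF f] by blast
  interpret D: abelian_group N_dual
    by (rule vspace_abelian[OF vspace_N_dual])
  have "finsum N_dual g A \<in> carrier N_dual \<and> phi0 (finsum N_dual g A) b \<in> GH" if "finite A" "A \<subseteq> F" for A
    using that
  proof (induction A)
    case empty
    have z: "\<zero>\<^bsub>N_dual\<^esub> \<in> carrier N_dual"
      by (rule vspace_zero_closed[OF vspace_N_dual])
    have "phi0 (0 \<odot>\<^bsub>N_dual\<^esub> \<zero>\<^bsub>N_dual\<^esub>) b = (\<lambda>x\<in>carrier U. 0 \<odot>\<^bsub>kgB\<^esub> phi0 \<zero>\<^bsub>N_dual\<^esub> b x)"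
      by (rule phi0_lin(3)[OF z z b b])
    also have "\<dots> = (\<lambda>x\<in>carrier U. \<zero>\<^bsub>kgB\<^esub>)"
      by (rule restrict_ext) (simp add: vspace_zero_smult[OF vspace_kgB] lin_closed[OF phi0(1)[OF z b]])
    finally have "phi0 \<zero>\<^bsub>N_dual\<^esub> b = (\<lambda>x\<in>carrier U. \<zero>\<^bsub>kgB\<^esub>)"
      unfolding vspace_zero_smult[OF vspace_N_dual z] .
    thus ?case
      unfolding D.finsum_empty by (metis z graded_hom_U(1)[OF U_grading])
  next
    case (insert e A)
    have e: "finsum N_dual g (insert e A) = g e \<oplus>\<^bsub>N_dual\<^esub> finsum N_dual g A"
      by (rule D.finsum_insert) (use insert F in auto)
    have ge: "g e \<in> carrier N_dual" "vanish_off (g e) 0 {e}" "e \<in> Gam S"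
      using insert F by auto
    have fA: "finsum N_dual g A \<in> carrier N_dual" "phi0 (finsum N_dual g A) b \<in> GH"
      using insert by auto
    show ?case
      unfolding e phi0_lin(1)[OF ge(1) fA(1) b b]
      by (intro conjI vspace_add_closed[OF vspace_N_dual] ge fA graded_hom_U(2)[OF U_grading] 1[OF ge b])
  qed
  thus ?thesis
    using F by blast
qed

lemma phi0_closed: "f \<in> carrier N_dual \<Longrightarrow> b \<in> carrier B \<Longrightarrow> phi0 f b \<in> carrier (Hom_B \<gamma>)"
  by (simp add: carrier_Hom_B phi0_GH phi0(2))

text \<open>The description of \<open>phi\<close> prescribes only values at products b' n. These
  determine it, because members of \<open>Hom_B\<close> are determined by their restriction to N,
  that is by the case b' = 1.\<close>

lemma phi: "phi \<gamma> \<in> lin_maps NB (Hom_B \<gamma>)"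
    "\<And>f b. f \<in> carrier N_dual \<Longrightarrow> b \<in> carrier B \<Longrightarrow> phi \<gamma> (NB_tens f b) = phi0 f b"
proof -
  have bl: "bilin N_dual B (Hom_B \<gamma>) phi0"
    by (rule bilinI) (simp_all add: phi0_closed phi0_lin Hom_B_simps)
  obtain h where h: "h \<in> lin_maps NB (Hom_B \<gamma>)" "\<forall>f\<in>carrier N_dual. \<forall>b\<in>carrier B. h (NB_tens f b) = phi0 f b"
    using tensor_lift[OF vspace_N_dual vspace_env vspace_Hom_B bl, of "{}"] by auto
  have "phi \<gamma> = h"
    unfolding phi_def
  proof (rule the_equality)
    have "h (NB_tens f b) (env_incl b' \<cdot> env_incl n) = kgB_action \<gamma> b' (kgB_tens (f n) b)"
      if "f \<in> carrier N_dual" "b \<in> carrier B" "b' \<in> carrier B" "n \<in> carrier N" for f b b' n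
      using that h(2) B_linearD[OF phi0(2)[OF that(1,2)] that(3) incl_closed[OF that(4)]] phi0(3)[OF that(1,2,4)] by simp
    thus "h \<in> lin_maps NB (Hom_B \<gamma>) \<and> (\<forall>f\<in>carrier N_dual. \<forall>b\<in>carrier B. \<forall>b'\<in>carrier B. \<forall>n\<in>carrier N.
        h (NB_tens f b) (env_incl b' \<cdot> env_incl n) = kgB_action \<gamma> b' (kgB_tens (f n) b))"
      using h(1) by blast
    fix g assume g: "g \<in> lin_maps NB (Hom_B \<gamma>) \<and> (\<forall>f\<in>carrier N_dual. \<forall>b\<in>carrier B. \<forall>b'\<in>carrier B. \<forall>n\<in>carrier N.
        g (NB_tens f b) (env_incl b' \<cdot> env_incl n) = kgB_action \<gamma> b' (kgB_tens (f n) b))"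
    show "g = h"
    proof (rule tensor_lin_maps_eqI[OF vspace_N_dual vspace_env vspace_Hom_B _ h(1)])
      show "g \<in> lin_maps NB (Hom_B \<gamma>)"
        using g by blast
      fix f b assume fb: "f \<in> carrier N_dual" "b \<in> carrier B"
      have gc: "g (NB_tens f b) \<in> carrier (Hom_B \<gamma>)"
        using g fb by (auto intro: lin_closed tens_closed)
      have "phi0 f b = g (NB_tens f b)"
      proof (rule phi0_unique[OF fb Hom_B_lin[OF gc] Hom_B_B_linear[OF gc]])
        fix n assume n: "n \<in> carrier N"
        have "g (NB_tens f b) (env_incl \<one>\<^bsub>B\<^esub> \<cdot> env_incl n) = kgB_action \<gamma> \<one>\<^bsub>B\<^esub> (kgB_tens (f n) b)"
          using g fb n env_one_closed by blast
        thus "g (NB_tens f b) (env_incl n) = kgB_tens (f n) b"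
          using n fb by (simp add: env_incl_one env_one_left[OF sub_U] incl_closed left_action_one[OF kgB_action] kgB_tens_closed)
      qed
      thus "g (NB_tens f b) = h (NB_tens f b)"
        using h(2) fb by simp
    qed
  qed
  thus "phi \<gamma> \<in> lin_maps NB (Hom_B \<gamma>)"
    "\<And>f b. f \<in> carrier N_dual \<Longrightarrow> b \<in> carrier B \<Longrightarrow> phi \<gamma> (NB_tens f b) = phi0 f b"
    using h by simp_all
qed

end


lemma kgB_retraction: "\<exists>\<beta>\<in>lin_maps kgB B. (\<forall>z\<in>carrier kgB. kgB_tens 1 (\<beta> z) = z) \<and>
    (\<forall>c. \<forall>b\<in>carrier B. \<beta> (kgB_tens c b) = c \<odot>\<^bsub>B\<^esub> b)"
proof -
  have "bilin base_field B B (\<lambda>c b. c \<odot>\<^bsub>B\<^esub> b)"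
    by (rule bilinI)
       (simp_all add: env_smult_closed vspace_add_smult[OF vspace_env] vspace_smult_add[OF vspace_env]
          vspace_mult_smult[OF vspace_env] mult.commute flip: vspace_mult_smult[OF vspace_env])
  from tensor_lift[OF vspace_base vspace_env vspace_env this, of "{}"]
  obtain \<beta> where \<beta>: "\<beta> \<in> lin_maps kgB B" "\<forall>c. \<forall>b\<in>carrier B. \<beta> (kgB_tens c b) = c \<odot>\<^bsub>B\<^esub> b"
    by auto
  have "kgB_tens 1 (\<beta> z) = z" if z: "z \<in> carrier kgB" for z
  proof -
    obtain b where "b \<in> carrier B" "z = kgB_tens 1 b"
      using kgB_rep[OF z] by blast
    thus ?thesis
      using \<beta>(2) vspace_one_smult[OF vspace_env] by simp
  qed
  thus ?thesis
    using \<beta> by blast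
qed

text \<open>Inverse of the identification b -> 1 \<otimes> b of B with \<open>kgB\<close>. It
  identifies vector spaces only: the left B-actions differ by the twist with the character.\<close>

definition kgB_to_B :: "('f \<times> ('k list \<Rightarrow>\<^sub>0 'f) set \<Rightarrow>\<^sub>0 'f) set \<Rightarrow> ('k list \<Rightarrow>\<^sub>0 'f) set" where
  "kgB_to_B = (SOME \<beta>. \<beta> \<in> lin_maps kgB B \<and> (\<forall>z\<in>carrier kgB. kgB_tens 1 (\<beta> z) = z) \<and>
    (\<forall>c. \<forall>b\<in>carrier B. \<beta> (kgB_tens c b) = c \<odot>\<^bsub>B\<^esub> b))"

lemma kgB_to_B: "kgB_to_B \<in> lin_maps kgB B" "z \<in> carrier kgB \<Longrightarrow> kgB_tens 1 (kgB_to_B z) = z"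
    "b \<in> carrier B \<Longrightarrow> kgB_to_B (kgB_tens c b) = c \<odot>\<^bsub>B\<^esub> b"
proof -
  have "\<exists>\<beta>. \<beta> \<in> lin_maps kgB B \<and> (\<forall>z\<in>carrier kgB. kgB_tens 1 (\<beta> z) = z) \<and>
    (\<forall>c. \<forall>b\<in>carrier B. \<beta> (kgB_tens c b) = c \<odot>\<^bsub>B\<^esub> b)"
    using kgB_retraction by blast
  from someI_ex[OF this, folded kgB_to_B_def]
  show "kgB_to_B \<in> lin_maps kgB B" "z \<in> carrier kgB \<Longrightarrow> kgB_tens 1 (kgB_to_B z) = z"
    "b \<in> carrier B \<Longrightarrow> kgB_to_B (kgB_tens c b) = c \<odot>\<^bsub>B\<^esub> b"
    by blast+
qed

section \<open>Bijectivity of \<open>phi\<close> and the left action\<close>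

context
  fixes \<gamma> :: "'k \<Rightarrow> 'f"
  assumes char: "character \<gamma>"
begin

lemmas HB_lin = Hom_B_lin[OF char]
lemmas HB_B_linear = Hom_B_B_linear[OF char]
lemmas phi_lin = phi(1)[OF char]
lemmas phi_tens = phi(2)[OF char]
lemmas HB_vs = vspace_Hom_B[OF char]
lemmas BL_D = B_linearD[OF char]
lemmas p0 = phi0[OF char]

lemma phi_closed: "x \<in> carrier NB \<Longrightarrow> phi \<gamma> x \<in> carrier (Hom_B \<gamma>)"
  by (rule lin_closed[OF phi_lin])

lemma phi_ev_closed: "x \<in> carrier NB \<Longrightarrow> X \<in> carrier U \<Longrightarrow> phi \<gamma> x X \<in> carrier kgB"
  by (rule lin_closed[OF HB_lin[OF phi_closed]])

lemma phi_ev_lin: "X \<in> carrier U \<Longrightarrow> (\<lambda>x\<in>carrier NB. phi \<gamma> x X) \<in> lin_maps NB kgB"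
  by (rule restrict_linI[OF vspace_NB])
     (simp_all add: phi_ev_closed lin_add[OF phi_lin] lin_smult[OF phi_lin] Hom_B_simps[OF char])

lemma phi_N: "\<lbrakk>f \<in> carrier N_dual; b \<in> carrier B; n \<in> carrier N\<rbrakk> \<Longrightarrow> phi \<gamma> (NB_tens f b) (env_incl n) = kgB_tens (f n) b"
  by (simp add: phi_tens p0(3))

lemma Hom_B_eqI:
  "h \<in> carrier (Hom_B \<gamma>) \<Longrightarrow> g \<in> carrier (Hom_B \<gamma>) \<Longrightarrow> (\<And>n. n \<in> carrier N \<Longrightarrow> h (env_incl n) = g (env_incl n)) \<Longrightarrow> h = g"
  by (rule B_linear_eqI[OF char HB_lin HB_B_linear HB_lin HB_B_linear])

lemma Hom_B_restrict_lin:
  "h \<in> carrier (Hom_B \<gamma>) \<Longrightarrow> (\<lambda>n\<in>carrier N. h (env_incl n)) \<in> lin_maps N kgB"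
  by (rule restrict_linI[OF vspace_env])
     (simp_all add: lin_closed[OF HB_lin] incl_closed env_incl_add env_incl_smult lin_add[OF HB_lin] lin_smult[OF HB_lin])

text \<open>A part of degree a maps a word of N of degree c into degree a + c of \<open>kgB\<close>,
  which is zero unless a + c has nonnegative coordinates. On the other hand c has coordinates at
  most 0 unless the word lies in the ideal. So c lies between -a and 0, a finite box.\<close>

lemma Hom_B_vanish:
  assumes h: "h \<in> carrier (Hom_B \<gamma>)"
  shows "\<exists>F. finite F \<and> F \<subseteq> Gam S \<and> vanish_off (\<lambda>n\<in>carrier N. h (env_incl n)) \<zero>\<^bsub>kgB\<^esub> F"
proof -
  have "h \<in> graded_hom S U (env_grading UNIV) kgB kgB_grading"
    using h carrier_Hom_B[OF char] by blast
  then obtain A g where A: "finite A" "A \<subseteq> Gam S"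
    and g: "\<And>a. a \<in> A \<Longrightarrow> g a \<in> hom_deg S U (env_grading UNIV) kgB kgB_grading a"
    and hg: "h = (\<lambda>x\<in>carrier U. \<Oplus>\<^bsub>kgB\<^esub>a\<in>A. g a x)"
    unfolding graded_hom_def by blast
  have gl: "g a \<in> lin_maps U kgB" if "a \<in> A" for a
    using g[OF that] by (simp add: hom_deg_def)
  define F where "F = (\<Union>a\<in>A. {d. below (- a) d \<and> below d 0}) \<inter> Gam S"
  have F: "finite F" "F \<subseteq> Gam S"
    using A(1) finite_between by (auto simp: F_def)
  have "h (env_incl (cl k_lt (bas w))) = \<zero>\<^bsub>kgB\<^esub>" if c: "c \<notin> F" and w: "hw k_lt c w" for c w
  proof (cases "bas w \<in> env_ideal k_lt")
    case True
    hence "bas w \<in> env_ideal UNIV"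
      using env_ideal_mono[of k_lt UNIV] by blast
    hence "env_incl (cl k_lt (bas w)) = \<zero>\<^bsub>U\<^esub>"
      by (simp only: env_incl_cl env_zero coset_zero[OF subspace_ideal] ideal_closed(1))
    thus ?thesis
      by (simp add: lin_zero[OF vspace_env vspace_kgB HB_lin[OF h]])
  next
    case False
    let ?X = "env_incl (cl k_lt (bas w))"
    have b: "below c 0"
    proof -
      have "gr e \<subseteq> span k_lt" if "e \<in> Gam S" "ht e < 0" for e
        using gr_k_lt[OF that] span_superset by blast
      thus ?thesis
        using hw_k_lt_bound[OF w order_refl] False by blast
    qed
    have X: "?X \<in> env_grading UNIV c" "?X \<in> carrier U"
    proof -
      show "?X \<in> carrier U"
        by (rule incl_closed[OF hw_closed[OF w]])
      show "?X \<in> env_grading UNIV c"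
        unfolding env_grading_eq env_incl_cl
        by (intro imageI fs.span_base) (use hw_mono[OF w] in blast)
    qed
    have z: "g a ?X = \<zero>\<^bsub>kgB\<^esub>" if a: "a \<in> A" for a
    proof (rule ccontr)
      assume nz: "g a ?X \<noteq> \<zero>\<^bsub>kgB\<^esub>"
      have "g a ?X \<in> kgB_grading (a + c)"
        using g[OF a] X(1) hw_Gam[OF w] by (auto simp: hom_deg_def)
      hence "below 0 (a + c)"
        using kgB_grading_sign nz by blast
      hence "below (- a) c"
        by (auto simp: below_def lookup_add) (metis add.commute minus_le_iff neg_le_iff_le le_minus_iff diff_ge_0_iff_ge diff_minus_eq_add)
      thus False
        using a b c hw_Gam[OF w] by (auto simp: F_def)
    qed
    have "h ?X \<in> carrier kgB \<and> emb kgB (h ?X) = (\<Sum>a\<in>A. emb kgB (g a ?X))"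
      using emb_finsum[OF vspace_kgB A(1), of "\<lambda>a. g a ?X"] lin_closed[OF gl X(2)] X(2) by (simp add: hg)
    also have "(\<Sum>a\<in>A. emb kgB (g a ?X)) = 0"
      by (rule sum.neutral) (simp add: z emb_zero[OF vspace_kgB])
    finally have e: "h ?X \<in> carrier kgB \<and> emb kgB (h ?X) = emb kgB \<zero>\<^bsub>kgB\<^esub>"
      by (simp only: emb_zero[OF vspace_kgB])
    show ?thesis
      by (rule emb_eqD[OF vspace_kgB e[THEN conjunct2] e[THEN conjunct1] vspace_zero_closed[OF vspace_kgB]])
  qed
  hence "vanish_off (\<lambda>n\<in>carrier N. h (env_incl n)) \<zero>\<^bsub>kgB\<^esub> F"
    unfolding vanish_off_def by (auto simp: hw_closed)
  thus ?thesis
    using F by blast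
qed

lemma dual_family_closed: "dual_family F J \<phi> \<Longrightarrow> j \<in> J \<Longrightarrow> cl k_lt j \<in> carrier N"
  unfolding dual_family_def by (auto intro: env_closed)

text \<open>The preimage is the sum of \<phi>_j \<otimes> h(j) over a dual family for the support of
  h, with h(j) read as an element of B.\<close>

lemma phi_surj:
  assumes h: "h \<in> carrier (Hom_B \<gamma>)"
  shows "\<exists>x\<in>carrier NB. phi \<gamma> x = h"
proof -
  obtain F where F: "finite F" "F \<subseteq> Gam S" "vanish_off (\<lambda>n\<in>carrier N. h (env_incl n)) \<zero>\<^bsub>kgB\<^esub> F"
    using Hom_B_vanish[OF h] by blast
  obtain J \<phi> where D: "dual_family F J \<phi>"
    using dual_family_ex[OF F(1,2)] by blast
  have J: "finite J" "\<And>j. j \<in> J \<Longrightarrow> \<phi> j \<in> carrier N_dual"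
    using D by (auto simp: dual_family_def)
  note jc = dual_family_closed[OF D]
  have hc: "h (env_incl n) \<in> carrier kgB" if "n \<in> carrier N" for n
    by (rule lin_closed[OF HB_lin[OF h] incl_closed[OF that]])
  define g where "g j = NB_tens (\<phi> j) (kgB_to_B (h (env_incl (cl k_lt j))))" for j
  have bc: "kgB_to_B (h (env_incl (cl k_lt j))) \<in> carrier B" if "j \<in> J" for j
    by (rule lin_closed[OF kgB_to_B(1) hc[OF jc[OF that]]])
  have g: "g j \<in> carrier NB" if "j \<in> J" for j
    unfolding g_def by (rule tens_closed[OF J(2)[OF that] bc[OF that]])
  define x where "x = finsum NB g J"
  have x: "x \<in> carrier NB"
    unfolding x_def
    by (rule lin_maps_finsum[where g = g, OF vspace_NB vspace_kgB phi_ev_lin[OF env_one_closed] J(1), THEN conjunct1]) (rule g)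
  have "phi \<gamma> x (env_incl n) = h (env_incl n)" if n: "n \<in> carrier N" for n
  proof -
    obtain p where p: "p \<in> FA k_lt" "n = cl k_lt p"
      using env_cases[OF n] by blast
    have "emb kgB (phi \<gamma> x (env_incl n)) = (\<Sum>j\<in>J. emb kgB (phi \<gamma> (g j) (env_incl n)))"
      using lin_maps_finsum[OF vspace_NB vspace_kgB phi_ev_lin[OF incl_closed[OF n]] J(1), of g] g x
      unfolding x_def by simp
    also have "\<dots> = (\<Sum>j\<in>J. fscale (\<phi> j n) (emb kgB (h (env_incl (cl k_lt j)))))"
    proof (rule sum.cong[OF refl])
      fix j assume j: "j \<in> J"
      let ?b = "kgB_to_B (h (env_incl (cl k_lt j)))"
      have "kgB_tens (\<phi> j n) ?b = \<phi> j n \<odot>\<^bsub>kgB\<^esub> kgB_tens 1 ?b"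
        using bilin_smult_left[OF kgB_bilin _ bc[OF j], of 1 "\<phi> j n"] by simp
      also have "kgB_tens 1 ?b = h (env_incl (cl k_lt j))"
        by (rule kgB_to_B(2)[OF hc[OF jc[OF j]]])
      finally show "emb kgB (phi \<gamma> (g j) (env_incl n)) = fscale (\<phi> j n) (emb kgB (h (env_incl (cl k_lt j))))"
        using j n by (simp add: g_def phi_N J bc emb_smult[OF vspace_kgB] hc jc)
    qed
    also have "\<dots> = emb kgB (h (env_incl n))"
      using dual_family_expand[OF D vspace_kgB Hom_B_restrict_lin[OF h] F(3) p(1)] n
      by (simp add: p(2) jc)
    finally show ?thesis
      by (rule emb_eqD[OF vspace_kgB _ phi_ev_closed[OF x incl_closed[OF n]] hc[OF n]])
  qed
  hence "phi \<gamma> x = h"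
    by (rule Hom_B_eqI[OF phi_closed[OF x] h])
  thus ?thesis
    using x by blast
qed

text \<open>The same sum recovers x from its image, for every dual family covering enough degrees.
  This gives injectivity, two elements being compared in a common family, and later the expansion of
  L_X (f \<otimes> 1).\<close>

lemma phi_determines:
  assumes "x \<in> carrier NB"
  shows "\<exists>F. finite F \<and> F \<subseteq> Gam S \<and> (\<forall>F' J \<phi>. F \<subseteq> F' \<longrightarrow> dual_family F' J \<phi> \<longrightarrow>
    emb NB x = (\<Sum>j\<in>J. emb NB (NB_tens (\<phi> j) (kgB_to_B (phi \<gamma> x (env_incl (cl k_lt j)))))))"
  using assms vspace_N_dual vspace_env
proof (induction rule: tensor_induct)
  case zero
  have "emb NB (NB_tens f (kgB_to_B (phi \<gamma> \<zero>\<^bsub>NB\<^esub> (env_incl n)))) = 0" if "f \<in> carrier N_dual" "n \<in> carrier N" for f n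
  proof -
    have "phi \<gamma> \<zero>\<^bsub>NB\<^esub> (env_incl n) = \<zero>\<^bsub>kgB\<^esub>"
      using lin_zero[OF vspace_NB HB_vs phi_lin] incl_closed[OF that(2)] by (simp add: Hom_B_simps[OF char])
    moreover have "NB_tens f (0 \<odot>\<^bsub>B\<^esub> \<zero>\<^bsub>B\<^esub>) = 0 \<odot>\<^bsub>NB\<^esub> NB_tens f \<zero>\<^bsub>B\<^esub>"
      by (rule bilin_smult_right[OF bilin_tens that(1) env_zero_closed])
    hence "NB_tens f \<zero>\<^bsub>B\<^esub> = \<zero>\<^bsub>NB\<^esub>"
      unfolding vspace_zero_smult[OF vspace_env env_zero_closed]
        vspace_zero_smult[OF vspace_NB tens_closed[OF that(1) env_zero_closed]] .
    ultimately show ?thesis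
      by (simp add: lin_zero[OF vspace_kgB vspace_env kgB_to_B(1)] emb_zero[OF vspace_NB])
  qed
  thus ?case
    by (intro exI[of _ "{}"]) (auto simp: emb_zero[OF vspace_NB] dual_family_def env_closed subset_iff intro!: sum.neutral[symmetric])
next
  case (tens f b)
  obtain F where F: "finite F" "F \<subseteq> Gam S" "vanish_off f 0 F"
    using tens(1) by (auto simp: N_dual_iff)
  have "emb NB (NB_tens f b) = (\<Sum>j\<in>J. emb NB (NB_tens (\<phi> j) (kgB_to_B (phi \<gamma> (NB_tens f b) (env_incl (cl k_lt j))))))"
    if FF: "F \<subseteq> F'" and D: "dual_family F' J \<phi>" for F' J \<phi>
  proof -
    have J: "finite J" "\<And>j. j \<in> J \<Longrightarrow> \<phi> j \<in> carrier N_dual"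
      using D by (auto simp: dual_family_def)
    note jc = dual_family_closed[OF D]
    define k where "k j = f (cl k_lt j) \<odot>\<^bsub>N_dual\<^esub> \<phi> j" for j
    have k: "k j \<in> carrier N_dual" if "j \<in> J" for j
      unfolding k_def by (rule vspace_smult_closed[OF vspace_N_dual J(2)[OF that]])
    have tl: "(\<lambda>f\<in>carrier N_dual. NB_tens f b) \<in> lin_maps N_dual NB"
      by (rule restrict_linI[OF vspace_N_dual]) (simp_all add: bilinD[OF bilin_tens] tens(2))
    have el: "(\<lambda>f\<in>carrier N_dual. f X) \<in> lin_maps N_dual base_field" if "X \<in> carrier N" for X
      by (rule restrict_linI[OF vspace_N_dual]) (simp_all add: N_dual_simps that)
    have fc: "finsum N_dual k J \<in> carrier N_dual"
      by (rule lin_maps_finsum[where g = k, OF vspace_N_dual vspace_NB tl J(1), THEN conjunct1]) (rule k)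
    have "f = finsum N_dual k J"
    proof (rule N_dual_eqI[OF tens(1) fc])
      fix p assume p: "p \<in> FA k_lt"
      have pc: "cl k_lt p \<in> carrier N"
        by (rule env_closed[OF p])
      have "emb base_field (finsum N_dual k J (cl k_lt p)) = (\<Sum>j\<in>J. emb base_field (k j (cl k_lt p)))"
        using lin_maps_finsum[where g = k, OF vspace_N_dual vspace_base el[OF pc] J(1)] k fc by simp
      also have "\<dots> = (\<Sum>j\<in>J. fscale (\<phi> j (cl k_lt p)) (emb base_field (f (cl k_lt j))))"
      proof (rule sum.cong[OF refl])
        fix j assume "j \<in> J"
        have "k j (cl k_lt p) = \<phi> j (cl k_lt p) \<odot>\<^bsub>base_field\<^esub> f (cl k_lt j)"
          using pc by (simp add: k_def N_dual_simps)
        thus "emb base_field (k j (cl k_lt p)) = fscale (\<phi> j (cl k_lt p)) (emb base_field (f (cl k_lt j)))"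
          using emb_smult[OF vspace_base, of "f (cl k_lt j)" "\<phi> j (cl k_lt p)"] by (simp del: base_field_simps(4))
      qed
      also have "\<dots> = emb base_field (f (cl k_lt p))"
        using dual_family_expand[OF D vspace_base N_dual_lin[OF tens(1)] _ p] vanish_off_mono[OF F(3) FF] by simp
      finally show "f (cl k_lt p) = finsum N_dual k J (cl k_lt p)"
        using emb_inj[OF vspace_base, of "f (cl k_lt p)"] by (metis UNIV_I base_field_simps(1))
    qed
    hence "emb NB (NB_tens f b) = (\<Sum>j\<in>J. emb NB (NB_tens (k j) b))"
      using lin_maps_finsum[OF vspace_N_dual vspace_NB tl J(1), of k] k fc by simp
    also have "\<dots> = (\<Sum>j\<in>J. emb NB (NB_tens (\<phi> j) (kgB_to_B (phi \<gamma> (NB_tens f b) (env_incl (cl k_lt j))))))"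
      by (rule sum.cong)
         (simp_all add: k_def phi_N tens jc kgB_to_B(3) J bilin_smult_left[OF bilin_tens] bilin_smult_right[OF bilin_tens])
    finally show ?thesis .
  qed
  thus ?case
    using F by blast
next
  case (add X Y)
  then obtain F G where F: "finite F" "F \<subseteq> Gam S" "\<And>F' J \<phi>. F \<subseteq> F' \<Longrightarrow> dual_family F' J \<phi> \<Longrightarrow>
      emb NB X = (\<Sum>j\<in>J. emb NB (NB_tens (\<phi> j) (kgB_to_B (phi \<gamma> X (env_incl (cl k_lt j))))))"
    and G: "finite G" "G \<subseteq> Gam S" "\<And>F' J \<phi>. G \<subseteq> F' \<Longrightarrow> dual_family F' J \<phi> \<Longrightarrow>
      emb NB Y = (\<Sum>j\<in>J. emb NB (NB_tens (\<phi> j) (kgB_to_B (phi \<gamma> Y (env_incl (cl k_lt j))))))"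
    by blast
  have "emb NB (X \<oplus>\<^bsub>NB\<^esub> Y) = (\<Sum>j\<in>J. emb NB (NB_tens (\<phi> j) (kgB_to_B (phi \<gamma> (X \<oplus>\<^bsub>NB\<^esub> Y) (env_incl (cl k_lt j))))))"
    if FF: "F \<union> G \<subseteq> F'" and D: "dual_family F' J \<phi>" for F' J \<phi>
  proof -
    have J: "finite J" "\<And>j. j \<in> J \<Longrightarrow> \<phi> j \<in> carrier N_dual"
      using D by (auto simp: dual_family_def)
    note jc = dual_family_closed[OF D]
    have "emb NB (NB_tens (\<phi> j) (kgB_to_B (phi \<gamma> (X \<oplus>\<^bsub>NB\<^esub> Y) (env_incl (cl k_lt j))))) =
        emb NB (NB_tens (\<phi> j) (kgB_to_B (phi \<gamma> X (env_incl (cl k_lt j))))) + emb NB (NB_tens (\<phi> j) (kgB_to_B (phi \<gamma> Y (env_incl (cl k_lt j)))))"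
      if j: "j \<in> J" for j
      using add(1,2) jc[OF j] J(2)[OF j]
      by (simp add: lin_add[OF phi_lin] Hom_B_simps[OF char] incl_closed lin_add[OF kgB_to_B(1)] phi_ev_closed
          bilin_add_right[OF bilin_tens] lin_closed[OF kgB_to_B(1)] emb_add[OF vspace_NB] tens_closed)
    thus ?thesis
      using F(3)[OF _ D] G(3)[OF _ D] FF add(1,2) by (simp add: emb_add[OF vspace_NB] sum.distrib)
  qed
  thus ?case
    using F(1,2) G(1,2) by (intro exI[of _ "F \<union> G"]) auto
qed

lemma phi_inj:
  assumes x: "x \<in> carrier NB" and y: "y \<in> carrier NB" and eq: "phi \<gamma> x = phi \<gamma> y"
  shows "x = y"
proof -
  obtain F where F: "finite F" "F \<subseteq> Gam S" "\<And>F' J \<phi>. F \<subseteq> F' \<Longrightarrow> dual_family F' J \<phi> \<Longrightarrow>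
      emb NB x = (\<Sum>j\<in>J. emb NB (NB_tens (\<phi> j) (kgB_to_B (phi \<gamma> x (env_incl (cl k_lt j))))))"
    using phi_determines[OF x] by blast
  obtain G where G: "finite G" "G \<subseteq> Gam S" "\<And>F' J \<phi>. G \<subseteq> F' \<Longrightarrow> dual_family F' J \<phi> \<Longrightarrow>
      emb NB y = (\<Sum>j\<in>J. emb NB (NB_tens (\<phi> j) (kgB_to_B (phi \<gamma> y (env_incl (cl k_lt j))))))"
    using phi_determines[OF y] by blast
  obtain J \<phi> where D: "dual_family (F \<union> G) J \<phi>"
    using dual_family_ex[of "F \<union> G"] F G by auto
  have "emb NB x = emb NB y"
    using F(3)[OF _ D] G(3)[OF _ D] eq by simp
  thus ?thesis
    by (rule emb_eqD[OF vspace_NB _ x y])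
qed

lemma U_grading_mult:
  assumes "X \<in> env_grading UNIV c" "hw UNIV d w"
  shows "X \<cdot> cl UNIV (bas w) \<in> env_grading UNIV (c + d)"
proof -
  obtain p where p: "p \<in> fspan {bas w | w. hw UNIV c w}" "X = cl UNIV p"
    using assms(1) unfolding env_grading_eq by blast
  have "bas w \<in> fspan {bas w}"
    by (rule fs.span_base) simp
  hence "p * bas w \<in> fspan {bas w | w. hw UNIV (c + d) w}"
    by (rule fspan_mult_closed[OF p(1)])
       (clarsimp simp: bas_mult, rule fs.span_base, use hw_append[OF _ assms(2)] in blast)
  thus ?thesis
    by (simp add: p(2) env_mult[OF sub_U] env_grading_eq)
qed

lemma Hom_B_left_lin:
  assumes h: "h \<in> lin_maps U kgB" and u: "u \<in> carrier U"
  shows "Hom_B_left u h \<in> lin_maps U kgB"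
  unfolding Hom_B_left_def
  by (rule restrict_linI[OF vspace_env])
     (simp_all add: u U_mult_closed lin_closed[OF h] bilin_add_left[OF bilin_env_mult[OF sub_U]] lin_add[OF h]
        bilin_smult_left[OF bilin_env_mult[OF sub_U]] lin_smult[OF h])

abbreviation "GHU \<equiv> graded_hom S U (env_grading UNIV) kgB kgB_grading"
lemmas GHU = graded_hom_U[OF char U_grading[OF char]]
lemmas GHU_lin = GH_lin[OF char]

text \<open>Right multiplication by a homogeneous word of degree d moves a map of degree a to degree
  a + d; a general u is a combination of such words modulo the ideal.\<close>

lemma Hom_B_left_GH:
  assumes h: "h \<in> GHU" and u: "u \<in> carrier U"
  shows "Hom_B_left u h \<in> GHU"
proof -
  note hl = GHU_lin[OF h]
  obtain A g where A: "finite A" "A \<subseteq> Gam S"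
    and g: "\<And>a. a \<in> A \<Longrightarrow> g a \<in> hom_deg S U (env_grading UNIV) kgB kgB_grading a"
    and hg: "h = (\<lambda>x\<in>carrier U. \<Oplus>\<^bsub>kgB\<^esub>a\<in>A. g a x)"
    using h unfolding graded_hom_def by blast
  have clU: "cl UNIV q \<in> carrier U" for q
    by (rule env_closed) simp
  interpret K: abelian_group kgB
    by (rule vspace_abelian[OF vspace_kgB])
  have word: "Hom_B_left (cl UNIV (bas w)) h \<in> GHU" if w: "hw UNIV d w" for d w
  proof -
    let ?u = "cl UNIV (bas w)"
    have gc: "g a X \<in> carrier kgB" if "a \<in> A" "X \<in> carrier U" for a X
      using g[OF that(1)] that(2) by (auto simp: hom_deg_def intro: lin_closed)
    have 1: "Hom_B_left ?u (g a) \<in> hom_deg S U (env_grading UNIV) kgB kgB_grading (a + d)" if a: "a \<in> A" for a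
      unfolding hom_deg_def
    proof (intro CollectI conjI ballI subsetI)
      show "Hom_B_left ?u (g a) \<in> lin_maps U kgB"
        using g[OF a] clU by (intro Hom_B_left_lin) (auto simp: hom_deg_def)
      fix b y assume b: "b \<in> Gam S" and "y \<in> Hom_B_left ?u (g a) ` env_grading UNIV b"
      then obtain X where X: "X \<in> env_grading UNIV b" "y = Hom_B_left ?u (g a) X"
        by blast
      have "y = g a (X \<cdot> ?u)"
        using X env_grading_closed by (simp add: Hom_B_left_def)
      moreover have "g a ` env_grading UNIV (b + d) \<subseteq> kgB_grading (a + (b + d))"
        using g[OF a] Gam_closed(2)[OF b hw_Gam[OF w]] unfolding hom_deg_def by blast
      ultimately show "y \<in> kgB_grading (a + d + b)"
        using U_grading_mult[OF X(1) w] by (auto simp: ac_simps)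
    qed
    have "Hom_B_left ?u h = (\<lambda>x\<in>carrier U. \<Oplus>\<^bsub>kgB\<^esub>a\<in>(\<lambda>a. a + d) ` A. Hom_B_left ?u (g (a - d)) x)"
      unfolding Hom_B_left_def
    proof (rule restrict_ext)
      fix X assume X: "X \<in> carrier U"
      have Xu: "X \<cdot> ?u \<in> carrier U"
        by (rule U_mult_closed[OF X clU])
      have "(\<Oplus>\<^bsub>kgB\<^esub>a\<in>(\<lambda>a. a + d) ` A. g (a - d) (X \<cdot> ?u)) = (\<Oplus>\<^bsub>kgB\<^esub>a\<in>A. g (a + d - d) (X \<cdot> ?u))"
        by (rule K.finsum_reindex) (use gc[OF _ Xu] in \<open>auto simp: inj_on_def\<close>)
      thus "h (X \<cdot> ?u) = (\<Oplus>\<^bsub>kgB\<^esub>a\<in>(\<lambda>a. a + d) ` A. (\<lambda>u'\<in>carrier U. g (a - d) (u' \<cdot> ?u)) X)"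
        using X Xu by (simp add: hg)
    qed
    moreover have "(\<lambda>a. a + d) ` A \<subseteq> Gam S"
      using A(2) Gam_closed(2)[OF _ hw_Gam[OF w]] by blast
    ultimately show ?thesis
      unfolding graded_hom_def using A(1) 1
      by (intro CollectI exI[of _ "(\<lambda>a. a + d) ` A"] exI[of _ "\<lambda>a. Hom_B_left ?u (g (a - d))"]) auto
  qed
  obtain p where p: "u = cl UNIV p"
    using u by (auto elim: env_cases)
  let ?Q = "{p. Hom_B_left (cl UNIV p) h \<in> GHU}"
  have z: "Hom_B_left \<zero>\<^bsub>U\<^esub> h \<in> GHU"
  proof -
    have "X \<cdot> \<zero>\<^bsub>U\<^esub> = \<zero>\<^bsub>U\<^esub>" if "X \<in> carrier U" for X
      using that by (elim env_cases) (simp add: env_zero env_mult[OF sub_U] del: set_zero_plus)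
    hence "Hom_B_left \<zero>\<^bsub>U\<^esub> h = (\<lambda>x\<in>carrier U. \<zero>\<^bsub>kgB\<^esub>)"
      unfolding Hom_B_left_def by (intro restrict_ext) (simp add: lin_zero[OF vspace_env vspace_kgB hl])
    thus ?thesis
      using GHU(1) by simp
  qed
  have "fs.subspace ?Q"
  proof (rule fs.subspaceI)
    show "0 \<in> ?Q"
      using z unfolding env_zero by (simp only: mem_Collect_eq)
    fix x y c assume x: "x \<in> ?Q"
    have "Hom_B_left (cl UNIV (fscale c x)) h = (\<lambda>X\<in>carrier U. c \<odot>\<^bsub>kgB\<^esub> Hom_B_left (cl UNIV x) h X)"
      unfolding Hom_B_left_def env_smult[symmetric]
      by (rule restrict_ext) (simp add: bilin_smult_right[OF bilin_env_mult[OF sub_U]] clU lin_smult[OF hl] U_mult_closed)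
    thus "fscale c x \<in> ?Q"
      using GHU(3)[of "Hom_B_left (cl UNIV x) h" c] x by simp
    assume y: "y \<in> ?Q"
    have "Hom_B_left (cl UNIV (x + y)) h = (\<lambda>X\<in>carrier U. Hom_B_left (cl UNIV x) h X \<oplus>\<^bsub>kgB\<^esub> Hom_B_left (cl UNIV y) h X)"
      unfolding Hom_B_left_def env_add[symmetric]
      by (rule restrict_ext) (simp add: bilin_add_right[OF bilin_env_mult[OF sub_U]] clU lin_add[OF hl] U_mult_closed)
    thus "x + y \<in> ?Q"
      using GHU(2)[of "Hom_B_left (cl UNIV x) h" "Hom_B_left (cl UNIV y) h"] x y by simp
  qed
  moreover have "{bas w | w d. hw UNIV d w} \<union> env_ideal UNIV \<subseteq> ?Q"
  proof -
    have "r \<in> ?Q" if "r \<in> env_ideal UNIV" for r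
    proof -
      have "cl UNIV r = \<zero>\<^bsub>U\<^esub>"
        using that by (simp add: env_zero coset_zero[OF subspace_ideal])
      thus ?thesis
        using z by simp
    qed
    thus ?thesis
      using word by blast
  qed
  ultimately have "fspan ({bas w | w d. hw UNIV d w} \<union> env_ideal UNIV) \<subseteq> ?Q"
    by (intro fs.span_minimal)
  moreover have "supp_sub (\<lambda>_. True) = UNIV"
    by (auto simp: supp_sub_def)
  hence "p \<in> fspan ({bas w | w d. hw UNIV d w} \<union> env_ideal UNIV)"
    using FA_homogeneous[of "\<lambda>_. True" p] sub_U by simp
  ultimately show ?thesis
    unfolding p by blast
qed

lemma Hom_B_left_closed:
  assumes h: "h \<in> carrier (Hom_B \<gamma>)" and u: "u \<in> carrier U"
  shows "Hom_B_left u h \<in> carrier (Hom_B \<gamma>)"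
proof -
  have "B_linear \<gamma> (Hom_B_left u h)"
    unfolding B_linear_def[OF char] Hom_B_left_def
    using u BL_D[OF HB_B_linear[OF h]] by (simp add: incl_closed U_mult_closed env_mult_assoc[OF sub_U])
  thus ?thesis
    using h Hom_B_left_GH[OF _ u] unfolding carrier_Hom_B[OF char] by blast
qed

lemma left_act:
  assumes u: "u \<in> carrier U" and x: "x \<in> carrier NB"
  shows left_act_closed: "left_act \<gamma> u x \<in> carrier NB"
    and phi_left_act: "phi \<gamma> (left_act \<gamma> u x) = Hom_B_left u (phi \<gamma> x)"
proof -
  have "Hom_B_left u (phi \<gamma> x) \<in> phi \<gamma> ` carrier NB"
    using phi_surj[OF Hom_B_left_closed[OF phi_closed[OF x] u]] by (metis image_eqI)
  thus "left_act \<gamma> u x \<in> carrier NB" "phi \<gamma> (left_act \<gamma> u x) = Hom_B_left u (phi \<gamma> x)"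
    unfolding left_act_def by (rule inv_into_into, rule f_inv_into_f)
qed

text \<open>\<open>phi\<close> is injective and B-linear maps are compared on N, so identities for
  the left action reduce to evaluation at products n u.\<close>

lemma left_act_eqI:
  assumes "u \<in> carrier U" "x \<in> carrier NB" "y \<in> carrier NB"
    "\<And>n. n \<in> carrier N \<Longrightarrow> phi \<gamma> x (env_incl n \<cdot> u) = phi \<gamma> y (env_incl n)"
  shows "left_act \<gamma> u x = y"
proof (rule phi_inj[OF left_act_closed[OF assms(1,2)] assms(3)])
  show "phi \<gamma> (left_act \<gamma> u x) = phi \<gamma> y"
    unfolding phi_left_act[OF assms(1,2)]
    by (rule Hom_B_eqI[OF Hom_B_left_closed[OF phi_closed[OF assms(2)] assms(1)] phi_closed[OF assms(3)]])
       (simp add: Hom_B_left_def incl_closed assms(4))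
qed

lemma phi_left_act_ev: "\<lbrakk>u \<in> carrier U; x \<in> carrier NB; X \<in> carrier U\<rbrakk> \<Longrightarrow>
    phi \<gamma> (left_act \<gamma> u x) X = phi \<gamma> x (X \<cdot> u)"
  by (simp add: phi_left_act Hom_B_left_def)

lemma left_act_lin: "u \<in> carrier U \<Longrightarrow> (\<lambda>x\<in>carrier NB. left_act \<gamma> u x) \<in> lin_maps NB NB"
proof (rule restrict_linI[OF vspace_NB])
  fix x y c assume u: "u \<in> carrier U" and x: "x \<in> carrier NB"
  show "left_act \<gamma> u x \<in> carrier NB"
    by (rule left_act_closed[OF u x])
  show "left_act \<gamma> u (c \<odot>\<^bsub>NB\<^esub> x) = c \<odot>\<^bsub>NB\<^esub> left_act \<gamma> u x"
    by (rule left_act_eqI)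
       (simp_all add: u x NB_smult_closed left_act_closed lin_smult[OF phi_lin] Hom_B_simps[OF char]
          incl_closed U_mult_closed phi_left_act_ev)
  assume y: "y \<in> carrier NB"
  show "left_act \<gamma> u (x \<oplus>\<^bsub>NB\<^esub> y) = left_act \<gamma> u x \<oplus>\<^bsub>NB\<^esub> left_act \<gamma> u y"
    by (rule left_act_eqI)
       (simp_all add: u x y NB_add_closed left_act_closed lin_add[OF phi_lin] Hom_B_simps[OF char]
          incl_closed U_mult_closed phi_left_act_ev)
qed

lemma left_act_elt:
  assumes u: "u \<in> carrier U" "w \<in> carrier U" and x: "x \<in> carrier NB"
  shows "left_act \<gamma> (u \<oplus>\<^bsub>U\<^esub> w) x = left_act \<gamma> u x \<oplus>\<^bsub>NB\<^esub> left_act \<gamma> w x"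
    and "left_act \<gamma> (c \<odot>\<^bsub>U\<^esub> u) x = c \<odot>\<^bsub>NB\<^esub> left_act \<gamma> u x"
    and "left_act \<gamma> (u \<cdot> w) x = left_act \<gamma> u (left_act \<gamma> w x)"
  by (rule left_act_eqI;
      simp add: u x env_add_closed env_smult_closed U_mult_closed left_act_closed
        NB_add_closed NB_smult_closed lin_add[OF phi_lin] lin_smult[OF phi_lin]
        Hom_B_simps[OF char] incl_closed phi_left_act_ev bilin_add_right[OF bilin_env_mult[OF sub_U]]
        bilin_smult_right[OF bilin_env_mult[OF sub_U]] lin_add[OF HB_lin[OF phi_closed]] lin_smult[OF HB_lin[OF phi_closed]]
        env_mult_assoc[OF sub_U])+

text \<open>Right multiplication \<rho> by b on the second factor of \<open>kgB\<close> commutes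
  with the left B-action, hence the image of x b under \<open>phi\<close> is \<rho> after the image
  of x. The left action of U changes only the argument of these maps and therefore commutes with
  \<rho>.\<close>

lemma left_right_B:
  assumes u: "u \<in> carrier U" and b: "b \<in> carrier B" and x: "x \<in> carrier NB"
  shows "left_act \<gamma> u (right_act x (env_incl b)) = right_act (left_act \<gamma> u x) (env_incl b)"
proof -
  note ib = incl_closed[OF b]
  have "bilin base_field B kgB (\<lambda>c b0. kgB_tens c (b0 \<otimes>\<^bsub>B\<^esub> b))"
    by (rule bilinI)
       (simp_all add: bilinD[OF kgB_bilin, simplified] env_mult_closed[OF sub_B] b bilin_add_left[OF bilin_env_mult[OF sub_B]]
         bilin_smult_left[OF bilin_env_mult[OF sub_B]])
  from tensor_lift[OF vspace_base vspace_env vspace_kgB this, of "{}"]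
  obtain \<rho> where \<rho>: "\<rho> \<in> lin_maps kgB kgB" "\<And>c b0. b0 \<in> carrier B \<Longrightarrow> \<rho> (kgB_tens c b0) = kgB_tens c (b0 \<otimes>\<^bsub>B\<^esub> b)"
    by auto
  note ka = kgB_action[OF char]
  note ka_lin = left_action_lin[OF ka]
  have gen: "\<rho> (kgB_action \<gamma> (env_in k_ge y) z) = kgB_action \<gamma> (env_in k_ge y) (\<rho> z)" if y: "y \<in> k_ge" and z: "z \<in> carrier kgB" for y z
  proof -
    note yc = env_in_closed[OF y]
    obtain b0 where b0: "b0 \<in> carrier B" "z = kgB_tens 1 b0"
      using kgB_rep[OF z] by blast
    thus ?thesis
      using y yc b
      by (simp add: kgB_action_in[OF char] \<rho>(2) lin_add[OF \<rho>(1)] kgB_tens_closed env_mult_closed[OF sub_B] env_mult_assoc[OF sub_B])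
  qed
  have comm: "\<forall>z\<in>carrier kgB. \<rho> (kgB_action \<gamma> b' z) = kgB_action \<gamma> b' (\<rho> z)" if b': "b' \<in> carrier B" for b'
    using b' sub_B
    by (induction rule: env_induct)
       (simp_all add: left_action_zero[OF vspace_env vspace_kgB ka] lin_closed[OF \<rho>(1)] lin_zero[OF vspace_kgB vspace_kgB \<rho>(1)]
         left_action_one[OF ka] left_action_mult[OF ka] env_in_closed gen left_action_closed[OF ka] left_action_add[OF ka]
         lin_add[OF \<rho>(1)] left_action_smult[OF ka] lin_smult[OF \<rho>(1)])
  have key: "phi \<gamma> (right_act x (env_incl b)) X = \<rho> (phi \<gamma> x X)" if X: "X \<in> carrier U" and x: "x \<in> carrier NB" for x X
    using x vspace_N_dual vspace_env
  proof (induction rule: tensor_induct)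
    case zero
    have r0: "right_act \<zero>\<^bsub>NB\<^esub> (env_incl b) = \<zero>\<^bsub>NB\<^esub>"
      using lin_zero[OF vspace_NB vspace_NB right_act_lin[OF ib]] by (simp add: NB_zero_closed)
    have p0: "phi \<gamma> \<zero>\<^bsub>NB\<^esub> X = \<zero>\<^bsub>kgB\<^esub>"
      using lin_zero[OF vspace_NB HB_vs phi_lin] X by (simp add: Hom_B_simps[OF char])
    show ?case
      by (simp add: r0 p0 lin_zero[OF vspace_kgB vspace_kgB \<rho>(1)])
  next
    case (tens f b0)
    have hl: "(\<lambda>X\<in>carrier U. \<rho> (phi0 \<gamma> f b0 X)) \<in> lin_maps U kgB"
      by (rule lin_maps_comp[OF vspace_env \<rho>(1) p0(1)[OF tens]])
    have "phi0 \<gamma> f (b0 \<otimes>\<^bsub>B\<^esub> b) = (\<lambda>X\<in>carrier U. \<rho> (phi0 \<gamma> f b0 X))"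
    proof (rule phi0_unique[OF char tens(1) env_mult_closed[OF sub_B tens(2) b] hl])
      show "B_linear \<gamma> (\<lambda>X\<in>carrier U. \<rho> (phi0 \<gamma> f b0 X))"
        unfolding B_linear_def[OF char]
        using comm by (simp add: incl_closed U_mult_closed BL_D[OF p0(2)[OF tens]] lin_closed[OF p0(1)[OF tens]])
      show "(\<lambda>X\<in>carrier U. \<rho> (phi0 \<gamma> f b0 X)) (env_incl n) = kgB_tens (f n) (b0 \<otimes>\<^bsub>B\<^esub> b)" if "n \<in> carrier N" for n
        using that by (simp add: incl_closed p0(3)[OF tens] \<rho>(2) tens)
    qed
    thus ?case
      using X by (simp add: right_act_B tens b phi_tens env_mult_closed[OF sub_B])
  next
    case (add x y)
    thus ?case
      using X by (simp add: right_act_add ib right_act_closed lin_add[OF phi_lin] Hom_B_simps[OF char] lin_add[OF \<rho>(1)] phi_ev_closed)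
  qed
  show ?thesis
    by (rule left_act_eqI)
       (simp_all add: u x ib right_act_closed left_act_closed key U_mult_closed incl_closed phi_left_act_ev)
qed

end

end

section \<open>Moving an element of degree zero or one past the negative part\<close>

context vector_space
begin

lemma flin_diff: "flin scale k (p - q) = flin scale k p - flin scale k q"
  using flin_add[of k "p - q" q] by (simp add: algebra_simps)

text \<open>The trace of z -> sum_j l_j(z) v_j is sum_j l_j(v_j), in any basis and also in infinite
  dimension. The factor c stays in front of \<open>T\<close>, since in the application it is f(w)
  and may be 0.\<close>

lemma trace_on_finite_rank:
  assumes V: "subspace V" and T: "\<And>z. z \<in> V \<Longrightarrow> T z \<in> V"
    and J: "finite J" "\<And>j. j \<in> J \<Longrightarrow> v j \<in> V"
    and l: "\<And>j x y. \<lbrakk>j \<in> J; x \<in> V; y \<in> V\<rbrakk> \<Longrightarrow> l j (x + y) = l j x + l j y"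
      "\<And>j c x. j \<in> J \<Longrightarrow> x \<in> V \<Longrightarrow> l j (scale c x) = c * l j x"
    and eq: "\<And>z. z \<in> V \<Longrightarrow> scale c (T z) = (\<Sum>j\<in>J. scale (l j z) (v j))"
  shows "c * trace_on V T = (\<Sum>j\<in>J. l j (v j))"
proof -
  define E where "E = (SOME E. independent E \<and> span E = V)"
  obtain E0 where "E0 \<subseteq> V" "independent E0" "V \<subseteq> span E0"
    using maximal_independent_subset by blast
  hence "independent E0 \<and> span E0 = V"
    using V by (metis span_subspace)
  hence E: "independent E" "span E = V"
    unfolding E_def by (metis (mono_tags, lifting) someI_ex)+
  have EV: "e \<in> V" if "e \<in> E" for e
    using that E(2) span_base by blast
  \<comment> \<open>Basis vectors occurring in some v_j; outside this finite set the diagonal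
    entries of c T vanish.\<close>
  define E' where "E' = (\<Union>j\<in>J. {e. representation E (v j) e \<noteq> 0})"
  have E': "finite E'" "E' \<subseteq> E"
    using J(1) by (auto simp: E'_def finite_representation dest: representation_ne_zero)
  have lsum: "l j (\<Sum>e\<in>A. scale (a e) e) = (\<Sum>e\<in>A. a e * l j e)" if "finite A" "A \<subseteq> E" "j \<in> J" for A a j
    using that
  proof (induction A)
    case empty
    thus ?case
      using l(2)[of j 0 0] subspace_0[OF V] by simp
  next
    case (insert e A)
    have "(\<Sum>e\<in>A. scale (a e) e) \<in> V"
      using insert EV by (intro subspace_sum[OF V] subspace_scale[OF V]) auto
    thus ?case
      using insert EV by (simp add: l subspace_scale[OF V])
  qed
  have "l j (v j) = (\<Sum>e\<in>E'. representation E (v j) e * l j e)" if j: "j \<in> J" for j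
  proof -
    have "v j = (\<Sum>e | representation E (v j) e \<noteq> 0. scale (representation E (v j) e) e)"
      using sum_nonzero_representation_eq[OF E(1), of "v j"] J(2)[OF j] E(2) by simp
    also have "\<dots> = (\<Sum>e\<in>E'. scale (representation E (v j) e) e)"
      by (rule sum.mono_neutral_left) (use E' j in \<open>auto simp: E'_def\<close>)
    finally show ?thesis
      using lsum[OF E' j] by metis
  qed
  hence "(\<Sum>j\<in>J. l j (v j)) = (\<Sum>e\<in>E'. \<Sum>j\<in>J. representation E (v j) e * l j e)"
    by (simp add: sum.swap[of _ E' J])
  moreover have c: "c * representation E (T e) e = (\<Sum>j\<in>J. representation E (v j) e * l j e)" if e: "e \<in> E" for e
  proof -
    have "c * representation E (T e) e = representation E (scale c (T e)) e"
      using representation_scale[OF E(1)] T[OF EV[OF e]] E(2) by simp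
    also have "\<dots> = (\<Sum>j\<in>J. representation E (scale (l j e) (v j)) e)"
      unfolding eq[OF EV[OF e]] by (subst representation_sum[OF E(1)]) (auto simp: E(2) J subspace_scale[OF V])
    also have "\<dots> = (\<Sum>j\<in>J. representation E (v j) e * l j e)"
      by (rule sum.cong[OF refl]) (simp add: representation_scale[OF E(1)] E(2) J mult.commute)
    finally show ?thesis .
  qed
  moreover have "c * trace_on V T = (\<Sum>e\<in>E'. c * representation E (T e) e)"
  \<comment> \<open>For c = 0 nothing is known about the diagonal of \<open>T\<close>, but both
    sides are 0.\<close>
  proof (cases "c = 0")
    case False
    have "(\<Sum>e | e \<in> E \<and> representation E (T e) e \<noteq> 0. representation E (T e) e) = (\<Sum>e\<in>E'. representation E (T e) e)"
    proof (rule sum.mono_neutral_left[OF E'(1)])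
      show "{e \<in> E. representation E (T e) e \<noteq> 0} \<subseteq> E'"
      proof
        fix e assume e: "e \<in> {e \<in> E. representation E (T e) e \<noteq> 0}"
        hence "(\<Sum>j\<in>J. representation E (v j) e * l j e) \<noteq> 0"
          using c[of e] False by auto
        then obtain j where "j \<in> J" "representation E (v j) e * l j e \<noteq> 0"
          by (meson sum.neutral)
        thus "e \<in> E'"
          by (auto simp: E'_def)
      qed
    qed (use E' in auto)
    thus ?thesis
      by (simp add: trace_on_def Let_def E_def[symmetric] sum_distrib_left)
  qed simp
  ultimately show ?thesis
    using E'(2) by (simp add: subset_iff)
qed

end

definition omit :: "nat \<Rightarrow> 'a list \<Rightarrow> 'a list" where
  "omit i w = take i w @ drop (Suc i) w"

lemma omit_Cons [simp]: "omit 0 (y # w) = w" "omit (Suc i) (y # w) = y # omit i w"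
  by (simp_all add: omit_def)

lemma omit_lists: "w \<in> lists L \<Longrightarrow> omit i w \<in> lists L"
  by (auto simp: omit_def in_lists_conv_set dest: in_set_takeD in_set_dropD)

section \<open>The corrections from moving X through a word\<close>

context triangular_lie_algebra
begin

lemma dual_family_functional:
  assumes D: "dual_family F J \<phi>" and f: "f \<in> carrier N_dual" "vanish_off f 0 F" and p: "p \<in> FA k_lt"
  shows "f (cl k_lt p) = (\<Sum>j\<in>J. \<phi> j (cl k_lt p) * f (cl k_lt j))"
proof -
  have "emb base_field (f (cl k_lt p)) = (\<Sum>j\<in>J. fscale (\<phi> j (cl k_lt p)) (emb base_field (f (cl k_lt j))))"
    using dual_family_expand[OF D vspace_base N_dual_lin[OF f(1)] _ p] f(2) by simp
  also have "\<dots> = (\<Sum>j\<in>J. emb base_field (\<phi> j (cl k_lt p) * f (cl k_lt j)))"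
    by (simp add: emb_smult[OF vspace_base, simplified])
  also have "\<dots> = emb base_field (\<Sum>j\<in>J. \<phi> j (cl k_lt p) * f (cl k_lt j))"
    using emb_finsum[OF vspace_base, of J "\<lambda>j. \<phi> j (cl k_lt p) * f (cl k_lt j)"] D
    by (simp add: dual_family_def finsum_base_field)
  finally show ?thesis
    by (rule emb_eqD[OF vspace_base]) simp_all
qed

lemma dual_family_vector:
  fixes \<kappa> :: "('k list \<Rightarrow>\<^sub>0 'f) \<Rightarrow> 'k"
  assumes D: "dual_family F J \<phi>" and p: "p \<in> FA k_lt"
    and \<kappa>: "\<And>p q. \<kappa> (p + q) = \<kappa> p + \<kappa> q" "\<And>c p. \<kappa> (fscale c p) = scale c (\<kappa> p)" "\<And>r. r \<in> env_ideal k_lt \<Longrightarrow> \<kappa> r = 0"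
      "\<And>c w. c \<notin> F \<Longrightarrow> hw k_lt c w \<Longrightarrow> \<kappa> (bas w) = 0"
  shows "\<kappa> p = (\<Sum>j\<in>J. scale (\<phi> j (cl k_lt p)) (\<kappa> j))"
proof -
  have k0: "\<kappa> 0 = 0"
    using \<kappa>(1)[of 0 0] by simp
  have "{bas w | w c. c \<notin> F \<and> hw k_lt c w} \<union> env_ideal k_lt \<subseteq> {q. \<kappa> q = 0}"
    using \<kappa>(3,4) by auto
  moreover have "fs.subspace {q. \<kappa> q = 0}"
    by (rule fs.subspaceI) (simp_all add: k0 \<kappa>(1,2))
  ultimately have "fspan ({bas w | w c. c \<notin> F \<and> hw k_lt c w} \<union> env_ideal k_lt) \<subseteq> {q. \<kappa> q = 0}"
    by (rule fs.span_minimal)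
  hence "\<kappa> (p - (\<Sum>j\<in>J. fscale (\<phi> j (cl k_lt p)) j)) = 0"
    using D p unfolding dual_family_def by blast
  moreover have "\<kappa> (\<Sum>j\<in>A. fscale (\<phi> j (cl k_lt p)) j) = (\<Sum>j\<in>A. scale (\<phi> j (cl k_lt p)) (\<kappa> j))" for A
    by (induction A rule: infinite_finite_induct) (simp_all add: k0 \<kappa>(1,2))
  ultimately show ?thesis
    using \<kappa>(1)[of "p - (\<Sum>j\<in>J. fscale (\<phi> j (cl k_lt p)) j)" "\<Sum>j\<in>J. fscale (\<phi> j (cl k_lt p)) j"] by simp
qed

text \<open>Functionals on N are handled on representatives, so that the shift by a letter,
  \<open>k (bas [y] * p)\<close> as a function of p, stays inside the same notion.\<close>

definition functional :: "(('k list \<Rightarrow>\<^sub>0 'f) \<Rightarrow> 'f) \<Rightarrow> bool" where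
  "functional k \<longleftrightarrow> (\<forall>p\<in>FA k_lt. \<forall>q\<in>FA k_lt. k (p + q) = k p + k q) \<and>
     (\<forall>c. \<forall>p\<in>FA k_lt. k (fscale c p) = c * k p) \<and> (\<forall>r\<in>env_ideal k_lt. k r = 0)"

lemma functionalD:
  assumes "functional k"
  shows "p \<in> FA k_lt \<Longrightarrow> q \<in> FA k_lt \<Longrightarrow> k (p + q) = k p + k q"
    and "p \<in> FA k_lt \<Longrightarrow> k (fscale c p) = c * k p"
    and "r \<in> env_ideal k_lt \<Longrightarrow> k r = 0"
    and "k 0 = 0"
  using assms ideal_closed(1)[of k_lt] unfolding functional_def by blast+

lemma functional_diff: "\<lbrakk>functional k; p \<in> FA k_lt; q \<in> FA k_lt\<rbrakk> \<Longrightarrow> k (p - q) = k p - k q"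
  using functionalD(1)[of k "p - q" q] by (simp add: free_on_closed)

lemma functional_N_dual: "f \<in> carrier N_dual \<Longrightarrow> functional (\<lambda>p. f (cl k_lt p))"
  unfolding functional_def by (simp add: N_dual_fun)

lemma functional_shift:
  assumes k: "functional k" and y: "y \<in> k_lt"
  shows "functional (\<lambda>p. k (bas [y] * p))"
proof -
  have y: "bas [y] \<in> FA k_lt"
    using y by (intro bas_free_on) simp
  thus ?thesis
    unfolding functional_def
    by (simp add: distrib_left fscale_mult_right functionalD[OF k] free_on_closed env_ideal_left)
qed

text \<open>The correction sum_i [X, w_i]_0 (w without w_i) after \<open>k\<close> has been applied
  to its factor in N; what remains is an element of degree 0 of the Lie algebra.\<close>

definition kappa :: "'k \<Rightarrow> (('k list \<Rightarrow>\<^sub>0 'f) \<Rightarrow> 'f) \<Rightarrow> 'k list \<Rightarrow> 'k" where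
  "kappa X k w = (\<Sum>i<length w. scale (k (bas (omit i w))) (component 0 (bracket X (w ! i))))"

lemma kappa_Nil [simp]: "kappa X k [] = 0"
  and kappa_Cons: "kappa X k (y # w) = scale (k (bas w)) (component 0 (bracket X y)) + kappa X (\<lambda>p. k (bas [y] * p)) w"
  by (simp_all add: kappa_def sum.lessThan_Suc_shift bas_mult del: sum.lessThan_Suc)

lemma kappa_add: "kappa X (\<lambda>p. k p + k' p) w = kappa X k w + kappa X k' w"
  and kappa_scale: "kappa X (\<lambda>p. c * k p) w = scale c (kappa X k w)"
  by (simp_all add: kappa_def scale_left_distrib sum.distrib scale_sum_right)

lemma kappa_cong:
  "w \<in> lists k_lt \<Longrightarrow> (\<And>u. u \<in> lists k_lt \<Longrightarrow> k (bas u) = k' (bas u)) \<Longrightarrow> kappa X k w = kappa X k' w"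
  by (simp add: kappa_def omit_lists)

lemma component_0_zgr: "component 0 v \<in> zgr 0"
  unfolding zgr_0 by (rule dec(2)) (rule Gam_closed)

lemma subspace_zgr: "subspace (zgr i)"
  unfolding zgr_eq by (rule subspace_supp_sub)

lemma kappa_zgr: "kappa X k w \<in> zgr 0"
  unfolding kappa_def by (intro subspace_sum[OF subspace_zgr] subspace_scale[OF subspace_zgr] component_0_zgr)

lemma kappa_ext_zgr: "flin scale (kappa X k) p \<in> zgr 0"
  unfolding flin_def by (intro subspace_sum[OF subspace_zgr] subspace_scale[OF subspace_zgr] kappa_zgr)

lemma kappa_ext_Cons:
  assumes k: "functional k" and y: "y \<in> k_lt" and p: "p \<in> FA k_lt"
  shows "flin scale (kappa X k) (bas [y] * p) =
    scale (k p) (component 0 (bracket X y)) + flin scale (kappa X (\<lambda>p. k (bas [y] * p))) p"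
  using p
proof (induction rule: free_on_induct)
  case zero
  thus ?case
    by (simp add: functionalD(4)[OF k])
next
  case (bas w)
  thus ?case
    by (simp add: bas_mult kappa_Cons)
next
  case (add p q)
  thus ?case
    by (simp add: distrib_left flin_add functionalD(1)[OF k] scale_left_distrib)
next
  case (scale c p)
  thus ?case
    by (simp add: fscale_mult_right flin_scale functionalD(2)[OF k] scale_right_distrib)
qed

text \<open>A letter contributes only if its degree is -d; removing it from a word of degree c
  leaves degree c + d.\<close>

lemma kappa_vanish:
  assumes X: "d \<in> Gam S" "X \<in> gr d"
  shows "hw k_lt c w \<Longrightarrow> (\<And>u. hw k_lt (c + d) u \<Longrightarrow> k (bas u) = 0) \<Longrightarrow> kappa X k w = 0"
proof (induction arbitrary: k rule: hw_induct)
  case Nil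
  thus ?case
    by simp
next
  case (Cons y e c w)
  have "k (bas w) = 0 \<or> component 0 (bracket X y) = 0"
  proof (cases "d + e = 0")
    case True
    hence "e + c + d = c"
      by (metis add.commute add.left_commute add.right_neutral)
    hence "hw k_lt (e + c + d) w"
      by (simp only: Cons.hyps(4))
    thus ?thesis
      using Cons.prems by blast
  next
    case False
    thus ?thesis
      using component_gr[OF Gam_closed(2)[OF X(1) Cons.hyps(3)] gr_bracket[OF X(1) Cons.hyps(3) X(2) Cons.hyps(2)], of 0] by simp
  qed
  moreover have "kappa X (\<lambda>p. k (bas [y] * p)) w = 0"
  proof (rule Cons.IH)
    fix u assume "hw k_lt (c + d) u"
    hence "hw k_lt (e + c + d) (y # u)"
      using hw_Cons[OF Cons.hyps(1-3)] by (simp add: add.assoc)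
    thus "k (bas [y] * bas u) = 0"
      using Cons.prems by (simp add: bas_mult)
  qed
  ultimately show ?case
    by (auto simp: kappa_Cons)
qed

text \<open>This is the part in \<open>k_lt\<close> only for v of height at most 0, the case that
  occurs for brackets [X, y]; see \<open>lt_part_closed\<close>.\<close>

definition lt_part :: "'k \<Rightarrow> 'k" where
  "lt_part v = v - component 0 v"

text \<open>This is D(w). For the word y w, put y in front of the formula for w X. Then y X w
  contributes -[X, y] w, whose part in \<open>k_lt\<close> gives the first summand, and replacing
  each y [X, w_i]_0 by [X, w_i]_0 y costs the brackets in the last sum.\<close>

primrec straight :: "'k \<Rightarrow> 'k list \<Rightarrow> ('k list \<Rightarrow>\<^sub>0 'f)" where
  "straight X [] = 0"
| "straight X (y # w) = bas (lt_part (bracket X y) # w) + bas [y] * straight X w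
     - (\<Sum>i<length w. bas (bracket (component 0 (bracket X (w ! i))) y # omit i w))"

lemma k_lt_word_rels:
  assumes "a \<in> L" "b \<in> L" "u \<in> lists L"
  shows "bas ((a + b) # u) - bas (a # u) - bas (b # u) \<in> env_ideal L"
    and "bas (scale c a # u) - fscale c (bas (a # u)) \<in> env_ideal L"
    and "bas (a # b # u) - bas (b # a # u) - bas (bracket a b # u) \<in> env_ideal L"
proof -
  have u: "bas u \<in> FA L"
    using assms by (intro bas_free_on)
  have "(bas [a + b] - bas [a] - bas [b]) * bas u \<in> env_ideal L"
    "(bas [scale c a] - fscale c (bas [a])) * bas u \<in> env_ideal L"
    "(bas [a] * bas [b] - bas [b] * bas [a] - bas [bracket a b]) * bas u \<in> env_ideal L"
    using assms by (intro env_ideal_right[OF u] env_ideal_gen; unfold env_gens_def; blast)+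
  thus "bas ((a + b) # u) - bas (a # u) - bas (b # u) \<in> env_ideal L"
    "bas (scale c a # u) - fscale c (bas (a # u)) \<in> env_ideal L"
    "bas (a # b # u) - bas (b # a # u) - bas (bracket a b # u) \<in> env_ideal L"
    by (simp_all add: left_diff_distrib bas_mult fscale_mult_left)
qed

context
  fixes X
  assumes X: "X \<in> supp_sub (\<lambda>a. ht a \<le> 1)"
begin

text \<open>A bracket of two elements of \<open>k_lt\<close> has height at most -2, so bracketing it
  with X of height at most 1 leaves negative height. Because of this \<open>kappa\<close> respects
  commutators.\<close>

lemma component_bracket_bracket:
  assumes "x \<in> k_lt" "y \<in> k_lt"
  shows "component 0 (bracket X (bracket x y)) = 0"
proof -
  have "bracket x y \<in> supp_sub (\<lambda>a. ht a \<le> - 2)"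
    by (rule supp_sub_bracket[OF _ assms[unfolded k_lt_eq]]) (simp add: ht_add)
  from supp_sub_bracket[OF _ X this] have "bracket X (bracket x y) \<in> supp_sub (\<lambda>a. ht a < 0)"
    by (simp add: ht_add)
  thus ?thesis
    by (rule supp_subD) simp
qed

lemma lt_part_closed:
  assumes v: "v \<in> supp_sub (\<lambda>a. ht a \<le> 0)"
  shows "lt_part v \<in> k_lt"
  unfolding k_lt_eq supp_sub_def lt_part_def
proof (intro CollectI allI impI)
  fix a assume a: "component a (v - component 0 v) \<noteq> 0"
  have "component a (v - component 0 v) = component a v - component a (component 0 v)"
    using component_add[of a "v - component 0 v" "component 0 v"] by simp
  also have "component a (component 0 v) = (if a = 0 then component 0 v else 0)"
    by (rule component_gr[OF Gam_closed(1) dec(2)[OF Gam_closed(1)]])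
  finally have a0: "a \<noteq> 0" "component a v \<noteq> 0"
    using a by (auto split: if_splits)
  hence "a \<in> Gam S" "ht a \<le> 0"
    using component_outside v by (auto simp: supp_sub_def)
  moreover have "ht a \<noteq> 0"
    using ht_sum_zero gr_sign[OF \<open>a \<in> Gam S\<close> dec(2)[OF \<open>a \<in> Gam S\<close>] a0(2)] a0(1) by blast
  ultimately show "ht a < 0"
    by simp
qed

lemma bracket_ht: "y \<in> k_lt \<Longrightarrow> bracket X y \<in> supp_sub (\<lambda>a. ht a \<le> 0)"
  by (rule supp_sub_bracket[OF _ X, where Q = "\<lambda>a. ht a < 0"]) (simp_all add: ht_add k_lt_eq)

lemma zgr_bracket_k_lt: "z \<in> zgr 0 \<Longrightarrow> y \<in> k_lt \<Longrightarrow> bracket z y \<in> k_lt"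
  unfolding zgr_eq k_lt_eq by (rule supp_sub_bracket) (simp_all add: ht_add)

lemma straight_FA: "w \<in> lists k_lt \<Longrightarrow> straight X w \<in> FA k_lt"
proof (induction w)
  case (Cons y w)
  hence "(\<Sum>i<length w. bas (bracket (component 0 (bracket X (w ! i))) y # omit i w)) \<in> FA k_lt"
    by (intro fs.subspace_sum[OF subspace_free_on] bas_free_on)
       (simp add: omit_lists zgr_bracket_k_lt component_0_zgr)
  moreover have "bas (lt_part (bracket X y) # w) \<in> FA k_lt" "bas [y] \<in> FA k_lt"
    using Cons by (auto intro!: bas_free_on lt_part_closed bracket_ht)
  ultimately show ?case
    using Cons by (simp add: free_on_closed)
qed (simp add: free_on_closed)

text \<open>The formula for w X as a membership in the ideal. In the induction the expression for y
  w is y times the one for w, combined with the commutator relation of X and y, the additivity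
  relation for the splitting of [X, y], and one commutator relation of y for each letter of
  w.\<close>

lemma straighten_word:
  "bas (w @ [X]) - bas (X # w) + (\<Sum>i<length w. bas (component 0 (bracket X (w ! i)) # omit i w)) + straight X w
     \<in> env_ideal UNIV"
proof (induction w)
  case (Cons y w)
  let ?z = "\<lambda>i. component 0 (bracket X (w ! i))"
  let ?b = "bas :: 'k list \<Rightarrow> 'k list \<Rightarrow>\<^sub>0 'f"
  have 1: "?b [y] * (bas (w @ [X]) - bas (X # w) + (\<Sum>i<length w. bas (?z i # omit i w)) + straight X w) \<in> env_ideal UNIV"
    by (rule env_ideal_left[OF _ Cons]) simp
  have 2: "?b (X # y # w) - bas (y # X # w) - bas (bracket X y # w) \<in> env_ideal UNIV"
    by (rule k_lt_word_rels(3)) simp_all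
  have 3: "?b ((component 0 (bracket X y) + lt_part (bracket X y)) # w) - bas (component 0 (bracket X y) # w)
      - bas (lt_part (bracket X y) # w) \<in> env_ideal UNIV"
    by (rule k_lt_word_rels(1)) simp_all
  have 4: "(\<Sum>i<length w. ?b (?z i # y # omit i w) - bas (y # ?z i # omit i w) - bas (bracket (?z i) y # omit i w)) \<in> env_ideal UNIV"
    by (intro fs.subspace_sum[OF subspace_ideal] k_lt_word_rels(3)) simp_all
  have eq: "?b ((y # w) @ [X]) - bas (X # y # w) + (\<Sum>i<length (y # w). bas (component 0 (bracket X ((y # w) ! i)) # omit i (y # w))) +
      straight X (y # w) =
    ?b [y] * (bas (w @ [X]) - bas (X # w) + (\<Sum>i<length w. bas (?z i # omit i w)) + straight X w)
    - (?b (X # y # w) - bas (y # X # w) - bas (bracket X y # w))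
    - (?b ((component 0 (bracket X y) + lt_part (bracket X y)) # w) - bas (component 0 (bracket X y) # w)
      - bas (lt_part (bracket X y) # w))
    + (\<Sum>i<length w. ?b (?z i # y # omit i w) - bas (y # ?z i # omit i w) - bas (bracket (?z i) y # omit i w))"
    by (simp add: sum.lessThan_Suc_shift distrib_left right_diff_distrib bas_mult sum_distrib_left sum_subtractf lt_part_def
        del: sum.lessThan_Suc)
  show ?case
    unfolding eq by (rule ideal_closed(2)[OF ideal_closed(4)[OF ideal_closed(4)[OF 1 2] 3] 4])
qed (simp add: ideal_closed)

text \<open>Needed for \<open>kappa\<close> to descend to N. The prefix is removed letter by letter,
  each bracket term carrying a value of \<open>k\<close> on the ideal. At the empty prefix a
  commutator [x, y] has no bracket term by \<open>component_bracket_bracket\<close>, and the other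
  terms cancel because \<open>k\<close> vanishes on the ideal.\<close>

lemma kappa_ideal_word:
  assumes g: "g \<in> env_gens k_lt" and w: "w \<in> lists k_lt"
  shows "u \<in> lists k_lt \<Longrightarrow> functional k \<Longrightarrow> flin scale (kappa X k) (bas u * g * bas w) = 0"
proof (induction u arbitrary: k)
  case Nil
  note k = Nil(2)
  have fa: "bas u \<in> FA k_lt" if "u \<in> lists k_lt" for u
    using that by (rule bas_free_on)
  show ?case
    using g
  proof (cases rule: env_gens_cases)
    case (add x y)
    have e: "k (bas ((x + y) # u)) = k (bas (x # u)) + k (bas (y # u))" if "u \<in> lists k_lt" for u
      using functionalD(3)[OF k k_lt_word_rels(1)[OF add(1,2) that]] add that
      by (simp add: functional_diff[OF k] fa free_on_closed sub_N[unfolded lie_subalgebra_def] subspace_add diff_eq_eq add.commute)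
    have "kappa X (\<lambda>p. k (bas [x + y] * p)) w = kappa X (\<lambda>p. k (bas [x] * p) + k (bas [y] * p)) w"
      by (rule kappa_cong[OF w]) (simp add: bas_mult e)
    thus ?thesis
      unfolding add(3)
      by (simp add: left_diff_distrib bas_mult bas_Nil flin_diff kappa_Cons kappa_add bracket_add_right component_add scale_right_distrib)
  next
    case (scale c x)
    have e: "k (bas (scale c x # u)) = c * k (bas (x # u))" if "u \<in> lists k_lt" for u
      using functionalD(3)[OF k k_lt_word_rels(2)[OF scale(1,1) that]] scale that functionalD(2)[OF k]
      by (simp add: functional_diff[OF k] fa free_on_closed sub_N[unfolded lie_subalgebra_def] subspace_scale)
    have "kappa X (\<lambda>p. k (bas [scale c x] * p)) w = kappa X (\<lambda>p. c * k (bas [x] * p)) w"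
      by (rule kappa_cong[OF w]) (simp add: bas_mult e)
    thus ?thesis
      unfolding scale(2)
      by (simp add: left_diff_distrib bas_mult bas_Nil flin_diff flin_scale fscale_mult_left kappa_Cons kappa_scale bracket_scale_right
        component_scale scale_right_distrib mult.commute)
  next
    case (bracket x y)
    have xy: "bracket x y \<in> k_lt"
      using bracket sub_N by (simp add: lie_subalgebra_def)
    have e: "k (bas (x # y # u)) = k (bas (y # x # u)) + k (bas (bracket x y # u))" if "u \<in> lists k_lt" for u
      using functionalD(3)[OF k k_lt_word_rels(3)[OF bracket(1,2) that]] bracket that xy
      by (simp add: functional_diff[OF k] fa free_on_closed diff_eq_eq add.commute)
    have "kappa X (\<lambda>p. k (bas [x, y] * p)) w = kappa X (\<lambda>p. k (bas [y, x] * p) + k (bas [bracket x y] * p)) w"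
      by (rule kappa_cong[OF w]) (simp add: bas_mult e)
    hence "kappa X (\<lambda>p. k (bas [x, y] * p)) w = kappa X (\<lambda>p. k (bas [y, x] * p)) w + kappa X (\<lambda>p. k (bas [bracket x y] * p)) w"
      by (simp only: kappa_add)
    thus ?thesis
      unfolding bracket(3)
      by (simp add: left_diff_distrib bas_mult bas_Nil flin_diff kappa_Cons component_bracket_bracket[OF bracket(1,2)]
          mult.assoc[symmetric])
  qed
next
  case (Cons y u)
  have g': "bas u * g * bas w \<in> env_ideal k_lt"
    using Cons.prems w by (intro env_ideal_left env_ideal_right env_ideal_gen[OF g]) (simp_all add: bas_free_on)
  have "bas (y # u) * g * bas w = bas [y] * (bas u * g * bas w)"
    by (simp add: mult.assoc[symmetric] bas_mult)
  moreover have "bas u * g * bas w \<in> FA k_lt"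
    using g' env_ideal_sub[OF sub_N] by blast
  ultimately show ?case
    using kappa_ext_Cons[OF Cons.prems(2), of y] Cons.prems(1) Cons.IH[OF _ functional_shift[OF Cons.prems(2)]] functionalD(3)[OF Cons.prems(2) g']
    by simp
qed

lemma kappa_ideal:
  assumes k: "functional k" and r: "r \<in> env_ideal k_lt"
  shows "flin scale (kappa X k) r = 0"
proof -
  have "fspan {bas u * g * bas w | u w g. u \<in> lists k_lt \<and> w \<in> lists k_lt \<and> g \<in> env_gens k_lt} \<subseteq> {r. flin scale (kappa X k) r = 0}"
  proof (rule fs.span_minimal)
    show "fs.subspace {r. flin scale (kappa X k) r = 0}"
      by (rule fs.subspaceI) (simp_all add: flin_add flin_scale)
  qed (use kappa_ideal_word[OF _ _ _ k] in blast)
  thus ?thesis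
    using r unfolding env_ideal_span by blast
qed

end

end

section \<open>Commutation on \<open>f \<otimes> 1\<close>\<close>

context triangular_lie_algebra
begin

text \<open>Values in \<open>kgB\<close> are compared in its embedding, where those that occur are
  written as some \<open>bet x\<close> plus a multiple of \<open>beta one_B\<close>.\<close>

definition beta :: "('k list \<Rightarrow>\<^sub>0 'f) set \<Rightarrow> (('f \<times> ('k list \<Rightarrow>\<^sub>0 'f) set \<Rightarrow>\<^sub>0 'f) set \<Rightarrow>\<^sub>0 'f)" where
  "beta b = emb kgB (kgB_tens 1 b)"

lemma beta_tens: "b \<in> carrier B \<Longrightarrow> emb kgB (kgB_tens c b) = fscale c (beta b)"
  using bilin_smult_left[OF kgB_bilin, of 1 b c]
  by (simp add: beta_def emb_smult[OF vspace_kgB] kgB_tens_closed)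

lemma beta_add: "b \<in> carrier B \<Longrightarrow> b' \<in> carrier B \<Longrightarrow> beta (b \<oplus>\<^bsub>B\<^esub> b') = beta b + beta b'"
  and beta_smult: "b \<in> carrier B \<Longrightarrow> beta (c \<odot>\<^bsub>B\<^esub> b) = fscale c (beta b)"
  by (simp_all add: beta_def bilin_add_right[OF kgB_bilin] bilin_smult_right[OF kgB_bilin] emb_add[OF vspace_kgB]
      emb_smult[OF vspace_kgB] kgB_tens_closed)

abbreviation "bet x \<equiv> beta (env_in k_ge x)"
abbreviation "one_B \<equiv> \<one>\<^bsub>B\<^esub>"

lemma k_ge_closed: "x \<in> k_ge \<Longrightarrow> y \<in> k_ge \<Longrightarrow> x + y \<in> k_ge" "x \<in> k_ge \<Longrightarrow> scale c x \<in> k_ge" "0 \<in> k_ge"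
  "x \<in> k_ge \<Longrightarrow> y \<in> k_ge \<Longrightarrow> x - y \<in> k_ge"
  using sub_B unfolding lie_subalgebra_def by (simp_all add: subspace_add subspace_scale subspace_0 subspace_diff)

lemma k_lt_closed: "x \<in> k_lt \<Longrightarrow> y \<in> k_lt \<Longrightarrow> x + y \<in> k_lt" "x \<in> k_lt \<Longrightarrow> scale c x \<in> k_lt" "0 \<in> k_lt"
  "x \<in> k_lt \<Longrightarrow> y \<in> k_lt \<Longrightarrow> x - y \<in> k_lt"
  using sub_N unfolding lie_subalgebra_def by (simp_all add: subspace_add subspace_scale subspace_0 subspace_diff)

lemma zgr_k_ge: "z \<in> zgr 0 \<Longrightarrow> z \<in> k_ge"
  by (auto simp: zgr_eq k_ge_eq supp_sub_def)

lemma zgr_ht: "z \<in> zgr 0 \<Longrightarrow> z \<in> supp_sub (\<lambda>a. ht a \<le> 1)"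
  by (auto simp: zgr_eq supp_sub_def)

lemma zgr_k_lt: "z \<in> zgr (- 1) \<Longrightarrow> z \<in> k_lt"
  by (auto simp: zgr_eq k_lt_eq supp_sub_def)

lemma component_diff: "component a (x - y) = component a x - component a y"
  using component_add[of a "x - y" y] by simp

lemma component_zgr: "z \<in> zgr 0 \<Longrightarrow> component 0 z = z"
  using component_gr[OF Gam_closed(1), of z 0] by (simp add: zgr_0)

lemma component_k_lt: "z \<in> k_lt \<Longrightarrow> component 0 z = 0"
  unfolding k_lt_eq by (rule supp_subD[of z "\<lambda>a. ht a < 0"]) simp_all

lemma bet_add: "x \<in> k_ge \<Longrightarrow> y \<in> k_ge \<Longrightarrow> bet (x + y) = bet x + bet y"
  and bet_scale: "x \<in> k_ge \<Longrightarrow> bet (scale c x) = fscale c (bet x)"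
  by (simp_all add: env_in_add env_in_scale[where y = x] beta_add beta_smult env_in_closed)

lemma bet_diff: "x \<in> k_ge \<Longrightarrow> y \<in> k_ge \<Longrightarrow> bet (x - y) = bet x - bet y"
  using bet_add[of "x - y" y] by (simp add: k_ge_closed)

lemma bet_sum: "(\<And>i. i \<in> A \<Longrightarrow> x i \<in> k_ge) \<Longrightarrow> bet (\<Sum>i\<in>A. scale (c i) (x i)) = (\<Sum>i\<in>A. fscale (c i) (bet (x i)))"
proof (induction A rule: infinite_finite_induct)
  case (insert i A)
  have "(\<Sum>i\<in>A. scale (c i) (x i)) \<in> k_ge"
    using insert by (intro subspace_sum) (use sub_B in \<open>auto simp: lie_subalgebra_def k_ge_closed\<close>)
  thus ?case
    using insert by (simp add: bet_add bet_scale k_ge_closed)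
qed (use bet_scale[of 0 0] k_ge_closed(3) in simp_all)

lemma dual_right_word: "y \<in> k_lt \<Longrightarrow> p \<in> FA k_lt \<Longrightarrow> dual_right f (env_in k_lt y) (cl k_lt p) = f (cl k_lt (bas [y] * p))"
  unfolding env_in_def by (rule dual_right_cl) (simp_all add: bas_free_on)

lemma word_lin:
  assumes f: "f \<in> carrier N_dual" and y: "y \<in> k_lt" "y' \<in> k_lt" and w: "w \<in> lists k_lt"
  shows "f (cl k_lt (bas ((y + y') # w))) = f (cl k_lt (bas (y # w))) + f (cl k_lt (bas (y' # w)))"
    and "f (cl k_lt (bas (scale c y # w))) = c * f (cl k_lt (bas (y # w)))"
proof -
  note F = functional_N_dual[OF f]
  have b: "bas (v # w) \<in> FA k_lt" if "v \<in> k_lt" for v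
    using that w by (intro bas_free_on) simp
  note bb = b[OF y(1)] b[OF y(2)] b[OF k_lt_closed(1)[OF y]] b[OF k_lt_closed(2)[OF y(1)]]
  show "f (cl k_lt (bas ((y + y') # w))) = f (cl k_lt (bas (y # w))) + f (cl k_lt (bas (y' # w)))"
    using functionalD(3)[OF F k_lt_word_rels(1)[OF y w]]
    unfolding functional_diff[OF F free_on_closed(4)[OF bb(3) bb(1)] bb(2)] functional_diff[OF F bb(3) bb(1)]
    by (simp add: diff_eq_eq add.commute)
  have s: "fscale c (bas (y # w)) \<in> FA k_lt"
    by (rule free_on_closed(3)[OF bb(1)])
  show "f (cl k_lt (bas (scale c y # w))) = c * f (cl k_lt (bas (y # w)))"
    using functionalD(3)[OF F k_lt_word_rels(2)[OF y(1) y(1) w, of c]]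
    unfolding functional_diff[OF F bb(4) s] functionalD(2)[OF F bb(1)] by simp
qed

lemma word_diff:
  assumes f: "f \<in> carrier N_dual" and y: "y \<in> k_lt" "y' \<in> k_lt" and w: "w \<in> lists k_lt"
  shows "f (cl k_lt (bas ((y - y') # w))) = f (cl k_lt (bas (y # w))) - f (cl k_lt (bas (y' # w)))"
  using word_lin(1)[OF f k_lt_closed(4)[OF y] y(2) w] by simp

text \<open>L_X (f \<otimes> 1), viewed as a map on N, sends p to an element of \<open>k_ge\<close>
  plus a scalar; this is the former, and \<open>spart\<close> is the latter. See
  \<open>phi_straight\<close>.\<close>

definition xpart :: "'k \<Rightarrow> ((('k list \<Rightarrow>\<^sub>0 'f) set) \<Rightarrow> 'f) \<Rightarrow> ('k list \<Rightarrow>\<^sub>0 'f) \<Rightarrow> 'k" where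
  "xpart X f p = scale (f (cl k_lt p)) X - flin scale (kappa X (\<lambda>p. f (cl k_lt p))) p"

lemma xpart_k_ge: "X \<in> k_ge \<Longrightarrow> xpart X f p \<in> k_ge"
  unfolding xpart_def by (rule k_ge_closed(4)[OF k_ge_closed(2) zgr_k_ge[OF kappa_ext_zgr]])

lemma xpart_ht: "X \<in> supp_sub (\<lambda>a. ht a \<le> 1) \<Longrightarrow> xpart X f p \<in> supp_sub (\<lambda>a. ht a \<le> 1)"
  unfolding xpart_def
  by (rule subspace_diff[OF subspace_supp_sub subspace_scale[OF subspace_supp_sub] zgr_ht[OF kappa_ext_zgr]])

text \<open>x Y = Y x + [x, Y], where [x, Y] has height at most 0. Its part in degree 0 stays in B,
  and its part in \<open>k_lt\<close> moves over to f, like Y itself. An element b of this affine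
  form is what L_X (f \<otimes> 1) takes as values.\<close>

lemma right_act_tens_affine:
  assumes f: "f \<in> carrier N_dual" and x: "x \<in> k_ge" "x \<in> supp_sub (\<lambda>a. ht a \<le> 1)" and Y: "Y \<in> zgr (- 1)"
    and b: "b = env_in k_ge x \<oplus>\<^bsub>B\<^esub> s \<odot>\<^bsub>B\<^esub> one_B"
  shows "right_act (NB_tens f b) (env_in UNIV Y) = NB_tens (dual_right f (env_in k_lt Y)) b \<oplus>\<^bsub>NB\<^esub>
     (NB_tens f (env_in k_ge (component 0 (bracket x Y))) \<oplus>\<^bsub>NB\<^esub> NB_tens (dual_right f (env_in k_lt (lt_part (bracket x Y)))) one_B)"
proof -
  interpret A: abelian_group NB
    by (rule vspace_abelian[OF vspace_NB])
  have Yl: "Y \<in> k_lt"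
    by (rule zgr_k_lt[OF Y])
  let ?br = "bracket x Y"
  let ?ze = "component 0 ?br"
  let ?lt = "lt_part ?br"
  have v0: "?ze \<in> k_ge"
    by (rule zgr_k_ge[OF component_0_zgr])
  have v1: "?lt \<in> k_lt"
    by (rule lt_part_closed[OF x(2) bracket_ht[OF x(2) Yl]])
  have xB: "env_in k_ge x \<in> carrier B" "env_in k_ge ?ze \<in> carrier B" "one_B \<in> carrier B" "s \<odot>\<^bsub>B\<^esub> one_B \<in> carrier B"
    by (simp_all add: env_in_closed x v0 env_one_closed env_smult_closed)
  have yN: "env_in k_lt Y \<in> carrier N" "env_in k_lt ?lt \<in> carrier N"
    by (simp_all add: env_in_closed Yl v1)
  have uU: "env_in UNIV z \<in> carrier U" for z
    by (simp add: env_in_closed)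
  have fY: "dual_right f (env_in k_lt Y) \<in> carrier N_dual" "dual_right f (env_in k_lt ?lt) \<in> carrier N_dual"
    by (rule dual_right_closed[OF f yN(1)], rule dual_right_closed[OF f yN(2)])
  have f1: "NB_tens f one_B \<in> carrier NB"
    by (rule tens_closed[OF f xB(3)])
  have RB: "right_act (NB_tens g one_B) (env_in UNIV z) = NB_tens g (env_in k_ge z)" if "g \<in> carrier N_dual" "z \<in> k_ge" for g z
    using right_act_B[OF that(1) env_one_closed env_in_closed[OF that(2)]]
    by (simp add: env_incl_in env_one_left[OF sub_B env_in_closed[OF that(2)]])
  have RN: "right_act (NB_tens f one_B) (env_in UNIV z) = NB_tens (dual_right f (env_in k_lt z)) one_B" if "z \<in> k_lt" for z
    using right_act_N[OF f env_in_closed[OF that]] by (simp add: env_incl_in)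
  have "env_in UNIV ?br = env_in UNIV (?ze + ?lt)"
    by (simp add: lt_part_def)
  also have "\<dots> = env_in UNIV ?ze \<oplus>\<^bsub>U\<^esub> env_in UNIV ?lt"
    by (rule env_in_add) simp_all
  finally have c: "env_in UNIV x \<cdot> env_in UNIV Y =
      env_in UNIV Y \<cdot> env_in UNIV x \<oplus>\<^bsub>U\<^esub> (env_in UNIV ?ze \<oplus>\<^bsub>U\<^esub> env_in UNIV ?lt)"
    using env_in_bracket[OF sub_U, of x Y] by simp
  have "right_act (NB_tens f (env_in k_ge x)) (env_in UNIV Y) = right_act (NB_tens f one_B) (env_in UNIV x \<cdot> env_in UNIV Y)"
    by (simp add: right_act_add_elt(3)[OF uU uU f1] RB[OF f x(1)])
  also have "\<dots> = right_act (right_act (NB_tens f one_B) (env_in UNIV Y)) (env_in UNIV x) \<oplus>\<^bsub>NB\<^esub>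
     (right_act (NB_tens f one_B) (env_in UNIV ?ze) \<oplus>\<^bsub>NB\<^esub> right_act (NB_tens f one_B) (env_in UNIV ?lt))"
    unfolding c
    by (simp add: right_act_add_elt(1)[OF _ _ f1] right_act_add_elt(3)[OF uU uU f1] U_mult_closed[OF uU uU] uU env_add_closed)
  also have "\<dots> = NB_tens (dual_right f (env_in k_lt Y)) (env_in k_ge x) \<oplus>\<^bsub>NB\<^esub>
     (NB_tens f (env_in k_ge ?ze) \<oplus>\<^bsub>NB\<^esub> NB_tens (dual_right f (env_in k_lt ?lt)) one_B)"
    by (simp add: RN[OF Yl] RN[OF v1] RB[OF fY(1) x(1)] RB[OF f v0])
  finally have 1: "right_act (NB_tens f (env_in k_ge x)) (env_in UNIV Y) = NB_tens (dual_right f (env_in k_lt Y)) (env_in k_ge x) \<oplus>\<^bsub>NB\<^esub>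
     (NB_tens f (env_in k_ge ?ze) \<oplus>\<^bsub>NB\<^esub> NB_tens (dual_right f (env_in k_lt ?lt)) one_B)" .
  have e: "NB_tens g b = NB_tens g (env_in k_ge x) \<oplus>\<^bsub>NB\<^esub> s \<odot>\<^bsub>NB\<^esub> NB_tens g one_B" if "g \<in> carrier N_dual" for g
    unfolding b by (simp add: bilin_add_right[OF bilin_tens that xB(1,4)] bilin_smult_right[OF bilin_tens that xB(3)])
  have t: "NB_tens f (env_in k_ge x) \<in> carrier NB" "NB_tens f (env_in k_ge ?ze) \<in> carrier NB"
    "NB_tens (dual_right f (env_in k_lt Y)) (env_in k_ge x) \<in> carrier NB" "NB_tens (dual_right f (env_in k_lt Y)) one_B \<in> carrier NB"
    "NB_tens (dual_right f (env_in k_lt ?lt)) one_B \<in> carrier NB"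
    by (intro tens_closed f fY xB)+
  show ?thesis
    unfolding e[OF f] e[OF fY(1)] right_act_add[OF uU t(1) vspace_smult_closed[OF vspace_NB f1]] right_act_smult[OF uU f1] 1 RN[OF Yl]
    using t vspace_smult_closed[OF vspace_NB t(4)] by (simp add: A.a_ac A.add.m_closed)
qed

section \<open>Explicit form of L_X on f \<otimes> 1\<close>

context
  fixes \<gamma> :: "'k \<Rightarrow> 'f"
  assumes char: "character \<gamma>"
begin

lemma gamma_add: "x \<in> zgr 0 \<Longrightarrow> y \<in> zgr 0 \<Longrightarrow> \<gamma> (x + y) = \<gamma> x + \<gamma> y"
  and gamma_scale: "x \<in> zgr 0 \<Longrightarrow> \<gamma> (scale c x) = c * \<gamma> x"
  using char unfolding character_def by blast+

lemma gamma_zero: "\<gamma> 0 = 0"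
  using gamma_scale[of 0 0] subspace_0[OF subspace_zgr] by simp

lemma gamma_sum: "(\<And>i. i \<in> A \<Longrightarrow> x i \<in> zgr 0) \<Longrightarrow> \<gamma> (\<Sum>i\<in>A. scale (c i) (x i)) = (\<Sum>i\<in>A. c i * \<gamma> (x i))"
proof (induction A rule: infinite_finite_induct)
  case (insert i A)
  have "(\<Sum>i\<in>A. scale (c i) (x i)) \<in> zgr 0"
    using insert by (intro subspace_sum[OF subspace_zgr] subspace_scale[OF subspace_zgr]) auto
  thus ?case
    using insert by (simp add: gamma_add gamma_scale subspace_scale[OF subspace_zgr])
qed (simp_all add: gamma_zero)

text \<open>The scalar part has three sources: \<gamma> of X and \<gamma> of the elements
  [X, w_i]_0, both from the twist in the left action on \<open>kgB\<close>, and f applied to the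
  remainder D.\<close>

definition spart :: "'k \<Rightarrow> ((('k list \<Rightarrow>\<^sub>0 'f) set) \<Rightarrow> 'f) \<Rightarrow> ('k list \<Rightarrow>\<^sub>0 'f) \<Rightarrow> 'f" where
  "spart X f p = f (cl k_lt p) * \<gamma> (component 0 X) - \<gamma> (flin scale (kappa X (\<lambda>p. f (cl k_lt p))) p)
     - f (cl k_lt (flin fscale (straight X) p))"

text \<open>The B-linear map is evaluated on the straightened form of w X: words with first letter
  in \<open>k_ge\<close> by B-linearity, words in \<open>k_lt\<close> by f.\<close>

lemma phi_straight_word:
  assumes f: "f \<in> carrier N_dual" and X: "X \<in> k_ge" "X \<in> supp_sub (\<lambda>a. ht a \<le> 1)" and w: "w \<in> lists k_lt"
  shows "emb kgB (phi \<gamma> (NB_tens f one_B) (cl UNIV (bas w) \<cdot> env_in UNIV X)) =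
    bet (xpart X f (bas w)) + fscale (spart X f (bas w)) (beta one_B)"
proof -
  let ?F = "\<lambda>p. f (cl k_lt p)"
  let ?z = "\<lambda>i. component 0 (bracket X (w ! i))"
  have oB: "one_B \<in> carrier B"
    by (rule env_one_closed)
  have tc: "NB_tens f one_B \<in> carrier NB"
    by (rule tens_closed[OF f oB])
  let ?h = "phi \<gamma> (NB_tens f one_B)"
  have h: "?h \<in> carrier (Hom_B \<gamma>)"
    by (rule phi_closed[OF char tc])
  note hl = HB_lin[OF char h]
  have clU: "cl UNIV q \<in> carrier U" for q
    by (rule env_closed) simp
  define P where "P q = emb kgB (?h (cl UNIV q))" for q
  have P_add: "P (p + q) = P p + P q" for p q
    by (simp add: P_def env_add[symmetric] lin_add[OF hl] clU emb_add[OF vspace_kgB] lin_closed[OF hl])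
  have P_zero: "P q = 0" if "q \<in> env_ideal UNIV" for q
  proof -
    have "cl UNIV q = \<zero>\<^bsub>U\<^esub>"
      using that by (simp only: env_zero coset_zero[OF subspace_ideal] ideal_closed(1))
    thus ?thesis
      by (simp add: P_def lin_zero[OF vspace_env vspace_kgB hl] emb_zero[OF vspace_kgB])
  qed
  have P_sum: "P (sum q A) = (\<Sum>i\<in>A. P (q i))" for q and A :: "nat set"
    by (induction A rule: infinite_finite_induct) (simp_all add: P_add P_zero ideal_closed)
  have P_diff: "P (p - q) = P p - P q" for p q
    using P_add[of "p - q" q] by simp
  have P_N: "P q = fscale (?F q) (beta one_B)" if "q \<in> FA k_lt" for q
    using phi_N[OF char f oB env_closed[OF that]] by (simp add: P_def env_incl_cl beta_tens oB)
  \<comment> \<open>By the Leibniz rule x acts on f(u) \<otimes> 1 twice, once through \<gamma> and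
    once as an element of B.\<close>
  have P_ge: "P (bas (x # u)) = fscale (?F (bas u) * \<gamma> (component 0 x)) (beta one_B) + fscale (?F (bas u)) (bet x)"
    if x: "x \<in> k_ge" and u: "u \<in> lists k_lt" for x u
  proof -
    have xB: "env_in k_ge x \<in> carrier B"
      by (rule env_in_closed[OF x])
    have uN: "cl k_lt (bas u) \<in> carrier N"
      by (rule env_closed) (rule bas_free_on[OF u])
    have "cl UNIV (bas (x # u)) = env_incl (env_in k_ge x) \<cdot> env_incl (cl k_lt (bas u))"
      by (simp add: env_incl_in env_incl_cl env_in_def env_mult[OF sub_U] bas_mult)
    hence "?h (cl UNIV (bas (x # u))) = kgB_action \<gamma> (env_in k_ge x) (kgB_tens (?F (bas u)) one_B)"
      using BL_D[OF char HB_B_linear[OF char h] xB incl_closed[OF uN]] phi_N[OF char f oB uN] by simp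
    also have "\<dots> = kgB_tens (\<gamma> (component 0 x) * ?F (bas u)) one_B \<oplus>\<^bsub>kgB\<^esub> kgB_tens (?F (bas u)) (env_in k_ge x)"
      by (simp add: kgB_action_in[OF char x oB] env_one_right[OF sub_B xB])
    finally show ?thesis
      by (simp add: P_def emb_add[OF vspace_kgB] kgB_tens_closed oB xB beta_tens mult.commute)
  qed
  have "cl UNIV (bas w) \<cdot> env_in UNIV X = cl UNIV (bas (w @ [X]))"
    by (simp add: env_in_def env_mult[OF sub_U] bas_mult)
  hence "emb kgB (?h (cl UNIV (bas w) \<cdot> env_in UNIV X)) = P (bas (w @ [X]))"
    by (simp add: P_def)
  also have "\<dots> = P (bas (X # w)) - (\<Sum>i<length w. P (bas (?z i # omit i w))) - P (straight X w)"
    using P_zero[OF straighten_word[OF X(2), of w]] unfolding P_add P_diff P_sum by (simp add: algebra_simps)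
  also have "(\<Sum>i<length w. P (bas (?z i # omit i w))) =
      (\<Sum>i<length w. fscale (?F (bas (omit i w)) * \<gamma> (?z i)) (beta one_B) + fscale (?F (bas (omit i w))) (bet (?z i)))"
    by (rule sum.cong[OF refl]) (simp add: P_ge zgr_k_ge[OF component_0_zgr] omit_lists[OF w] component_zgr[OF component_0_zgr])
  also have "\<dots> = fscale (\<gamma> (kappa X ?F w)) (beta one_B) + bet (kappa X ?F w)"
    by (simp add: sum.distrib kappa_def gamma_sum component_0_zgr bet_sum zgr_k_ge[OF component_0_zgr] fs.scale_sum_left)
  finally have e: "emb kgB (?h (cl UNIV (bas w) \<cdot> env_in UNIV X)) =
      fscale (?F (bas w) * \<gamma> (component 0 X)) (beta one_B) + fscale (?F (bas w)) (bet X)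
      - (fscale (\<gamma> (kappa X ?F w)) (beta one_B) + bet (kappa X ?F w)) - fscale (?F (straight X w)) (beta one_B)"
    by (simp only: P_ge[OF X(1) w] P_N[OF straight_FA[OF X(2) w]])
  have "bet (xpart X f (bas w)) = fscale (?F (bas w)) (bet X) - bet (kappa X ?F w)"
    by (simp add: xpart_def bet_diff bet_scale X(1) k_ge_closed zgr_k_ge[OF kappa_zgr])
  moreover have "spart X f (bas w) = ?F (bas w) * \<gamma> (component 0 X) - \<gamma> (kappa X ?F w) - ?F (straight X w)"
    by (simp add: spart_def fs.flin_bas)
  ultimately show ?thesis
    unfolding e by (simp add: fs.scale_left_diff_distrib)
qed

lemma straight_ext_FA:
  assumes X: "X \<in> supp_sub (\<lambda>a. ht a \<le> 1)" and p: "p \<in> FA k_lt"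
  shows "flin fscale (straight X) p \<in> FA k_lt"
  using p by (induction rule: free_on_induct) (simp_all add: fs.flin_add fs.flin_scale free_on_closed straight_FA[OF X] fs.flin_bas)

lemma xpart_lin:
  assumes f: "f \<in> carrier N_dual" and pq: "p \<in> FA k_lt" "q \<in> FA k_lt"
  shows "xpart X f (p + q) = xpart X f p + xpart X f q" "xpart X f (fscale c p) = scale c (xpart X f p)"
  using functionalD(1)[OF functional_N_dual[OF f] pq] functionalD(2)[OF functional_N_dual[OF f] pq(1)]
  by (simp_all add: xpart_def flin_add flin_scale scale_left_distrib scale_right_diff_distrib)

lemma spart_lin:
  assumes f: "f \<in> carrier N_dual" and X: "X \<in> supp_sub (\<lambda>a. ht a \<le> 1)" and pq: "p \<in> FA k_lt" "q \<in> FA k_lt"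
  shows "spart X f (p + q) = spart X f p + spart X f q" "spart X f (fscale c p) = c * spart X f p"
proof -
  note F = functional_N_dual[OF f] and D = straight_ext_FA[OF X]
  show "spart X f (p + q) = spart X f p + spart X f q"
    unfolding spart_def flin_add fs.flin_add functionalD(1)[OF F pq] functionalD(1)[OF F D[OF pq(1)] D[OF pq(2)]]
      gamma_add[OF kappa_ext_zgr kappa_ext_zgr] distrib_right
    by simp
  show "spart X f (fscale c p) = c * spart X f p"
    unfolding spart_def flin_scale fs.flin_scale functionalD(2)[OF F pq(1)] functionalD(2)[OF F D[OF pq(1)]]
      gamma_scale[OF kappa_ext_zgr] right_diff_distrib mult.assoc ..
qed

lemma phi_straight:
  assumes f: "f \<in> carrier N_dual" and X: "X \<in> k_ge" "X \<in> supp_sub (\<lambda>a. ht a \<le> 1)" and p: "p \<in> FA k_lt"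
  shows "emb kgB (phi \<gamma> (NB_tens f one_B) (cl UNIV p \<cdot> env_in UNIV X)) =
    bet (xpart X f p) + fscale (spart X f p) (beta one_B)"
proof -
  have tc: "NB_tens f one_B \<in> carrier NB"
    by (rule tens_closed[OF f env_one_closed])
  note hl = HB_lin[OF char phi_closed[OF char tc]]
  have clU: "cl UNIV q \<in> carrier U" for q
    by (rule env_closed) simp
  have iU: "env_in UNIV X \<in> carrier U"
    by (rule env_in_closed) simp
  define P where "P q = emb kgB (phi \<gamma> (NB_tens f one_B) (cl UNIV q \<cdot> env_in UNIV X))" for q
  have P_add: "P (p + q) = P p + P q" for p q
    unfolding P_def env_add[symmetric] bilin_add_left[OF bilin_env_mult[OF sub_U] clU iU clU]
    by (simp add: lin_add[OF hl] U_mult_closed clU iU emb_add[OF vspace_kgB] lin_closed[OF hl])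
  have P_scale: "P (fscale c p) = fscale c (P p)" for c p
    unfolding P_def env_smult[symmetric] bilin_smult_left[OF bilin_env_mult[OF sub_U] clU iU]
    by (simp add: lin_smult[OF hl] U_mult_closed clU iU emb_smult[OF vspace_kgB] lin_closed[OF hl])
  have "P p = bet (xpart X f p) + fscale (spart X f p) (beta one_B)"
    using p
  proof (induction rule: free_on_induct)
    case zero
    have z: "(0 :: 'k list \<Rightarrow>\<^sub>0 'f) \<in> FA k_lt"
      by (rule free_on_closed)
    have "P 0 = 0" "xpart X f 0 = 0" "spart X f 0 = 0"
      using P_scale[of 0 0] xpart_lin(2)[OF f z z, of X 0] spart_lin(2)[OF f X(2) z z, of 0] by simp_all
    thus ?case
      using bet_scale[OF k_ge_closed(3), of 0] by simp
  next
    case (bas w)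
    thus ?case
      unfolding P_def by (rule phi_straight_word[OF f X])
  next
    case (add p q)
    thus ?case
      by (simp add: P_add xpart_lin[OF f] spart_lin[OF f X(2)] bet_add xpart_k_ge[OF X(1)] fs.scale_left_distrib)
  next
    case (scale c p)
    thus ?case
      by (simp add: P_scale xpart_lin(2)[OF f _ scale(1)] spart_lin(2)[OF f X(2) _ scale(1)] bet_scale xpart_k_ge[OF X(1)] fs.scale_right_distrib)
  qed
  thus ?thesis
    by (simp add: P_def)
qed

end


lemma functional_sum:
  assumes k: "functional k" and q: "\<And>i. q i \<in> FA k_lt"
  shows "k (\<Sum>i\<in>A. q i) = (\<Sum>i\<in>A. k (q i))"
proof (induction A rule: infinite_finite_induct)
  case (insert i A)
  have "(\<Sum>i\<in>A. q i) \<in> FA k_lt"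
    by (rule fs.subspace_sum[OF subspace_free_on q])
  thus ?case
    using insert functionalD(1)[OF k q[of i]] by simp
qed (simp_all add: functionalD(4)[OF k])

lemma bracket_diff_left: "bracket (x - y) z = bracket x z - bracket y z"
  using bracket_add_left[of "x - y" y z] by simp

section \<open>Comparison of both composites for X of height 0 or 1\<close>

context
  fixes \<gamma> :: "'k \<Rightarrow> 'f"
  assumes char: "character \<gamma>"
begin

lemma right_act_tens_ev:
  assumes f: "f \<in> carrier N_dual" and x: "x \<in> k_ge" "x \<in> supp_sub (\<lambda>a. ht a \<le> 1)" and Y: "Y \<in> zgr (- 1)"
    and b: "b = env_in k_ge x \<oplus>\<^bsub>B\<^esub> s \<odot>\<^bsub>B\<^esub> one_B" and w: "w \<in> lists k_lt"
  shows "emb kgB (phi \<gamma> (right_act (NB_tens f b) (env_in UNIV Y)) (env_incl (cl k_lt (bas w)))) =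
    emb kgB (phi \<gamma> (NB_tens f b) (env_incl (cl k_lt (bas (Y # w))))) +
    fscale (f (cl k_lt (bas (lt_part (bracket x Y) # w)))) (beta one_B) +
    fscale (f (cl k_lt (bas w))) (bet (component 0 (bracket x Y)))"
proof -
  have Yl: "Y \<in> k_lt"
    by (rule zgr_k_lt[OF Y])
  have lt: "lt_part (bracket x Y) \<in> k_lt"
    by (rule lt_part_closed[OF x(2) bracket_ht[OF x(2) Yl]])
  have bw: "bas w \<in> FA k_lt" "bas (Y # w) \<in> FA k_lt"
    using w Yl by (auto intro!: bas_free_on)
  have n: "cl k_lt (bas w) \<in> carrier N" "cl k_lt (bas (Y # w)) \<in> carrier N"
    by (rule env_closed[OF bw(1)], rule env_closed[OF bw(2)])
  have oB: "one_B \<in> carrier B" and zB: "env_in k_ge (component 0 (bracket x Y)) \<in> carrier B"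
    by (rule env_one_closed, rule env_in_closed[OF zgr_k_ge[OF component_0_zgr]])
  have bB: "b \<in> carrier B"
    unfolding b by (intro env_add_closed env_smult_closed oB env_in_closed[OF x(1)])
  have d: "dual_right f (env_in k_lt Y) \<in> carrier N_dual" "dual_right f (env_in k_lt (lt_part (bracket x Y))) \<in> carrier N_dual"
    by (rule dual_right_closed[OF f env_in_closed[OF Yl]], rule dual_right_closed[OF f env_in_closed[OF lt]])
  note t = tens_closed[OF d(1) bB] tens_closed[OF f zB] tens_closed[OF d(2) oB]
  note ev = lin_add[OF phi_ev_lin[OF char incl_closed[OF n(1)]]]
  have "phi \<gamma> (right_act (NB_tens f b) (env_in UNIV Y)) (env_incl (cl k_lt (bas w))) =
     phi \<gamma> (NB_tens (dual_right f (env_in k_lt Y)) b) (env_incl (cl k_lt (bas w))) \<oplus>\<^bsub>kgB\<^esub>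
     (phi \<gamma> (NB_tens f (env_in k_ge (component 0 (bracket x Y)))) (env_incl (cl k_lt (bas w))) \<oplus>\<^bsub>kgB\<^esub>
      phi \<gamma> (NB_tens (dual_right f (env_in k_lt (lt_part (bracket x Y)))) one_B) (env_incl (cl k_lt (bas w))))"
    unfolding right_act_tens_affine[OF f x Y b]
    using ev[OF t(1) vspace_add_closed[OF vspace_NB t(2,3)]] ev[OF t(2,3)] t vspace_add_closed[OF vspace_NB t(2,3)]
      vspace_add_closed[OF vspace_NB t(1) vspace_add_closed[OF vspace_NB t(2,3)]] by simp
  thus ?thesis
    unfolding phi_N[OF char d(1) bB n(1)] phi_N[OF char f zB n(1)] phi_N[OF char d(2) oB n(1)] phi_N[OF char f bB n(2)]
    by (simp add: emb_add[OF vspace_kgB] vspace_add_closed[OF vspace_kgB] kgB_tens_closed bB zB oB beta_tens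
      dual_right_word[OF Yl bw(1)] dual_right_word[OF lt bw(1)] bas_mult add.assoc add.commute)
qed

text \<open>
  Expanding \<open>f(w) [X, [Y, z]]\<close> with the dual family exhibits it as an explicit map of finite rank in \<open>z\<close>.
\<close>

lemma trace_identity:
  assumes f: "f \<in> carrier N_dual" and X: "X \<in> supp_sub (\<lambda>a. ht a \<le> 1)" and Y: "Y \<in> zgr (- 1)" and w: "w \<in> lists k_lt"
    and J: "finite J" "\<And>j. j \<in> J \<Longrightarrow> \<phi> j \<in> carrier N_dual"
    and exp: "\<And>p. p \<in> FA k_lt \<Longrightarrow> flin scale (kappa X (\<lambda>p. f (cl k_lt p))) p =
      (\<Sum>j\<in>J. scale (\<phi> j (cl k_lt p)) (flin scale (kappa X (\<lambda>p. f (cl k_lt p))) j))"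
  shows "f (cl k_lt (bas w)) * trace_on (zgr 0) (\<lambda>z. component 0 (bracket X (bracket Y z))) =
    (\<Sum>i<length w. f (cl k_lt (bas (bracket (component 0 (bracket X (w ! i))) Y # omit i w))))
    - (\<Sum>j\<in>J. \<phi> j (cl k_lt (bas (bracket (flin scale (kappa X (\<lambda>p. f (cl k_lt p))) j) Y # w))))"
proof -
  let ?K = "flin scale (kappa X (\<lambda>p. f (cl k_lt p)))"
  let ?z = "\<lambda>i. component 0 (bracket X (w ! i))"
  \<comment> \<open>Two families of vectors of degree 0: the values of \<open>kappa\<close> on the
    dual family and the elements [X, w_i]_0.\<close>
  define I where "I = J <+> {..<length w}"
  define v where "v = case_sum ?K ?z"
  define l where "l i z = (case i of Inl j \<Rightarrow> - \<phi> j (cl k_lt (bas (bracket z Y # w)))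
     | Inr i \<Rightarrow> f (cl k_lt (bas (bracket z Y # omit i w))))" for i z
  have Yl: "Y \<in> k_lt"
    by (rule zgr_k_lt[OF Y])
  have br: "bracket z Y \<in> k_lt" if "z \<in> zgr 0" for z
    by (rule zgr_bracket_k_lt[OF X that Yl])
  have "f (cl k_lt (bas w)) * trace_on (zgr 0) (\<lambda>z. component 0 (bracket X (bracket Y z))) = (\<Sum>i\<in>I. l i (v i))"
  proof (rule trace_on_finite_rank[OF subspace_zgr])
    show "finite I"
      using J(1) by (simp add: I_def)
    show "v i \<in> zgr 0" if "i \<in> I" for i
      by (cases i) (simp_all add: v_def kappa_ext_zgr component_0_zgr)
    show "l i (x + y) = l i x + l i y" if "i \<in> I" "x \<in> zgr 0" "y \<in> zgr 0" for i x y
      using that J(2) by (cases i) (auto simp: l_def I_def bracket_add_left word_lin(1)[OF _ br br] f w omit_lists)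
    show "l i (scale c x) = c * l i x" if "i \<in> I" "x \<in> zgr 0" for i c x
      using that J(2) by (cases i) (auto simp: l_def I_def bracket_scale_left word_lin(2)[OF _ br br] f w omit_lists)
    show "scale (f (cl k_lt (bas w))) (component 0 (bracket X (bracket Y z))) = (\<Sum>i\<in>I. scale (l i z) (v i))" if z: "z \<in> zgr 0" for z
    proof -
      have bw: "bas w \<in> FA k_lt" "bas (bracket z Y # w) \<in> FA k_lt"
        using w br[OF z] by (auto intro!: bas_free_on)
      \<comment> \<open>The first term of \<open>kappa\<close> on the word [z, Y] w is f(w) [X,
        [z, Y]]_0. Expanding the total value in the dual family as well leaves this term as a map of
        finite rank in z.\<close>
      have "?K (bas (bracket z Y # w)) = scale (f (cl k_lt (bas w))) (component 0 (bracket X (bracket z Y))) +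
          (\<Sum>i<length w. scale (f (cl k_lt (bas (bracket z Y # omit i w)))) (?z i))"
        by (simp add: kappa_Cons) (simp add: kappa_def bas_mult)
      moreover have "component 0 (bracket X (bracket Y z)) = - component 0 (bracket X (bracket z Y))"
        using component_scale[of 0 "- 1"] bracket_antisym[of z Y] by (simp add: bracket_minus_right)
      ultimately have "scale (f (cl k_lt (bas w))) (component 0 (bracket X (bracket Y z))) =
          (\<Sum>i<length w. scale (f (cl k_lt (bas (bracket z Y # omit i w)))) (?z i)) - ?K (bas (bracket z Y # w))"
        by simp
      also have "?K (bas (bracket z Y # w)) = (\<Sum>j\<in>J. scale (\<phi> j (cl k_lt (bas (bracket z Y # w)))) (?K j))"
        by (rule exp[OF bw(2)])
      finally show ?thesis
        by (simp add: I_def sum.Plus J(1) l_def v_def sum_negf)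
    qed
  qed (rule component_0_zgr)
  thus ?thesis
    by (simp add: I_def sum.Plus J(1) l_def v_def sum_negf)
qed

text \<open>With g = f Y, one composite is L_X (g \<otimes> 1), known from
  \<open>phi_straight\<close>. For the other, L_X (f \<otimes> 1) is expanded as the sum of \<phi>_j
  \<otimes> b_j, and Y acts on each term by \<open>right_act_tens_affine\<close>. Both are evaluated
  at a word w of N. The assumption \<open>tr\<close> concerns parts of degree 0, so that it covers
  height 0 as well, where both of its sides vanish.\<close>

lemma left_right_one_ge:
  assumes f: "f \<in> carrier N_dual" and d: "d \<in> Gam S" "ht d = 0 \<or> ht d = 1" and X: "X \<in> gr d" and Y: "Y \<in> zgr (- 1)"
    and tr: "\<gamma> (component 0 (bracket X Y)) = trace_on (zgr 0) (\<lambda>z. component 0 (bracket X (bracket Y z)))"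
  shows "left_act \<gamma> (env_in UNIV X) (right_act (NB_tens f one_B) (env_in UNIV Y)) =
    right_act (left_act \<gamma> (env_in UNIV X) (NB_tens f one_B)) (env_in UNIV Y)"
proof -
  have Xge: "X \<in> k_ge"
    unfolding k_ge_eq by (rule gr_supp_sub[OF d(1) X]) (use d(2) in auto)
  have X1: "X \<in> supp_sub (\<lambda>a. ht a \<le> 1)"
    by (rule gr_supp_sub[OF d(1) X]) (use d(2) in auto)
  have Yl: "Y \<in> k_lt"
    by (rule zgr_k_lt[OF Y])
  have uU: "env_in UNIV z \<in> carrier U" for z
    by (simp add: env_in_closed)
  have oB: "one_B \<in> carrier B"
    by (rule env_one_closed)
  have f1: "NB_tens f one_B \<in> carrier NB"
    by (rule tens_closed[OF f oB])
  define z where "z = left_act \<gamma> (env_in UNIV X) (NB_tens f one_B)"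
  have z: "z \<in> carrier NB"
    unfolding z_def by (rule left_act_closed[OF char uU f1])
  define g where "g = dual_right f (env_in k_lt Y)"
  have g: "g \<in> carrier N_dual"
    unfolding g_def by (rule dual_right_closed[OF f env_in_closed[OF Yl]])
  let ?F = "\<lambda>p. f (cl k_lt p)"
  let ?K = "flin scale (kappa X ?F)"
  obtain F0 where F0: "finite F0" "F0 \<subseteq> Gam S" "vanish_off f 0 F0"
    using f by (auto simp: N_dual_iff)
  obtain F1 where F1: "finite F1" "F1 \<subseteq> Gam S" and zexp: "\<forall>F' J \<phi>. F1 \<subseteq> F' \<longrightarrow> dual_family F' J \<phi> \<longrightarrow>
    emb NB z = (\<Sum>j\<in>J. emb NB (NB_tens (\<phi> j) (kgB_to_B (phi \<gamma> z (env_incl (cl k_lt j))))))"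
    using phi_determines[OF char z] by blast
  \<comment> \<open>\<open>F1\<close> serves the expansion of L_X (f \<otimes> 1), \<open>F0\<close>
    that of f, and the shifted set that of \<open>kappa\<close>, whose support is moved by -d
    according to \<open>kappa_vanish\<close>.\<close>
  define F' where "F' = F1 \<union> F0 \<union> (\<lambda>c. c - d) ` F0"
  have "finite F'" "F' \<subseteq> Gam S"
    using F0(1,2) F1 Gam_closed(4)[OF _ d(1)] by (auto simp: F'_def)
  then obtain J \<phi> where D: "dual_family F' J \<phi>"
    using dual_family_ex by blast
  have J: "finite J" "\<And>j. j \<in> J \<Longrightarrow> \<phi> j \<in> carrier N_dual" "\<And>j. j \<in> J \<Longrightarrow> j \<in> FA k_lt"
    using D by (auto simp: dual_family_def)
  have fexp: "?F p = (\<Sum>j\<in>J. \<phi> j (cl k_lt p) * ?F j)" if "p \<in> FA k_lt" for p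
    by (rule dual_family_functional[OF D f vanish_off_mono[OF F0(3)] that]) (auto simp: F'_def)
  have Kexp: "?K p = (\<Sum>j\<in>J. scale (\<phi> j (cl k_lt p)) (?K j))" if "p \<in> FA k_lt" for p
  proof (rule dual_family_vector[OF D that])
    show "?K r = 0" if "r \<in> env_ideal k_lt" for r
      by (rule kappa_ideal[OF X1 functional_N_dual[OF f] that])
    show "?K (bas w) = 0" if c: "c \<notin> F'" and w: "hw k_lt c w" for c w
    proof -
      have "c + d \<notin> F0"
        using c unfolding F'_def by (metis UnCI add_diff_cancel_right' image_eqI)
      thus ?thesis
        using kappa_vanish[OF d(1) X w, of ?F] vanish_offD[OF F0(3)] by simp
    qed
  qed (simp_all add: flin_add flin_scale)
  define b where "b j = env_in k_ge (xpart X f j) \<oplus>\<^bsub>B\<^esub> spart \<gamma> X f j \<odot>\<^bsub>B\<^esub> one_B" for j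
  have xB: "env_in k_ge (xpart X f p) \<in> carrier B" for p
    by (rule env_in_closed[OF xpart_k_ge[OF Xge]])
  have bB: "b j \<in> carrier B" for j
    unfolding b_def by (intro env_add_closed env_smult_closed oB xB)
  have beta_b: "beta (b j) = bet (xpart X f j) + fscale (spart \<gamma> X f j) (beta one_B)" for j
    unfolding b_def by (simp add: beta_add beta_smult xB oB env_smult_closed)
  have z_ev: "emb kgB (phi \<gamma> z (env_incl (cl k_lt p))) = bet (xpart X f p) + fscale (spart \<gamma> X f p) (beta one_B)"
    if p: "p \<in> FA k_lt" for p
    unfolding z_def phi_left_act_ev[OF char uU f1 incl_closed[OF env_closed[OF p]]]
    using phi_straight[OF char f Xge X1 p] by (simp add: env_incl_cl)
  have z_b: "kgB_to_B (phi \<gamma> z (env_incl (cl k_lt j))) = b j" if j: "j \<in> J" for j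
  proof -
    have "phi \<gamma> z (env_incl (cl k_lt j)) = kgB_tens 1 (b j)"
    proof (rule emb_eqD[OF vspace_kgB])
      show "emb kgB (phi \<gamma> z (env_incl (cl k_lt j))) = emb kgB (kgB_tens 1 (b j))"
        unfolding z_ev[OF J(3)[OF j]] by (simp add: beta_tens bB beta_b)
    qed (rule phi_ev_closed[OF char z incl_closed[OF env_closed[OF J(3)[OF j]]]], rule kgB_tens_closed[OF bB])
    thus ?thesis
      using kgB_to_B(3)[OF bB, of 1 j] vspace_one_smult[OF vspace_env bB] by simp
  qed
  have gj: "NB_tens (\<phi> j) (b j) \<in> carrier NB" if "j \<in> J" for j
    by (rule tens_closed[OF J(2)[OF that] bB])
  note fin = emb_finsum[where g = "\<lambda>j. NB_tens (\<phi> j) (b j)", OF vspace_NB J(1) gj]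
  have "emb NB z = (\<Sum>j\<in>J. emb NB (NB_tens (\<phi> j) (b j)))"
    using zexp[rule_format, of F' J \<phi>] D z_b by (simp add: F'_def Un_assoc)
  hence z_sum: "z = finsum NB (\<lambda>j. NB_tens (\<phi> j) (b j)) J"
    using fin by (intro emb_eqD[OF vspace_NB _ z]) simp_all
  have z_lin: "emb kgB (h z) = (\<Sum>j\<in>J. emb kgB (h (NB_tens (\<phi> j) (b j))))" if "h \<in> lin_maps NB kgB" for h
    unfolding z_sum
    by (rule lin_maps_finsum[where g = "\<lambda>j. NB_tens (\<phi> j) (b j)", OF vspace_NB vspace_kgB that J(1) gj, THEN conjunct2])
  have rz: "right_act z (env_in UNIV Y) \<in> carrier NB"
    by (rule right_act_closed[OF uU z])
  have word: "phi \<gamma> (NB_tens g one_B) (env_incl (cl k_lt (bas w)) \<cdot> env_in UNIV X) =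
      phi \<gamma> (right_act z (env_in UNIV Y)) (env_incl (cl k_lt (bas w)))" if w: "w \<in> lists k_lt" for w
  proof -
    let ?W = "bracket X Y"
    let ?G = "\<lambda>p. g (cl k_lt p)"
    have bw: "bas w \<in> FA k_lt" "bas (Y # w) \<in> FA k_lt"
      using w Yl by (auto intro!: bas_free_on)
    have n: "cl k_lt (bas w) \<in> carrier N" "cl k_lt (bas (Y # w)) \<in> carrier N"
      by (rule env_closed[OF bw(1)], rule env_closed[OF bw(2)])
    note en = incl_closed[OF n(1)] incl_closed[OF n(2)]
    have Gp: "?G p = ?F (bas [Y] * p)" if "p \<in> FA k_lt" for p
      unfolding g_def by (rule dual_right_word[OF Yl that])
    have ltW: "lt_part ?W \<in> k_lt"
      by (rule lt_part_closed[OF X1 bracket_ht[OF X1 Yl]])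
    have KY: "bracket (?K j) Y \<in> k_lt" for j
      by (rule zgr_bracket_k_lt[OF X1 kappa_ext_zgr Yl])
    have brx: "component 0 (bracket (xpart X f p) Y) = scale (?F p) (component 0 ?W)"
      "lt_part (bracket (xpart X f p) Y) = scale (?F p) (lt_part ?W) - bracket (?K p) Y" for p
      using component_k_lt[OF KY[of p]]
      by (simp_all add: xpart_def lt_part_def bracket_diff_left bracket_scale_left component_diff component_scale scale_right_diff_distrib)
    have kG: "kappa X (\<lambda>p. ?F (bas [Y] * p)) w = kappa X ?G w"
      by (rule kappa_cong[OF w]) (simp add: Gp bas_free_on)
    \<comment> \<open>Evaluating at Y w for f is evaluating at w for g, up to the terms in which X
      or some [X, w_i]_0 meets the letter Y; these are collected here and in
      \<open>sY\<close>.\<close>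
    have xY: "xpart X f (bas (Y # w)) = xpart X g (bas w) - scale (?F (bas w)) (component 0 ?W)"
      using Gp[OF bw(1)] by (simp add: xpart_def kappa_Cons kG bas_mult)
    let ?R = "\<Sum>i<length w. ?F (bas (bracket (component 0 (bracket X (w ! i))) Y # omit i w))"
    have bi: "bas (bracket (component 0 (bracket X (w ! i))) Y # omit i w) \<in> FA k_lt" for i
      by (rule bas_free_on) (simp add: zgr_bracket_k_lt[OF X1 component_0_zgr Yl] omit_lists[OF w])
    have Fst: "?F (straight X (Y # w)) = ?F (bas (lt_part ?W # w)) + ?G (straight X w) - ?R"
    proof -
      have 1: "bas (lt_part ?W # w) \<in> FA k_lt" "bas [Y] * straight X w \<in> FA k_lt"
        using ltW w Yl straight_FA[OF X1 w] by (auto intro!: bas_free_on free_on_lists_mult)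
      show ?thesis
        unfolding straight.simps Gp[OF straight_FA[OF X1 w]] functionalD(1)[OF functional_N_dual[OF f] 1, symmetric]
          functional_sum[OF functional_N_dual[OF f] bi, symmetric]
        by (rule functional_diff[OF functional_N_dual[OF f] free_on_closed(2)[OF 1] fs.subspace_sum[OF subspace_free_on bi]])
    qed
    have sY: "spart \<gamma> X f (bas (Y # w)) = spart \<gamma> X g (bas w) - ?F (bas w) * \<gamma> (component 0 ?W) - ?F (bas (lt_part ?W # w)) + ?R"
      unfolding spart_def[OF char] flin_bas fs.flin_bas Fst kappa_Cons kG
        gamma_add[OF char subspace_scale[OF subspace_zgr component_0_zgr] kappa_zgr] gamma_scale[OF char component_0_zgr]
      using Gp[OF bw(1)] by (simp add: bas_mult algebra_simps del: straight.simps)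
    have h2: "(\<lambda>x\<in>carrier NB. phi \<gamma> (right_act x (env_in UNIV Y)) (env_incl (cl k_lt (bas w)))) \<in> lin_maps NB kgB"
      using lin_maps_comp[OF vspace_NB phi_ev_lin[OF char en(1)] right_act_lin[OF uU, of Y]]
      by (rule back_subst[where P = "\<lambda>h. h \<in> lin_maps NB kgB"]) (auto simp: right_act_closed[OF uU] intro!: restrict_ext)
    have "emb kgB (phi \<gamma> (right_act z (env_in UNIV Y)) (env_incl (cl k_lt (bas w)))) =
        (\<Sum>j\<in>J. emb kgB (phi \<gamma> (right_act (NB_tens (\<phi> j) (b j)) (env_in UNIV Y)) (env_incl (cl k_lt (bas w)))))"
      using z_lin[OF h2] z gj by simp
    also have "\<dots> = (\<Sum>j\<in>J. emb kgB (phi \<gamma> (NB_tens (\<phi> j) (b j)) (env_incl (cl k_lt (bas (Y # w))))) +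
        fscale (\<phi> j (cl k_lt (bas (lt_part (bracket (xpart X f j) Y) # w)))) (beta one_B) +
        fscale (\<phi> j (cl k_lt (bas w))) (bet (component 0 (bracket (xpart X f j) Y))))"
      by (rule sum.cong[OF refl], rule right_act_tens_ev[OF J(2) xpart_k_ge[OF Xge] xpart_ht[OF X1] Y b_def w])
    also have "\<dots> = emb kgB (phi \<gamma> z (env_incl (cl k_lt (bas (Y # w))))) +
        fscale (\<Sum>j\<in>J. \<phi> j (cl k_lt (bas (lt_part (bracket (xpart X f j) Y) # w)))) (beta one_B) +
        (\<Sum>j\<in>J. fscale (\<phi> j (cl k_lt (bas w))) (bet (component 0 (bracket (xpart X f j) Y))))"
      using z_lin[OF phi_ev_lin[OF char en(2)]] z gj by (simp add: sum.distrib fs.scale_sum_left)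
    also have "(\<Sum>j\<in>J. fscale (\<phi> j (cl k_lt (bas w))) (bet (component 0 (bracket (xpart X f j) Y)))) =
        fscale (?F (bas w)) (bet (component 0 ?W))"
      unfolding brx fexp[OF bw(1)]
      by (simp add: bet_scale zgr_k_ge[OF component_0_zgr] fs.scale_sum_left)
    \<comment> \<open>By \<open>brx\<close> the negative part consists of f(j) times that of [X, Y],
      minus the bracket of \<open>?K j\<close> with Y. The first sums up to f by the dual family,
      the second is what leads to the trace.\<close>
    also have "(\<Sum>j\<in>J. \<phi> j (cl k_lt (bas (lt_part (bracket (xpart X f j) Y) # w)))) =
        ?F (bas (lt_part ?W # w)) - (\<Sum>j\<in>J. \<phi> j (cl k_lt (bas (bracket (?K j) Y # w))))"
    proof -
      have "\<phi> j (cl k_lt (bas (lt_part (bracket (xpart X f j) Y) # w))) =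
          \<phi> j (cl k_lt (bas (lt_part ?W # w))) * ?F j - \<phi> j (cl k_lt (bas (bracket (?K j) Y # w)))" if j: "j \<in> J" for j
        unfolding brx word_diff[OF J(2)[OF j] k_lt_closed(2)[OF ltW] KY w] word_lin(2)[OF J(2)[OF j] ltW ltW w] by simp
      moreover have "bas (lt_part ?W # w) \<in> FA k_lt"
        using ltW w by (auto intro!: bas_free_on)
      ultimately show ?thesis
        using fexp[of "bas (lt_part ?W # w)"] by (simp add: sum_subtractf)
    qed
    \<comment> \<open>The place where \<open>tr\<close> enters: it replaces the trace by \<gamma>,
      and the result cancels against \<open>?R\<close> and the term with \<gamma> in
      \<open>sY\<close>.\<close>
    also have "(\<Sum>j\<in>J. \<phi> j (cl k_lt (bas (bracket (?K j) Y # w)))) = ?R - ?F (bas w) * \<gamma> (component 0 ?W)"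
      using trace_identity[OF f X1 Y w J(1,2) Kexp] tr by simp
    also have "emb kgB (phi \<gamma> z (env_incl (cl k_lt (bas (Y # w))))) =
        bet (xpart X g (bas w)) - fscale (?F (bas w)) (bet (component 0 ?W)) +
        fscale (spart \<gamma> X g (bas w) - ?F (bas w) * \<gamma> (component 0 ?W) - ?F (bas (lt_part ?W # w)) + ?R) (beta one_B)"
      unfolding z_ev[OF bw(2)] xY sY
      by (simp add: bet_diff bet_scale xpart_k_ge[OF Xge] k_ge_closed zgr_k_ge[OF component_0_zgr])
    finally have "emb kgB (phi \<gamma> (right_act z (env_in UNIV Y)) (env_incl (cl k_lt (bas w)))) =
        bet (xpart X g (bas w)) + fscale (spart \<gamma> X g (bas w)) (beta one_B)"
      by (simp add: fs.scale_left_diff_distrib fs.scale_left_distrib)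
    hence "emb kgB (phi \<gamma> (NB_tens g one_B) (env_incl (cl k_lt (bas w)) \<cdot> env_in UNIV X)) =
        emb kgB (phi \<gamma> (right_act z (env_in UNIV Y)) (env_incl (cl k_lt (bas w))))"
      using phi_straight[OF char g Xge X1 bw(1)] by (simp add: env_incl_cl)
    thus ?thesis
      by (rule emb_eqD[OF vspace_kgB])
         (rule phi_ev_closed[OF char tens_closed[OF g oB] U_mult_closed[OF en(1) uU]], rule phi_ev_closed[OF char rz en(1)])
  qed
  have g1: "NB_tens g one_B \<in> carrier NB"
    by (rule tens_closed[OF g oB])
  have "left_act \<gamma> (env_in UNIV X) (NB_tens g one_B) = right_act z (env_in UNIV Y)"
  proof (rule phi_inj[OF char left_act_closed[OF char uU g1] rz], rule Hom_B_eqI[OF char])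
    show c: "phi \<gamma> (left_act \<gamma> (env_in UNIV X) (NB_tens g one_B)) \<in> carrier (Hom_B \<gamma>)" "phi \<gamma> (right_act z (env_in UNIV Y)) \<in> carrier (Hom_B \<gamma>)"
      by (rule phi_closed[OF char left_act_closed[OF char uU g1]], rule phi_closed[OF char rz])
    have "(\<lambda>n\<in>carrier N. phi \<gamma> (left_act \<gamma> (env_in UNIV X) (NB_tens g one_B)) (env_incl n)) =
        (\<lambda>n\<in>carrier N. phi \<gamma> (right_act z (env_in UNIV Y)) (env_incl n))"
    proof (rule N_eqI[OF Hom_B_restrict_lin[OF char c(1)] Hom_B_restrict_lin[OF char c(2)] vspace_kgB])
      fix e w assume w: "hw k_lt e w"
      note n = hw_closed[OF w]
      show "(\<lambda>n\<in>carrier N. phi \<gamma> (left_act \<gamma> (env_in UNIV X) (NB_tens g one_B)) (env_incl n)) (cl k_lt (bas w)) =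
        (\<lambda>n\<in>carrier N. phi \<gamma> (right_act z (env_in UNIV Y)) (env_incl n)) (cl k_lt (bas w))"
        using word[OF hw_lists[OF w]] n by (simp add: phi_left_act_ev[OF char uU g1 incl_closed[OF n]])
    qed
    note eq = this
    show "phi \<gamma> (left_act \<gamma> (env_in UNIV X) (NB_tens g one_B)) (env_incl n) = phi \<gamma> (right_act z (env_in UNIV Y)) (env_incl n)"
      if "n \<in> carrier N" for n
      using fun_cong[OF eq, of n] that by simp
  qed
  moreover have "right_act (NB_tens f one_B) (env_in UNIV Y) = NB_tens g one_B"
    unfolding g_def using right_act_N[OF f env_in_closed[OF Yl]] by (simp add: env_incl_in)
  ultimately show ?thesis
    by (simp add: z_def)
qed

end

end

section \<open>Generation\<close>

lemma (in vector_space) trace_on_cong: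
  assumes V: "subspace V" and T: "\<And>z. z \<in> V \<Longrightarrow> T z = T' z"
  shows "trace_on V T = trace_on V T'"
proof -
  define E where "E = (SOME E. independent E \<and> span E = V)"
  obtain E0 where "E0 \<subseteq> V" "independent E0" "V \<subseteq> span E0"
    using maximal_independent_subset by blast
  hence "independent E0 \<and> span E0 = V"
    using V by (metis span_subspace)
  hence "span E = V"
    unfolding E_def by (metis (mono_tags, lifting) someI_ex)
  hence "T e = T' e" if "e \<in> E" for e
    using that T span_base by blast
  thus ?thesis
    unfolding trace_on_def Let_def E_def[symmetric] by (intro sum.cong) auto
qed

context triangular_lie_algebra
begin

lemma env_in_bracket_diff:
  "env_in UNIV (bracket x y) = env_in UNIV x \<cdot> env_in UNIV y \<oplus>\<^bsub>U\<^esub> (- 1) \<odot>\<^bsub>U\<^esub> (env_in UNIV y \<cdot> env_in UNIV x)"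
proof -
  let ?r = "bas [x, y] - bas [y, x] - bas [bracket x y] :: 'k list \<Rightarrow>\<^sub>0 'f"
  have "- ?r \<in> env_ideal UNIV"
    by (rule ideal_closed(5)[OF k_lt_word_rels(3)]) simp_all
  also have "- ?r = bas [bracket x y] - (bas [x, y] + fscale (- 1) (bas [y, x]))"
    by simp
  finally show ?thesis
    by (simp add: env_in_def env_mult[OF sub_U] bas_mult env_smult env_add cl_eq_iff)
qed

text \<open>The elements z whose image satisfies \<open>Q\<close> form a Lie subalgebra, since
  [x, y] = xy - yx in U. It contains heights -1, 0 and 1, hence it is everything by
  \<open>generated\<close>.\<close>

lemma U_generation [consumes 1, case_names gen one add smult mult]:
  assumes u: "u \<in> carrier U"
    and gen: "\<And>d z. \<lbrakk>d \<in> Gam S; ht d \<in> {-1, 0, 1}; z \<in> gr d\<rbrakk> \<Longrightarrow> Q (env_in UNIV z)"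
    and one: "Q \<one>\<^bsub>U\<^esub>"
    and add: "\<And>u v. \<lbrakk>u \<in> carrier U; v \<in> carrier U; Q u; Q v\<rbrakk> \<Longrightarrow> Q (u \<oplus>\<^bsub>U\<^esub> v)"
    and smult: "\<And>c u. u \<in> carrier U \<Longrightarrow> Q u \<Longrightarrow> Q (c \<odot>\<^bsub>U\<^esub> u)"
    and mult: "\<And>u v. \<lbrakk>u \<in> carrier U; v \<in> carrier U; Q u; Q v\<rbrakk> \<Longrightarrow> Q (u \<cdot> v)"
  shows "Q u"
proof -
  have iU: "env_in UNIV z \<in> carrier U" for z
    by (rule env_in_closed) simp
  have z: "Q (env_in UNIV 0)"
    using gen[OF Gam_closed(1), of 0] gr_zero[OF Gam_closed(1)] by simp
  define H where "H = {z. Q (env_in UNIV z)}"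
  have "lie_subalgebra H"
    unfolding lie_subalgebra_def
  proof (intro conjI subspaceI ballI)
    show "0 \<in> H"
      using z by (simp add: H_def)
    show "x + y \<in> H" if "x \<in> H" "y \<in> H" for x y
      using that add[OF iU iU] by (simp add: H_def env_in_add)
    show "scale c x \<in> H" if "x \<in> H" for c x
      using that smult[OF iU] by (simp add: H_def env_in_scale[where y = x])
    show "bracket x y \<in> H" if "x \<in> H" "y \<in> H" for x y
      using that mult[OF iU iU] unfolding H_def mem_Collect_eq env_in_bracket_diff
      by (intro add smult U_mult_closed iU env_smult_closed) blast+
  qed
  moreover have "zgr i \<subseteq> H" if i: "i \<in> {-1, 0, 1}" for i
  proof
    fix x assume "x \<in> zgr i"
    hence "x \<in> supp_sub (\<lambda>a. ht a = i)"
      by (simp add: zgr_eq)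
    thus "x \<in> H"
    proof (induction rule: supp_sub_induct)
      case (homogeneous d y)
      have "y = 0 \<or> ht d = i"
        using component_gr[OF homogeneous(1,2), of d] supp_subD[OF homogeneous(3), of d] by auto
      thus ?case
        using gen[OF homogeneous(1) _ homogeneous(2)] z i by (auto simp: H_def)
    next
      case (add y z)
      thus ?case
        using assms(4)[OF iU iU, of y z] by (simp add: H_def env_in_add)
    qed
  qed
  hence "zgr 1 \<union> zgr 0 \<union> zgr (-1) \<subseteq> H"
    by simp
  ultimately have "lie_subalgebra hull (zgr 1 \<union> zgr 0 \<union> zgr (-1)) \<subseteq> H"
    by (intro hull_minimal)
  hence H: "Q (env_in UNIV z)" for z
    unfolding generated H_def by blast
  show ?thesis
    using u sub_U
  proof (induction rule: env_induct)
    case zero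
    have "0 \<odot>\<^bsub>U\<^esub> env_in UNIV 0 = \<zero>\<^bsub>U\<^esub>"
      by (rule vspace_zero_smult[OF vspace_env iU])
    thus ?case
      using smult[OF iU z, of 0] by simp
  qed (use one add smult mult H iU in blast)+
qed

lemma right_act_zero: "v \<in> carrier U \<Longrightarrow> right_act \<zero>\<^bsub>NB\<^esub> v = \<zero>\<^bsub>NB\<^esub>"
  using lin_zero[OF vspace_NB vspace_NB right_act_lin[of v]] NB_zero_closed by simp

lemma right_act_one:
  assumes "m \<in> carrier NB"
  shows "right_act m \<one>\<^bsub>U\<^esub> = m"
  using assms vspace_N_dual vspace_env
proof (induction rule: tensor_induct)
  case zero
  show ?case
    by (rule right_act_zero[OF env_one_closed])
next
  case (tens f b)
  thus ?case
    using right_act_B[OF tens env_one_closed] by (simp add: env_incl_one env_one_right[OF sub_B])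
next
  case (add x y)
  thus ?case
    by (simp add: right_act_add env_one_closed)
qed

lemma right_act_swap:
  assumes "m \<in> carrier NB"
  shows "right_act (right_act m (env_in UNIV x)) (env_in UNIV y) =
    right_act (right_act m (env_in UNIV y)) (env_in UNIV x) \<oplus>\<^bsub>NB\<^esub> right_act m (env_in UNIV (bracket x y))"
proof -
  have iU: "env_in UNIV z \<in> carrier U" for z
    by (rule env_in_closed) simp
  show ?thesis
    unfolding right_act_add_elt(3)[OF iU iU assms, symmetric] right_act_add_elt(1)[OF U_mult_closed[OF iU iU] iU assms, symmetric]
    by (simp add: env_in_bracket[OF sub_U, of x y])
qed

section \<open>Assembling the cases, and extension to all of \<open>NB\<close>\<close>

context
  fixes \<gamma> :: "'k \<Rightarrow> 'f"
  assumes char: "character \<gamma>"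
begin

lemma left_act_add: "\<lbrakk>u \<in> carrier U; x \<in> carrier NB; y \<in> carrier NB\<rbrakk> \<Longrightarrow>
    left_act \<gamma> u (x \<oplus>\<^bsub>NB\<^esub> y) = left_act \<gamma> u x \<oplus>\<^bsub>NB\<^esub> left_act \<gamma> u y"
  and left_act_smult: "u \<in> carrier U \<Longrightarrow> x \<in> carrier NB \<Longrightarrow> left_act \<gamma> u (c \<odot>\<^bsub>NB\<^esub> x) = c \<odot>\<^bsub>NB\<^esub> left_act \<gamma> u x"
  using lin_add[OF left_act_lin[OF char], of u x y] lin_smult[OF left_act_lin[OF char], of u x c]
  by (simp_all add: NB_add_closed NB_smult_closed)

lemma left_act_one: "x \<in> carrier NB \<Longrightarrow> left_act \<gamma> \<one>\<^bsub>U\<^esub> x = x"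
  by (rule left_act_eqI[OF char env_one_closed]) (simp_all add: env_one_right[OF sub_U incl_closed])

text \<open>For X in \<open>k_lt\<close> the product n X is already in N, so f \<otimes> 1 goes to h
  \<otimes> 1, where h is the result of the left N-action on \<open>N_dual\<close>.\<close>

lemma left_act_k_lt:
  assumes f: "f \<in> carrier N_dual" and d: "d \<in> Gam S" and X: "X \<in> gr d" "X \<in> k_lt"
  shows "\<exists>h\<in>carrier N_dual. left_act \<gamma> (env_in UNIV X) (NB_tens f one_B) = NB_tens h one_B \<and>
    (\<forall>n\<in>carrier N. h n = f (n \<otimes>\<^bsub>N\<^esub> env_in k_lt X))"
proof -
  obtain F0 where F0: "finite F0" "F0 \<subseteq> Gam S" "vanish_off f 0 F0"
    using f by (auto simp: N_dual_iff)
  have bX: "bas [X] \<in> FA k_lt"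
    using X(2) by (intro bas_free_on) simp
  note Fn = functional_N_dual[OF f]
  let ?k = "\<lambda>p. f (cl k_lt (p * bas [X]))"
  define h where "h = quot_map (FA k_lt) (env_ideal k_lt) ?k"
  have 1: "?k (p + q) = ?k p + ?k q" if "p \<in> FA k_lt" "q \<in> FA k_lt" for p q
    unfolding distrib_right by (rule functionalD(1)[OF Fn free_on_closed(6)[OF that(1) bX] free_on_closed(6)[OF that(2) bX]])
  have 2: "?k (fscale c p) = c * ?k p" if "p \<in> FA k_lt" for c p
    unfolding fscale_mult_left by (rule functionalD(2)[OF Fn free_on_closed(6)[OF that bX]])
  have 3: "?k r = 0" if "r \<in> env_ideal k_lt" for r
    by (rule functionalD(3)[OF Fn env_ideal_right[OF bX that]])
  have 4: "finite ((\<lambda>c. c - d) ` F0)" "(\<lambda>c. c - d) ` F0 \<subseteq> Gam S"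
    using F0(1,2) Gam_closed(4)[OF _ d] by auto
  have 5: "?k (bas w) = 0" if c: "c \<notin> (\<lambda>c. c - d) ` F0" and w: "hw k_lt c w" for c w
  proof -
    have "hw k_lt (c + d) (w @ [X])"
      using hw_append[OF w hw_Cons[OF X(2,1) d hw_Nil]] by simp
    moreover have "c + d \<notin> F0"
      using c by (metis add_diff_cancel_right' image_eqI)
    ultimately show ?thesis
      using vanish_offD[OF F0(3)] by (simp add: bas_mult)
  qed
  have h: "h \<in> carrier N_dual" "\<And>p. p \<in> FA k_lt \<Longrightarrow> h (cl k_lt p) = ?k p"
    unfolding h_def by (rule N_dualI(1)[OF 1 2 3 4 5]; assumption) (rule N_dualI(2)[OF 1 2 3 4 5]; assumption)
  have XN: "env_in k_lt X \<in> carrier N"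
    by (rule env_in_closed[OF X(2)])
  have hn: "h n = f (n \<otimes>\<^bsub>N\<^esub> env_in k_lt X)" if n: "n \<in> carrier N" for n
    using env_cases[OF n] h(2) bX by (metis env_in_def env_mult[OF sub_N])
  have oB: "one_B \<in> carrier B"
    by (rule env_one_closed)
  have "left_act \<gamma> (env_in UNIV X) (NB_tens f one_B) = NB_tens h one_B"
  proof (rule left_act_eqI[OF char])
    fix n assume n: "n \<in> carrier N"
    have "env_incl n \<cdot> env_in UNIV X = env_incl (n \<otimes>\<^bsub>N\<^esub> env_in k_lt X)"
      by (simp add: env_incl_mult[OF sub_N n XN] env_incl_in)
    thus "phi \<gamma> (NB_tens f one_B) (env_incl n \<cdot> env_in UNIV X) = phi \<gamma> (NB_tens h one_B) (env_incl n)"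
      by (simp add: phi_N[OF char f oB env_mult_closed[OF sub_N n XN]] phi_N[OF char h(1) oB n] hn[OF n])
  qed (simp_all add: env_in_closed tens_closed f h(1) oB)
  thus ?thesis
    using h(1) hn by blast
qed

text \<open>Both actions stay in \<open>N_dual\<close> here, as the two sides of its N-bimodule
  structure; they commute by associativity in N.\<close>

lemma left_right_one_lt:
  assumes f: "f \<in> carrier N_dual" and d: "d \<in> Gam S" and X: "X \<in> gr d" "X \<in> k_lt" and Y: "Y \<in> k_lt"
  shows "left_act \<gamma> (env_in UNIV X) (right_act (NB_tens f one_B) (env_in UNIV Y)) =
    right_act (left_act \<gamma> (env_in UNIV X) (NB_tens f one_B)) (env_in UNIV Y)"
proof -
  have XN: "env_in k_lt X \<in> carrier N" and YN: "env_in k_lt Y \<in> carrier N"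
    by (rule env_in_closed[OF X(2)], rule env_in_closed[OF Y])
  have g: "dual_right f (env_in k_lt Y) \<in> carrier N_dual"
    by (rule dual_right_closed[OF f YN])
  obtain h where h: "h \<in> carrier N_dual" "left_act \<gamma> (env_in UNIV X) (NB_tens f one_B) = NB_tens h one_B"
    "\<And>n. n \<in> carrier N \<Longrightarrow> h n = f (n \<otimes>\<^bsub>N\<^esub> env_in k_lt X)"
    using left_act_k_lt[OF f d X] by blast
  obtain h' where h': "h' \<in> carrier N_dual"
    "left_act \<gamma> (env_in UNIV X) (NB_tens (dual_right f (env_in k_lt Y)) one_B) = NB_tens h' one_B"
    "\<And>n. n \<in> carrier N \<Longrightarrow> h' n = dual_right f (env_in k_lt Y) (n \<otimes>\<^bsub>N\<^esub> env_in k_lt X)"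
    using left_act_k_lt[OF g d X] by blast
  have "h' = dual_right h (env_in k_lt Y)"
  proof (rule N_dual_eqI[OF h'(1) dual_right_closed[OF h(1) YN]])
    fix p assume "p \<in> FA k_lt"
    hence n: "cl k_lt p \<in> carrier N"
      by (rule env_closed)
    show "h' (cl k_lt p) = dual_right h (env_in k_lt Y) (cl k_lt p)"
      using n by (simp add: h'(3) h(3) dual_right_def env_mult_closed[OF sub_N] XN YN env_mult_assoc[OF sub_N YN n XN])
  qed
  thus ?thesis
    using right_act_N[OF f YN] right_act_N[OF h(1) YN] h(2) h'(2) by (simp add: env_incl_in)
qed

context
  assumes semi: "semi_infinite \<gamma>"
begin

text \<open>The semi-infinite condition is applied at height 1. At height 0 the brackets in question
  have height -1, so their parts of degree 0 vanish and the trace condition reads 0 = 0; at height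
  -1 associativity decides.\<close>

lemma left_right_one:
  assumes f: "f \<in> carrier N_dual" and d: "d \<in> Gam S" "ht d \<in> {-1, 0, 1}" and X: "X \<in> gr d" and Y: "Y \<in> zgr (- 1)"
  shows "left_act \<gamma> (env_in UNIV X) (right_act (NB_tens f one_B) (env_in UNIV Y)) =
    right_act (left_act \<gamma> (env_in UNIV X) (NB_tens f one_B)) (env_in UNIV Y)"
proof -
  have Xd: "X \<in> supp_sub (\<lambda>a. ht a = ht d)"
    by (rule gr_supp_sub[OF d(1) X]) simp
  have Yd: "Y \<in> supp_sub (\<lambda>a. ht a = - 1)"
    using Y by (simp add: zgr_eq)
  consider "ht d = - 1" | "ht d = 0" | "ht d = 1"
    using d(2) by auto
  thus ?thesis
  proof cases
    case 1
    hence "X \<in> k_lt"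
      using gr_k_lt[OF d(1)] X by auto
    thus ?thesis
      by (rule left_right_one_lt[OF f d(1) X _ zgr_k_lt[OF Y]])
  next
    case 2
    have lt: "component 0 (bracket X V) = 0" if "V \<in> supp_sub (\<lambda>a. ht a = - 1)" for V
    proof (rule component_k_lt)
      show "bracket X V \<in> k_lt"
        unfolding k_lt_eq by (rule supp_sub_bracket[OF _ Xd that]) (simp add: ht_add 2)
    qed
    have "component 0 (bracket X (bracket Y z)) = 0" if "z \<in> zgr 0" for z
      by (rule lt, rule supp_sub_bracket[OF _ Yd that[unfolded zgr_eq]]) (simp add: ht_add)
    \<comment> \<open>Finite rank with the empty family and c = 1.\<close>
    hence "trace_on (zgr 0) (\<lambda>z. component 0 (bracket X (bracket Y z))) = 0"
      using trace_on_finite_rank[OF subspace_zgr, of 0 "\<lambda>z. component 0 (bracket X (bracket Y z))" "{}" "\<lambda>_. 0" "\<lambda>_ _. 0" 1] component_0_zgr subspace_0[OF subspace_zgr]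
      by simp
    thus ?thesis
      using lt[OF Yd] gamma_zero[OF char] 2 by (intro left_right_one_ge[OF char f d(1) _ X Y]) simp_all
  next
    case 3
    have br: "component 0 (bracket X V) = bracket X V" if "V \<in> supp_sub (\<lambda>a. ht a = - 1)" for V
    proof (rule component_zgr)
      show "bracket X V \<in> zgr 0"
        unfolding zgr_eq by (rule supp_sub_bracket[OF _ Xd that]) (simp add: ht_add 3)
    qed
    have "X \<in> zgr 1"
      using Xd 3 by (simp add: zgr_eq)
    hence "\<gamma> (bracket X Y) = trace_on (zgr 0) (\<lambda>Z. bracket X (bracket Y Z))"
      using semi Y unfolding semi_infinite_def by blast
    also have "\<dots> = trace_on (zgr 0) (\<lambda>z. component 0 (bracket X (bracket Y z)))"
    proof (rule trace_on_cong[OF subspace_zgr])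
      fix z assume "z \<in> zgr 0"
      hence "bracket Y z \<in> supp_sub (\<lambda>a. ht a = - 1)"
        unfolding zgr_eq by (rule supp_sub_bracket[OF _ Yd, rotated]) (simp add: ht_add)
      thus "bracket X (bracket Y z) = component 0 (bracket X (bracket Y z))"
        by (rule br[symmetric])
    qed
    finally show ?thesis
      using br[OF Yd] 3 by (intro left_right_one_ge[OF char f d(1) _ X Y]) simp_all
  qed
qed

definition commutes :: "('k list \<Rightarrow>\<^sub>0 'f) set \<Rightarrow> ('k list \<Rightarrow>\<^sub>0 'f) set \<Rightarrow> bool" where
  "commutes u v \<longleftrightarrow> (\<forall>m\<in>carrier NB. left_act \<gamma> u (right_act m v) = right_act (left_act \<gamma> u m) v)"

lemma commutes_k_ge: "u \<in> carrier U \<Longrightarrow> z \<in> k_ge \<Longrightarrow> commutes u (env_in UNIV z)"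
  unfolding commutes_def using left_right_B[OF char, of u "env_in k_ge z"] by (simp add: env_in_closed env_incl_in)

text \<open>
  Since \<open>[x, Y]\<close> has height \<open>-1\<close> or nonnegative height for homogeneous \<open>x\<close> in \<open>k_ge\<close>, commutation
  with all \<open>Y\<close> of height \<open>-1\<close> propagates from \<open>m\<close> to \<open>m x\<close>.
\<close>

lemma commutes_minus_one:
  assumes d: "d \<in> Gam S" "ht d \<in> {-1, 0, 1}" and X: "X \<in> gr d" and Y: "Y \<in> zgr (- 1)"
  shows "commutes (env_in UNIV X) (env_in UNIV Y)"
proof -
  have iU: "env_in UNIV z \<in> carrier U" for z
    by (rule env_in_closed) simp
  let ?L = "left_act \<gamma> (env_in UNIV X)" and ?R = "\<lambda>z m. right_act m (env_in UNIV z)"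
  note Lc = left_act_closed[OF char iU, of _ X] and Rc = right_act_closed[OF iU]
  note closed = NB_add_closed NB_smult_closed Lc Rc
  \<comment> \<open>All Y of height -1 are required at once, since moving x of height 0 past Y
    replaces Y by [x, Y]. The aim is stability of \<open>M\<close> under right multiplication by
    B.\<close>
  define M where "M = {m \<in> carrier NB. \<forall>Y\<in>zgr (- 1). ?L (?R Y m) = ?R Y (?L m)}"
  have M: "m \<in> carrier NB" "Y \<in> zgr (- 1) \<Longrightarrow> ?L (?R Y m) = ?R Y (?L m)" if "m \<in> M" for m Y
    using that by (auto simp: M_def)
  have M_add: "m \<oplus>\<^bsub>NB\<^esub> m' \<in> M" if "m \<in> M" "m' \<in> M" for m m'
    using that by (simp add: M_def right_act_add[OF iU] left_act_add[OF iU] closed)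
  have M_smult: "c \<odot>\<^bsub>NB\<^esub> m \<in> M" if "m \<in> M" for c m
    using that by (simp add: M_def right_act_smult[OF iU] left_act_smult[OF iU] closed)
  have ge: "?L (?R x m) = ?R x (?L m)" if "x \<in> k_ge" "m \<in> carrier NB" for x m
    using commutes_k_ge[OF iU that(1)] that(2) by (simp add: commutes_def)
  have M_hom: "?R x m \<in> M" if m: "m \<in> M" and e: "e \<in> Gam S" "ht e \<ge> 0" and x: "x \<in> gr e" for x e m
    unfolding M_def
  proof (intro CollectI conjI ballI)
    note mc = M(1)[OF m]
    have xs: "x \<in> supp_sub (\<lambda>a. ht a = ht e)"
      by (rule gr_supp_sub[OF e(1) x]) simp
    have xge: "x \<in> k_ge"
      unfolding k_ge_eq by (rule gr_supp_sub[OF e(1) x]) (use e(2) in simp)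
    show "?R x m \<in> carrier NB"
      by (rule Rc[OF mc])
    fix Y assume Y: "Y \<in> zgr (- 1)"
    have br: "?L (?R (bracket x Y) m) = ?R (bracket x Y) (?L m)"
    proof (cases "ht e = 0")
      case True
      have "bracket x Y \<in> zgr (- 1)"
        unfolding zgr_eq by (rule supp_sub_bracket[OF _ xs Y[unfolded zgr_eq]]) (simp add: ht_add True)
      thus ?thesis
        by (rule M(2)[OF m])
    next
      case False
      have "bracket x Y \<in> k_ge"
        unfolding k_ge_eq by (rule supp_sub_bracket[OF _ xs Y[unfolded zgr_eq]]) (use False e(2) in \<open>simp add: ht_add\<close>)
      thus ?thesis
        by (rule ge[OF _ mc])
    qed
    show "?L (?R Y (?R x m)) = ?R Y (?L (?R x m))"
      unfolding right_act_swap[OF mc, of x Y] ge[OF xge mc] right_act_swap[OF Lc[OF mc], of x Y]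
        left_act_add[OF iU Rc[OF Rc[OF mc]] Rc[OF mc]] ge[OF xge Rc[OF mc]] M(2)[OF m Y] br ..
  qed
  have M_ge: "?R x m \<in> M" if m: "m \<in> M" and x: "x \<in> k_ge" for x m
    using x
  proof (induction rule: k_ge_induct)
    case (homogeneous e y)
    show ?case
    proof (cases "ht e \<ge> 0")
      case True
      thus ?thesis
        by (rule M_hom[OF m homogeneous(1) _ homogeneous(2)])
    next
      case False
      have "component e y = 0"
        by (rule supp_subD[OF homogeneous(3)[unfolded k_ge_eq] False])
      hence "y = 0"
        using component_gr[OF homogeneous(1,2), of e] by simp
      thus ?thesis
        using M_hom[OF m Gam_closed(1) _ gr_zero[OF Gam_closed(1)]] by simp
    qed
  next
    case (add y z)
    thus ?case
      using M_add by (simp add: env_in_add right_act_add_elt(1)[OF iU iU M(1)[OF m]])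
  qed
  have M_B: "\<forall>m\<in>M. right_act m (env_incl b) \<in> M" if b: "b \<in> carrier B" for b
    using b sub_B
  proof (induction rule: env_induct)
    case zero
    have z: "env_incl \<zero>\<^bsub>B\<^esub> = 0 \<odot>\<^bsub>U\<^esub> env_incl \<zero>\<^bsub>B\<^esub>"
      using env_incl_smult[OF vspace_zero_closed[OF vspace_env[of k_ge]], of 0]
      by (simp add: vspace_zero_smult[OF vspace_env env_zero_closed])
    have zU: "env_incl \<zero>\<^bsub>B\<^esub> \<in> carrier U"
      by (rule incl_closed[OF env_zero_closed])
    show ?case
    proof
      fix m assume m: "m \<in> M"
      have "right_act m (env_incl \<zero>\<^bsub>B\<^esub>) = 0 \<odot>\<^bsub>NB\<^esub> right_act m (env_incl \<zero>\<^bsub>B\<^esub>)"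
        by (subst z) (rule right_act_add_elt(2)[OF zU zU M(1)[OF m]])
      also have "\<dots> = 0 \<odot>\<^bsub>NB\<^esub> m"
        unfolding vspace_zero_smult[OF vspace_NB right_act_closed[OF zU M(1)[OF m]]] vspace_zero_smult[OF vspace_NB M(1)[OF m]] ..
      finally show "right_act m (env_incl \<zero>\<^bsub>B\<^esub>) \<in> M"
        using M_smult[OF m, of 0] by simp
    qed
  next
    case one
    show ?case
      by (simp add: env_incl_one right_act_one M(1))
  next
    case (step x b)
    thus ?case
      using M_ge[OF _ step(1)]
      by (simp add: env_incl_mult[OF sub_B env_in_closed] env_incl_in right_act_add_elt(3)[OF iU incl_closed M(1)])
  next
    case (add b b')
    thus ?case
      by (simp add: env_incl_add right_act_add_elt(1)[OF incl_closed incl_closed M(1)] M_add)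
  next
    case (smult c b)
    thus ?case
      by (simp add: env_incl_smult right_act_add_elt(2)[OF incl_closed incl_closed M(1)] M_smult)
  qed
  have "m \<in> M" if "m \<in> carrier NB" for m
    using that vspace_N_dual vspace_env
  proof (induction rule: tensor_induct)
    case zero
    have oB: "one_B \<in> carrier B"
      by (rule env_one_closed)
    show ?case
      using lin_zero[OF vspace_NB vspace_NB left_act_lin[OF char iU, of X]] NB_zero_closed right_act_zero[OF iU]
      by (simp add: M_def)
  next
    case (tens f b)
    have oB: "one_B \<in> carrier B"
      by (rule env_one_closed)
    \<comment> \<open>f \<otimes> b is (f \<otimes> 1) b, so stability of \<open>M\<close> under B
      leaves the case b = 1.\<close>
    have "NB_tens f one_B \<in> M"
      using left_right_one[OF tens(1) d X] tens_closed[OF tens(1) oB] by (simp add: M_def)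
    hence "right_act (NB_tens f one_B) (env_incl b) \<in> M"
      using M_B[OF tens(2)] by blast
    thus ?case
      by (simp add: right_act_B[OF tens(1) oB tens(2)] env_one_left[OF sub_B tens(2)])
  next
    case (add x y)
    thus ?case
      by (intro M_add)
  qed
  thus ?thesis
    using M(2)[OF _ Y] by (simp add: commutes_def)
qed

lemma commutes_generator:
  assumes d: "d \<in> Gam S" "ht d \<in> {-1, 0, 1}" and X: "X \<in> gr d" and v: "v \<in> carrier U"
  shows "commutes (env_in UNIV X) v"
proof -
  have iU: "env_in UNIV z \<in> carrier U" for z
    by (rule env_in_closed) simp
  note simps = commutes_def right_act_closed left_act_closed[OF char iU]
  show ?thesis
    using v
  proof (induction rule: U_generation)
    case (gen e z)
    show ?case
    proof (cases "ht e = - 1")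
      case True
      hence "z \<in> zgr (- 1)"
        unfolding zgr_eq by (intro gr_supp_sub[OF gen(1,3)]) simp
      thus ?thesis
        by (rule commutes_minus_one[OF d X])
    next
      case False
      have "z \<in> k_ge"
        unfolding k_ge_eq by (rule gr_supp_sub[OF gen(1,3)]) (use False gen(2) in auto)
      thus ?thesis
        by (rule commutes_k_ge[OF iU])
    qed
  next
    case one
    show ?case
      by (simp add: simps right_act_one)
  next
    case (add u v)
    thus ?case
      by (simp add: simps right_act_add_elt(1) left_act_add[OF iU])
  next
    case (smult c u)
    thus ?case
      by (simp add: simps right_act_add_elt(2)[OF smult(1) smult(1)] left_act_smult[OF iU])
  next
    case (mult u v)
    thus ?case
      by (simp add: simps right_act_add_elt(3))
  qed
qed

lemma left_right_commute:
  assumes u: "u \<in> carrier U" and v: "v \<in> carrier U"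
  shows "commutes u v"
  using u
proof (induction rule: U_generation)
  case (gen d z)
  thus ?case
    by (rule commutes_generator[OF _ _ _ v])
next
  case one
  show ?case
    by (simp add: commutes_def left_act_one right_act_closed[OF v])
next
  case (add u u')
  thus ?case
    by (simp add: commutes_def left_act_elt(1)[OF char] right_act_closed[OF v] right_act_add[OF v] left_act_closed[OF char])
next
  case (smult c u)
  thus ?case
    by (simp add: commutes_def left_act_elt(2)[OF char smult(1) smult(1)] right_act_closed[OF v] right_act_smult[OF v] left_act_closed[OF char])
next
  case (mult u u')
  thus ?case
    by (simp add: commutes_def left_act_elt(3)[OF char] right_act_closed[OF v] left_act_closed[OF char])
qed

end

end

end

theorem proposition6p3p1:
  fixes scale :: "'f::{alg_closed_field, field_char_0} \<Rightarrow> 'k::ab_group_add \<Rightarrow> 'k"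
    and bracket :: "'k \<Rightarrow> 'k \<Rightarrow> 'k"
    and S :: "'s set"
    and gr :: "('s \<Rightarrow>\<^sub>0 int) \<Rightarrow> 'k set"
    and \<gamma> :: "'k \<Rightarrow> 'f"
  assumes "triangular_lie_algebra scale bracket S gr"
    and "graded_lie_algebra.character scale bracket S gr \<gamma>"
    and "graded_lie_algebra.semi_infinite scale bracket S gr \<gamma>"
    and "u \<in> carrier (lie_algebra.env scale bracket UNIV)"
    and "v \<in> carrier (lie_algebra.env scale bracket UNIV)"
    and "x \<in> carrier (graded_lie_algebra.NB scale bracket S gr)"
  shows "graded_lie_algebra.right_act scale bracket S gr
           (graded_lie_algebra.left_act scale bracket S gr \<gamma> u x) v =
         graded_lie_algebra.left_act scale bracket S gr \<gamma> u
           (graded_lie_algebra.right_act scale bracket S gr x v)"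
proof -
  interpret triangular_lie_algebra scale bracket S gr
    by (rule assms(1))
  show ?thesis
    using left_right_commute[OF assms(2-5)] assms(2,3,6) by (simp add: commutes_def)
qed

end
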